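(* Let $\mathcal{G}$ be a planar graph and $J$ a finite-range interaction on $\mathcal{G}$ as in the context, and fix a real number $q\ge1$. There exists $\beta_c=\beta_c(\mathcal{G},J)\in[0,\infty]$ such that: (1) for every $\beta>0$ with $\beta<\beta_c$ there exists $c=c(\beta,\mathcal{G},J)>0$ such that for any vertices $x,y$ of $\mathcal{G}$, $$\phi^1_{\beta,q,\mathcal{G},J}\big[x\text{ and }y\text{ are connected by a path of open edges}\big]\le\exp(-c|x-y|);$$ (2) for every $\beta>0$ with $\beta>\beta_c$, there exists $\phi^0_{\beta,q,\mathcal{G},J}$-almost surely an infinite open cluster.
   Context: $\mathcal{G}=(V_{\mathcal{G}},E_{\mathcal{G}})$ is a connected, locally finite planar graph, (properly) embedded in $\mathbb{R}^2$, invariant under the translations by $(1,0)$ and $(0,1)$, under reflection with respect to the line $\{(0,y):y\in\mathbb{R}\}$, and under rotation by $\pi/2$ around $0$. $|x-y|$ is the graph distance in $\mathcal{G}$. $J:V_{\mathcal{G}}\times V_{\mathcal{G}}\to[0,+\infty)$ is a function with $J(x,y)=J(y,x)$, with the same symmetries as $\mathcal{G}$ (invariant under the translations, reflection and rotation above), and of finite range: there is $M\ge1$ such that $J(x,y)=0$ whenever the graph distance satisfies $d_{\mathcal{G}}(x,y)>M$. For a finite subgraph $G$ of $\mathcal{G}$, $\beta>0$ and $q\ge1$, the measure $\phi_{\beta,q,G,J}$ on configurations $\omega$ assigning to each unordered pair $e=\{x,y\}$ of distinct vertices of $G$ a value $\omega(e)\in\{0,1\}$ is $$\phi_{\beta,q,G,J}(\omega)=\frac{\Big(\prod_{e=\{x,y\}}(e^{\beta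 J(x,y)}-1)^{\omega(e)}\Big)q^{k(\omega)}}{Z(\beta,q,G,J)}\qquad(0^0=1),$$ where $k(\omega)$ is the number of clusters (connected components of the graph on $V_G$ whose edges are the open pairs, i.e. those with $\omega(e)=1$) and $Z$ is the normalising constant. The free infinite-volume measure $\phi^0_{\beta,q,\mathcal{G},J}$ is the weak limit of $\phi_{\beta,q,G_n,J}$ along increasing finite subgraphs $G_n$ exhausting $\mathcal{G}$; the wired measure $\phi^1_{\beta,q,\mathcal{G},J}$ is the weak limit of the analogous measures where all clusters touching the boundary of $G_n$ (vertices $x$ of $G_n$ with $J(x,y)>0$ for some $y\notin G_n$) are counted as a single cluster in $k(\omega)$. *)

theory Defs
  imports "HOL-Probability.Probability"
begin

section \<open>Symmetric planar graphs\<close>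

type_synonym point = "real \<times> real"

text \<open>An unordered pair of distinct elements \<open>x\<close>, \<open>y\<close> is represented by the set \<open>{x, y}\<close>.\<close>

definition pairs_on :: "'v set \<Rightarrow> 'v set set" where
  "pairs_on S = {{x, y} | x y. x \<in> S \<and> y \<in> S \<and> x \<noteq> y}"

definition graph_connected :: "'v set \<Rightarrow> 'v set set \<Rightarrow> bool" where
  "graph_connected V E \<longleftrightarrow>
     V \<noteq> {} \<and> (\<forall>x\<in>V. \<forall>y\<in>V. (\<lambda>u v. {u, v} \<in> E)\<^sup>*\<^sup>* x y)"

definition graph_dist :: "'v set set \<Rightarrow> 'v \<Rightarrow> 'v \<Rightarrow> nat" where
  "graph_dist E x y = (LEAST n. ((\<lambda>u v. {u, v} \<in> E) ^^ n) x y)"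

definition locally_finite :: "'v set \<Rightarrow> 'v set set \<Rightarrow> bool" where
  "locally_finite V E \<longleftrightarrow> (\<forall>v\<in>V. finite {e \<in> E. v \<in> e})"

text \<open>The graph with vertex set \<open>V\<close> (points of the plane) and edge set \<open>E\<close> is drawn in the
  plane by representing each edge \<open>e\<close> by the arc \<open>drawing e\<close>. The last two conditions say that
  the embedding is proper: no accumulation of vertices or edges at finite distance.\<close>

definition properly_embedded :: "point set \<Rightarrow> point set set \<Rightarrow> (point set \<Rightarrow> point set) \<Rightarrow> bool" where
  "properly_embedded V E drawing \<longleftrightarrow>
     (\<forall>e\<in>E. \<exists>g. arc g \<and> {pathstart g, pathfinish g} = e \<and> path_image g = drawing e) \<and>
     (\<forall>e\<in>E. drawing e \<inter> V = e) \<and>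
     (\<forall>e\<in>E. \<forall>e'\<in>E. e \<noteq> e' \<longrightarrow> drawing e \<inter> drawing e' = e \<inter> e') \<and>
     (\<forall>K. compact K \<longrightarrow> finite (V \<inter> K)) \<and>
     (\<forall>K. compact K \<longrightarrow> finite {e \<in> E. drawing e \<inter> K \<noteq> {}})"

text \<open>The translations by \<open>(1, 0)\<close> and \<open>(0, 1)\<close>, the reflection with respect to
  \<open>{(0, y) | y}\<close> and the rotation by \<open>pi / 2\<close> around the origin.\<close>

definition plane_symmetries :: "(point \<Rightarrow> point) set" where
  "plane_symmetries =
     {\<lambda>(a, b). (a + 1, b), \<lambda>(a, b). (a, b + 1), \<lambda>(a, b). (- a, b), \<lambda>(a, b). (- b, a)}"

definition embedding_invariant ::
    "(point \<Rightarrow> point) \<Rightarrow> point set \<Rightarrow> point set set \<Rightarrow> (point set \<Rightarrow> point set) \<Rightarrow> bool" where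
  "embedding_invariant T V E drawing \<longleftrightarrow>
     T ` V = V \<and> (\<lambda>e. T ` e) ` E = E \<and> (\<forall>e\<in>E. drawing (T ` e) = T ` drawing e)"

definition symmetric_planar_graph ::
    "point set \<Rightarrow> point set set \<Rightarrow> (point set \<Rightarrow> point set) \<Rightarrow> bool" where
  "symmetric_planar_graph V E drawing \<longleftrightarrow>
     E \<subseteq> pairs_on V \<and> graph_connected V E \<and> locally_finite V E \<and>
     properly_embedded V E drawing \<and>
     (\<forall>T\<in>plane_symmetries. embedding_invariant T V E drawing)"

text \<open>Only the values of \<open>J\<close> on \<open>V \<times> V\<close> are meaningful.\<close>

definition finite_range_interaction ::
    "point set \<Rightarrow> point set set \<Rightarrow> (point \<Rightarrow> point \<Rightarrow> real) \<Rightarrow> bool" where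
  "finite_range_interaction V E J \<longleftrightarrow>
     (\<forall>x\<in>V. \<forall>y\<in>V. 0 \<le> J x y) \<and>
     (\<forall>x\<in>V. \<forall>y\<in>V. J x y = J y x) \<and>
     (\<forall>T\<in>plane_symmetries. \<forall>x\<in>V. \<forall>y\<in>V. J (T x) (T y) = J x y) \<and>
     (\<exists>M::real. 1 \<le> M \<and> (\<forall>x\<in>V. \<forall>y\<in>V. M < real (graph_dist E x y) \<longrightarrow> J x y = 0))"


section \<open>Configurations and clusters\<close>

text \<open>A configuration on the vertex set \<open>S\<close> is an extensional function on \<open>pairs_on S\<close>,
  with \<open>True\<close> (\<open>False\<close>) for open (closed) pairs.\<close>

type_synonym 'v config = "'v set \<Rightarrow> bool"

definition configs :: "'v set \<Rightarrow> 'v config set" where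
  "configs S = pairs_on S \<rightarrow>\<^sub>E UNIV"

definition open_adj :: "'v set \<Rightarrow> 'v config \<Rightarrow> 'v \<Rightarrow> 'v \<Rightarrow> bool" where
  "open_adj S \<omega> x y \<longleftrightarrow> {x, y} \<in> pairs_on S \<and> \<omega> {x, y}"

definition open_connected :: "'v set \<Rightarrow> 'v config \<Rightarrow> 'v \<Rightarrow> 'v \<Rightarrow> bool" where
  "open_connected S \<omega> = (open_adj S \<omega>)\<^sup>*\<^sup>*"

definition clusters :: "'v set \<Rightarrow> 'v config \<Rightarrow> 'v set set" where
  "clusters S \<omega> = (\<lambda>x. {y. open_connected S \<omega> x y}) ` S"

definition free_count :: "'v set \<Rightarrow> 'v config \<Rightarrow> nat" where
  "free_count S \<omega> = card (clusters S \<omega>)"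

definition boundary :: "'v set \<Rightarrow> ('v \<Rightarrow> 'v \<Rightarrow> real) \<Rightarrow> 'v set \<Rightarrow> 'v set" where
  "boundary V J S = {x \<in> S. \<exists>y \<in> V - S. 0 < J x y}"

definition wired_count :: "'v set \<Rightarrow> ('v \<Rightarrow> 'v \<Rightarrow> real) \<Rightarrow> 'v set \<Rightarrow> 'v config \<Rightarrow> nat" where
  "wired_count V J S \<omega> =
     card {C \<in> clusters S \<omega>. C \<inter> boundary V J S = {}} +
     (if boundary V J S = {} then 0 else 1)"


section \<open>The random-cluster measures\<close>

text \<open>The common value \<open>J x y = J y x\<close> for \<open>e = {x, y}\<close>.\<close>

definition coupling :: "('v \<Rightarrow> 'v \<Rightarrow> real) \<Rightarrow> 'v set \<Rightarrow> real" where
  "coupling J e = (THE j. \<exists>x y. e = {x, y} \<and> j = J x y)"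

text \<open>Finite volume. The argument \<open>k\<close> counts the clusters of a configuration, and thereby
  encodes the boundary condition.\<close>

definition fk_weight ::
    "('v set \<Rightarrow> 'v config \<Rightarrow> nat) \<Rightarrow> ('v \<Rightarrow> 'v \<Rightarrow> real) \<Rightarrow> real \<Rightarrow> real \<Rightarrow> 'v set \<Rightarrow> 'v config \<Rightarrow> real" where
  "fk_weight k J \<beta> q S \<omega> =
     (\<Prod>e\<in>pairs_on S. (exp (\<beta> * coupling J e) - 1) ^ of_bool (\<omega> e)) * q ^ k S \<omega>"

definition fk_partition ::
    "('v set \<Rightarrow> 'v config \<Rightarrow> nat) \<Rightarrow> ('v \<Rightarrow> 'v \<Rightarrow> real) \<Rightarrow> real \<Rightarrow> real \<Rightarrow> 'v set \<Rightarrow> real" where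
  "fk_partition k J \<beta> q S = (\<Sum>\<omega>\<in>configs S. fk_weight k J \<beta> q S \<omega>)"

definition fk_finite ::
    "('v set \<Rightarrow> 'v config \<Rightarrow> nat) \<Rightarrow> ('v \<Rightarrow> 'v \<Rightarrow> real) \<Rightarrow> real \<Rightarrow> real \<Rightarrow> 'v set \<Rightarrow> 'v config measure" where
  "fk_finite k J \<beta> q S =
     point_measure (configs S) (\<lambda>\<omega>. ennreal (fk_weight k J \<beta> q S \<omega> / fk_partition k J \<beta> q S))"

definition config_algebra :: "'v set \<Rightarrow> 'v config measure" where
  "config_algebra V = (\<Pi>\<^sub>M e\<in>pairs_on V. count_space UNIV)"

definition config_topology :: "'v set \<Rightarrow> 'v config topology" where
  "config_topology V = product_topology (\<lambda>e. discrete_topology UNIV) (pairs_on V)"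

text \<open>To speak of the weak limit of measures living on different finite sets, a configuration
  on \<open>S\<close> is regarded as one on \<open>V\<close> by closing all other pairs. Since \<open>S\<close> increases to \<open>V\<close>, this
  choice does not affect the limit.\<close>

definition extend_config :: "'v set \<Rightarrow> 'v set \<Rightarrow> 'v config \<Rightarrow> 'v config" where
  "extend_config V S \<omega> = (\<lambda>e\<in>pairs_on V. e \<in> pairs_on S \<and> \<omega> e)"

definition exhausting :: "'v set \<Rightarrow> (nat \<Rightarrow> 'v set) \<Rightarrow> bool" where
  "exhausting V S \<longleftrightarrow> (\<forall>n. finite (S n)) \<and> incseq S \<and> (\<Union>n. S n) = V"

definition weak_limit ::
    "'v set \<Rightarrow> (nat \<Rightarrow> 'v set) \<Rightarrow> (nat \<Rightarrow> 'v config measure) \<Rightarrow> 'v config measure \<Rightarrow> bool" where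
  "weak_limit V S \<phi> \<mu> \<longleftrightarrow>
     (\<forall>f. continuous_map (config_topology V) euclideanreal f \<and> bounded (f ` configs V) \<longrightarrow>
        (\<lambda>n. \<integral>\<omega>. f (extend_config V (S n) \<omega>) \<partial>(\<phi> n)) \<longlonglongrightarrow> (\<integral>\<omega>. f \<omega> \<partial>\<mu>))"

definition infinite_volume ::
    "'v set \<Rightarrow> ('v set \<Rightarrow> 'v config measure) \<Rightarrow> 'v config measure" where
  "infinite_volume V \<phi> =
     (THE \<mu>. prob_space \<mu> \<and> sets \<mu> = sets (config_algebra V) \<and>
        (\<forall>S. exhausting V S \<longrightarrow> weak_limit V S (\<lambda>n. \<phi> (S n)) \<mu>))"

definition fk_free :: "'v set \<Rightarrow> ('v \<Rightarrow> 'v \<Rightarrow> real) \<Rightarrow> real \<Rightarrow> real \<Rightarrow> 'v config measure" where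
  "fk_free V J \<beta> q = infinite_volume V (fk_finite free_count J \<beta> q)"

definition fk_wired :: "'v set \<Rightarrow> ('v \<Rightarrow> 'v \<Rightarrow> real) \<Rightarrow> real \<Rightarrow> real \<Rightarrow> 'v config measure" where
  "fk_wired V J \<beta> q = infinite_volume V (fk_finite (wired_count V J) J \<beta> q)"

end

theory Submission
  imports Defs "HOL-Real_Asymp.Real_Asymp"
begin

text \<open>The proof follows the approach of Duminil-Copin, Raoufi and Tassion. Random-cluster weights with
  \<open>q \<ge> 1\<close> satisfy the FKG lattice condition, and for such weights the OSSS inequality bounds the
  variance of an increasing event by the covariances with its edges, weighted by the probabilities that
  an exploration algorithm reveals them. Exploring the clusters of a sphere of random radius around a
  vertex \<open>x\<close>, and recognising the covariances as derivatives in \<open>\<beta>\<close>, one gets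
  \<open>\<theta>\<^sub>n' \<ge> c n \<theta>\<^sub>n / (\<theta>\<^sub>0 + \<dots> + \<theta>\<^sub>n\<^sub>-\<^sub>1)\<close>, where \<open>\<theta>\<^sub>n\<close> is the wired probability that \<open>x\<close> is
  connected to distance \<open>n\<close>, summed over representatives of the vertices modulo translations. By
  this inequality \<open>\<theta>\<^sub>n\<close> decays exponentially below some parameter and is bounded away from 0 above it.

  Above that parameter, the free measure is reached as follows. The free energies of large boxes under
  the two boundary conditions differ by a boundary term, hence the edge densities agree at parameters
  arbitrarily close to any given one, so that the wired measure at \<open>a\<close> is dominated by the free
  measure at any \<open>b > a\<close>. Finally, conditionally on a tail event the free measure still dominates its
  own finite-volume versions; applied to the absence of infinite clusters, this turns positive
  probability of percolation into probability one.\<close>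

section \<open>The four functions theorem and stochastic domination\<close>

text \<open>The edges are dependent, so a queried edge cannot simply be resampled. What replaces
  this is a monotone coupling of the explored configuration with a second one: each query costs at
  most a covariance, and both the bound on this cost and its averaging over the past rest on the FKG
  condition. The measure defining \<theta>_n changes with n, yet connections around every explored
  vertex must be bounded by the same family at smaller scales. Wired measures on balls of radius
  about 2n achieve this: they decrease as the volume grows, and the smaller balls around explored
  vertices fit inside. Summing over representatives is needed because an explored vertex may belong
  to another translation class than the centre. Free and wired edge densities are shown to be close
  only at parameters that depend on the chosen edges and the precision, so passing from wired to
  free moves the parameter upwards. This is harmless: \<beta>_c is the supremum of the parameters
  with exponential decay, and both conclusions concern parameters strictly on one side of
  it.\<close>

lemma sum_Pow_insert:
  fixes g :: "'e set \<Rightarrow> real"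
  assumes "finite F" "e \<notin> F"
  shows "sum g (Pow (insert e F)) = (\<Sum>A\<in>Pow F. g A + g (insert e A))"
proof -
  have inj: "inj_on (insert e) (Pow F)"
    using assms(2) by (auto simp: inj_on_def)
  have "sum g (Pow (insert e F)) = sum g (Pow F) + sum g (insert e ` Pow F)"
    unfolding Pow_insert using assms by (subst sum.union_disjoint) auto
  also have "sum g (insert e ` Pow F) = (\<Sum>A\<in>Pow F. g (insert e A))"
    by (subst sum.reindex[OF inj]) simp
  finally show ?thesis by (simp add: sum.distrib)
qed

text \<open>The one-point case of the four functions theorem; the index tells whether the point is
  present. Both cross terms u = a0 b1 and v = a1 b0 are at most P = c1 d0, and u v is at most (c0
  d0)(c1 d1). Expanding (P - u)(P - v) \<ge> 0 gives u + v \<le> P + u v / P, hence u + v \<le> c1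
  d0 + c0 d1. If P = 0, both cross terms vanish.\<close>

lemma four_numbers:
  fixes a0 a1 b0 b1 c0 c1 d0 d1 :: real
  assumes nn: "0 \<le> a0" "0 \<le> a1" "0 \<le> b0" "0 \<le> b1" "0 \<le> c0" "0 \<le> c1" "0 \<le> d0" "0 \<le> d1"
    and h: "a0 * b0 \<le> c0 * d0" "a0 * b1 \<le> c1 * d0" "a1 * b0 \<le> c1 * d0" "a1 * b1 \<le> c1 * d1"
  shows "(a0 + a1) * (b0 + b1) \<le> (c0 + c1) * (d0 + d1)"
proof (cases "c1 * d0 = 0")
  case True
  hence "a0 * b1 = 0" "a1 * b0 = 0"
    using h(2,3) nn by (metis mult_nonneg_nonneg order_antisym)+
  moreover have "0 \<le> c0 * d1" using nn by simp
  moreover have "(a0 + a1) * (b0 + b1) = a0 * b0 + a0 * b1 + a1 * b0 + a1 * b1"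
    "(c0 + c1) * (d0 + d1) = c0 * d0 + c0 * d1 + c1 * d0 + c1 * d1" by (simp_all add: algebra_simps)
  ultimately show ?thesis using h True by linarith
next
  case False
  define P where "P = c1 * d0"
  have P: "0 < P" unfolding P_def using False nn by (simp add: less_le)
  have cross: "a0 * b1 + a1 * b0 \<le> P + (c0 * d0) * (c1 * d1) / P"
  proof -
    define u v where "u = a0 * b1" and "v = a1 * b0"
    have uv: "u \<le> P" "v \<le> P" "0 \<le> u" "0 \<le> v" using h nn by (auto simp: u_def v_def P_def)
    have "u * v = (a0 * b0) * (a1 * b1)" by (simp add: u_def v_def)
    also have "\<dots> \<le> (c0 * d0) * (c1 * d1)" by (rule mult_mono[OF h(1) h(4)]) (use nn in auto)
    finally have w: "u * v \<le> (c0 * d0) * (c1 * d1)" .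
    have "0 \<le> (P - u) * (P - v)" using uv by simp
    hence "(u + v) * P \<le> P * P + u * v" by (simp add: algebra_simps)
    hence "(u + v) * P \<le> P * P + (c0 * d0) * (c1 * d1)" using w by linarith
    thus ?thesis unfolding u_def[symmetric] v_def[symmetric] using P by (simp add: field_simps)
  qed
  have "(c0 * d0) * (c1 * d1) / P = c0 * d1" unfolding P_def using False by (simp add: field_simps)
  hence "a0 * b1 + a1 * b0 \<le> c1 * d0 + c0 * d1" using cross unfolding P_def by linarith
  thus ?thesis using h(1,4) by (simp add: algebra_simps)
qed

text \<open>The Ahlswede-Daykin inequality. One point e is summed out: adding the values at A and
  \<open>insert e A\<close> gives four functions on the subsets of F, which inherit the hypothesis
  by \<open>four_numbers\<close>.\<close>

theorem four_functions:
  fixes \<alpha> \<beta> \<gamma> \<delta> :: "'e set \<Rightarrow> real"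
  assumes "finite F"
    and "\<And>A. A \<subseteq> F \<Longrightarrow> 0 \<le> \<alpha> A" "\<And>A. A \<subseteq> F \<Longrightarrow> 0 \<le> \<beta> A"
    and "\<And>A. A \<subseteq> F \<Longrightarrow> 0 \<le> \<gamma> A" "\<And>A. A \<subseteq> F \<Longrightarrow> 0 \<le> \<delta> A"
    and "\<And>A B. A \<subseteq> F \<Longrightarrow> B \<subseteq> F \<Longrightarrow> \<alpha> A * \<beta> B \<le> \<gamma> (A \<union> B) * \<delta> (A \<inter> B)"
  shows "sum \<alpha> (Pow F) * sum \<beta> (Pow F) \<le> sum \<gamma> (Pow F) * sum \<delta> (Pow F)"
  using assms
proof (induction F arbitrary: \<alpha> \<beta> \<gamma> \<delta> rule: finite_induct)
  case empty
  from empty(5)[of "{}" "{}"] show ?case by simp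
next
  case (insert e F)
  let ?m = "\<lambda>g :: 'e set \<Rightarrow> real. \<lambda>A. g A + g (insert e A)"
  have "sum (?m \<alpha>) (Pow F) * sum (?m \<beta>) (Pow F) \<le> sum (?m \<gamma>) (Pow F) * sum (?m \<delta>) (Pow F)"
  proof (rule insert.IH)
    fix A B assume A: "A \<subseteq> F" and B: "B \<subseteq> F"
    have e: "e \<notin> A" "e \<notin> B" using A B insert(2) by auto
    have sub: "A \<subseteq> insert e F" "B \<subseteq> insert e F" "insert e A \<subseteq> insert e F" "insert e B \<subseteq> insert e F"
      "A \<union> B \<subseteq> insert e F" "A \<inter> B \<subseteq> insert e F" "insert e (A \<union> B) \<subseteq> insert e F"
      "insert e (A \<inter> B) \<subseteq> insert e F" using A B by auto
    have s: "A \<union> insert e B = insert e (A \<union> B)" "insert e A \<union> B = insert e (A \<union> B)"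
      "insert e A \<union> insert e B = insert e (A \<union> B)" "A \<inter> insert e B = A \<inter> B"
      "insert e A \<inter> B = A \<inter> B" "insert e A \<inter> insert e B = insert e (A \<inter> B)"
      using e by auto
    show "?m \<alpha> A * ?m \<beta> B \<le> ?m \<gamma> (A \<union> B) * ?m \<delta> (A \<inter> B)"
      by (rule four_numbers)
        (use sub insert.prems(5)[of A B] insert.prems(5)[of A "insert e B"]
          insert.prems(5)[of "insert e A" B] insert.prems(5)[of "insert e A" "insert e B"]
          in \<open>auto simp: s intro!: insert.prems(1-4)\<close>)
  qed (auto intro!: add_nonneg_nonneg insert.prems(1-4))
  thus ?case by (simp add: sum_Pow_insert insert)
qed

section \<open>Weighted means, Holley's comparison theorem and the FKG inequality\<close>

definition expect :: "'e set \<Rightarrow> ('e set \<Rightarrow> real) \<Rightarrow> ('e set \<Rightarrow> real) \<Rightarrow> real" where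
  "expect F w f = (\<Sum>\<eta>\<in>Pow F. w \<eta> * f \<eta>) / (\<Sum>\<eta>\<in>Pow F. w \<eta>)"

text \<open>Opening \<open>e\<close> multiplies the weight \<open>w1\<close> by at most as much as \<open>w2\<close>, even when more edges
  are open under \<open>w2\<close>. This is Holley's criterion in single-edge form.\<close>

definition dominated :: "'e set \<Rightarrow> ('e set \<Rightarrow> real) \<Rightarrow> ('e set \<Rightarrow> real) \<Rightarrow> bool" where
  "dominated F w1 w2 \<longleftrightarrow>
     (\<forall>\<eta> \<eta>' e. \<eta> \<subseteq> \<eta>' \<and> \<eta>' \<subseteq> F \<and> e \<in> F - \<eta>' \<longrightarrow> w1 (insert e \<eta>) * w2 \<eta>' \<le> w1 \<eta> * w2 (insert e \<eta>'))"

abbreviation positive_on :: "'e set \<Rightarrow> ('e set \<Rightarrow> real) \<Rightarrow> bool" where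
  "positive_on F w \<equiv> \<forall>\<eta>\<subseteq>F. 0 < w \<eta>"

abbreviation increasing_on :: "'e set \<Rightarrow> ('e set \<Rightarrow> real) \<Rightarrow> bool" where
  "increasing_on F f \<equiv> mono_on (Pow F) f"

lemma dominatedD:
  "dominated F w1 w2 \<Longrightarrow> \<eta> \<subseteq> \<eta>' \<Longrightarrow> \<eta>' \<subseteq> F \<Longrightarrow> e \<in> F \<Longrightarrow> e \<notin> \<eta>' \<Longrightarrow>
    w1 (insert e \<eta>) * w2 \<eta>' \<le> w1 \<eta> * w2 (insert e \<eta>')"
  unfolding dominated_def by blast

text \<open>Telescopes the single-edge criterion over the elements of D. Positivity of the weights
  allows the intermediate factor \<open>w2 (\<eta>' \<union> D)\<close> to be cancelled.\<close>

lemma dominated_union: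
  assumes "finite D" "positive_on F w1" "positive_on F w2" "dominated F w1 w2"
    "\<eta> \<subseteq> \<eta>'" "\<eta>' \<subseteq> F" "D \<subseteq> F" "D \<inter> \<eta>' = {}"
  shows "w1 (\<eta> \<union> D) * w2 \<eta>' \<le> w1 \<eta> * w2 (\<eta>' \<union> D)"
  using assms(1,7,8)
proof (induction D rule: finite_induct)
  case (insert e D)
  have IH: "w1 (\<eta> \<union> D) * w2 \<eta>' \<le> w1 \<eta> * w2 (\<eta>' \<union> D)" using insert by auto
  have step: "w1 (insert e (\<eta> \<union> D)) * w2 (\<eta>' \<union> D) \<le> w1 (\<eta> \<union> D) * w2 (insert e (\<eta>' \<union> D))"
    by (rule dominatedD[OF assms(4)]) (use insert assms(5,6) in auto)
  have pos: "0 < w1 (\<eta> \<union> D)" "0 < w2 (\<eta>' \<union> D)" "0 < w1 \<eta>" "0 < w2 \<eta>'"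
    using assms insert.prems by auto
  have "w1 (insert e (\<eta> \<union> D)) * w2 \<eta>' * w2 (\<eta>' \<union> D)
      = w1 (insert e (\<eta> \<union> D)) * w2 (\<eta>' \<union> D) * w2 \<eta>'" by simp
  also have "\<dots> \<le> w1 (\<eta> \<union> D) * w2 (insert e (\<eta>' \<union> D)) * w2 \<eta>'"
    using step pos by (intro mult_right_mono) auto
  also have "\<dots> = w1 (\<eta> \<union> D) * w2 \<eta>' * w2 (insert e (\<eta>' \<union> D))" by simp
  also have "\<dots> \<le> w1 \<eta> * w2 (\<eta>' \<union> D) * w2 (insert e (\<eta>' \<union> D))"
    using IH assms insert.prems by (intro mult_right_mono) (auto simp: less_imp_le)
  finally have "(w1 (insert e (\<eta> \<union> D)) * w2 \<eta>') * w2 (\<eta>' \<union> D)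
      \<le> (w1 \<eta> * w2 (insert e (\<eta>' \<union> D))) * w2 (\<eta>' \<union> D)" by (simp add: mult_ac)
  hence "w1 (insert e (\<eta> \<union> D)) * w2 \<eta>' \<le> w1 \<eta> * w2 (insert e (\<eta>' \<union> D))"
    using pos by (simp add: mult_le_cancel_right)
  thus ?case by simp
qed simp

text \<open>Holley's lattice condition, the form of domination that the four functions theorem
  accepts.\<close>

lemma dominated_lattice:
  assumes "finite F" "positive_on F w1" "positive_on F w2" "dominated F w1 w2"
    "A \<subseteq> F" "B \<subseteq> F"
  shows "w1 A * w2 B \<le> w2 (A \<union> B) * w1 (A \<inter> B)"
proof -
  have "w1 ((A \<inter> B) \<union> (A - B)) * w2 B \<le> w1 (A \<inter> B) * w2 (B \<union> (A - B))"
    by (rule dominated_union[OF _ assms(2,3,4)]) (use assms finite_subset[OF assms(5,1)] in auto)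
  moreover have "(A \<inter> B) \<union> (A - B) = A" "B \<union> (A - B) = A \<union> B" by auto
  ultimately show ?thesis by (simp add: mult.commute)
qed

lemma sum_Pow_pos: "finite F \<Longrightarrow> positive_on F w \<Longrightarrow> 0 < (\<Sum>\<eta>\<in>Pow F. w \<eta>)" for w :: "'e set \<Rightarrow> real"
  by (rule sum_pos) auto

lemma expect_const: "finite F \<Longrightarrow> positive_on F w \<Longrightarrow> expect F w (\<lambda>_. c) = c"
  using sum_Pow_pos[of F w] by (simp add: expect_def sum_distrib_right[symmetric])

lemma expect_add: "expect F w (\<lambda>\<eta>. f \<eta> + g \<eta>) = expect F w f + expect F w g"
  by (simp add: expect_def distrib_left sum.distrib add_divide_distrib)

lemma expect_diff: "expect F w (\<lambda>\<eta>. f \<eta> - g \<eta>) = expect F w f - expect F w g"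
  by (simp add: expect_def right_diff_distrib sum_subtractf diff_divide_distrib)

lemma expect_cmult: "expect F w (\<lambda>\<eta>. c * f \<eta>) = c * expect F w f"
  by (simp add: expect_def sum_distrib_left mult_ac)

lemma expect_sum: "expect F w (\<lambda>\<eta>. \<Sum>i\<in>I. f i \<eta>) = (\<Sum>i\<in>I. expect F w (f i))"
  unfolding expect_def sum_distrib_left by (subst sum.swap) (simp add: sum_divide_distrib)

lemma expect_cong: "(\<And>\<eta>. \<eta> \<subseteq> F \<Longrightarrow> f \<eta> = g \<eta>) \<Longrightarrow> expect F w f = expect F w g"
  by (simp add: expect_def)

lemma expect_mono:
  assumes "finite F" "positive_on F w" "\<And>\<eta>. \<eta> \<subseteq> F \<Longrightarrow> f \<eta> \<le> g \<eta>"
  shows "expect F w f \<le> expect F w g"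
  unfolding expect_def using assms sum_Pow_pos[OF assms(1,2)]
  by (intro divide_right_mono sum_mono mult_left_mono) (auto simp: less_imp_le)

lemma expect_bounds:
  assumes "finite F" "positive_on F w" "\<And>\<eta>. \<eta> \<subseteq> F \<Longrightarrow> a \<le> f \<eta>" "\<And>\<eta>. \<eta> \<subseteq> F \<Longrightarrow> f \<eta> \<le> b"
  shows "a \<le> expect F w f" "expect F w f \<le> b"
  using expect_mono[OF assms(1,2), of "\<lambda>_. a" f] expect_mono[OF assms(1,2), of f "\<lambda>_. b"] assms
  by (simp_all add: expect_const)

lemma expect_nonneg:
  "finite F \<Longrightarrow> positive_on F w \<Longrightarrow> (\<And>\<eta>. \<eta> \<subseteq> F \<Longrightarrow> 0 \<le> f \<eta>) \<Longrightarrow> 0 \<le> expect F w f"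
  using expect_mono[of F w "\<lambda>_. 0" f] by (simp add: expect_const)

text \<open>The four functions theorem for w1 g, w2, w2 g and w1, where g is f minus its smallest
  value, the one at the empty set.\<close>

theorem dominated_expect_mono:
  assumes fin: "finite F" and w: "positive_on F w1" "positive_on F w2"
    and dom: "dominated F w1 w2" and f: "increasing_on F f"
  shows "expect F w1 f \<le> expect F w2 f"
proof -
  define g where "g \<eta> = f \<eta> - f {}" for \<eta>
  have g0: "0 \<le> g \<eta>" if "\<eta> \<subseteq> F" for \<eta>
    unfolding g_def using mono_onD[OF f, of "{}" \<eta>] that by auto
  have gm: "g A \<le> g B" if "A \<subseteq> B" "B \<subseteq> F" for A B
    unfolding g_def using mono_onD[OF f, of A B] that by auto
  have "(\<Sum>\<eta>\<in>Pow F. w1 \<eta> * g \<eta>) * (\<Sum>\<eta>\<in>Pow F. w2 \<eta>) \<le> (\<Sum>\<eta>\<in>Pow F. w2 \<eta> * g \<eta>) * (\<Sum>\<eta>\<in>Pow F. w1 \<eta>)"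
  proof (rule four_functions[OF fin])
    fix A B assume AB: "A \<subseteq> F" "B \<subseteq> F"
    have "w1 A * g A * w2 B = (w1 A * w2 B) * g A" by simp
    also have "\<dots> \<le> (w2 (A \<union> B) * w1 (A \<inter> B)) * g A"
      using dominated_lattice[OF fin w dom AB] g0[OF AB(1)] by (rule mult_right_mono)
    also have "\<dots> \<le> (w2 (A \<union> B) * w1 (A \<inter> B)) * g (A \<union> B)"
      using AB w gm[of A "A \<union> B"] by (intro mult_left_mono) (auto simp: less_imp_le le_infI1)
    finally show "w1 A * g A * w2 B \<le> w2 (A \<union> B) * g (A \<union> B) * w1 (A \<inter> B)" by (simp add: mult_ac)
  qed (use w g0 in \<open>auto simp: less_imp_le intro!: mult_nonneg_nonneg\<close>)
  hence "expect F w1 g \<le> expect F w2 g"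
    using sum_Pow_pos[OF fin w(1)] sum_Pow_pos[OF fin w(2)] by (simp add: expect_def field_simps)
  thus ?thesis unfolding g_def expect_diff using fin w by (simp add: expect_const)
qed

definition cov :: "'e set \<Rightarrow> ('e set \<Rightarrow> real) \<Rightarrow> ('e set \<Rightarrow> real) \<Rightarrow> ('e set \<Rightarrow> real) \<Rightarrow> real" where
  "cov F w f g = expect F w (\<lambda>\<eta>. f \<eta> * g \<eta>) - expect F w f * expect F w g"

text \<open>The four functions theorem for w f', w g', w f' g' and w. Subtracting constants leaves
  the covariance unchanged, so both functions may be taken nonnegative.\<close>

theorem FKG:
  assumes fin: "finite F" and w: "positive_on F w"
    and dom: "dominated F w w" and f: "increasing_on F f" and g: "increasing_on F g"
  shows "0 \<le> cov F w f g"
proof -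
  define f' where "f' \<eta> = f \<eta> - f {}" for \<eta>
  define g' where "g' \<eta> = g \<eta> - g {}" for \<eta>
  have f0: "0 \<le> f' \<eta>" if "\<eta> \<subseteq> F" for \<eta>
    unfolding f'_def using mono_onD[OF f, of "{}" \<eta>] that by auto
  have fm: "f' A \<le> f' B" if "A \<subseteq> B" "B \<subseteq> F" for A B
    unfolding f'_def using mono_onD[OF f, of A B] that by auto
  have g0: "0 \<le> g' \<eta>" if "\<eta> \<subseteq> F" for \<eta>
    unfolding g'_def using mono_onD[OF g, of "{}" \<eta>] that by auto
  have gm: "g' A \<le> g' B" if "A \<subseteq> B" "B \<subseteq> F" for A B
    unfolding g'_def using mono_onD[OF g, of A B] that by auto
  let ?Z = "\<Sum>\<eta>\<in>Pow F. w \<eta>"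
  have "(\<Sum>\<eta>\<in>Pow F. w \<eta> * f' \<eta>) * (\<Sum>\<eta>\<in>Pow F. w \<eta> * g' \<eta>)
      \<le> (\<Sum>\<eta>\<in>Pow F. w \<eta> * (f' \<eta> * g' \<eta>)) * ?Z"
  proof (rule four_functions[OF fin])
    fix A B assume AB: "A \<subseteq> F" "B \<subseteq> F"
    have "(w A * f' A) * (w B * g' B) = (w A * w B) * (f' A * g' B)" by simp
    also have "\<dots> \<le> (w (A \<union> B) * w (A \<inter> B)) * (f' A * g' B)"
      using dominated_lattice[OF fin w w dom AB] f0[OF AB(1)] g0[OF AB(2)]
      by (intro mult_right_mono) auto
    also have "\<dots> \<le> (w (A \<union> B) * w (A \<inter> B)) * (f' (A \<union> B) * g' (A \<union> B))"
      using AB w fm[of A "A \<union> B"] gm[of B "A \<union> B"] f0 g0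
      by (intro mult_left_mono mult_mono) (auto simp: less_imp_le le_infI1)
    finally show "(w A * f' A) * (w B * g' B) \<le> w (A \<union> B) * (f' (A \<union> B) * g' (A \<union> B)) * w (A \<inter> B)"
      by (simp add: mult_ac)
  qed (use w f0 g0 in \<open>auto simp: less_imp_le intro!: mult_nonneg_nonneg\<close>)
  hence "expect F w f' * expect F w g' \<le> expect F w (\<lambda>\<eta>. f' \<eta> * g' \<eta>)"
    using sum_Pow_pos[OF fin w] by (simp add: expect_def field_simps power2_eq_square)
  moreover have eq: "(\<lambda>\<eta>. f' \<eta> * g' \<eta>) = (\<lambda>\<eta>. (f \<eta> * g \<eta> - g {} * f \<eta>) - (f {} * g \<eta> - f {} * g {}))"
    by (auto simp: f'_def g'_def algebra_simps)
  moreover have "expect F w (\<lambda>\<eta>. f' \<eta> * g' \<eta>) = expect F w (\<lambda>\<eta>. f \<eta> * g \<eta>) - g {} * expect F w f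
      - (f {} * expect F w g - f {} * g {})"
    unfolding eq expect_diff expect_cmult using fin w by (simp add: expect_const)
  moreover have "expect F w f' = expect F w f - f {}" "expect F w g' = expect F w g - g {}"
    unfolding f'_def g'_def expect_diff using fin w by (simp_all add: expect_const)
  ultimately show ?thesis
    unfolding cov_def by (simp add: algebra_simps)
qed

section \<open>The OSSS inequality for decision trees\<close>

lemma increasing_bool: "increasing_on F (\<lambda>\<omega>. of_bool (e \<in> \<omega>) :: real)"
  by (auto intro!: mono_onI)

datatype 'e dtree = Leaf real | Node 'e "'e dtree" "'e dtree"

primrec tree_value :: "'e dtree \<Rightarrow> 'e set \<Rightarrow> real" where
  "tree_value (Leaf c) \<omega> = c"
| "tree_value (Node e t0 t1) \<omega> = (if e \<in> \<omega> then tree_value t1 \<omega> else tree_value t0 \<omega>)"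

primrec tree_queries :: "'e dtree \<Rightarrow> 'e set \<Rightarrow> 'e set" where
  "tree_queries (Leaf c) \<omega> = {}"
| "tree_queries (Node e t0 t1) \<omega> = insert e (if e \<in> \<omega> then tree_queries t1 \<omega> else tree_queries t0 \<omega>)"

text \<open>\<open>A\<close> is the set of edges that have been queried already.\<close>

primrec valid_tree :: "'e set \<Rightarrow> 'e dtree \<Rightarrow> 'e set \<Rightarrow> bool" where
  "valid_tree F (Leaf c) A \<longleftrightarrow> 0 \<le> c \<and> c \<le> 1"
| "valid_tree F (Node e t0 t1) A \<longleftrightarrow>
     e \<in> F - A \<and> valid_tree F t0 (insert e A) \<and> valid_tree F t1 (insert e A)"

lemma tree_queries_subset: "valid_tree F t A \<Longrightarrow> tree_queries t \<omega> \<subseteq> F - A"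
proof (induction t arbitrary: A)
  case (Node e t0 t1)
  thus ?case using Node.IH(1)[of "insert e A"] Node.IH(2)[of "insert e A"] by auto
qed simp

text \<open>The expectation of \<open>x\<close> under the monotone coupling of Bernoulli variables of
  parameters \<open>a\<close> and \<open>b\<close>.\<close>

definition mix :: "real \<Rightarrow> real \<Rightarrow> real \<Rightarrow> real \<Rightarrow> real \<Rightarrow> real \<Rightarrow> real" where
  "mix a b x11 x10 x01 x00 =
     min a b * x11 + (a - min a b) * x10 + (b - min a b) * x01 + (1 - a - b + min a b) * x00"

text \<open>Raising the second parameter moves mass only from states with second bit 0 to states
  with second bit 1 and the same first bit, and y increases in the second bit.\<close>

lemma mix_mono:
  assumes "0 \<le> a" "a \<le> 1" "0 \<le> b" "b \<le> b'" "b' \<le> 1"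
    and x: "x11 \<le> y11" "x10 \<le> y10" "x01 \<le> y01" "x00 \<le> y00" and y: "y10 \<le> y11" "y00 \<le> y01"
  shows "mix a b x11 x10 x01 x00 \<le> mix a b' y11 y10 y01 y00"
proof -
  have "mix a b x11 x10 x01 x00 \<le> mix a b y11 y10 y01 y00"
    unfolding mix_def using assms by (intro add_mono mult_left_mono) (auto simp: min_def)
  also have "\<dots> \<le> mix a b' y11 y10 y01 y00"
  proof -
    have "mix a b' y11 y10 y01 y00 - mix a b y11 y10 y01 y00
      = (min a b' - min a b) * (y11 - y10) + ((b' - min a b') - (b - min a b)) * (y01 - y00)"
      unfolding mix_def by (simp add: algebra_simps)
    also have "\<dots> \<ge> 0" using assms by (intro add_nonneg_nonneg mult_nonneg_nonneg) (auto simp: min_def)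
    finally show ?thesis by simp
  qed
  finally show ?thesis .
qed

text \<open>The monotone coupling differs from the independent one by the covariance min a b - a b
  times the mixed second difference of x. The covariance is at most b (1 - b), and
  \<open>x00 \<le> x01\<close> discards the negative half of the second difference.\<close>

lemma mix_le_indep:
  assumes "0 \<le> a" "a \<le> 1" "0 \<le> b" "b \<le> 1" and "x00 \<le> x01" "x11 - x10 \<le> D" "0 \<le> D"
  shows "mix a b x11 x10 x01 x00
    \<le> a * (b * x11 + (1 - b) * x10) + (1 - a) * (b * x01 + (1 - b) * x00) + b * (1 - b) * D"
proof -
  have c: "0 \<le> min a b - a * b" "min a b - a * b \<le> b * (1 - b)"
  proof -
    show "0 \<le> min a b - a * b" using assms
      by (auto simp: min_def intro: mult_left_le mult_left_le_one_le)
    show "min a b - a * b \<le> b * (1 - b)"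
    proof (cases "a \<le> b")
      case True
      have "a * (1 - b) \<le> b * (1 - b)" using True assms by (intro mult_right_mono) auto
      thus ?thesis using True by (simp add: min_def algebra_simps)
    next
      case False
      have "b * (1 - a) \<le> b * (1 - b)" using False assms by (intro mult_left_mono) auto
      thus ?thesis using False by (simp add: min_def algebra_simps)
    qed
  qed
  have "mix a b x11 x10 x01 x00 - (a * (b * x11 + (1 - b) * x10) + (1 - a) * (b * x01 + (1 - b) * x00))
      = (min a b - a * b) * ((x11 - x10) - (x01 - x00))"
    unfolding mix_def by (simp add: algebra_simps)
  also have "\<dots> \<le> (min a b - a * b) * D" using assms c by (intro mult_left_mono) auto
  also have "\<dots> \<le> b * (1 - b) * D" using assms c by (intro mult_right_mono) auto
  finally show ?thesis by simp
qed

lemma sum_Pow_split: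
  fixes h :: "'e set \<Rightarrow> real"
  assumes "A \<subseteq> F"
  shows "sum h (Pow F) = (\<Sum>\<zeta>\<in>Pow A. \<Sum>\<eta>\<in>Pow (F - A). h (\<eta> \<union> \<zeta>))"
proof -
  have "(\<Sum>\<zeta>\<in>Pow A. \<Sum>\<eta>\<in>Pow (F - A). h (\<eta> \<union> \<zeta>)) = (\<Sum>(\<zeta>, \<eta>)\<in>Pow A \<times> Pow (F - A). h (\<eta> \<union> \<zeta>))"
    by (rule sum.cartesian_product)
  also have "\<dots> = sum h (Pow F)"
    by (rule sum.reindex_bij_witness[of _ "\<lambda>\<eta>. (\<eta> \<inter> A, \<eta> - A)" "\<lambda>(\<zeta>, \<eta>). \<eta> \<union> \<zeta>"])
      (use assms in \<open>auto simp: Int_Un_distrib2\<close>)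
  finally show ?thesis by simp
qed

section \<open>Conditioning a weight that satisfies the FKG condition\<close>

locale fkg_weight =
  fixes F :: "'e set" and w :: "'e set \<Rightarrow> real"
  assumes fin: "finite F" and pos: "positive_on F w" and fkg: "dominated F w w"
begin

text \<open>The conditional expectation given that the configuration agrees with
  \<open>\<zeta>\<close> on A. Accordingly \<open>cZ A \<zeta>\<close> is the unnormalised weight of
  that event, and \<open>cprob e A \<zeta>\<close> the conditional probability that e is
  open.\<close>

definition cexp :: "('e set \<Rightarrow> real) \<Rightarrow> 'e set \<Rightarrow> 'e set \<Rightarrow> real" where
  "cexp f A \<zeta> = expect (F - A) (\<lambda>\<eta>. w (\<eta> \<union> \<zeta>)) (\<lambda>\<eta>. f (\<eta> \<union> \<zeta>))"

definition cZ :: "'e set \<Rightarrow> 'e set \<Rightarrow> real" where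
  "cZ A \<zeta> = (\<Sum>\<eta>\<in>Pow (F - A). w (\<eta> \<union> \<zeta>))"

definition cprob :: "'e \<Rightarrow> 'e set \<Rightarrow> 'e set \<Rightarrow> real" where
  "cprob e A \<zeta> = cZ (insert e A) (insert e \<zeta>) / cZ A \<zeta>"

abbreviation "Z \<equiv> (\<Sum>\<eta>\<in>Pow F. w \<eta>)"

lemma Z_pos: "0 < Z"
  by (rule sum_Pow_pos[OF fin pos])

lemma pos_Un: "\<eta> \<subseteq> F - A \<Longrightarrow> \<zeta> \<subseteq> A \<Longrightarrow> A \<subseteq> F \<Longrightarrow> 0 < w (\<eta> \<union> \<zeta>)"
  using pos[rule_format, of "\<eta> \<union> \<zeta>"] by blast

lemma cZ_pos: "\<zeta> \<subseteq> A \<Longrightarrow> A \<subseteq> F \<Longrightarrow> 0 < cZ A \<zeta>"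
  unfolding cZ_def using fin by (intro sum_Pow_pos) (auto intro: pos_Un)

lemma cexp_cZ: "\<zeta> \<subseteq> A \<Longrightarrow> A \<subseteq> F \<Longrightarrow> cZ A \<zeta> * cexp f A \<zeta> = (\<Sum>\<eta>\<in>Pow (F - A). w (\<eta> \<union> \<zeta>) * f (\<eta> \<union> \<zeta>))"
  using cZ_pos[of \<zeta> A] unfolding cexp_def expect_def cZ_def by simp

lemma cexp_empty: "cexp f {} {} = expect F w f"
  by (simp add: cexp_def)

lemma cexp_cong:
  "(\<And>\<omega>. \<omega> \<subseteq> F \<Longrightarrow> \<omega> \<inter> A = \<zeta> \<Longrightarrow> f \<omega> = g \<omega>) \<Longrightarrow> \<zeta> \<subseteq> A \<Longrightarrow> A \<subseteq> F \<Longrightarrow> cexp f A \<zeta> = cexp g A \<zeta>"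
  unfolding cexp_def
proof (rule expect_cong)
  fix \<eta> assume a: "\<And>\<omega>. \<omega> \<subseteq> F \<Longrightarrow> \<omega> \<inter> A = \<zeta> \<Longrightarrow> f \<omega> = g \<omega>" and "\<zeta> \<subseteq> A" "A \<subseteq> F" "\<eta> \<subseteq> F - A"
  thus "f (\<eta> \<union> \<zeta>) = g (\<eta> \<union> \<zeta>)" by (intro a) auto
qed

lemma sum_split_step:
  fixes h :: "'e set \<Rightarrow> real"
  assumes "A \<subseteq> F" "e \<in> F - A" "\<zeta> \<subseteq> A"
  shows "(\<Sum>\<eta>\<in>Pow (F - A). h (\<eta> \<union> \<zeta>)) = (\<Sum>\<eta>\<in>Pow (F - insert e A). h (\<eta> \<union> \<zeta>))
     + (\<Sum>\<eta>\<in>Pow (F - insert e A). h (\<eta> \<union> insert e \<zeta>))"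
proof -
  have eq: "F - A = insert e (F - insert e A)" using assms by auto
  have "(\<Sum>\<eta>\<in>Pow (insert e (F - insert e A)). h (\<eta> \<union> \<zeta>)) = (\<Sum>\<eta>\<in>Pow (F - insert e A). h (\<eta> \<union> \<zeta>))
     + (\<Sum>\<eta>\<in>Pow (F - insert e A). h (\<eta> \<union> insert e \<zeta>))"
    by (subst sum_Pow_insert) (use fin in \<open>auto simp: sum.distrib\<close>)
  thus ?thesis using eq by (simp only:)
qed

lemma cZ_split:
  assumes "A \<subseteq> F" "e \<in> F - A" "\<zeta> \<subseteq> A"
  shows "cZ A \<zeta> = cZ (insert e A) \<zeta> + cZ (insert e A) (insert e \<zeta>)"
  unfolding cZ_def by (rule sum_split_step[OF assms])

lemma cZ_cprob:
  assumes "A \<subseteq> F" "e \<in> F - A" "\<zeta> \<subseteq> A"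
  shows "cZ (insert e A) (insert e \<zeta>) = cprob e A \<zeta> * cZ A \<zeta>"
    "cZ (insert e A) \<zeta> = (1 - cprob e A \<zeta>) * cZ A \<zeta>"
  using cZ_pos[OF assms(3,1)] cZ_split[OF assms] by (auto simp: cprob_def field_simps)

lemma cprob_bounds:
  assumes "A \<subseteq> F" "e \<in> F - A" "\<zeta> \<subseteq> A"
  shows "0 \<le> cprob e A \<zeta>" "cprob e A \<zeta> \<le> 1"
proof -
  have "0 < cZ A \<zeta>" "0 < cZ (insert e A) (insert e \<zeta>)" "0 < cZ (insert e A) \<zeta>"
    using assms by (auto intro!: cZ_pos)
  thus "0 \<le> cprob e A \<zeta>" "cprob e A \<zeta> \<le> 1"
    using cZ_split[OF assms] by (auto simp: cprob_def)
qed

lemma cexp_split: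
  assumes "A \<subseteq> F" "e \<in> F - A" "\<zeta> \<subseteq> A"
  shows "cexp f A \<zeta> = cprob e A \<zeta> * cexp f (insert e A) (insert e \<zeta>)
    + (1 - cprob e A \<zeta>) * cexp f (insert e A) \<zeta>"
proof -
  have "cZ A \<zeta> * cexp f A \<zeta> = cZ (insert e A) \<zeta> * cexp f (insert e A) \<zeta>
      + cZ (insert e A) (insert e \<zeta>) * cexp f (insert e A) (insert e \<zeta>)"
    using assms sum_split_step[OF assms, of "\<lambda>\<eta>. w \<eta> * f \<eta>"]
    by (subst (1 2 3) cexp_cZ) auto
  also have "\<dots> = cZ A \<zeta> * (cprob e A \<zeta> * cexp f (insert e A) (insert e \<zeta>)
    + (1 - cprob e A \<zeta>) * cexp f (insert e A) \<zeta>)"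
    unfolding cZ_cprob[OF assms] by (simp add: algebra_simps)
  finally show ?thesis using cZ_pos[OF assms(3,1)] by simp
qed

lemma cexp_const: "\<zeta> \<subseteq> A \<Longrightarrow> A \<subseteq> F \<Longrightarrow> cexp (\<lambda>_. c) A \<zeta> = c"
  unfolding cexp_def using fin by (intro expect_const) (auto intro: pos_Un)

lemma cexp_cmult: "cexp (\<lambda>\<omega>. c * f \<omega>) A \<zeta> = c * cexp f A \<zeta>"
  unfolding cexp_def by (rule expect_cmult)

lemma cexp_add: "cexp (\<lambda>\<omega>. f \<omega> + g \<omega>) A \<zeta> = cexp f A \<zeta> + cexp g A \<zeta>"
  unfolding cexp_def by (rule expect_add)

lemma cexp_bool:
  assumes "A \<subseteq> F" "e \<in> F - A" "\<zeta> \<subseteq> A"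
  shows "cexp (\<lambda>\<omega>. of_bool (e \<in> \<omega>)) A \<zeta> = cprob e A \<zeta>"
proof -
  have "cexp (\<lambda>\<omega>. of_bool (e \<in> \<omega>)) (insert e A) (insert e \<zeta>) = cexp (\<lambda>\<omega>. 1) (insert e A) (insert e \<zeta>)"
    by (rule cexp_cong) (use assms in auto)
  moreover have "cexp (\<lambda>\<omega>. of_bool (e \<in> \<omega>)) (insert e A) \<zeta> = cexp (\<lambda>\<omega>. 0) (insert e A) \<zeta>"
    by (rule cexp_cong) (use assms in auto)
  ultimately show ?thesis
    using assms cexp_split[OF assms, of "\<lambda>\<omega>. of_bool (e \<in> \<omega>)"]
    by (subst (asm) (1 2) cexp_const) auto
qed

text \<open>Enlarging \<open>\<zeta>\<close> raises the integrand pointwise, and by the FKG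
  condition it also raises the conditional weight in the sense of \<open>dominated\<close>.\<close>

lemma cexp_mono:
  assumes f: "increasing_on F f" and "\<zeta> \<subseteq> \<zeta>'" "\<zeta>' \<subseteq> A" "A \<subseteq> F"
  shows "cexp f A \<zeta> \<le> cexp f A \<zeta>'"
proof -
  have "cexp f A \<zeta> \<le> expect (F - A) (\<lambda>\<eta>. w (\<eta> \<union> \<zeta>)) (\<lambda>\<eta>. f (\<eta> \<union> \<zeta>'))"
    unfolding cexp_def using assms fin
    by (intro expect_mono mono_onD[OF f]) (auto intro: pos_Un)
  also have "\<dots> \<le> cexp f A \<zeta>'" unfolding cexp_def
  proof (rule dominated_expect_mono)
    show "dominated (F - A) (\<lambda>\<eta>. w (\<eta> \<union> \<zeta>)) (\<lambda>\<eta>. w (\<eta> \<union> \<zeta>'))"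
      unfolding dominated_def
    proof (intro allI impI, elim conjE)
      fix \<eta> \<eta>' e assume h: "\<eta> \<subseteq> \<eta>'" "\<eta>' \<subseteq> F - A" "e \<in> F - A - \<eta>'"
      show "w (insert e \<eta> \<union> \<zeta>) * w (\<eta>' \<union> \<zeta>') \<le> w (\<eta> \<union> \<zeta>) * w (insert e \<eta>' \<union> \<zeta>')"
        using dominatedD[OF fkg, of "\<eta> \<union> \<zeta>" "\<eta>' \<union> \<zeta>'" e] h assms
        by (simp add: le_supI1 le_supI2) blast
    qed
  qed (use assms fin in \<open>auto intro!: mono_onI mono_onD[OF f] intro: pos_Un\<close>)
  finally show ?thesis .
qed

lemma sum_cZ:
  assumes "A \<subseteq> F"
  shows "(\<Sum>\<zeta>\<in>Pow A. cZ A \<zeta> * g \<zeta>) = Z * expect F w (\<lambda>\<eta>. g (\<eta> \<inter> A))"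
proof -
  have "Z * expect F w (\<lambda>\<eta>. g (\<eta> \<inter> A)) = (\<Sum>\<eta>\<in>Pow F. w \<eta> * g (\<eta> \<inter> A))"
    using Z_pos by (simp add: expect_def)
  also have "\<dots> = (\<Sum>\<zeta>\<in>Pow A. \<Sum>\<eta>\<in>Pow (F - A). w (\<eta> \<union> \<zeta>) * g ((\<eta> \<union> \<zeta>) \<inter> A))"
    by (rule sum_Pow_split[OF assms])
  also have "\<dots> = (\<Sum>\<zeta>\<in>Pow A. \<Sum>\<eta>\<in>Pow (F - A). w (\<eta> \<union> \<zeta>) * g \<zeta>)"
  proof (intro sum.cong refl)
    fix \<zeta> \<eta> assume "\<zeta> \<in> Pow A" "\<eta> \<in> Pow (F - A)"
    hence "(\<eta> \<union> \<zeta>) \<inter> A = \<zeta>" by auto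
    thus "w (\<eta> \<union> \<zeta>) * g ((\<eta> \<union> \<zeta>) \<inter> A) = w (\<eta> \<union> \<zeta>) * g \<zeta>" by simp
  qed
  finally show ?thesis by (simp add: cZ_def sum_distrib_right)
qed

text \<open>The tower property for conditioning on the states in A, left unnormalised.\<close>

lemma sum_cZ_cexp:
  assumes "A \<subseteq> F"
  shows "(\<Sum>\<zeta>\<in>Pow A. cZ A \<zeta> * cexp f A \<zeta>) = Z * expect F w f"
proof -
  have "(\<Sum>\<zeta>\<in>Pow A. cZ A \<zeta> * cexp f A \<zeta>) = (\<Sum>\<zeta>\<in>Pow A. \<Sum>\<eta>\<in>Pow (F - A). w (\<eta> \<union> \<zeta>) * f (\<eta> \<union> \<zeta>))"
    using assms by (intro sum.cong refl cexp_cZ) auto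
  also have "\<dots> = Z * expect F w f"
    using Z_pos by (simp add: expect_def sum_Pow_split[OF assms])
  finally show ?thesis .
qed

abbreviation edge_cov :: "('e set \<Rightarrow> real) \<Rightarrow> 'e \<Rightarrow> real" where
  "edge_cov f e \<equiv> cov F w f (\<lambda>\<omega>. of_bool (e \<in> \<omega>))"

lemma edge_cov_nonneg: "increasing_on F f \<Longrightarrow> 0 \<le> edge_cov f e"
  by (intro FKG fin pos fkg increasing_bool)

text \<open>The covariance dominates the mean conditional covariance, since the conditional expectations
  are increasing functions and hence positively correlated.\<close>

lemma sum_cond_cov:
  assumes f: "increasing_on F f" and A: "A \<subseteq> F" "e \<in> F - A"
  shows "(\<Sum>\<zeta>\<in>Pow A. cZ A \<zeta> * (cprob e A \<zeta> * (1 - cprob e A \<zeta>) *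
           (cexp f (insert e A) (insert e \<zeta>) - cexp f (insert e A) \<zeta>))) \<le> Z * edge_cov f e"
proof -
  let ?b = "\<lambda>\<omega>. of_bool (e \<in> \<omega>) :: real"
  have "cprob e A \<zeta> * (1 - cprob e A \<zeta>) * (cexp f (insert e A) (insert e \<zeta>) - cexp f (insert e A) \<zeta>)
      = cexp (\<lambda>\<omega>. f \<omega> * ?b \<omega>) A \<zeta> - cexp f A \<zeta> * cexp ?b A \<zeta>" if z: "\<zeta> \<subseteq> A" for \<zeta>
  proof -
    have "cexp (\<lambda>\<omega>. f \<omega> * ?b \<omega>) (insert e A) (insert e \<zeta>) = cexp f (insert e A) (insert e \<zeta>)"
      by (rule cexp_cong) (use A z in auto)
    moreover have "cexp (\<lambda>\<omega>. f \<omega> * ?b \<omega>) (insert e A) \<zeta> = cexp (\<lambda>_. 0) (insert e A) \<zeta>"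
      by (rule cexp_cong) (use A z in auto)
    moreover have "cexp (\<lambda>_. 0) (insert e A) \<zeta> = 0"
      by (rule cexp_const) (use A z in auto)
    ultimately have "cexp (\<lambda>\<omega>. f \<omega> * ?b \<omega>) A \<zeta> = cprob e A \<zeta> * cexp f (insert e A) (insert e \<zeta>)"
      using cexp_split[OF A z, of "\<lambda>\<omega>. f \<omega> * ?b \<omega>"] by simp
    thus ?thesis by (simp only: cexp_split[OF A z, of f] cexp_bool[OF A z]) (simp add: algebra_simps)
  qed
  hence "(\<Sum>\<zeta>\<in>Pow A. cZ A \<zeta> * (cprob e A \<zeta> * (1 - cprob e A \<zeta>) *
           (cexp f (insert e A) (insert e \<zeta>) - cexp f (insert e A) \<zeta>)))
     = (\<Sum>\<zeta>\<in>Pow A. cZ A \<zeta> * cexp (\<lambda>\<omega>. f \<omega> * ?b \<omega>) A \<zeta>)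
      - (\<Sum>\<zeta>\<in>Pow A. cZ A \<zeta> * (cexp f A \<zeta> * cexp ?b A \<zeta>))"
    by (simp add: right_diff_distrib sum_subtractf)
  also have "\<dots> = Z * (expect F w (\<lambda>\<omega>. f \<omega> * ?b \<omega>)
      - expect F w (\<lambda>\<eta>. cexp f A (\<eta> \<inter> A) * cexp ?b A (\<eta> \<inter> A)))"
    unfolding sum_cZ_cexp[OF A(1)] sum_cZ[OF A(1)] by (simp add: algebra_simps)
  also have "\<dots> \<le> Z * edge_cov f e"
  proof (rule mult_left_mono)
    have tower: "expect F w (\<lambda>\<eta>. cexp g A (\<eta> \<inter> A)) = expect F w g" for g
      using sum_cZ[OF A(1), of "cexp g A"] sum_cZ_cexp[OF A(1), of g] Z_pos by simp
    have inc: "increasing_on F (\<lambda>\<eta>. cexp g A (\<eta> \<inter> A))" if "increasing_on F g" for g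
      using A by (intro mono_onI cexp_mono[OF that]) auto
    have "0 \<le> cov F w (\<lambda>\<eta>. cexp f A (\<eta> \<inter> A)) (\<lambda>\<eta>. cexp ?b A (\<eta> \<inter> A))"
      by (rule FKG[OF fin pos fkg]) (auto intro!: inc f increasing_bool)
    thus "expect F w (\<lambda>\<omega>. f \<omega> * ?b \<omega>) - expect F w (\<lambda>\<eta>. cexp f A (\<eta> \<inter> A) * cexp ?b A (\<eta> \<inter> A))
        \<le> edge_cov f e"
      unfolding cov_def tower by simp
  qed (use Z_pos in simp)
  finally show ?thesis .
qed

text \<open>The tree \<open>t\<close> explores a configuration \<open>X\<close>, conditioned on \<open>X \<inter> A = \<eta>\<close>; a second
  configuration \<open>Y\<close>, conditioned on \<open>Y \<inter> A = \<zeta>\<close>, is sampled along with \<open>X\<close>, monotonically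
  coupled to it at each query, and independently once the exploration has stopped. The value of
  \<open>coupled\<close> is the expectation of \<open>tree_value t X * f Y\<close>.\<close>

primrec coupled :: "('e set \<Rightarrow> real) \<Rightarrow> 'e dtree \<Rightarrow> 'e set \<Rightarrow> 'e set \<Rightarrow> 'e set \<Rightarrow> real" where
  "coupled f (Leaf c) A \<eta> \<zeta> = c * cexp f A \<zeta>"
| "coupled f (Node e t0 t1) A \<eta> \<zeta> = mix (cprob e A \<eta>) (cprob e A \<zeta>)
     (coupled f t1 (insert e A) (insert e \<eta>) (insert e \<zeta>)) (coupled f t1 (insert e A) (insert e \<eta>) \<zeta>)
     (coupled f t0 (insert e A) \<eta> (insert e \<zeta>)) (coupled f t0 (insert e A) \<eta> \<zeta>)"

text \<open>The two conclusions place the increment of \<open>coupled\<close> in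
  \<open>\<zeta>\<close> between 0 and the increment of \<open>cexp f\<close>, as
  \<open>mix_le_indep\<close> requires. The second is the first for a tree with leaf values 1 - c,
  which is where the bound of leaf values by 1 enters. Both pass through a query by
  \<open>mix_mono\<close>.\<close>

lemma coupled_mono:
  assumes f: "increasing_on F f"
  shows "valid_tree F t A \<Longrightarrow> A \<subseteq> F \<Longrightarrow> \<eta> \<subseteq> A \<Longrightarrow> \<zeta> \<subseteq> \<zeta>' \<Longrightarrow> \<zeta>' \<subseteq> A \<Longrightarrow>
    coupled f t A \<eta> \<zeta> \<le> coupled f t A \<eta> \<zeta>' \<and>
    cexp f A \<zeta> - coupled f t A \<eta> \<zeta> \<le> cexp f A \<zeta>' - coupled f t A \<eta> \<zeta>'"
proof (induction t arbitrary: A \<eta> \<zeta> \<zeta>')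
  case (Leaf c)
  have "cexp f A \<zeta> \<le> cexp f A \<zeta>'" using Leaf by (intro cexp_mono[OF f]) auto
  hence "c * cexp f A \<zeta> \<le> c * cexp f A \<zeta>'" "(1 - c) * cexp f A \<zeta> \<le> (1 - c) * cexp f A \<zeta>'"
    using Leaf by (auto intro!: mult_left_mono)
  thus ?case by (simp add: algebra_simps)
next
  case (Node e t0 t1)
  let ?A = "insert e A"
  have e: "e \<in> F - A" and v: "valid_tree F t0 ?A" "valid_tree F t1 ?A" using Node.prems by auto
  have A: "?A \<subseteq> F" using e Node.prems by auto
  note IH0 = Node.IH(1)[OF v(1) A] and IH1 = Node.IH(2)[OF v(2) A]
  let ?a = "cprob e A \<eta>" and ?b = "cprob e A \<zeta>" and ?b' = "cprob e A \<zeta>'"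
  have z: "\<zeta> \<subseteq> A" using Node.prems by auto
  have bb: "?b \<le> ?b'"
    using cexp_mono[OF increasing_bool, of \<zeta> \<zeta>' A e] Node.prems z e
    by (simp add: cexp_bool)
  have bnd: "0 \<le> ?a" "?a \<le> 1" "0 \<le> ?b" "?b \<le> 1" "0 \<le> ?b'" "?b' \<le> 1"
    using cprob_bounds[OF Node.prems(2) e] Node.prems z by auto
  let ?x1 = "coupled f t1 ?A (insert e \<eta>)" and ?x0 = "coupled f t0 ?A \<eta>" and ?E = "cexp f ?A"
  have sub: "\<zeta> \<subseteq> ?A" "\<zeta>' \<subseteq> ?A" "insert e \<zeta> \<subseteq> ?A" "insert e \<zeta>' \<subseteq> ?A" "\<eta> \<subseteq> ?A" "insert e \<eta> \<subseteq> ?A"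
    "\<zeta> \<subseteq> insert e \<zeta>" "\<zeta>' \<subseteq> insert e \<zeta>'" "insert e \<zeta> \<subseteq> insert e \<zeta>'"
    using Node.prems z by auto
  have 1: "coupled f (Node e t0 t1) A \<eta> \<zeta> \<le> coupled f (Node e t0 t1) A \<eta> \<zeta>'"
    unfolding coupled.simps
    by (rule mix_mono) (use bnd bb sub IH0 IH1 Node.prems(4) in auto)
  have E: "cexp f A z = mix (cprob e A \<eta>) (cprob e A z) (?E (insert e z)) (?E z) (?E (insert e z)) (?E z)"
    if "z \<subseteq> A" for z
    using cexp_split[OF Node.prems(2) e that, of f] by (simp add: mix_def algebra_simps)
  have D: "cexp f A z - coupled f (Node e t0 t1) A \<eta> z = mix (cprob e A \<eta>) (cprob e A z)
      (?E (insert e z) - ?x1 (insert e z)) (?E z - ?x1 z)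
      (?E (insert e z) - ?x0 (insert e z)) (?E z - ?x0 z)" if "z \<subseteq> A" for z
    unfolding E[OF that] by (simp add: mix_def algebra_simps)
  have 2: "cexp f A \<zeta> - coupled f (Node e t0 t1) A \<eta> \<zeta> \<le> cexp f A \<zeta>' - coupled f (Node e t0 t1) A \<eta> \<zeta>'"
    unfolding D[OF z] D[OF Node.prems(5)]
    by (rule mix_mono) (use bnd bb sub IH0 IH1 Node.prems(4) in auto)
  show ?case using 1 2 by blast
qed

primrec tree_mean :: "'e dtree \<Rightarrow> 'e set \<Rightarrow> 'e set \<Rightarrow> real" where
  "tree_mean (Leaf c) A \<eta> = c"
| "tree_mean (Node e t0 t1) A \<eta> = cprob e A \<eta> * tree_mean t1 (insert e A) (insert e \<eta>)
     + (1 - cprob e A \<eta>) * tree_mean t0 (insert e A) \<eta>"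

primrec tree_cost :: "('e \<Rightarrow> real) \<Rightarrow> 'e dtree \<Rightarrow> 'e set \<Rightarrow> 'e set \<Rightarrow> real" where
  "tree_cost c (Leaf _) A \<eta> = 0"
| "tree_cost c (Node e t0 t1) A \<eta> = c e + cprob e A \<eta> * tree_cost c t1 (insert e A) (insert e \<eta>)
     + (1 - cprob e A \<eta>) * tree_cost c t0 (insert e A) \<eta>"

text \<open>Averaging over \<open>\<zeta>\<close> with weights \<open>cZ\<close> gives the second
  configuration its unconditioned law. Replacing the monotone coupling of one query by the
  independent one costs a conditional covariance of f with that edge, whose mean
  \<open>sum_cond_cov\<close> bounds by \<open>edge_cov f e\<close>. Once no query is coupled, the
  expectation factorises.\<close>

lemma coupled_le_cost:
  assumes f: "increasing_on F f"
  shows "valid_tree F t A \<Longrightarrow> A \<subseteq> F \<Longrightarrow> \<eta> \<subseteq> A \<Longrightarrow>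
    (\<Sum>\<zeta>\<in>Pow A. cZ A \<zeta> * coupled f t A \<eta> \<zeta>)
      \<le> Z * (tree_mean t A \<eta> * expect F w f + tree_cost (edge_cov f) t A \<eta>)"
proof (induction t arbitrary: A \<eta>)
  case (Leaf c)
  have "(\<Sum>\<zeta>\<in>Pow A. cZ A \<zeta> * coupled f (Leaf c) A \<eta> \<zeta>) = c * (\<Sum>\<zeta>\<in>Pow A. cZ A \<zeta> * cexp f A \<zeta>)"
    by (simp add: sum_distrib_left mult_ac)
  thus ?case using sum_cZ_cexp[OF Leaf(2), of f] by simp
next
  case (Node e t0 t1)
  let ?A = "insert e A"
  have e: "e \<in> F - A" and v: "valid_tree F t0 ?A" "valid_tree F t1 ?A" using Node.prems by auto
  have A: "?A \<subseteq> F" and eta: "\<eta> \<subseteq> ?A" "insert e \<eta> \<subseteq> ?A" using e Node.prems by auto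
  have finA: "finite A" using Node.prems fin finite_subset by auto
  let ?x1 = "coupled f t1 ?A (insert e \<eta>)" and ?x0 = "coupled f t0 ?A \<eta>" and ?E = "cexp f ?A"
  let ?a = "cprob e A \<eta>"
  let ?D = "\<lambda>\<zeta>. cprob e A \<zeta> * (1 - cprob e A \<zeta>) * (?E (insert e \<zeta>) - ?E \<zeta>)"
  have split: "(\<Sum>\<zeta>\<in>Pow ?A. cZ ?A \<zeta> * g \<zeta>)
      = (\<Sum>\<zeta>\<in>Pow A. cZ A \<zeta> * (cprob e A \<zeta> * g (insert e \<zeta>) + (1 - cprob e A \<zeta>) * g \<zeta>))" for g
    using finA e Node.prems
    by (subst sum_Pow_insert) (auto intro!: sum.cong simp: cZ_cprob algebra_simps)
  have "(\<Sum>\<zeta>\<in>Pow A. cZ A \<zeta> * coupled f (Node e t0 t1) A \<eta> \<zeta>)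
      \<le> (\<Sum>\<zeta>\<in>Pow A. cZ A \<zeta> * (?a * (cprob e A \<zeta> * ?x1 (insert e \<zeta>) + (1 - cprob e A \<zeta>) * ?x1 \<zeta>)
          + (1 - ?a) * (cprob e A \<zeta> * ?x0 (insert e \<zeta>) + (1 - cprob e A \<zeta>) * ?x0 \<zeta>) + ?D \<zeta>))"
  proof (intro sum_mono mult_left_mono)
    fix \<zeta> assume "\<zeta> \<in> Pow A"
    hence z: "\<zeta> \<subseteq> A" by simp
    have s: "\<zeta> \<subseteq> insert e \<zeta>" "insert e \<zeta> \<subseteq> ?A" using z by auto
    note m1 = coupled_mono[OF f v(2) A eta(2) s] and m0 = coupled_mono[OF f v(1) A eta(1) s]
    show "0 \<le> cZ A \<zeta>" using cZ_pos[OF z] Node.prems by simp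
    show "coupled f (Node e t0 t1) A \<eta> \<zeta> \<le> ?a * (cprob e A \<zeta> * ?x1 (insert e \<zeta>) + (1 - cprob e A \<zeta>) * ?x1 \<zeta>)
          + (1 - ?a) * (cprob e A \<zeta> * ?x0 (insert e \<zeta>) + (1 - cprob e A \<zeta>) * ?x0 \<zeta>) + ?D \<zeta>"
      unfolding coupled.simps
      by (rule mix_le_indep)
        (use cprob_bounds[OF Node.prems(2) e] Node.prems z m1 m0 cexp_mono[OF f s A] in auto)
  qed
  also have "\<dots> = ?a * (\<Sum>\<zeta>\<in>Pow ?A. cZ ?A \<zeta> * ?x1 \<zeta>) + (1 - ?a) * (\<Sum>\<zeta>\<in>Pow ?A. cZ ?A \<zeta> * ?x0 \<zeta>)
      + (\<Sum>\<zeta>\<in>Pow A. cZ A \<zeta> * ?D \<zeta>)"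
    unfolding split by (simp add: sum_distrib_left sum.distrib distrib_left mult_ac)
  also have "\<dots> \<le> ?a * (Z * (tree_mean t1 ?A (insert e \<eta>) * expect F w f + tree_cost (edge_cov f) t1 ?A (insert e \<eta>)))
      + (1 - ?a) * (Z * (tree_mean t0 ?A \<eta> * expect F w f + tree_cost (edge_cov f) t0 ?A \<eta>)) + Z * edge_cov f e"
    using cprob_bounds[OF Node.prems(2) e Node.prems(3)]
    by (intro add_mono mult_left_mono Node.IH v A eta sum_cond_cov[OF f Node.prems(2) e]) auto
  also have "\<dots> = Z * (tree_mean (Node e t0 t1) A \<eta> * expect F w f + tree_cost (edge_cov f) (Node e t0 t1) A \<eta>)"
    by (simp add: algebra_simps)
  finally show ?case .
qed

text \<open>With equal parameters the monotone coupling gives no mass to the states in which the two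
  bits differ, so the two configurations agree on every queried edge.\<close>

lemma coupled_diagonal:
  "valid_tree F t A \<Longrightarrow> A \<subseteq> F \<Longrightarrow> \<eta> \<subseteq> A \<Longrightarrow> coupled f t A \<eta> \<eta> = cexp (\<lambda>\<omega>. tree_value t \<omega> * f \<omega>) A \<eta>"
proof (induction t arbitrary: A \<eta>)
  case (Node e t0 t1)
  let ?A = "insert e A"
  have e: "e \<in> F - A" and v: "valid_tree F t0 ?A" "valid_tree F t1 ?A" using Node.prems by auto
  have A: "?A \<subseteq> F" and eta: "\<eta> \<subseteq> ?A" "insert e \<eta> \<subseteq> ?A" using e Node.prems by auto
  have "cexp (\<lambda>\<omega>. tree_value (Node e t0 t1) \<omega> * f \<omega>) ?A (insert e \<eta>) = cexp (\<lambda>\<omega>. tree_value t1 \<omega> * f \<omega>) ?A (insert e \<eta>)"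
    by (rule cexp_cong[OF _ eta(2) A]) auto
  moreover have "cexp (\<lambda>\<omega>. tree_value (Node e t0 t1) \<omega> * f \<omega>) ?A \<eta> = cexp (\<lambda>\<omega>. tree_value t0 \<omega> * f \<omega>) ?A \<eta>"
    by (rule cexp_cong[OF _ eta(1) A]) (use e Node.prems in auto)
  ultimately show ?case
    using cexp_split[OF Node.prems(2) e Node.prems(3), of "\<lambda>\<omega>. tree_value (Node e t0 t1) \<omega> * f \<omega>"]
      Node.IH(1)[OF v(1) A eta(1)] Node.IH(2)[OF v(2) A eta(2)]
    by (simp add: mix_def)
qed (simp add: cexp_cmult)

lemma tree_mean_eq:
  "valid_tree F t A \<Longrightarrow> A \<subseteq> F \<Longrightarrow> \<eta> \<subseteq> A \<Longrightarrow> tree_mean t A \<eta> = cexp (tree_value t) A \<eta>"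
proof (induction t arbitrary: A \<eta>)
  case (Node e t0 t1)
  let ?A = "insert e A"
  have e: "e \<in> F - A" and v: "valid_tree F t0 ?A" "valid_tree F t1 ?A" using Node.prems by auto
  have A: "?A \<subseteq> F" and eta: "\<eta> \<subseteq> ?A" "insert e \<eta> \<subseteq> ?A" using e Node.prems by auto
  have "cexp (tree_value (Node e t0 t1)) ?A (insert e \<eta>) = cexp (tree_value t1) ?A (insert e \<eta>)"
    by (rule cexp_cong[OF _ eta(2) A]) auto
  moreover have "cexp (tree_value (Node e t0 t1)) ?A \<eta> = cexp (tree_value t0) ?A \<eta>"
    by (rule cexp_cong[OF _ eta(1) A]) (use e Node.prems in auto)
  ultimately show ?case
    using cexp_split[OF Node.prems(2) e Node.prems(3), of "tree_value (Node e t0 t1)"]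
      Node.IH(1)[OF v(1) A eta(1)] Node.IH(2)[OF v(2) A eta(2)]
    by (simp del: tree_value.simps)
next
  case (Leaf c)
  have "tree_value (Leaf c) = (\<lambda>_. c :: real)" by (simp add: fun_eq_iff)
  thus ?case using Leaf by (simp add: cexp_const)
qed

lemma tree_cost_eq:
  "valid_tree F t A \<Longrightarrow> A \<subseteq> F \<Longrightarrow> \<eta> \<subseteq> A \<Longrightarrow> tree_cost c t A \<eta> = cexp (\<lambda>\<omega>. sum c (tree_queries t \<omega>)) A \<eta>"
proof (induction t arbitrary: A \<eta>)
  case (Node e t0 t1)
  let ?A = "insert e A"
  have e: "e \<in> F - A" and v: "valid_tree F t0 ?A" "valid_tree F t1 ?A" using Node.prems by auto
  have A: "?A \<subseteq> F" and eta: "\<eta> \<subseteq> ?A" "insert e \<eta> \<subseteq> ?A" using e Node.prems by auto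
  have q: "e \<notin> tree_queries t \<omega>" "finite (tree_queries t \<omega>)" if "t \<in> {t0, t1}" for t \<omega>
    using tree_queries_subset[of F t ?A \<omega>] v that fin by (auto intro: finite_subset)
  have "cexp (\<lambda>\<omega>. sum c (tree_queries (Node e t0 t1) \<omega>)) ?A (insert e \<eta>)
      = cexp (\<lambda>\<omega>. c e + sum c (tree_queries t1 \<omega>)) ?A (insert e \<eta>)"
    by (rule cexp_cong[OF _ eta(2) A]) (use q in auto)
  moreover have "cexp (\<lambda>\<omega>. sum c (tree_queries (Node e t0 t1) \<omega>)) ?A \<eta>
      = cexp (\<lambda>\<omega>. c e + sum c (tree_queries t0 \<omega>)) ?A \<eta>"
    by (rule cexp_cong[OF _ eta(1) A]) (use e Node.prems q in auto)
  ultimately show ?case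
    using cexp_split[OF Node.prems(2) e Node.prems(3), of "\<lambda>\<omega>. sum c (tree_queries (Node e t0 t1) \<omega>)"]
      Node.IH(1)[OF v(1) A eta(1)] Node.IH(2)[OF v(2) A eta(2)] cexp_const[OF eta(1) A] cexp_const[OF eta(2) A]
    by (simp add: cexp_add algebra_simps)
qed (simp add: cexp_const)

text \<open>With nothing revealed, \<open>coupled f t {} {} {}\<close> is the mean of f squared by
  \<open>coupled_diagonal\<close>, because the tree computes f. By \<open>coupled_le_cost\<close> it
  is also at most the square of the mean plus the expected total of \<open>edge_cov\<close> over the
  queries. The difference of the two is the variance.\<close>

theorem OSSS:
  assumes f: "increasing_on F f" and t: "valid_tree F t {}"
    and tf: "\<And>\<omega>. \<omega> \<subseteq> F \<Longrightarrow> tree_value t \<omega> = f \<omega>"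
  shows "cov F w f f \<le> (\<Sum>e\<in>F. expect F w (\<lambda>\<omega>. of_bool (e \<in> tree_queries t \<omega>)) * edge_cov f e)"
proof -
  have "Z * coupled f t {} {} {} \<le> Z * (tree_mean t {} {} * expect F w f + tree_cost (edge_cov f) t {} {})"
    using coupled_le_cost[OF f t, of "{}"] by (simp add: cZ_def)
  hence "coupled f t {} {} {} \<le> tree_mean t {} {} * expect F w f + tree_cost (edge_cov f) t {} {}"
    using Z_pos by simp
  moreover have "coupled f t {} {} {} = expect F w (\<lambda>\<omega>. f \<omega> * f \<omega>)"
    using coupled_diagonal[OF t, of "{}" f] by (simp add: cexp_empty) (auto intro!: expect_cong simp: tf)
  moreover have "tree_mean t {} {} = expect F w f"
    using tree_mean_eq[OF t, of "{}"] by (simp add: cexp_empty) (auto intro!: expect_cong simp: tf)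
  moreover have "tree_cost (edge_cov f) t {} {}
      = (\<Sum>e\<in>F. expect F w (\<lambda>\<omega>. of_bool (e \<in> tree_queries t \<omega>)) * edge_cov f e)"
  proof -
    have "sum (edge_cov f) (tree_queries t \<omega>) = (\<Sum>e\<in>F. edge_cov f e * of_bool (e \<in> tree_queries t \<omega>))" (is "_ = ?S \<omega>") for \<omega>
      using tree_queries_subset[OF t, of \<omega>] fin
      by (intro sum.mono_neutral_cong_left) auto
    thus ?thesis using tree_cost_eq[OF t, of "{}" "edge_cov f"]
      by (simp only: cexp_empty expect_sum expect_cmult) (simp add: mult.commute)
  qed
  ultimately show ?thesis by (simp add: cov_def)
qed

end

section \<open>Connectivity and cluster counts\<close>

definition conn :: "'v set set \<Rightarrow> 'v \<Rightarrow> 'v \<Rightarrow> bool" where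
  "conn \<eta> = (\<lambda>u v. {u, v} \<in> \<eta>)\<^sup>*\<^sup>*"

definition comps :: "'v set \<Rightarrow> 'v set set \<Rightarrow> 'v set set" where
  "comps S \<eta> = (\<lambda>x. {y. conn \<eta> x y}) ` S"

lemma conn_refl [simp]: "conn \<eta> x x"
  by (simp add: conn_def)

lemma conn_trans: "conn \<eta> x y \<Longrightarrow> conn \<eta> y z \<Longrightarrow> conn \<eta> x z"
  by (simp add: conn_def)

lemma conn_sym: "conn \<eta> x y \<Longrightarrow> conn \<eta> y x"
  unfolding conn_def
  by (rule sympD[OF symp_rtranclp]) (auto intro!: sympI simp: insert_commute)

lemma conn_edge: "{x, y} \<in> \<eta> \<Longrightarrow> conn \<eta> x y"
  by (simp add: conn_def r_into_rtranclp)

lemma conn_mono: "\<eta> \<subseteq> \<eta>' \<Longrightarrow> conn \<eta> x y \<Longrightarrow> conn \<eta>' x y"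
  unfolding conn_def by (erule rtranclp_mono[THEN predicate2D, rotated]) auto

lemma conn_induct [consumes 1, case_names base step]:
  assumes "conn \<eta> x y" "P x" "\<And>y z. conn \<eta> x y \<Longrightarrow> {y, z} \<in> \<eta> \<Longrightarrow> P y \<Longrightarrow> P z"
  shows "P y"
  using assms unfolding conn_def by (rule rtranclp_induct)

text \<open>The path is stopped at its first vertex violating P; every edge used so far starts from
  a vertex satisfying P.\<close>

lemma conn_first_exit:
  assumes "conn \<eta> x y" "P x" "\<not> P y"
  shows "\<exists>u v. conn {e \<in> \<eta>. \<exists>u v. e = {u, v} \<and> P u} x v \<and> P u \<and> \<not> P v \<and> {u, v} \<in> \<eta>"
proof -
  let ?\<eta> = "{e \<in> \<eta>. \<exists>u v. e = {u, v} \<and> P u}"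
  have "(conn ?\<eta> x y \<and> P y) \<or> (\<exists>u v. conn ?\<eta> x v \<and> P u \<and> \<not> P v \<and> {u, v} \<in> \<eta>)"
    using assms(1)
  proof (induction rule: conn_induct)
    case (step y z)
    show ?case
    proof (cases "conn ?\<eta> x y \<and> P y")
      case True
      hence "conn ?\<eta> x z" using step(2) by (blast intro: conn_trans conn_edge)
      thus ?thesis using True step(2) by blast
    qed (use step in blast)
  qed (use assms in auto)
  thus ?thesis using assms(3) by blast
qed

lemma conn_in:
  assumes "conn \<eta> x y" "\<eta> \<subseteq> pairs_on S" "x \<in> S"
  shows "y \<in> S"
  using assms(1)
proof (induction rule: conn_induct)
  case (step y z)
  thus ?case using assms(2) by (auto simp: pairs_on_def doubleton_eq_iff)
qed (fact assms(3))

lemma conn_insert: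
  "conn (insert {x, y} \<eta>) u v \<longleftrightarrow>
     conn \<eta> u v \<or> (conn \<eta> u x \<and> conn \<eta> y v) \<or> (conn \<eta> u y \<and> conn \<eta> x v)"
  (is "?L \<longleftrightarrow> ?R v")
proof
  assume ?L
  thus "?R v"
  proof (induction rule: conn_induct)
    case (step v z)
    show ?case
    proof (cases "{v, z} \<in> \<eta>")
      case True
      thus ?thesis using step(3) conn_edge conn_trans by metis
    next
      case False
      hence "(v = x \<and> z = y) \<or> (v = y \<and> z = x)" using step(2) by (auto simp: doubleton_eq_iff)
      thus ?thesis using step(3) conn_trans conn_sym conn_refl by metis
    qed
  qed simp
next
  assume r: "?R v"
  have m: "conn \<eta> a b \<Longrightarrow> conn (insert {x, y} \<eta>) a b" for a b
    by (rule conn_mono[of \<eta>]) auto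
  have "conn (insert {x, y} \<eta>) x y" by (rule conn_edge) simp
  thus ?L using r m conn_trans conn_sym by metis
qed

lemma conn_class_eq_iff: "{z. conn \<eta> x z} = {z. conn \<eta> y z} \<longleftrightarrow> conn \<eta> x y"
proof
  assume "{z. conn \<eta> x z} = {z. conn \<eta> y z}"
  hence "conn \<eta> x y \<longleftrightarrow> conn \<eta> y y" by blast
  thus "conn \<eta> x y" by simp
next
  assume "conn \<eta> x y"
  thus "{z. conn \<eta> x z} = {z. conn \<eta> y z}" using conn_trans[of \<eta>] conn_sym[of \<eta>] by blast
qed

lemma conn_cong_left: "conn \<eta> x y \<Longrightarrow> conn \<eta> x = conn \<eta> y"
  using conn_class_eq_iff[of \<eta> x y] by (metis Collect_inj)

lemma card_comps_insert:
  assumes "finite S" "x \<in> S" "y \<in> S"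
  shows "card (comps S (insert {x, y} \<eta>)) + of_bool (\<not> conn \<eta> x y) = card (comps S \<eta>)"
proof (cases "conn \<eta> x y")
  case True
  have "conn (insert {x, y} \<eta>) u v = conn \<eta> u v" for u v
    unfolding conn_insert using True conn_trans[of \<eta> u x v] conn_trans[of \<eta> u y v]
      conn_cong_left[OF True] by auto
  hence "conn (insert {x, y} \<eta>) = conn \<eta>" by (intro ext)
  thus ?thesis using True by (simp add: comps_def)
next
  case False
  let ?C = "\<lambda>u. {z. conn \<eta> u z}" and ?C' = "\<lambda>u. {z. conn (insert {x, y} \<eta>) u z}"
  have far: "?C' u = ?C u" if "\<not> conn \<eta> u x" "\<not> conn \<eta> u y" for u
    using that by (simp add: conn_insert)
  have near: "?C' u = ?C x \<union> ?C y" if "conn \<eta> u x \<or> conn \<eta> u y" for u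
    using that
  proof
    assume "conn \<eta> u x"
    hence "conn \<eta> u = conn \<eta> x" by (rule conn_cong_left)
    thus ?thesis using False by (auto simp: conn_insert)
  next
    assume "conn \<eta> u y"
    hence "conn \<eta> u = conn \<eta> y" by (rule conn_cong_left)
    thus ?thesis using False conn_sym[of \<eta> y x] by (auto simp: conn_insert)
  qed
  have eq: "comps S (insert {x, y} \<eta>) = insert (?C x \<union> ?C y) (comps S \<eta> - {?C x, ?C y})"
  proof (intro equalityI subsetI)
    fix K assume "K \<in> comps S (insert {x, y} \<eta>)"
    then obtain u where u: "u \<in> S" "K = ?C' u" by (auto simp: comps_def)
    show "K \<in> insert (?C x \<union> ?C y) (comps S \<eta> - {?C x, ?C y})"
    proof (cases "conn \<eta> u x \<or> conn \<eta> u y")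
      case True
      thus ?thesis using near u by simp
    next
      case F: False
      hence "K = ?C u" using far u by simp
      moreover have "?C u \<in> comps S \<eta>" using u by (auto simp: comps_def)
      ultimately show ?thesis using F by (simp add: conn_class_eq_iff)
    qed
  next
    fix K assume "K \<in> insert (?C x \<union> ?C y) (comps S \<eta> - {?C x, ?C y})"
    thus "K \<in> comps S (insert {x, y} \<eta>)"
    proof
      assume "K = ?C x \<union> ?C y"
      hence "K = ?C' x" using near[of x] by simp
      thus ?thesis using assms by (simp add: comps_def)
    next
      assume a: "K \<in> comps S \<eta> - {?C x, ?C y}"
      then obtain u where u: "u \<in> S" "K = ?C u" by (auto simp: comps_def)
      hence "\<not> conn \<eta> u x" "\<not> conn \<eta> u y" using a by (auto simp: conn_class_eq_iff)
      hence "K = ?C' u" using far u by simp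
      thus ?thesis using u by (simp add: comps_def)
    qed
  qed
  have fin: "finite (comps S \<eta>)" using assms by (simp add: comps_def)
  have "?C x \<union> ?C y \<notin> comps S \<eta>"
  proof
    assume "?C x \<union> ?C y \<in> comps S \<eta>"
    then obtain u where u: "?C x \<union> ?C y = ?C u" by (auto simp: comps_def)
    have "x \<in> ?C x \<union> ?C y" "y \<in> ?C x \<union> ?C y" by auto
    hence "conn \<eta> u x" "conn \<eta> u y" unfolding u by auto
    thus False using False conn_trans[of \<eta> x u y] conn_sym[of \<eta> u x] by blast
  qed
  moreover have "?C x \<in> comps S \<eta>" "?C y \<in> comps S \<eta>" "?C x \<noteq> ?C y"
    using assms False by (auto simp: comps_def conn_class_eq_iff)
  moreover have "card {?C x, ?C y} \<le> card (comps S \<eta>)"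
    using calculation fin by (intro card_mono) auto
  ultimately show ?thesis
    unfolding eq using fin False by (simp add: card_Diff_subset)
qed

lemma conn_wired:
  "conn (\<eta> \<union> pairs_on B) x y \<longleftrightarrow> conn \<eta> x y \<or> (\<exists>a\<in>B. \<exists>b\<in>B. conn \<eta> x a \<and> conn \<eta> b y)"
  (is "?L \<longleftrightarrow> ?R y")
proof
  assume ?L
  thus "?R y"
  proof (induction rule: conn_induct)
    case (step y z)
    show ?case
    proof (cases "{y, z} \<in> \<eta>")
      case True
      thus ?thesis using step(3) conn_edge[of y z \<eta>] conn_trans[of \<eta> _ y z] by blast
    next
      case False
      hence "y \<in> B" "z \<in> B" using step(2) by (auto simp: pairs_on_def doubleton_eq_iff)
      thus ?thesis using step(3) conn_refl[of \<eta> z] by blast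
    qed
  qed simp
next
  assume r: "?R y"
  have m: "conn \<eta> a b \<Longrightarrow> conn (\<eta> \<union> pairs_on B) a b" for a b
    by (rule conn_mono[of \<eta>]) auto
  have "conn (\<eta> \<union> pairs_on B) a b" if "a \<in> B" "b \<in> B" for a b
  proof (cases "a = b")
    case False
    thus ?thesis using that by (intro conn_edge) (auto simp: pairs_on_def)
  qed simp
  thus ?L using r m conn_trans by metis
qed

lemma comps_wired:
  assumes "B \<subseteq> S" "B \<noteq> {}"
  shows "comps S (\<eta> \<union> pairs_on B) = insert {y. \<exists>b\<in>B. conn \<eta> b y} {C \<in> comps S \<eta>. C \<inter> B = {}}"
proof -
  let ?C = "\<lambda>u. {z. conn \<eta> u z}" and ?C' = "\<lambda>u. {z. conn (\<eta> \<union> pairs_on B) u z}"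
  let ?K = "{y. \<exists>b\<in>B. conn \<eta> b y}"
  have near: "?C' u = ?K" if "?C u \<inter> B \<noteq> {}" for u
    unfolding conn_wired using that conn_trans[of \<eta>] conn_sym[of \<eta>] conn_refl[of \<eta>] by blast
  have far: "?C' u = ?C u" if "?C u \<inter> B = {}" for u
    unfolding conn_wired using that by auto
  show ?thesis
  proof (intro equalityI subsetI)
    fix K assume "K \<in> comps S (\<eta> \<union> pairs_on B)"
    then obtain u where u: "u \<in> S" "K = ?C' u" by (auto simp: comps_def)
    show "K \<in> insert ?K {C \<in> comps S \<eta>. C \<inter> B = {}}"
    proof (cases "?C u \<inter> B = {}")
      case True
      thus ?thesis using far[OF True] u by (auto simp: comps_def)
    next
      case False
      thus ?thesis using near[OF False] u by simp
    qed
  next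
    fix K assume "K \<in> insert ?K {C \<in> comps S \<eta>. C \<inter> B = {}}"
    thus "K \<in> comps S (\<eta> \<union> pairs_on B)"
    proof
      assume K: "K = ?K"
      obtain b where b: "b \<in> B" using assms by auto
      have "?C b \<inter> B \<noteq> {}" using b conn_refl[of \<eta> b] by blast
      hence "K = ?C' b" using near K by simp
      thus ?thesis using b assms by (auto simp: comps_def)
    next
      assume "K \<in> {C \<in> comps S \<eta>. C \<inter> B = {}}"
      then obtain u where u: "u \<in> S" "K = ?C u" "?C u \<inter> B = {}" by (auto simp: comps_def)
      thus ?thesis using far[OF u(3)] by (auto simp: comps_def)
    qed
  qed
qed

lemma open_connected_conn: "open_connected S \<omega> = conn {e \<in> pairs_on S. \<omega> e}"
  by (simp add: open_connected_def conn_def open_adj_def[abs_def])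

lemma clusters_comps: "clusters S \<omega> = comps S {e \<in> pairs_on S. \<omega> e}"
  by (simp add: clusters_def comps_def open_connected_conn)

lemma free_count_comps: "free_count S \<omega> = card (comps S {e \<in> pairs_on S. \<omega> e})"
  by (simp add: free_count_def clusters_comps)

lemma boundary_subset: "boundary V J S \<subseteq> S"
  by (auto simp: boundary_def)

text \<open>Joining all boundary vertices by open edges fuses exactly the clusters meeting the
  boundary. The wired count thereby becomes an ordinary component count on a larger edge set, so
  that free and wired weights can be treated together.\<close>

lemma wired_count_comps:
  assumes "finite S"
  shows "wired_count V J S \<omega> = card (comps S ({e \<in> pairs_on S. \<omega> e} \<union> pairs_on (boundary V J S)))"
proof (cases "boundary V J S = {}")
  case True
  thus ?thesis by (simp add: wired_count_def clusters_comps) (simp add: pairs_on_def)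
next
  case False
  let ?B = "boundary V J S" and ?\<eta> = "{e \<in> pairs_on S. \<omega> e}"
  have "{y. \<exists>b\<in>?B. conn ?\<eta> b y} \<inter> ?B \<noteq> {}"
    using False conn_refl[of ?\<eta>] by blast
  hence "{y. \<exists>b\<in>?B. conn ?\<eta> b y} \<notin> {C \<in> comps S ?\<eta>. C \<inter> ?B = {}}" by blast
  moreover have "finite (comps S ?\<eta>)" using assms by (simp add: comps_def)
  ultimately show ?thesis using False
    unfolding wired_count_def clusters_comps comps_wired[OF boundary_subset False] by simp
qed

text \<open>Wiring replaces the components that meet B by a single one, and there are at most
  \<open>card B\<close> of them, since each is the component of some point of B.\<close>

lemma card_comps_wired_le:
  assumes "finite S" "B \<subseteq> S"
  shows "card (comps S (\<eta> \<union> pairs_on B)) \<le> card (comps S \<eta>)"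
    "card (comps S \<eta>) \<le> card (comps S (\<eta> \<union> pairs_on B)) + card B"
proof -
  have fin: "finite (comps S \<eta>)" "finite B" using assms finite_subset by (auto simp: comps_def)
  let ?far = "{C \<in> comps S \<eta>. C \<inter> B = {}}" and ?near = "{C \<in> comps S \<eta>. C \<inter> B \<noteq> {}}"
  have eq: "card (comps S \<eta>) = card ?far + card ?near"
  proof -
    have "comps S \<eta> = ?far \<union> ?near" by auto
    moreover have "card (?far \<union> ?near) = card ?far + card ?near"
      using fin by (intro card_Un_disjoint) auto
    ultimately show ?thesis by simp
  qed
  have near: "?near \<subseteq> (\<lambda>x. {y. conn \<eta> x y}) ` B"
  proof
    fix C assume "C \<in> ?near"
    then obtain u b where u: "C = {y. conn \<eta> u y}" "b \<in> C" "b \<in> B" by (auto simp: comps_def)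
    hence "C = {y. conn \<eta> b y}" using conn_class_eq_iff[of \<eta> u b] by simp
    thus "C \<in> (\<lambda>x. {y. conn \<eta> x y}) ` B" using u by auto
  qed
  have card_near: "card ?near \<le> card B"
    using card_mono[OF finite_imageI[OF fin(2)] near] card_image_le[OF fin(2)] le_trans by blast
  have "card (comps S (\<eta> \<union> pairs_on B)) \<le> card (comps S \<eta>) \<and>
    card (comps S \<eta>) \<le> card (comps S (\<eta> \<union> pairs_on B)) + card B"
  proof (cases "B = {}")
    case False
    then obtain b where b: "b \<in> B" by auto
    have "{y. conn \<eta> b y} \<in> ?near" using b assms by (auto simp: comps_def intro: conn_refl)
    hence "?near \<noteq> {}" by blast
    hence "0 < card ?near" using fin by (subst card_gt_0_iff) auto
    moreover have "card ?far \<le> card (insert {y. \<exists>b\<in>B. conn \<eta> b y} ?far)"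
      using fin by (intro card_mono) auto
    moreover have "card (insert {y. \<exists>b\<in>B. conn \<eta> b y} ?far) \<le> Suc (card ?far)"
      by (rule card_insert_le_m1) auto
    ultimately show ?thesis unfolding comps_wired[OF assms(2) False] using eq card_near by linarith
  qed (simp add: pairs_on_def)
  thus "card (comps S (\<eta> \<union> pairs_on B)) \<le> card (comps S \<eta>)"
    "card (comps S \<eta>) \<le> card (comps S (\<eta> \<union> pairs_on B)) + card B" by auto
qed

section \<open>Random-cluster weights in finite volume\<close>

definition EJ :: "('v \<Rightarrow> 'v \<Rightarrow> real) \<Rightarrow> 'v set \<Rightarrow> 'v set set" where
  "EJ J S = {e \<in> pairs_on S. 0 < coupling J e}"

definition bc_edges :: "'v set \<Rightarrow> ('v \<Rightarrow> 'v \<Rightarrow> real) \<Rightarrow> bool \<Rightarrow> 'v set \<Rightarrow> 'v set set" where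
  "bc_edges V J b S = (if b then pairs_on (boundary V J S) else {})"

text \<open>A finite-volume configuration is represented by its set of open edges; the boundary condition
  (\<open>b\<close> for wired) by additional edges, always open. Pairs with vanishing coupling, which are almost
  surely closed, are left out, so that all weights are positive.\<close>

definition fkw :: "'v set \<Rightarrow> ('v \<Rightarrow> 'v \<Rightarrow> real) \<Rightarrow> real \<Rightarrow> bool \<Rightarrow> 'v set \<Rightarrow> real \<Rightarrow> 'v set set \<Rightarrow> real" where
  "fkw V J q b S \<beta> \<eta> =
     (\<Prod>e\<in>\<eta>. exp (\<beta> * coupling J e) - 1) * q ^ card (comps S (\<eta> \<union> bc_edges V J b S))"

text \<open>Phrased for the edge as a set, so that no order of its endpoints has to be
  chosen.\<close>

definition econn :: "'v set set \<Rightarrow> 'v set \<Rightarrow> bool" where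
  "econn \<eta> e \<longleftrightarrow> (\<forall>x\<in>e. \<forall>y\<in>e. conn \<eta> x y)"

lemma econn_pair: "econn \<eta> {x, y} \<longleftrightarrow> conn \<eta> x y"
proof
  assume c: "conn \<eta> x y"
  have "conn \<eta> y x" using c by (rule conn_sym)
  thus "econn \<eta> {x, y}" using c by (simp add: econn_def)
qed (simp add: econn_def)

lemma econn_mono: "\<eta> \<subseteq> \<eta>' \<Longrightarrow> econn \<eta> e \<Longrightarrow> econn \<eta>' e"
  unfolding econn_def using conn_mono[of \<eta> \<eta>'] by auto

lemma pairs_on_mono: "S \<subseteq> S' \<Longrightarrow> pairs_on S \<subseteq> pairs_on S'"
  by (auto simp: pairs_on_def)

lemma finite_pairs_on: "finite S \<Longrightarrow> finite (pairs_on S)"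
  by (rule finite_subset[of _ "Pow S"]) (auto simp: pairs_on_def)

lemma EJ_mono: "S \<subseteq> S' \<Longrightarrow> EJ J S \<subseteq> EJ J S'"
  unfolding EJ_def using pairs_on_mono by blast

lemma EJ_pairs: "EJ J S \<subseteq> pairs_on S"
  by (auto simp: EJ_def)

lemma finite_EJ: "finite S \<Longrightarrow> finite (EJ J S)"
  using finite_pairs_on EJ_pairs finite_subset by metis

text \<open>Holley's criterion in terms of conditional odds: \<open>r1\<close> and \<open>r2\<close>
  are the factors by which opening an edge multiplies the weights.\<close>

lemma dominated_ratio:
  assumes pos: "\<And>\<eta>. \<eta> \<subseteq> F \<Longrightarrow> 0 < w1 \<eta>" "\<And>\<eta>. \<eta> \<subseteq> F \<Longrightarrow> 0 < w2 \<eta>"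
    and w1: "\<And>\<eta> e. \<eta> \<subseteq> F \<Longrightarrow> e \<in> F - \<eta> \<Longrightarrow> w1 (insert e \<eta>) = w1 \<eta> * r1 \<eta> e"
    and w2: "\<And>\<eta> e. \<eta> \<subseteq> F \<Longrightarrow> e \<in> F - \<eta> \<Longrightarrow> w2 (insert e \<eta>) = w2 \<eta> * r2 \<eta> e"
    and r: "\<And>\<eta> \<eta>' e. \<eta> \<subseteq> \<eta>' \<Longrightarrow> \<eta>' \<subseteq> F \<Longrightarrow> e \<in> F - \<eta>' \<Longrightarrow> r1 \<eta> e \<le> r2 \<eta>' e"
  shows "dominated F w1 w2"
  unfolding dominated_def
proof (intro allI impI, elim conjE)
  fix \<eta> \<eta>' e assume h: "\<eta> \<subseteq> \<eta>'" "\<eta>' \<subseteq> F" "e \<in> F - \<eta>'"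
  hence s: "\<eta> \<subseteq> F" "e \<in> F - \<eta>" by auto
  have "(w1 \<eta> * w2 \<eta>') * r1 \<eta> e \<le> (w1 \<eta> * w2 \<eta>') * r2 \<eta>' e"
    using pos(1)[OF s(1)] pos(2)[OF h(2)] r[OF h] by (intro mult_left_mono) auto
  thus "w1 (insert e \<eta>) * w2 \<eta>' \<le> w1 \<eta> * w2 (insert e \<eta>')"
    unfolding w1[OF s] w2[OF h(2,3)] by (simp add: mult_ac)
qed

text \<open>The configuration \<open>\<xi>\<close> outside F is fixed first. Given it, the mean of f
  over F is at least c; this is then integrated against the nonnegative function g of
  \<open>\<xi>\<close>.\<close>

lemma expect_cond_ge:
  assumes F: "F \<subseteq> F'" "finite F'" "positive_on F' w"
    and g: "\<And>\<xi>. \<xi> \<subseteq> F' - F \<Longrightarrow> 0 \<le> g \<xi>"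
    and h: "\<And>\<xi>. \<xi> \<subseteq> F' - F \<Longrightarrow> c \<le> expect F (\<lambda>\<eta>. w (\<eta> \<union> \<xi>)) f"
  shows "c * expect F' w (\<lambda>\<eta>. g (\<eta> - F)) \<le> expect F' w (\<lambda>\<eta>. f (\<eta> \<inter> F) * g (\<eta> - F))"
proof -
  have Z: "0 < (\<Sum>\<eta>\<in>Pow F'. w \<eta>)" by (rule sum_Pow_pos[OF F(2,3)])
  have FF: "F' - (F' - F) = F" using F by auto
  have split: "sum k (Pow F') = (\<Sum>\<xi>\<in>Pow (F' - F). \<Sum>\<eta>\<in>Pow F. k (\<eta> \<union> \<xi>))" for k :: "'a set \<Rightarrow> real"
    using sum_Pow_split[of "F' - F" F' k] unfolding FF by auto
  have sets: "(\<eta> \<union> \<xi>) \<inter> F = \<eta>" "(\<eta> \<union> \<xi>) - F = \<xi>" if "\<eta> \<in> Pow F" "\<xi> \<in> Pow (F' - F)" for \<eta> \<xi>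
    using that by auto
  have "(\<Sum>\<eta>\<in>Pow F'. w \<eta> * (c * g (\<eta> - F))) \<le> (\<Sum>\<eta>\<in>Pow F'. w \<eta> * (f (\<eta> \<inter> F) * g (\<eta> - F)))"
    unfolding split
  proof (rule sum_mono)
    fix \<xi> assume x: "\<xi> \<in> Pow (F' - F)"
    have pos: "0 < w (\<eta> \<union> \<xi>)" if "\<eta> \<in> Pow F" for \<eta>
      using F(3)[rule_format, of "\<eta> \<union> \<xi>"] that x F(1) by blast
    have finF: "finite (Pow F)" using F finite_subset by auto
    have "0 < (\<Sum>\<eta>\<in>Pow F. w (\<eta> \<union> \<xi>))" by (rule sum_pos) (use finF pos in auto)
    hence "c * (\<Sum>\<eta>\<in>Pow F. w (\<eta> \<union> \<xi>)) \<le> (\<Sum>\<eta>\<in>Pow F. w (\<eta> \<union> \<xi>) * f \<eta>)"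
      using h[of \<xi>] x by (simp add: expect_def pos_le_divide_eq)
    hence "g \<xi> * (c * (\<Sum>\<eta>\<in>Pow F. w (\<eta> \<union> \<xi>))) \<le> g \<xi> * (\<Sum>\<eta>\<in>Pow F. w (\<eta> \<union> \<xi>) * f \<eta>)"
      using g[of \<xi>] x by (intro mult_left_mono) auto
    hence "(\<Sum>\<eta>\<in>Pow F. w (\<eta> \<union> \<xi>) * (c * g \<xi>)) \<le> (\<Sum>\<eta>\<in>Pow F. w (\<eta> \<union> \<xi>) * (f \<eta> * g \<xi>))"
      by (simp add: sum_distrib_left mult_ac)
    moreover have "(\<Sum>\<eta>\<in>Pow F. w (\<eta> \<union> \<xi>) * (c * g (\<eta> \<union> \<xi> - F))) = (\<Sum>\<eta>\<in>Pow F. w (\<eta> \<union> \<xi>) * (c * g \<xi>))"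
      by (rule sum.cong[OF refl]) (simp only: sets[OF _ x])
    moreover have "(\<Sum>\<eta>\<in>Pow F. w (\<eta> \<union> \<xi>) * (f ((\<eta> \<union> \<xi>) \<inter> F) * g (\<eta> \<union> \<xi> - F)))
        = (\<Sum>\<eta>\<in>Pow F. w (\<eta> \<union> \<xi>) * (f \<eta> * g \<xi>))"
      by (rule sum.cong[OF refl]) (simp only: sets[OF _ x])
    ultimately show "(\<Sum>\<eta>\<in>Pow F. w (\<eta> \<union> \<xi>) * (c * g (\<eta> \<union> \<xi> - F)))
        \<le> (\<Sum>\<eta>\<in>Pow F. w (\<eta> \<union> \<xi>) * (f ((\<eta> \<union> \<xi>) \<inter> F) * g (\<eta> \<union> \<xi> - F)))" by simp
  qed
  hence "expect F' w (\<lambda>\<eta>. c * g (\<eta> - F)) \<le> expect F' w (\<lambda>\<eta>. f (\<eta> \<inter> F) * g (\<eta> - F))"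
    unfolding expect_def using Z by (intro divide_right_mono) auto
  thus ?thesis by (simp only: expect_cmult)
qed

section \<open>Monotonicity of the random-cluster weights in parameter, boundary condition and
  volume\<close>

locale fk_model =
  fixes V :: "'v set" and J :: "'v \<Rightarrow> 'v \<Rightarrow> real" and q :: real
  assumes J_nonneg: "x \<in> V \<Longrightarrow> y \<in> V \<Longrightarrow> 0 \<le> J x y"
    and J_sym: "x \<in> V \<Longrightarrow> y \<in> V \<Longrightarrow> J x y = J y x"
    and q1: "1 \<le> q"
begin

abbreviation "E \<equiv> EJ J"
abbreviation "bd \<equiv> bc_edges V J"
abbreviation "wt \<equiv> fkw V J q"
abbreviation "P b S \<beta> \<equiv> expect (E S) (wt b S \<beta>)"
abbreviation "finvol S \<equiv> finite S \<and> S \<subseteq> V"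

lemma coupling_eq: "x \<in> V \<Longrightarrow> y \<in> V \<Longrightarrow> coupling J {x, y} = J x y"
  unfolding coupling_def by (rule the_equality) (auto simp: doubleton_eq_iff J_sym)

lemma E_iff: "S \<subseteq> V \<Longrightarrow> {x, y} \<in> E S \<longleftrightarrow> x \<in> S \<and> y \<in> S \<and> x \<noteq> y \<and> 0 < J x y"
  by (auto simp: EJ_def pairs_on_def doubleton_eq_iff coupling_eq subset_iff)

lemma E_cases:
  assumes "e \<in> E S" "S \<subseteq> V"
  obtains x y where "e = {x, y}" "x \<in> S" "y \<in> S" "x \<noteq> y" "0 < J x y" "coupling J e = J x y"
  using assms by (auto simp: EJ_def pairs_on_def coupling_eq subset_iff)

lemma edge_factor_pos: "0 < \<beta> \<Longrightarrow> e \<in> E S \<Longrightarrow> 0 < exp (\<beta> * coupling J e) - 1"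
  by (auto simp: EJ_def)

lemma wt_pos: "0 < \<beta> \<Longrightarrow> positive_on (E S) (wt b S \<beta>)"
  unfolding fkw_def using q1 edge_factor_pos
  by (auto intro!: mult_pos_pos prod_pos)

lemma card_comps_edge:
  assumes "finite S" "e \<in> pairs_on S"
  shows "card (comps S (insert e \<eta>)) + of_bool (\<not> econn \<eta> e) = card (comps S \<eta>)"
proof -
  obtain x y where "e = {x, y}" "x \<in> S" "y \<in> S" using assms(2) by (auto simp: pairs_on_def)
  thus ?thesis using card_comps_insert[OF assms(1), of x y \<eta>] by (simp add: econn_pair)
qed

text \<open>The conditional odds of an edge being open depend on whether its endpoints are connected
  without it.\<close>

lemma wt_ratio:
  assumes S: "finvol S" and e: "e \<in> E S" "e \<in> E S' - \<eta>" "finite \<eta>" and B: "e \<notin> \<eta>"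
  shows "(\<Prod>e\<in>insert e \<eta>. exp (\<beta> * coupling J e) - 1) * q ^ card (comps S (insert e \<eta> \<union> B))
    = ((\<Prod>e\<in>\<eta>. exp (\<beta> * coupling J e) - 1) * q ^ card (comps S (\<eta> \<union> B)))
      * ((exp (\<beta> * coupling J e) - 1) * (if econn (\<eta> \<union> B) e then 1 else 1 / q))"
proof -
  have "e \<in> pairs_on S" using e EJ_pairs by auto
  hence "card (comps S (insert e (\<eta> \<union> B))) + of_bool (\<not> econn (\<eta> \<union> B) e) = card (comps S (\<eta> \<union> B))"
    using card_comps_edge S by blast
  hence "q ^ card (comps S (insert e (\<eta> \<union> B))) = q ^ card (comps S (\<eta> \<union> B)) * (if econn (\<eta> \<union> B) e then 1 else 1 / q)"
    using q1 by (cases "econn (\<eta> \<union> B) e") (auto simp: power_add[symmetric] field_simps simp flip: power_Suc)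
  thus ?thesis using e by simp
qed

text \<open>The factor by which opening e multiplies the weight when \<open>\<eta>\<close> is open:
  merging two components costs 1 / q. Since q \<ge> 1, additional connections raise the odds, which
  is the source of all comparisons below.\<close>

definition odds :: "real \<Rightarrow> 'v set set \<Rightarrow> 'v set \<Rightarrow> real" where
  "odds \<beta> \<eta> e = (exp (\<beta> * coupling J e) - 1) * (if econn \<eta> e then 1 else 1 / q)"

lemma odds_mono:
  assumes "0 < \<beta>" "\<beta> \<le> \<beta>'" "e \<in> E S" "econn \<eta> e \<longrightarrow> econn \<eta>' e"
  shows "odds \<beta> \<eta> e \<le> odds \<beta>' \<eta>' e"
proof -
  have c: "0 < coupling J e" using assms by (auto simp: EJ_def)
  have "exp (\<beta> * coupling J e) - 1 \<le> exp (\<beta>' * coupling J e) - 1" using c assms by simp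
  moreover have "0 \<le> exp (\<beta> * coupling J e) - 1" using c assms by simp
  ultimately show ?thesis unfolding odds_def using assms q1
    by (intro mult_mono) (auto simp: field_simps)
qed

lemma wt_insert:
  assumes "finvol S" "\<eta> \<subseteq> E S" "e \<in> E S - \<eta>"
  shows "wt b S \<beta> (insert e \<eta>) = wt b S \<beta> \<eta> * odds \<beta> (\<eta> \<union> bd b S) e"
proof -
  have "finite \<eta>" using assms finite_EJ finite_subset by metis
  thus ?thesis using wt_ratio[of S e S \<eta>] assms by (simp add: fkw_def odds_def)
qed

lemma bd_mono: "b \<le> b' \<Longrightarrow> bd b S \<subseteq> bd b' S"
  by (auto simp: bc_edges_def)

lemma dominated_wt:
  assumes S: "finvol S" and "0 < \<beta>" "\<beta> \<le> \<beta>'" "b \<le> b'"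
  shows "dominated (E S) (wt b S \<beta>) (wt b' S \<beta>')"
proof (rule dominated_ratio)
  show "odds \<beta> (\<eta> \<union> bd b S) e \<le> odds \<beta>' (\<eta>' \<union> bd b' S) e"
    if "\<eta> \<subseteq> \<eta>'" "\<eta>' \<subseteq> E S" "e \<in> E S - \<eta>'" for \<eta> \<eta>' e
    using that assms bd_mono[OF assms(4), of S]
    by (intro odds_mono[of _ _ _ S]) (auto elim!: econn_mono[rotated])
qed (use assms wt_pos[of \<beta> S b] wt_pos[of \<beta>' S b'] in \<open>auto simp: wt_insert\<close>)

lemma fkg_wt: "finvol S \<Longrightarrow> 0 < \<beta> \<Longrightarrow> fkg_weight (E S) (wt b S \<beta>)"
  by unfold_locales (use finite_EJ wt_pos dominated_wt in auto)

lemma P_mono: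
  assumes "finvol S" "0 < \<beta>" "\<beta> \<le> \<beta>'" "b \<le> b'" "increasing_on (E S) f"
  shows "P b S \<beta> f \<le> P b' S \<beta>' f"
  by (rule dominated_expect_mono) (use assms finite_EJ wt_pos dominated_wt in auto)

lemma wt_ext_insert:
  assumes "finvol S" "finvol S'" "S \<subseteq> S'" "\<eta> \<subseteq> E S" "e \<in> E S - \<eta>" "\<xi> \<subseteq> E S' - E S"
  shows "wt b S' \<beta> (insert e (\<eta> \<union> \<xi>)) = wt b S' \<beta> (\<eta> \<union> \<xi>) * odds \<beta> (\<eta> \<union> \<xi> \<union> bd b S') e"
  using wt_insert[of S' "\<eta> \<union> \<xi>" e b \<beta>] assms EJ_mono[OF assms(3), of J] by auto

lemma wt_ext_pos:
  assumes "0 < \<beta>" "S \<subseteq> S'" "\<eta> \<subseteq> E S" "\<xi> \<subseteq> E S' - E S"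
  shows "0 < wt b S' \<beta> (\<eta> \<union> \<xi>)"
  using wt_pos[OF assms(1), of S' b, rule_format, of "\<eta> \<union> \<xi>"] assms EJ_mono[OF assms(2), of J] by blast

text \<open>Open edges outside S can only create further connections between vertices of S, and
  these raise the odds.\<close>

lemma dominated_free_ext:
  assumes S: "finvol S" "finvol S'" "S \<subseteq> S'" and b: "0 < \<beta>" and x: "\<xi> \<subseteq> E S' - E S"
  shows "dominated (E S) (wt False S \<beta>) (\<lambda>\<eta>. wt False S' \<beta> (\<eta> \<union> \<xi>))"
proof (rule dominated_ratio)
  show "odds \<beta> (\<eta> \<union> bd False S) e \<le> odds \<beta> (\<eta>' \<union> \<xi> \<union> bd False S') e"
    if "\<eta> \<subseteq> \<eta>'" "\<eta>' \<subseteq> E S" "e \<in> E S - \<eta>'" for \<eta> \<eta>' e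
    using that b by (intro odds_mono[of _ _ _ S]) (auto simp: bc_edges_def elim!: econn_mono[rotated])
qed (use assms wt_pos[of \<beta> S False] wt_ext_pos[OF b S(3) _ x] in \<open>auto simp: wt_insert wt_ext_insert[OF S _ _ x]\<close>)

text \<open>Outside of \<open>S\<close>, the clusters of the larger volume connect at most boundary vertices of \<open>S\<close>
  to each other.\<close>

lemma conn_wired_volume:
  assumes S: "finvol S" "finvol S'" "S \<subseteq> S'" and x: "\<xi> \<subseteq> E S' - E S"
    and eta: "\<eta> \<subseteq> \<eta>'" "\<eta>' \<subseteq> E S" and "x \<in> S" "y \<in> S" and c: "conn (\<eta> \<union> \<xi> \<union> bd True S') x y"
  shows "conn (\<eta>' \<union> bd True S) x y"
proof -
  let ?c = "conn (\<eta>' \<union> bd True S)"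
  let ?B = "boundary V J S"
  have B: "?c a b" if "a \<in> ?B" "b \<in> ?B" for a b
  proof (cases "a = b")
    case False
    thus ?thesis using that by (intro conn_edge) (auto simp: bc_edges_def pairs_on_def)
  qed simp
  \<comment> \<open>While the path is outside S, it suffices to remember some boundary vertex
    connected to x: on its return the path enters S at a boundary vertex, and all of these are wired
    together.\<close>
  have "(y \<in> S \<longrightarrow> ?c x y) \<and> (y \<notin> S \<longrightarrow> (\<exists>a\<in>?B. ?c x a))"
    using c
  proof (induction rule: conn_induct)
    case base
    thus ?case using assms by simp
  next
    case (step y z)
    have edge: "({y, z} \<in> \<eta> \<and> y \<in> S \<and> z \<in> S) \<or>
      ((y \<in> S \<longrightarrow> y \<in> ?B) \<and> (z \<in> S \<longrightarrow> z \<in> ?B))"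
    proof -
      consider "{y, z} \<in> \<eta>" | "{y, z} \<in> \<xi>" | "{y, z} \<in> bd True S'" using step(2) by blast
      thus ?thesis
      proof cases
        case 1
        hence "{y, z} \<in> E S" using eta by auto
        thus ?thesis using 1 E_iff S by auto
      next
        case 2
        hence "y \<in> S'" "z \<in> S'" "0 < J y z" "y \<noteq> z" "\<not> (y \<in> S \<and> z \<in> S)"
          using x E_iff[of S' y z] E_iff[of S y z] S by auto
        moreover have "y \<in> V" "z \<in> V" using calculation S by blast+
        moreover have "0 < J z y" using calculation J_sym[of y z] by simp
        ultimately show ?thesis using S by (auto simp: boundary_def)
      next
        case 3
        hence "y \<in> boundary V J S'" "z \<in> boundary V J S'"
          by (auto simp: bc_edges_def pairs_on_def doubleton_eq_iff)
        thus ?thesis using S by (auto simp: boundary_def)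
      qed
    qed
    thus ?case
    proof (elim disjE conjE)
      assume "{y, z} \<in> \<eta>" "y \<in> S" "z \<in> S"
      hence "?c x y" "?c y z" using step(3) eta by (auto intro: conn_edge)
      hence "?c x z" by (rule conn_trans)
      thus ?thesis using \<open>z \<in> S\<close> by simp
    next
      assume b: "y \<in> S \<longrightarrow> y \<in> ?B" "z \<in> S \<longrightarrow> z \<in> ?B"
      then obtain a where a: "a \<in> ?B" "?c x a" using step(3) by (cases "y \<in> S") auto
      thus ?thesis using b B[of a z] conn_trans[of _ x a z] by blast
    qed
  qed
  thus ?thesis using assms by simp
qed

lemma dominated_wired_ext:
  assumes S: "finvol S" "finvol S'" "S \<subseteq> S'" and b: "0 < \<beta>" and x: "\<xi> \<subseteq> E S' - E S"
  shows "dominated (E S) (\<lambda>\<eta>. wt True S' \<beta> (\<eta> \<union> \<xi>)) (wt True S \<beta>)"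
proof (rule dominated_ratio)
  show "odds \<beta> (\<eta> \<union> \<xi> \<union> bd True S') e \<le> odds \<beta> (\<eta>' \<union> bd True S) e"
    if h: "\<eta> \<subseteq> \<eta>'" "\<eta>' \<subseteq> E S" "e \<in> E S - \<eta>'" for \<eta> \<eta>' e
  proof (rule odds_mono[OF b order.refl])
    show e: "e \<in> E S" using h by simp
    obtain x y where "e = {x, y}" "x \<in> S" "y \<in> S" using e S by (auto elim: E_cases)
    thus "econn (\<eta> \<union> \<xi> \<union> bd True S') e \<longrightarrow> econn (\<eta>' \<union> bd True S) e"
      using conn_wired_volume[OF S x h(1,2)] by (simp add: econn_pair)
  qed
qed (use assms wt_pos[of \<beta> S True] wt_ext_pos[OF b S(3) _ x] in \<open>auto simp: wt_insert wt_ext_insert[OF S _ _ x]\<close>)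

lemma P_const: "finvol S \<Longrightarrow> 0 < \<beta> \<Longrightarrow> P b S \<beta> (\<lambda>_. c) = c"
  by (rule expect_const) (use finite_EJ wt_pos in auto)

text \<open>The factor g carries information about the edges off S. With g = 1 this is monotonicity
  in the volume; general g is what makes conditioning on events off S possible.\<close>

lemma P_free_volume:
  assumes S: "finvol S" "finvol S'" "S \<subseteq> S'" and b: "0 < \<beta>" and f: "increasing_on (E S) f"
    and g: "\<And>\<xi>. 0 \<le> g \<xi>"
  shows "P False S \<beta> f * P False S' \<beta> (\<lambda>\<eta>. g (\<eta> - E S)) \<le> P False S' \<beta> (\<lambda>\<eta>. f (\<eta> \<inter> E S) * g (\<eta> - E S))"
proof (rule expect_cond_ge)
  show "P False S \<beta> f \<le> expect (E S) (\<lambda>\<eta>. wt False S' \<beta> (\<eta> \<union> \<xi>)) f" if x: "\<xi> \<subseteq> E S' - E S" for \<xi>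
    by (rule dominated_expect_mono[OF _ _ _ dominated_free_ext[OF S b x] f])
      (use S b finite_EJ wt_pos wt_ext_pos[OF b S(3) _ x] in auto)
qed (use S b g finite_EJ wt_pos EJ_mono[OF S(3), of J] in auto)

lemma P_free_mono_volume:
  assumes S: "finvol S" "finvol S'" "S \<subseteq> S'" and b: "0 < \<beta>" and f: "increasing_on (E S) f"
  shows "P False S \<beta> f \<le> P False S' \<beta> (\<lambda>\<eta>. f (\<eta> \<inter> E S))"
  using P_free_volume[OF S b f, of "\<lambda>_. 1"] P_const[OF S(2) b] by simp

lemma P_wired_mono_volume:
  assumes S: "finvol S" "finvol S'" "S \<subseteq> S'" and b: "0 < \<beta>" and f: "increasing_on (E S) f"
  shows "P True S' \<beta> (\<lambda>\<eta>. f (\<eta> \<inter> E S)) \<le> P True S \<beta> f"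
proof -
  have neg: "expect F w (\<lambda>\<eta>. - k \<eta>) = - expect F w k" for F w and k :: "'v set set \<Rightarrow> real"
    using expect_cmult[of F w "- 1" k] by simp
  \<comment> \<open>An upper bound on conditional means is obtained by applying the lower bound
    \<open>expect_cond_ge\<close> to -f.\<close>
  have "- P True S \<beta> f * P True S' \<beta> (\<lambda>\<eta>. 1) \<le> P True S' \<beta> (\<lambda>\<eta>. - f (\<eta> \<inter> E S) * 1)"
  proof (rule expect_cond_ge)
    show "- P True S \<beta> f \<le> expect (E S) (\<lambda>\<eta>. wt True S' \<beta> (\<eta> \<union> \<xi>)) (\<lambda>\<eta>. - f \<eta>)"
      if x: "\<xi> \<subseteq> E S' - E S" for \<xi>
    proof -
      have "expect (E S) (\<lambda>\<eta>. wt True S' \<beta> (\<eta> \<union> \<xi>)) f \<le> P True S \<beta> f"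
        by (rule dominated_expect_mono[OF _ _ _ dominated_wired_ext[OF S b x] f])
          (use S b finite_EJ wt_pos wt_ext_pos[OF b S(3) _ x] in auto)
      thus ?thesis by (simp add: neg)
    qed
  qed (use S b finite_EJ wt_pos EJ_mono[OF S(3), of J] in auto)
  thus ?thesis using P_const[OF S(2) b] by (simp add: neg)
qed

lemma wt_union_le:
  assumes S: "finvol S" and b: "0 < \<beta>" and "\<eta> \<subseteq> E S" "\<xi> \<subseteq> E S" "\<eta> \<inter> \<xi> = {}"
  shows "wt b S \<beta> (\<eta> \<union> \<xi>) \<le> wt b S \<beta> \<eta> * (\<Prod>e\<in>\<xi>. exp (\<beta> * coupling J e) - 1)"
proof -
  have fin: "finite \<xi>" using assms finite_EJ finite_subset by metis
  show ?thesis using fin assms(4,5)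
  proof (induction \<xi> rule: finite_induct)
    case (insert e \<xi>)
    have IH: "wt b S \<beta> (\<eta> \<union> \<xi>) \<le> wt b S \<beta> \<eta> * (\<Prod>e\<in>\<xi>. exp (\<beta> * coupling J e) - 1)"
      using insert by auto
    have y: "0 < exp (\<beta> * coupling J e) - 1" using edge_factor_pos[OF b] insert by auto
    have o: "odds \<beta> \<zeta> e \<le> exp (\<beta> * coupling J e) - 1" for \<zeta>
      unfolding odds_def using y q1 by (auto intro: mult_left_le)
    have "wt b S \<beta> (insert e (\<eta> \<union> \<xi>)) = wt b S \<beta> (\<eta> \<union> \<xi>) * odds \<beta> (\<eta> \<union> \<xi> \<union> bd b S) e"
      by (rule wt_insert) (use S insert assms in auto)
    also have "\<dots> \<le> wt b S \<beta> (\<eta> \<union> \<xi>) * (exp (\<beta> * coupling J e) - 1)"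
      using o wt_pos[OF b, of S b, rule_format, of "\<eta> \<union> \<xi>"] insert assms by (intro mult_left_mono) auto
    also have "\<dots> \<le> (wt b S \<beta> \<eta> * (\<Prod>e\<in>\<xi>. exp (\<beta> * coupling J e) - 1)) * (exp (\<beta> * coupling J e) - 1)"
      using IH y by (intro mult_right_mono) auto
    finally show ?case using insert by (simp add: mult_ac)
  qed simp
qed

text \<open>Opening a set \<open>\<xi>\<close> of edges multiplies the weight by at most the product
  of exp (\<beta> J) - 1 over \<open>\<xi>\<close>. Summed over all subsets of \<open>st\<close>
  these products give the product of exp (\<beta> J), so the total weight is at most exp (\<beta>
  \<Sum> J) times the weight of the configurations avoiding \<open>st\<close>.\<close>

lemma P_closed_ge:
  assumes S: "finvol S" and b: "0 < \<beta>" and st: "st \<subseteq> E S"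
  shows "exp (- \<beta> * (\<Sum>e\<in>st. coupling J e)) \<le> P b S \<beta> (\<lambda>\<eta>. of_bool (\<eta> \<inter> st = {}))"
proof -
  let ?y = "\<lambda>e. exp (\<beta> * coupling J e) - 1" and ?C = "\<Sum>e\<in>st. coupling J e"
  have fin: "finite (E S)" "finite st" using S st finite_EJ finite_subset by metis+
  have FF: "E S - (E S - st) = st" using st by auto
  have "(\<Sum>\<eta>\<in>Pow (E S). wt b S \<beta> \<eta>) = (\<Sum>\<eta>\<in>Pow (E S - st). \<Sum>\<xi>\<in>Pow st. wt b S \<beta> (\<xi> \<union> \<eta>))"
    using sum_Pow_split[of "E S - st" "E S" "wt b S \<beta>"] unfolding FF by auto
  also have "\<dots> \<le> (\<Sum>\<eta>\<in>Pow (E S - st). \<Sum>\<xi>\<in>Pow st. wt b S \<beta> \<eta> * prod ?y \<xi>)"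
  proof (intro sum_mono)
    fix \<eta> \<xi> assume "\<eta> \<in> Pow (E S - st)" "\<xi> \<in> Pow st"
    hence "\<eta> \<subseteq> E S" "\<xi> \<subseteq> E S" "\<eta> \<inter> \<xi> = {}" using st by auto
    thus "wt b S \<beta> (\<xi> \<union> \<eta>) \<le> wt b S \<beta> \<eta> * prod ?y \<xi>"
      using wt_union_le[OF S b, of \<eta> \<xi>] by (simp add: Un_commute)
  qed
  also have "\<dots> = (\<Sum>\<eta>\<in>Pow (E S - st). wt b S \<beta> \<eta>) * (\<Sum>\<xi>\<in>Pow st. prod ?y \<xi>)"
    by (simp add: sum_product)
  also have "(\<Sum>\<xi>\<in>Pow st. prod ?y \<xi>) = (\<Prod>e\<in>st. ?y e + 1)"
    using prod_add[OF fin(2), of ?y "\<lambda>_. 1"] by simp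
  also have "\<dots> = exp (\<beta> * ?C)"
    by (simp add: exp_sum fin sum_distrib_left)
  also have "(\<Sum>\<eta>\<in>Pow (E S - st). wt b S \<beta> \<eta>) = (\<Sum>\<eta>\<in>Pow (E S). wt b S \<beta> \<eta> * of_bool (\<eta> \<inter> st = {}))"
    using fin by (intro sum.mono_neutral_cong_left) auto
  finally have le: "(\<Sum>\<eta>\<in>Pow (E S). wt b S \<beta> \<eta>)
      \<le> (\<Sum>\<eta>\<in>Pow (E S). wt b S \<beta> \<eta> * of_bool (\<eta> \<inter> st = {})) * exp (\<beta> * ?C)" .
  have Z: "0 < (\<Sum>\<eta>\<in>Pow (E S). wt b S \<beta> \<eta>)" by (rule sum_Pow_pos[OF fin(1) wt_pos[OF b]])
  have "exp (- \<beta> * ?C) * (\<Sum>\<eta>\<in>Pow (E S). wt b S \<beta> \<eta>)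
      \<le> (\<Sum>\<eta>\<in>Pow (E S). wt b S \<beta> \<eta> * of_bool (\<eta> \<inter> st = {}))"
    using le by (simp add: exp_minus field_simps)
  thus ?thesis using Z by (simp add: expect_def pos_le_divide_eq)
qed

section \<open>Derivatives in the inverse temperature\<close>

definition edge_rate :: "real \<Rightarrow> 'v set \<Rightarrow> real" where
  "edge_rate \<beta> e = coupling J e * exp (\<beta> * coupling J e) / (exp (\<beta> * coupling J e) - 1)"

text \<open>For u = \<beta> J this is u exp u / (exp u - 1) \<ge> 1, that is, 1 - u \<le> exp (- u).
  The bound holds uniformly over the edges, however weak the coupling.\<close>

lemma edge_rate_ge:
  assumes "0 < \<beta>" "e \<in> E S"
  shows "1 / \<beta> \<le> edge_rate \<beta> e"
proof -
  have c: "0 < coupling J e" using assms by (auto simp: EJ_def)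
  define u where "u = \<beta> * coupling J e"
  have u: "0 < u" using c assms by (simp add: u_def)
  have "1 - u \<le> exp (- u)" using exp_ge_add_one_self[of "- u"] by simp
  hence "(1 - u) * exp u \<le> exp (- u) * exp u" by (rule mult_right_mono) simp
  hence "exp u - 1 \<le> u * exp u" by (simp add: mult_exp_exp algebra_simps)
  hence "1 \<le> u * exp u / (exp u - 1)" using u by (simp add: pos_le_divide_eq)
  hence "1 / \<beta> \<le> (u * exp u / (exp u - 1)) / \<beta>" using assms(1) by (intro divide_right_mono) auto
  also have "\<dots> = edge_rate \<beta> e" using assms(1) by (simp add: edge_rate_def u_def)
  finally show ?thesis .
qed

text \<open>\<open>edge_rate \<beta> e\<close> is the logarithmic derivative of the edge factor exp
  (\<beta> J) - 1, and the cluster term does not depend on \<beta>.\<close>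

lemma wt_deriv:
  assumes S: "finvol S" and b: "0 < \<beta>" and "\<eta> \<subseteq> E S"
  shows "((\<lambda>\<beta>. wt b S \<beta> \<eta>) has_real_derivative wt b S \<beta> \<eta> * (\<Sum>e\<in>\<eta>. edge_rate \<beta> e)) (at \<beta>)"
proof -
  let ?y = "\<lambda>\<beta> e. exp (\<beta> * coupling J e) - 1"
  have fin: "finite \<eta>" using assms finite_EJ finite_subset by metis
  have "((\<lambda>\<beta>. prod (?y \<beta>) \<eta>) has_real_derivative prod (?y \<beta>) \<eta> * (\<Sum>e\<in>\<eta>. edge_rate \<beta> e)) (at \<beta>)"
    using fin assms(3)
  proof (induction \<eta> rule: finite_induct)
    case (insert e \<eta>)
    have "?y \<beta> e \<noteq> 0" using edge_factor_pos[OF b, of e S] insert.prems by auto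
    hence y: "?y \<beta> e * edge_rate \<beta> e = coupling J e * exp (\<beta> * coupling J e)"
      unfolding edge_rate_def times_divide_eq_right by (rule nonzero_mult_div_cancel_left)
    have "((\<lambda>\<beta>. ?y \<beta> e) has_real_derivative ?y \<beta> e * edge_rate \<beta> e) (at \<beta>)"
      unfolding y by (auto intro!: derivative_eq_intros)
    from DERIV_mult[OF this insert.IH] show ?case
      using insert by (simp add: algebra_simps)
  qed simp
  from DERIV_mult[OF this DERIV_const[of "q ^ card (comps S (\<eta> \<union> bd b S))"]] show ?thesis
    by (simp add: fkw_def mult_ac)
qed

lemma sum_wt_deriv:
  assumes S: "finvol S" and b: "0 < \<beta>"
  shows "((\<lambda>\<beta>. \<Sum>\<eta>\<in>Pow (E S). wt b S \<beta> \<eta> * f \<eta>) has_real_derivative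
    (\<Sum>\<eta>\<in>Pow (E S). wt b S \<beta> \<eta>) * (\<Sum>e\<in>E S. edge_rate \<beta> e * P b S \<beta> (\<lambda>\<eta>. f \<eta> * of_bool (e \<in> \<eta>)))) (at \<beta>)"
proof -
  have fin: "finite (E S)" using S finite_EJ by metis
  have Z: "0 < (\<Sum>\<eta>\<in>Pow (E S). wt b S \<beta> \<eta>)" by (rule sum_Pow_pos[OF fin wt_pos[OF b]])
  have "((\<lambda>\<beta>. \<Sum>\<eta>\<in>Pow (E S). wt b S \<beta> \<eta> * f \<eta>) has_real_derivative
      (\<Sum>\<eta>\<in>Pow (E S). wt b S \<beta> \<eta> * (\<Sum>e\<in>\<eta>. edge_rate \<beta> e) * f \<eta>)) (at \<beta>)"
    by (intro DERIV_sum DERIV_cmult_right wt_deriv[OF S b]) auto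
  moreover have "(\<Sum>\<eta>\<in>Pow (E S). wt b S \<beta> \<eta> * (\<Sum>e\<in>\<eta>. edge_rate \<beta> e) * f \<eta>)
      = (\<Sum>\<eta>\<in>Pow (E S). \<Sum>e\<in>E S. edge_rate \<beta> e * (wt b S \<beta> \<eta> * (f \<eta> * of_bool (e \<in> \<eta>))))"
  proof (rule sum.cong[OF refl])
    fix \<eta> assume "\<eta> \<in> Pow (E S)"
    hence "(\<Sum>e\<in>\<eta>. edge_rate \<beta> e) = (\<Sum>e\<in>E S. edge_rate \<beta> e * of_bool (e \<in> \<eta>))"
      using fin by (intro sum.mono_neutral_cong_left) auto
    thus "wt b S \<beta> \<eta> * (\<Sum>e\<in>\<eta>. edge_rate \<beta> e) * f \<eta>
      = (\<Sum>e\<in>E S. edge_rate \<beta> e * (wt b S \<beta> \<eta> * (f \<eta> * of_bool (e \<in> \<eta>))))"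
      by (simp add: sum_distrib_left sum_distrib_right mult_ac)
  qed
  moreover have "\<dots> = (\<Sum>e\<in>E S. edge_rate \<beta> e * (\<Sum>\<eta>\<in>Pow (E S). wt b S \<beta> \<eta> * (f \<eta> * of_bool (e \<in> \<eta>))))"
    by (subst sum.swap) (simp only: sum_distrib_left)
  moreover have "\<dots> = (\<Sum>\<eta>\<in>Pow (E S). wt b S \<beta> \<eta>) * (\<Sum>e\<in>E S. edge_rate \<beta> e * P b S \<beta> (\<lambda>\<eta>. f \<eta> * of_bool (e \<in> \<eta>)))"
    by (subst sum_distrib_left) (intro sum.cong refl, use Z in \<open>simp add: expect_def\<close>)
  ultimately show ?thesis by simp
qed

text \<open>The counterpart of Russo's formula for dependent edges: differentiating the partition
  function in the denominator subtracts the product of means, which leaves covariances.\<close>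

lemma P_deriv:
  assumes S: "finvol S" and b: "0 < \<beta>"
  shows "((\<lambda>\<beta>. P b S \<beta> f) has_real_derivative
    (\<Sum>e\<in>E S. edge_rate \<beta> e * cov (E S) (wt b S \<beta>) f (\<lambda>\<eta>. of_bool (e \<in> \<eta>)))) (at \<beta>)"
proof -
  have fin: "finite (E S)" using S finite_EJ by metis
  let ?Z = "\<lambda>\<beta>. \<Sum>\<eta>\<in>Pow (E S). wt b S \<beta> \<eta>" and ?N = "\<lambda>\<beta>. \<Sum>\<eta>\<in>Pow (E S). wt b S \<beta> \<eta> * f \<eta>"
  let ?ef = "\<lambda>e. P b S \<beta> (\<lambda>\<eta>. f \<eta> * of_bool (e \<in> \<eta>))" and ?e = "\<lambda>e. P b S \<beta> (\<lambda>\<eta>. of_bool (e \<in> \<eta>))"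
  have Z: "0 < ?Z \<beta>" by (rule sum_Pow_pos[OF fin wt_pos[OF b]])
  have N: "?N \<beta> = ?Z \<beta> * P b S \<beta> f" using Z by (simp add: expect_def)
  have dN: "(?N has_real_derivative ?Z \<beta> * (\<Sum>e\<in>E S. edge_rate \<beta> e * ?ef e)) (at \<beta>)"
    by (rule sum_wt_deriv[OF S b])
  have dZ: "(?Z has_real_derivative ?Z \<beta> * (\<Sum>e\<in>E S. edge_rate \<beta> e * ?e e)) (at \<beta>)"
    using sum_wt_deriv[OF S b, of b "\<lambda>_. 1"] by simp
  have "((\<lambda>\<beta>. ?N \<beta> / ?Z \<beta>) has_real_derivative
      (?Z \<beta> * (\<Sum>e\<in>E S. edge_rate \<beta> e * ?ef e) * ?Z \<beta> - ?N \<beta> * (?Z \<beta> * (\<Sum>e\<in>E S. edge_rate \<beta> e * ?e e))) / (?Z \<beta> * ?Z \<beta>)) (at \<beta>)"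
    by (rule DERIV_divide[OF dN dZ]) (use Z in simp)
  moreover have "(?Z \<beta> * (\<Sum>e\<in>E S. edge_rate \<beta> e * ?ef e) * ?Z \<beta> - ?N \<beta> * (?Z \<beta> * (\<Sum>e\<in>E S. edge_rate \<beta> e * ?e e))) / (?Z \<beta> * ?Z \<beta>)
      = (\<Sum>e\<in>E S. edge_rate \<beta> e * ?ef e) - P b S \<beta> f * (\<Sum>e\<in>E S. edge_rate \<beta> e * ?e e)"
    unfolding N using Z by (simp add: field_simps)
  moreover have "\<dots> = (\<Sum>e\<in>E S. edge_rate \<beta> e * cov (E S) (wt b S \<beta>) f (\<lambda>\<eta>. of_bool (e \<in> \<eta>)))"
    unfolding cov_def by (simp add: sum_distrib_left sum_subtractf right_diff_distrib mult_ac)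
  ultimately show ?thesis by (simp add: expect_def)
qed

definition logZ :: "bool \<Rightarrow> 'v set \<Rightarrow> real \<Rightarrow> real" where
  "logZ b S \<beta> = ln (\<Sum>\<eta>\<in>Pow (E S). wt b S \<beta> \<eta>)"

lemma logZ_deriv:
  assumes S: "finvol S" and b: "0 < \<beta>"
  shows "(logZ b S has_real_derivative (\<Sum>e\<in>E S. edge_rate \<beta> e * P b S \<beta> (\<lambda>\<eta>. of_bool (e \<in> \<eta>)))) (at \<beta>)"
proof -
  have fin: "finite (E S)" using S finite_EJ by metis
  have Z: "0 < (\<Sum>\<eta>\<in>Pow (E S). wt b S \<beta> \<eta>)" by (rule sum_Pow_pos[OF fin wt_pos[OF b]])
  show ?thesis unfolding logZ_def[abs_def]
    using DERIV_chain2[OF DERIV_ln[OF Z] sum_wt_deriv[OF S b, of b "\<lambda>_. 1", simplified]] Z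
    by (simp add: divide_simps)
qed

text \<open>Wiring lowers the cluster count of each configuration by at most the number of boundary
  vertices, so each weight changes by at most that power of q.\<close>

lemma logZ_wired_free:
  assumes S: "finvol S" and b: "0 < \<beta>"
  shows "logZ True S \<beta> \<le> logZ False S \<beta>"
    "logZ False S \<beta> \<le> logZ True S \<beta> + real (card (boundary V J S)) * ln q"
proof -
  have fin: "finite (E S)" using S finite_EJ by metis
  let ?Z = "\<lambda>b. \<Sum>\<eta>\<in>Pow (E S). wt b S \<beta> \<eta>" and ?k = "card (boundary V J S)"
  have Z: "0 < ?Z b" for b by (rule sum_Pow_pos[OF fin wt_pos[OF b]])
  have cmp: "wt True S \<beta> \<eta> \<le> wt False S \<beta> \<eta> \<and> wt False S \<beta> \<eta> \<le> wt True S \<beta> \<eta> * q ^ ?k" if "\<eta> \<subseteq> E S" for \<eta>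
  proof -
    let ?p = "\<Prod>e\<in>\<eta>. exp (\<beta> * coupling J e) - 1"
    have p: "0 \<le> ?p" using edge_factor_pos[OF b] that by (intro prod_nonneg) (auto simp: less_imp_le)
    have S': "finite S" using S by simp
    note c = card_comps_wired_le[OF S' boundary_subset[of V J S], of \<eta>]
    have 1: "q ^ card (comps S (\<eta> \<union> pairs_on (boundary V J S))) \<le> q ^ card (comps S \<eta>)"
      using c(1) q1 by (rule power_increasing)
    have 2: "q ^ card (comps S \<eta>) \<le> q ^ card (comps S (\<eta> \<union> pairs_on (boundary V J S))) * q ^ ?k"
      unfolding power_add[symmetric] using c(2) q1 by (rule power_increasing)
    show ?thesis using mult_left_mono[OF 1 p] mult_left_mono[OF 2 p]
      by (simp add: fkw_def bc_edges_def mult_ac)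
  qed
  show "logZ True S \<beta> \<le> logZ False S \<beta>"
    unfolding logZ_def using Z cmp by (subst ln_le_cancel_iff) (auto intro!: sum_mono)
  have "?Z False \<le> ?Z True * q ^ ?k"
    unfolding sum_distrib_right using cmp by (intro sum_mono) auto
  hence "ln (?Z False) \<le> ln (?Z True * q ^ ?k)"
    using Z q1 by (subst ln_le_cancel_iff) auto
  thus "logZ False S \<beta> \<le> logZ True S \<beta> + real ?k * ln q"
    using Z[of True] q1 by (simp add: logZ_def ln_mult ln_realpow)
qed

end

section \<open>Exploring the clusters of a set of seeds\<close>

locale exploration =
  fixes F :: "'v set set" and K :: "'v set" and hit :: "'v set set \<Rightarrow> bool"
begin

definition touch :: "'v set set \<Rightarrow> 'v set \<Rightarrow> bool" where
  "touch \<eta> e \<longleftrightarrow> (\<exists>x\<in>e. \<exists>s\<in>K. conn \<eta> s x)"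

abbreviation next_edge :: "'v set set \<Rightarrow> 'v set set \<Rightarrow> 'v set" where
  "next_edge A \<eta> \<equiv> (SOME e. e \<in> F - A \<and> touch \<eta> e)"

text \<open>\<open>n\<close> is fuel, \<open>A\<close> the set of revealed edges and
  \<open>\<eta>\<close> the open ones among them. With enough fuel the exploration stops only when
  the revealed open edges contain every open edge of F in the clusters of the seeds.\<close>

primrec explore :: "nat \<Rightarrow> 'v set set \<Rightarrow> 'v set set \<Rightarrow> 'v set dtree" where
  "explore 0 A \<eta> = Leaf (of_bool (hit \<eta>))"
| "explore (Suc n) A \<eta> = (if \<exists>e. e \<in> F - A \<and> touch \<eta> e then
     Node (next_edge A \<eta>) (explore n (insert (next_edge A \<eta>) A) \<eta>)
       (explore n (insert (next_edge A \<eta>) A) (insert (next_edge A \<eta>) \<eta>))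
     else Leaf (of_bool (hit \<eta>)))"

lemma next_edge: "\<exists>e. e \<in> F - A \<and> touch \<eta> e \<Longrightarrow> next_edge A \<eta> \<in> F - A \<and> touch \<eta> (next_edge A \<eta>)"
  by (rule someI_ex)

lemma touch_mono: "\<eta> \<subseteq> \<eta>' \<Longrightarrow> touch \<eta> e \<Longrightarrow> touch \<eta>' e"
  unfolding touch_def using conn_mono[of \<eta> \<eta>'] by blast

lemma valid_explore: "F \<subseteq> F' \<Longrightarrow> valid_tree F' (explore n A \<eta>) A"
proof (induction n arbitrary: A \<eta>)
  case (Suc n)
  show ?case
  proof (cases "\<exists>e. e \<in> F - A \<and> touch \<eta> e")
    case True
    thus ?thesis using Suc next_edge[OF True] by auto
  next
    case False
    have "explore (Suc n) A \<eta> = Leaf (of_bool (hit \<eta>))" unfolding explore.simps using False by (rule if_not_P)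
    thus ?thesis by simp
  qed
qed simp

lemma queries_explore:
  "\<eta> \<subseteq> \<omega> \<Longrightarrow> e \<in> tree_queries (explore n A \<eta>) \<omega> \<Longrightarrow> e \<in> F \<and> touch \<omega> e"
proof (induction n arbitrary: A \<eta>)
  case (Suc n)
  show ?case
  proof (cases "\<exists>e. e \<in> F - A \<and> touch \<eta> e")
    case True
    let ?e = "next_edge A \<eta>"
    have n: "?e \<in> F - A" "touch \<eta> ?e" using next_edge[OF True] by auto
    have eq: "explore (Suc n) A \<eta> = Node ?e (explore n (insert ?e A) \<eta>) (explore n (insert ?e A) (insert ?e \<eta>))"
      unfolding explore.simps using True by (rule if_P)
    consider "e = ?e" | "?e \<in> \<omega>" "e \<in> tree_queries (explore n (insert ?e A) (insert ?e \<eta>)) \<omega>"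
      | "e \<in> tree_queries (explore n (insert ?e A) \<eta>) \<omega>"
      using Suc.prems(2) unfolding eq by (auto split: if_splits)
    thus ?thesis
    proof cases
      case 1
      thus ?thesis using n touch_mono[OF Suc.prems(1)] by auto
    next
      case 2
      thus ?thesis using Suc.IH[of "insert ?e \<eta>" "insert ?e A"] Suc.prems(1) by auto
    next
      case 3
      thus ?thesis using Suc.IH[of \<eta> "insert ?e A"] Suc.prems(1) by auto
    qed
  next
    case False
    have "explore (Suc n) A \<eta> = Leaf (of_bool (hit \<eta>))" unfolding explore.simps using False by (rule if_not_P)
    thus ?thesis using Suc.prems by simp
  qed
qed simp

text \<open>Each query removes one edge from F - A, so with fuel at least the size of this set the
  exploration cannot stop early. The witness \<open>\<eta>\<close> is the set of open edges revealed
  at the end; it is closed under adding open edges that touch the clusters of the seeds.\<close>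

lemma value_explore:
  "finite F \<Longrightarrow> card (F - A) \<le> n \<Longrightarrow> A \<subseteq> F \<Longrightarrow>
    \<exists>\<eta>. \<eta> \<subseteq> \<omega> \<inter> F \<and> tree_value (explore n A (\<omega> \<inter> A)) \<omega> = of_bool (hit \<eta>) \<and>
      (\<forall>e\<in>F \<inter> \<omega>. touch \<eta> e \<longrightarrow> e \<in> \<eta>)"
proof (induction n arbitrary: A)
  case 0
  hence "F - A = {}" by simp
  moreover have "tree_value (explore 0 A (\<omega> \<inter> A)) \<omega> = of_bool (hit (\<omega> \<inter> A))" by simp
  ultimately show ?case using 0 by blast
next
  case (Suc n)
  show ?case
  proof (cases "\<exists>e. e \<in> F - A \<and> touch (\<omega> \<inter> A) e")
    case True
    let ?e = "next_edge A (\<omega> \<inter> A)"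
    have n: "?e \<in> F - A" using next_edge[OF True] by auto
    have eq: "explore (Suc n) A (\<omega> \<inter> A)
        = Node ?e (explore n (insert ?e A) (\<omega> \<inter> A)) (explore n (insert ?e A) (insert ?e (\<omega> \<inter> A)))"
      unfolding explore.simps using True by (rule if_P)
    have val: "tree_value (explore (Suc n) A (\<omega> \<inter> A)) \<omega> = tree_value (explore n (insert ?e A) (\<omega> \<inter> insert ?e A)) \<omega>"
      unfolding eq by (cases "?e \<in> \<omega>") auto
    have "F - A = insert ?e (F - insert ?e A)" using n by blast
    moreover have "?e \<notin> F - insert ?e A" by simp
    ultimately have "card (F - A) = Suc (card (F - insert ?e A))"
      using Suc.prems(1) card_insert_disjoint[of "F - insert ?e A" ?e] by (metis finite_Diff)
    thus ?thesis unfolding val using Suc.prems n by (intro Suc.IH) auto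
  next
    case False
    have eq: "explore (Suc n) A (\<omega> \<inter> A) = Leaf (of_bool (hit (\<omega> \<inter> A)))"
      unfolding explore.simps using False by (rule if_not_P)
    show ?thesis using False Suc.prems unfolding eq by (intro exI[of _ "\<omega> \<inter> A"]) auto
  qed
qed

end

text \<open>The assumption \<open>cross\<close> says that the seeds separate x0 from T: whenever the
  two are joined, the cluster of x0 contains a seed and is therefore among the explored
  ones.\<close>

locale seed_exploration =
  fixes F :: "'v set set" and K T :: "'v set" and x0 :: 'v
  assumes finF: "finite F"
    and cross: "\<And>\<eta> y. \<eta> \<subseteq> F \<Longrightarrow> y \<in> T \<Longrightarrow> conn \<eta> x0 y \<Longrightarrow> \<exists>s\<in>K. conn \<eta> x0 s"
begin

sublocale exploration F K "\<lambda>\<eta>. \<exists>y\<in>T. conn \<eta> x0 y" .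

definition "seed_tree = explore (card F) {} {}"

lemma valid_seed_tree: "F \<subseteq> F' \<Longrightarrow> valid_tree F' seed_tree {}"
  unfolding seed_tree_def by (rule valid_explore)

lemma queries_seed_tree: "e \<in> tree_queries seed_tree \<omega> \<Longrightarrow> e \<in> F \<and> (\<exists>x\<in>e. \<exists>s\<in>K. conn \<omega> s x)"
  unfolding seed_tree_def touch_def[symmetric] by (rule queries_explore) auto

text \<open>The revealed edges reproduce the clusters of all seeds in full. If x0 is joined to T,
  then by \<open>cross\<close> the connection lies in the cluster of some seed, hence consists of
  revealed edges.\<close>

lemma value_seed_tree: "tree_value seed_tree \<omega> = of_bool (\<exists>y\<in>T. conn (\<omega> \<inter> F) x0 y)"
proof -
  obtain \<eta> where e: "\<eta> \<subseteq> \<omega> \<inter> F" "tree_value seed_tree \<omega> = of_bool (\<exists>y\<in>T. conn \<eta> x0 y)"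
    and cl: "\<And>e. e \<in> F \<inter> \<omega> \<Longrightarrow> touch \<eta> e \<Longrightarrow> e \<in> \<eta>"
    using value_explore[OF finF, of "{}" "card F" \<omega>] unfolding seed_tree_def by auto
  have same: "conn \<eta> s y" if s: "s \<in> K" and c: "conn (\<omega> \<inter> F) s y" for s y
    using c
  proof (induction rule: conn_induct)
    case (step y z)
    have "touch \<eta> {y, z}" unfolding touch_def using s step(3) by auto
    hence "{y, z} \<in> \<eta>" using cl step(2) by auto
    thus ?case using step(3) conn_edge conn_trans by metis
  qed simp
  have "(\<exists>y\<in>T. conn (\<omega> \<inter> F) x0 y) \<longleftrightarrow> (\<exists>y\<in>T. conn \<eta> x0 y)"
  proof
    assume "\<exists>y\<in>T. conn (\<omega> \<inter> F) x0 y"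
    then obtain y where y: "y \<in> T" "conn (\<omega> \<inter> F) x0 y" by auto
    then obtain s where s: "s \<in> K" "conn (\<omega> \<inter> F) x0 s" using cross[of "\<omega> \<inter> F" y] by auto
    have "conn \<eta> s x0" "conn \<eta> s y"
      using same[OF s(1)] s(2) y(2) conn_sym conn_trans by metis+
    hence "conn \<eta> x0 y" using conn_sym conn_trans by metis
    thus "\<exists>y\<in>T. conn \<eta> x0 y" using y by auto
  qed (use conn_mono[OF e(1)] in blast)
  thus ?thesis using e(2) by simp
qed

end

text \<open>The largest element of a set of m + 1 naturals is at least m. Removing it and using that
  G is antitone compares the sum term by term with an initial segment.\<close>

lemma sum_le_initial:
  fixes G :: "nat \<Rightarrow> real"
  assumes "finite A" "card A \<le> n" "antimono G" "\<And>j. 0 \<le> G j"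
  shows "sum G A \<le> (\<Sum>j<n. G j)"
proof -
  have "sum G A \<le> (\<Sum>j<card A. G j)"
    using assms(1)
  proof (induction "card A" arbitrary: A)
    case (Suc m)
    hence ne: "A \<noteq> {}" by auto
    let ?x = "Max A"
    have x: "?x \<in> A" using Suc ne by simp
    have "A \<subseteq> {..?x}" using Suc by auto
    hence "card A \<le> Suc ?x" using card_mono[of "{..?x}" A] by simp
    hence "m \<le> ?x" using Suc(2) by simp
    hence "G ?x \<le> G m" using assms(3) by (auto dest: antimonoD)
    moreover have "sum G (A - {?x}) \<le> (\<Sum>j<m. G j)"
    proof -
      have "card (A - {?x}) = m" using Suc(2,3) x by simp
      thus ?thesis using Suc(1)[of "A - {?x}"] Suc(3) by simp
    qed
    moreover have "sum G A = G ?x + sum G (A - {?x})" using Suc(3) x by (rule sum.remove)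
    ultimately show ?case unfolding Suc(2)[symmetric] by simp
  qed simp
  also have "\<dots> \<le> (\<Sum>j<n. G j)" using assms by (intro sum_mono2) auto
  finally show ?thesis .
qed

text \<open>Used with k the radius of a sphere and m the distance of a vertex from its centre;
  \<open>(k - m) + (m - k)\<close> is |k - m| in truncated arithmetic. The value of G at the minimum
  is at most the sum of its values at both arguments. The radii k \<ge> m and k < m contribute M + 1
  times the sum each, the truncated argument contributes M + 2 times the sum, and 2 (M + 1) + (M +
  2) = 3 M + 4.\<close>

lemma sum_distance_le:
  fixes G :: "nat \<Rightarrow> real"
  assumes G: "antimono G" "\<And>j. 0 \<le> G j" and n: "1 \<le> n"
  shows "(\<Sum>k\<in>{1..n}. G (min ((k - m) + (m - k) - M) ((n - M) div 2))) \<le> real (3 * M + 4) * (\<Sum>j<n. G j)"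
proof -
  let ?S = "\<Sum>j<n. G j"
  let ?H = "\<lambda>j. G (j - M)" and ?b = "(n - M) div 2"
  have H: "antimono ?H" "\<And>j. 0 \<le> ?H j" using G by (auto intro!: antimonoI antimonoD[OF G(1)] diff_le_mono)
  have card_le: "card (f ` ({1..n} \<inter> A)) \<le> n" for f :: "nat \<Rightarrow> nat" and A
    using card_image_le[of "{1..n} \<inter> A" f] card_mono[of "{1..n}" "{1..n} \<inter> A"] by simp
  have SH: "(\<Sum>j<n. ?H j) \<le> real (M + 1) * ?S"
  proof -
    have "(\<Sum>j<n. ?H j) \<le> (\<Sum>j<M + n. ?H j)" using G by (intro sum_mono2) auto
    also have "\<dots> = (\<Sum>j<M. ?H j) + (\<Sum>j<n. ?H (M + j))"
      by (induction n) simp_all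
    also have "\<dots> = real M * G 0 + ?S" by simp
    also have "\<dots> \<le> real M * ?S + ?S"
      using G n member_le_sum[of 0 "{..<n}" G] by (intro add_mono mult_left_mono) auto
    finally show ?thesis by (simp add: algebra_simps)
  qed
  have "(\<Sum>k\<in>{1..n}. ?H ((k - m) + (m - k))) = (\<Sum>k\<in>{1..n} \<inter> {m..}. ?H (k - m)) + (\<Sum>k\<in>{1..n} \<inter> {..<m}. ?H (m - k))"
  proof -
    have "{1..n} = ({1..n} \<inter> {m..}) \<union> ({1..n} \<inter> {..<m})" by auto
    hence "(\<Sum>k\<in>{1..n}. ?H ((k - m) + (m - k))) = (\<Sum>k\<in>({1..n} \<inter> {m..}) \<union> ({1..n} \<inter> {..<m}). ?H ((k - m) + (m - k)))"
      by simp
    also have "\<dots> = (\<Sum>k\<in>{1..n} \<inter> {m..}. ?H ((k - m) + (m - k))) + (\<Sum>k\<in>{1..n} \<inter> {..<m}. ?H ((k - m) + (m - k)))"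
      by (rule sum.union_disjoint) auto
    finally show ?thesis by simp
  qed
  also have "(\<Sum>k\<in>{1..n} \<inter> {m..}. ?H (k - m)) = sum ?H ((\<lambda>k. k - m) ` ({1..n} \<inter> {m..}))"
    by (subst sum.reindex) (auto simp: inj_on_def)
  also have "\<dots> \<le> (\<Sum>j<n. ?H j)"
    by (rule sum_le_initial[OF _ card_le H]) auto
  also have "(\<Sum>k\<in>{1..n} \<inter> {..<m}. ?H (m - k)) = sum ?H ((\<lambda>k. m - k) ` ({1..n} \<inter> {..<m}))"
    by (subst sum.reindex) (auto simp: inj_on_def)
  also have "\<dots> \<le> (\<Sum>j<n. ?H j)"
    by (rule sum_le_initial[OF _ card_le H]) auto
  finally have 1: "(\<Sum>k\<in>{1..n}. ?H ((k - m) + (m - k))) \<le> 2 * (real (M + 1) * ?S)" using SH by simp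
  have 2: "real n * G ?b \<le> real (M + 2) * ?S"
  proof -
    have "real (?b + 1) * G ?b = (\<Sum>j<?b + 1. G ?b)" by simp
    also have "\<dots> \<le> (\<Sum>j<?b + 1. G j)" by (intro sum_mono antimonoD[OF G(1)]) auto
    also have "\<dots> \<le> ?S" using G n by (intro sum_mono2) auto
    finally have "real (M + 2) * (real (?b + 1) * G ?b) \<le> real (M + 2) * ?S" by (intro mult_left_mono) auto
    moreover have "n \<le> (M + 2) * (?b + 1)"
    proof -
      have "n \<le> 2 * ?b + 1 + M" by linarith
      also have "\<dots> \<le> (M + 2) * (?b + 1)" by (simp add: algebra_simps)
      finally show ?thesis .
    qed
    hence "real n \<le> real (M + 2) * real (?b + 1)" by (metis of_nat_le_iff of_nat_mult)
    hence "real n * G ?b \<le> real (M + 2) * real (?b + 1) * G ?b" using G by (intro mult_right_mono) auto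
    ultimately show ?thesis by (simp only: mult.assoc)
  qed
  have "(\<Sum>k\<in>{1..n}. G (min ((k - m) + (m - k) - M) ?b)) \<le> (\<Sum>k\<in>{1..n}. ?H ((k - m) + (m - k)) + G ?b)"
    using G by (intro sum_mono) (auto simp: min_def)
  also have "\<dots> = (\<Sum>k\<in>{1..n}. ?H ((k - m) + (m - k))) + real n * G ?b" by (simp add: sum.distrib)
  also have "\<dots> \<le> 2 * (real (M + 1) * ?S) + real (M + 2) * ?S" using 1 2 by simp
  finally show ?thesis by (simp add: algebra_simps)
qed

section \<open>Periodic models and the differential inequality\<close>

abbreviation (input) shift :: "'v::ab_group_add \<Rightarrow> 'v \<Rightarrow> 'v" where
  "shift t \<equiv> (\<lambda>x. x + t)"

abbreviation (input) shift_edges :: "'v::ab_group_add \<Rightarrow> 'v set set \<Rightarrow> 'v set set" where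
  "shift_edges t \<equiv> (`) ((`) (shift t))"

lemma shift_shift_edges [simp]: "shift_edges (- t) (shift_edges t \<eta>) = \<eta>" "shift_edges t (shift_edges (- t) \<eta>) = \<eta>"
  by (simp_all add: image_image)

lemma conn_shift: "conn \<eta> x y \<Longrightarrow> conn (shift_edges t \<eta>) (x + t) (y + t)"
proof (induction rule: conn_induct)
  case (step y z)
  have "conn (shift_edges t \<eta>) (y + t) (z + t)"
    using imageI[OF step(2), of "(`) (shift t)"] by (intro conn_edge) simp
  thus ?case using step(3) conn_trans by metis
qed simp

lemma conn_shift_iff: "conn (shift_edges t \<eta>) (x + t) (y + t) \<longleftrightarrow> conn \<eta> x y"
  using conn_shift[of \<eta> x y t] conn_shift[of "shift_edges t \<eta>" "x + t" "y + t" "- t", unfolded shift_shift_edges] by auto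

lemma card_comps_shift: "card (comps (shift t ` S) (shift_edges t \<eta>)) = card (comps S \<eta>)"
proof -
  have "{y. conn (shift_edges t \<eta>) (x + t) y} = shift t ` {y. conn \<eta> x y}" for x
  proof (intro equalityI subsetI)
    fix y assume "y \<in> {y. conn (shift_edges t \<eta>) (x + t) y}"
    hence "conn \<eta> x (y - t)" using conn_shift_iff[of t \<eta> x "y - t"] by simp
    thus "y \<in> shift t ` {y. conn \<eta> x y}" by (intro image_eqI[of _ _ "y - t"]) auto
  qed (auto simp: conn_shift)
  hence "comps (shift t ` S) (shift_edges t \<eta>) = (`) (shift t) ` comps S \<eta>"
    by (simp add: comps_def image_image)
  thus ?thesis by (simp add: card_image inj_on_image inj_onI)
qed

lemma pairs_on_shift: "pairs_on (shift t ` S) = shift_edges t (pairs_on S)"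
proof (intro equalityI subsetI)
  fix e assume "e \<in> pairs_on (shift t ` S)"
  then obtain x y where "e = {x + t, y + t}" "x \<in> S" "y \<in> S" "x \<noteq> y" by (auto simp: pairs_on_def)
  hence "e = shift t ` {x, y}" "{x, y} \<in> pairs_on S" by (auto simp: pairs_on_def)
  thus "e \<in> shift_edges t (pairs_on S)" by blast
next
  fix e assume "e \<in> shift_edges t (pairs_on S)"
  then obtain x y where "e = shift t ` {x, y}" "x \<in> S" "y \<in> S" "x \<noteq> y" by (auto simp: pairs_on_def)
  thus "e \<in> pairs_on (shift t ` S)"
    unfolding pairs_on_def by (intro CollectI exI[of _ "x + t"] exI[of _ "y + t"]) auto
qed

section \<open>Translation invariance of the finite-volume measures\<close>

locale fk_lattice = fk_model V J q
  for V :: "'v::ab_group_add set" and J :: "'v \<Rightarrow> 'v \<Rightarrow> real" and q :: real +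
  fixes shifts :: "'v set" and d :: "'v \<Rightarrow> 'v \<Rightarrow> nat" and M :: nat and R :: "'v set"
  assumes shifts_neg: "t \<in> shifts \<Longrightarrow> - t \<in> shifts"
    and d_self: "x \<in> V \<Longrightarrow> d x x = 0"
    and d_sym: "x \<in> V \<Longrightarrow> y \<in> V \<Longrightarrow> d x y = d y x"
    and d_tri: "x \<in> V \<Longrightarrow> y \<in> V \<Longrightarrow> z \<in> V \<Longrightarrow> d x z \<le> d x y + d y z"
    and finite_bal: "x \<in> V \<Longrightarrow> finite {y \<in> V. d x y \<le> n}"
    and J_range: "x \<in> V \<Longrightarrow> y \<in> V \<Longrightarrow> 0 < J x y \<Longrightarrow> d x y \<le> M"
    and V_shift: "t \<in> shifts \<Longrightarrow> x \<in> V \<Longrightarrow> x + t \<in> V"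
    and d_shift: "t \<in> shifts \<Longrightarrow> x \<in> V \<Longrightarrow> y \<in> V \<Longrightarrow> d (x + t) (y + t) = d x y"
    and J_shift: "t \<in> shifts \<Longrightarrow> x \<in> V \<Longrightarrow> y \<in> V \<Longrightarrow> J (x + t) (y + t) = J x y"
    and R: "finite R" "R \<subseteq> V" "x \<in> V \<Longrightarrow> \<exists>r\<in>R. \<exists>t\<in>shifts. x = r + t"
begin

definition bal :: "'v \<Rightarrow> nat \<Rightarrow> 'v set" where
  "bal x n = {y \<in> V. d x y \<le> n}"

lemma finvol_bal: "x \<in> V \<Longrightarrow> finvol (bal x n)"
  by (auto simp: bal_def finite_bal)

lemma bal_mono: "n \<le> m \<Longrightarrow> bal x n \<subseteq> bal x m"
  by (auto simp: bal_def)

lemma bal_subset: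
  assumes "x \<in> V" "y \<in> bal x m" "m + k \<le> n"
  shows "bal y k \<subseteq> bal x n"
proof
  fix z assume "z \<in> bal y k"
  thus "z \<in> bal x n" using assms d_tri[of x y z] by (auto simp: bal_def)
qed

lemma V_shift_iff: "t \<in> shifts \<Longrightarrow> x + t \<in> V \<longleftrightarrow> x \<in> V"
  using V_shift[of t x] V_shift[of "- t" "x + t"] shifts_neg[of t] by auto

lemma V_shift_image: "t \<in> shifts \<Longrightarrow> S \<subseteq> V \<Longrightarrow> shift t ` S \<subseteq> V"
  using V_shift by auto

lemma bal_shift:
  assumes "t \<in> shifts" "x \<in> V"
  shows "bal (x + t) n = shift t ` bal x n"
proof (intro equalityI subsetI)
  fix y assume y: "y \<in> bal (x + t) n"
  hence "y - t \<in> V" using V_shift_iff[OF assms(1), of "y - t"] by (simp add: bal_def)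
  moreover have "d x (y - t) \<le> n" using d_shift[OF assms, of "y - t"] y calculation by (simp add: bal_def)
  ultimately show "y \<in> shift t ` bal x n" by (intro image_eqI[of _ _ "y - t"]) (auto simp: bal_def)
qed (use assms V_shift d_shift in \<open>auto simp: bal_def\<close>)

lemma coupling_shift:
  assumes "t \<in> shifts" "e \<in> pairs_on V"
  shows "coupling J (shift t ` e) = coupling J e"
proof -
  obtain x y where "e = {x, y}" "x \<in> V" "y \<in> V" using assms(2) by (auto simp: pairs_on_def)
  thus ?thesis using coupling_eq[of x y] coupling_eq[of "x + t" "y + t"] V_shift[OF assms(1)] J_shift[OF assms(1)] by simp
qed

lemma E_shift:
  assumes "t \<in> shifts" "S \<subseteq> V"
  shows "E (shift t ` S) = shift_edges t (E S)"
  using coupling_shift[OF assms(1)] pairs_on_mono[OF assms(2)]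
  by (auto simp: EJ_def pairs_on_shift)

lemma boundary_shift:
  assumes t: "t \<in> shifts" and S: "S \<subseteq> V"
  shows "boundary V J (shift t ` S) = shift t ` boundary V J S"
proof (intro equalityI subsetI)
  fix x assume "x \<in> boundary V J (shift t ` S)"
  then obtain z y where z: "z \<in> S" "x = z + t" "y \<in> V" "y \<notin> shift t ` S" "0 < J x y" by (auto simp: boundary_def)
  have "y - t \<in> V" using V_shift_iff[OF t, of "y - t"] z by simp
  moreover have "y - t \<notin> S" using z(4) by (metis diff_add_cancel imageI)
  moreover have "0 < J z (y - t)" using J_shift[OF t, of z "y - t"] z S calculation(1) by auto
  ultimately have "z \<in> boundary V J S" using z by (auto simp: boundary_def)
  thus "x \<in> shift t ` boundary V J S" using z by blast
next
  fix x assume "x \<in> shift t ` boundary V J S"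
  then obtain z y where z: "z \<in> S" "x = z + t" "y \<in> V" "y \<notin> S" "0 < J z y" by (auto simp: boundary_def)
  have "y + t \<in> V - shift t ` S" using z V_shift[OF t] by auto
  moreover have "0 < J x (y + t)" using J_shift[OF t, of z y] z S by auto
  ultimately show "x \<in> boundary V J (shift t ` S)" using z by (auto simp: boundary_def)
qed

lemma bd_shift:
  assumes "t \<in> shifts" "S \<subseteq> V"
  shows "bd b (shift t ` S) = shift_edges t (bd b S)"
  by (simp add: bc_edges_def boundary_shift[OF assms] pairs_on_shift)

lemma wt_shift:
  assumes t: "t \<in> shifts" and S: "S \<subseteq> V" and "\<eta> \<subseteq> E S"
  shows "wt b (shift t ` S) \<beta> (shift_edges t \<eta>) = wt b S \<beta> \<eta>"
proof -
  have inj: "inj_on ((`) (shift t)) \<eta>" by (rule inj_on_image) (auto intro: inj_onI)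
  have "(\<Prod>e\<in>shift_edges t \<eta>. exp (\<beta> * coupling J e) - 1) = (\<Prod>e\<in>\<eta>. exp (\<beta> * coupling J e) - 1)"
    unfolding prod.reindex[OF inj] comp_def
  proof (rule prod.cong[OF refl])
    fix e assume "e \<in> \<eta>"
    hence "e \<in> pairs_on V" using assms EJ_pairs pairs_on_mono by blast
    thus "exp (\<beta> * coupling J (shift t ` e)) - 1 = exp (\<beta> * coupling J e) - 1"
      using coupling_shift[OF t] by simp
  qed
  moreover have "shift_edges t \<eta> \<union> bd b (shift t ` S) = shift_edges t (\<eta> \<union> bd b S)"
    by (simp add: bd_shift[OF t S] image_Un)
  ultimately show ?thesis by (simp add: fkw_def card_comps_shift)
qed

lemma P_shift:
  assumes t: "t \<in> shifts" and S: "S \<subseteq> V"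
  shows "P b (shift t ` S) \<beta> f = P b S \<beta> (\<lambda>\<eta>. f (shift_edges t \<eta>))"
proof -
  have inj: "inj_on (shift_edges t) (Pow (E S))"
    by (rule inj_onI) (metis shift_shift_edges(1))
  have Pow: "Pow (E (shift t ` S)) = shift_edges t ` Pow (E S)"
    unfolding E_shift[OF t S] by (rule image_Pow_surj[OF refl, symmetric])
  show ?thesis unfolding expect_def Pow sum.reindex[OF inj] comp_def
    using wt_shift[OF t S] by simp
qed

section \<open>Connection to a given distance and its wired probability\<close>

definition reach :: "nat \<Rightarrow> 'v \<Rightarrow> 'v set set \<Rightarrow> bool" where
  "reach n x \<eta> \<longleftrightarrow> (\<exists>y\<in>V. n \<le> d x y \<and> conn \<eta> x y)"

lemma reach_0: "x \<in> V \<Longrightarrow> reach 0 x \<eta>"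
  by (auto simp: reach_def intro!: bexI[of _ x])

lemma reach_mono: "\<eta> \<subseteq> \<eta>' \<Longrightarrow> reach n x \<eta> \<Longrightarrow> reach n x \<eta>'"
  unfolding reach_def using conn_mono[of \<eta> \<eta>' x] by blast

lemma reach_antimono: "m \<le> n \<Longrightarrow> reach n x \<eta> \<Longrightarrow> reach m x \<eta>"
  unfolding reach_def by (meson le_trans)

lemma increasing_reach: "increasing_on F (\<lambda>\<eta>. of_bool (reach n x \<eta>))"
  by (rule mono_onI) (auto dest: reach_mono)

text \<open>The path is stopped at its first vertex at distance at least n. Its last edge starts
  closer than n and has length at most M, so nothing beyond distance n + M is used.\<close>

lemma conn_exit_ball:
  assumes "x \<in> V" "\<eta> \<subseteq> E V" "conn \<eta> x y" "n \<le> d x y" "1 \<le> n" "y \<in> V"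
  shows "\<exists>v\<in>V. n \<le> d x v \<and> d x v \<le> n + M \<and> conn (\<eta> \<inter> E (bal x (n + M))) x v"
proof -
  let ?P = "\<lambda>u. d x u < n"
  let ?\<eta> = "{e \<in> \<eta>. \<exists>u v. e = {u, v} \<and> ?P u}"
  have far: "u \<in> V \<and> v \<in> V \<and> d x v \<le> n + M" if "{u, v} \<in> \<eta>" "?P u" for u v
  proof -
    have uv: "u \<in> V" "v \<in> V" "0 < J u v" using that assms(2) E_iff[of V u v] by auto
    thus ?thesis using J_range[of u v] d_tri[of x u v] assms(1) that by auto
  qed
  have sub: "?\<eta> \<subseteq> \<eta> \<inter> E (bal x (n + M))"
  proof
    fix e assume "e \<in> ?\<eta>"
    then obtain u v where e: "e \<in> \<eta>" "e = {u, v}" "?P u" by auto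
    have uv: "u \<noteq> v" "0 < J u v" using e assms(2) E_iff[of V u v] by auto
    have "u \<in> bal x (n + M)" "v \<in> bal x (n + M)" using far[of u v] e by (auto simp: bal_def)
    thus "e \<in> \<eta> \<inter> E (bal x (n + M))" using e uv E_iff[of "bal x (n + M)" u v] by (auto simp: bal_def)
  qed
  have "?P x" "\<not> ?P y" using assms d_self by auto
  from conn_first_exit[OF assms(3), of ?P, OF this] obtain u v
    where v: "conn ?\<eta> x v" "?P u" "\<not> ?P v" "{u, v} \<in> \<eta>" by auto
  thus ?thesis using far[of u v] conn_mono[OF sub] by (intro bexI[of _ v]) auto
qed

lemma reach_local:
  assumes "x \<in> V" "\<eta> \<subseteq> E V" "bal x (n + M) \<subseteq> S"
  shows "reach n x (\<eta> \<inter> E S) \<longleftrightarrow> reach n x \<eta>"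
proof
  assume r: "reach n x \<eta>"
  show "reach n x (\<eta> \<inter> E S)"
  proof (cases "n = 0")
    case False
    obtain y where "y \<in> V" "n \<le> d x y" "conn \<eta> x y" using r by (auto simp: reach_def)
    then obtain v where v: "v \<in> V" "n \<le> d x v" "conn (\<eta> \<inter> E (bal x (n + M))) x v"
      using conn_exit_ball[of x \<eta> y n] assms False by auto
    have "conn (\<eta> \<inter> E S) x v" by (rule conn_mono[OF _ v(3)]) (use EJ_mono[OF assms(3)] in blast)
    thus ?thesis using v by (auto simp: reach_def)
  qed (use reach_0 assms in auto)
qed (rule reach_mono, auto)

text \<open>The radius is chosen for the exploration: explored vertices y lie within n + M of x, and
  for 2 j \<le> n - M the ball \<open>vol j y\<close> fits into \<open>vol n x\<close> because (n +
  M) + (2 j + 2 M) \<le> 2 n + 2 M.\<close>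

definition vol :: "nat \<Rightarrow> 'v \<Rightarrow> 'v set" where
  "vol n x = bal x (2 * n + 2 * M)"

lemma finvol_vol: "x \<in> V \<Longrightarrow> finvol (vol n x)"
  unfolding vol_def by (rule finvol_bal)

definition theta :: "nat \<Rightarrow> 'v \<Rightarrow> real \<Rightarrow> real" where
  "theta n x \<beta> = P True (vol n x) \<beta> (\<lambda>\<eta>. of_bool (reach n x \<eta>))"

lemma theta_bounds:
  assumes "x \<in> V" "0 < \<beta>"
  shows "0 \<le> theta n x \<beta>" "theta n x \<beta> \<le> 1"
proof -
  have S: "finvol (vol n x)" by (rule finvol_vol[OF assms(1)])
  show "0 \<le> theta n x \<beta>" unfolding theta_def
    by (rule expect_nonneg) (use S finite_EJ wt_pos[OF assms(2)] in auto)
  show "theta n x \<beta> \<le> 1" unfolding theta_def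
    by (rule expect_bounds(2)[of _ _ 0]) (use S finite_EJ wt_pos[OF assms(2)] in auto)
qed

lemma theta_0: "x \<in> V \<Longrightarrow> 0 < \<beta> \<Longrightarrow> theta 0 x \<beta> = 1"
  unfolding theta_def using P_const[OF finvol_vol] by (simp add: reach_0)

lemma theta_mono: "x \<in> V \<Longrightarrow> 0 < \<beta> \<Longrightarrow> \<beta> \<le> \<beta>' \<Longrightarrow> theta n x \<beta> \<le> theta n x \<beta>'"
  unfolding theta_def by (rule P_mono) (auto simp: finvol_vol increasing_reach)

text \<open>Lowering the distance from n to j makes the event depend on edges in
  \<open>vol j x\<close> only; shrinking the volume to this ball then raises the wired
  probability.\<close>

lemma reach_le_theta:
  assumes "finvol S" "0 < \<beta>" "x \<in> V" "vol j x \<subseteq> S" "j \<le> n"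
  shows "P True S \<beta> (\<lambda>\<eta>. of_bool (reach n x \<eta>)) \<le> theta j x \<beta>"
proof -
  have "P True S \<beta> (\<lambda>\<eta>. of_bool (reach n x \<eta>)) \<le> P True S \<beta> (\<lambda>\<eta>. of_bool (reach j x (\<eta> \<inter> E (vol j x))))"
  proof (rule expect_mono)
    fix \<eta> assume e: "\<eta> \<subseteq> E S"
    hence "\<eta> \<subseteq> E V" using assms EJ_mono by blast
    moreover have "bal x (j + M) \<subseteq> vol j x" unfolding vol_def by (rule bal_mono) simp
    ultimately have "reach j x (\<eta> \<inter> E (vol j x)) \<longleftrightarrow> reach j x \<eta>"
      using reach_local assms(3) by blast
    thus "of_bool (reach n x \<eta>) \<le> (of_bool (reach j x (\<eta> \<inter> E (vol j x))) :: real)"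
      using reach_antimono[OF assms(5)] by simp
  qed (use assms finite_EJ wt_pos in auto)
  also have "\<dots> \<le> theta j x \<beta>" unfolding theta_def
    by (rule P_wired_mono_volume[OF finvol_vol[OF assms(3)] assms(1,4,2) increasing_reach])
  finally show ?thesis .
qed

lemma theta_antimono: "x \<in> V \<Longrightarrow> 0 < \<beta> \<Longrightarrow> m \<le> n \<Longrightarrow> theta n x \<beta> \<le> theta m x \<beta>"
  unfolding theta_def[of n] by (rule reach_le_theta[OF finvol_vol]) (auto simp: vol_def intro!: bal_mono)

lemma reach_shift:
  assumes "t \<in> shifts" "x \<in> V"
  shows "reach n (x + t) (shift_edges t \<eta>) \<longleftrightarrow> reach n x \<eta>"
proof
  assume "reach n (x + t) (shift_edges t \<eta>)"
  then obtain y where y: "y \<in> V" "n \<le> d (x + t) y" "conn (shift_edges t \<eta>) (x + t) y" by (auto simp: reach_def)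
  have "y - t \<in> V" using V_shift_iff[OF assms(1), of "y - t"] y by simp
  thus "reach n x \<eta>"
    using y d_shift[OF assms, of "y - t"] conn_shift_iff[of t \<eta> x "y - t"] unfolding reach_def
    by (intro bexI[of _ "y - t"]) auto
next
  assume "reach n x \<eta>"
  thus "reach n (x + t) (shift_edges t \<eta>)"
    using V_shift[OF assms(1)] d_shift[OF assms] conn_shift unfolding reach_def by metis
qed

lemma theta_shift:
  assumes "t \<in> shifts" "x \<in> V"
  shows "theta n (x + t) \<beta> = theta n x \<beta>"
proof -
  have "vol n (x + t) = shift t ` vol n x" unfolding vol_def by (rule bal_shift[OF assms])
  moreover have "vol n x \<subseteq> V" using finvol_vol[OF assms(2)] by simp
  ultimately show ?thesis unfolding theta_def
    using P_shift[OF assms(1)] reach_shift[OF assms] by simp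
qed

text \<open>By translation invariance this sum bounds \<open>theta\<close> at every vertex, so that
  one family of functions controls all explored vertices.\<close>

definition Theta :: "nat \<Rightarrow> real \<Rightarrow> real" where
  "Theta n \<beta> = (\<Sum>r\<in>R. theta n r \<beta>)"

lemma theta_le_Theta:
  assumes "x \<in> V" "0 < \<beta>"
  shows "theta n x \<beta> \<le> Theta n \<beta>"
proof -
  obtain r t where r: "r \<in> R" "t \<in> shifts" "x = r + t" using R(3)[OF assms(1)] by auto
  have "theta n x \<beta> = theta n r \<beta>" using theta_shift[OF r(2), of r] r R by auto
  also have "\<dots> \<le> Theta n \<beta>" unfolding Theta_def
    using r R assms theta_bounds by (intro member_le_sum) auto
  finally show ?thesis .
qed

lemma Theta_nonneg: "0 < \<beta> \<Longrightarrow> 0 \<le> Theta n \<beta>"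
  unfolding Theta_def using R theta_bounds by (intro sum_nonneg) auto

lemma Theta_le: "0 < \<beta> \<Longrightarrow> Theta n \<beta> \<le> real (card R)"
  unfolding Theta_def using R(2) theta_bounds(2) sum_mono[of R "\<lambda>r. theta n r \<beta>" "\<lambda>_. 1"]
  by (simp add: subset_iff)

lemma Theta_mono: "0 < \<beta> \<Longrightarrow> \<beta> \<le> \<beta>' \<Longrightarrow> Theta n \<beta> \<le> Theta n \<beta>'"
  unfolding Theta_def using R theta_mono by (intro sum_mono) auto

lemma Theta_antimono: "0 < \<beta> \<Longrightarrow> m \<le> n \<Longrightarrow> Theta n \<beta> \<le> Theta m \<beta>"
  unfolding Theta_def using R theta_antimono by (intro sum_mono) auto

text \<open>A bound, uniform over the vertices, for the total coupling at a vertex.\<close>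

definition Jtot :: real where
  "Jtot = (\<Sum>r\<in>R. \<Sum>y\<in>bal r M. J r y)"

lemma Jtot_nonneg: "0 \<le> Jtot"
  unfolding Jtot_def using R by (intro sum_nonneg J_nonneg) (auto simp: bal_def)

text \<open>Finite energy: all edges at \<open>x\<close> are closed with at least the complementary probability.\<close>

lemma theta_le_energy:
  assumes x: "x \<in> V" and b: "0 < \<beta>" and n: "1 \<le> n"
  shows "theta n x \<beta> \<le> 1 - exp (- \<beta> * Jtot)"
proof -
  have *: "theta n r \<beta> \<le> 1 - exp (- \<beta> * Jtot)" if r: "r \<in> R" for r
  proof -
    let ?S = "vol n r"
    have rV: "r \<in> V" using r R by auto
    have S: "finvol ?S" by (rule finvol_vol[OF rV])
    let ?st = "{e \<in> E ?S. r \<in> e}"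
    have finE: "finite (E ?S)" using S finite_EJ by metis
    have "(\<Sum>e\<in>?st. coupling J e) \<le> (\<Sum>y\<in>bal r M. J r y)"
    proof -
      have sub: "?st \<subseteq> (\<lambda>y. {r, y}) ` bal r M"
      proof
        fix e assume e: "e \<in> ?st"
        then obtain u v where uv: "e = {u, v}" "u \<in> ?S" "v \<in> ?S" "u \<noteq> v" "0 < J u v"
          using S by (auto elim: E_cases)
        define y where "y = (if u = r then v else u)"
        have "u \<in> V" "v \<in> V" using uv S by blast+
        hence y: "e = {r, y}" "y \<in> V" "0 < J r y" using uv e S J_sym[of u v] unfolding y_def by auto
        thus "e \<in> (\<lambda>y. {r, y}) ` bal r M" using J_range[OF rV y(2,3)] by (auto simp: bal_def)
      qed
      have "(\<Sum>e\<in>?st. coupling J e) \<le> (\<Sum>e\<in>(\<lambda>y. {r, y}) ` bal r M. coupling J e)"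
        using finvol_bal[OF rV] sub coupling_eq[OF rV] J_nonneg[OF rV] by (intro sum_mono2) (auto simp: bal_def)
      also have "\<dots> = (\<Sum>y\<in>bal r M. coupling J {r, y})"
        by (subst sum.reindex) (auto simp: inj_on_def doubleton_eq_iff)
      also have "\<dots> = (\<Sum>y\<in>bal r M. J r y)"
        using coupling_eq[OF rV] by (intro sum.cong) (auto simp: bal_def)
      finally show ?thesis .
    qed
    also have "\<dots> \<le> Jtot" unfolding Jtot_def
      using R r by (intro member_le_sum[of r R "\<lambda>r. \<Sum>y\<in>bal r M. J r y"] sum_nonneg J_nonneg) (auto simp: bal_def)
    finally have "exp (- \<beta> * Jtot) \<le> exp (- \<beta> * (\<Sum>e\<in>?st. coupling J e))" using b by simp
    also have "\<dots> \<le> P True ?S \<beta> (\<lambda>\<eta>. of_bool (\<eta> \<inter> ?st = {}))" by (rule P_closed_ge[OF S b]) auto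
    also have "\<dots> \<le> P True ?S \<beta> (\<lambda>\<eta>. 1 - of_bool (reach n r \<eta>))"
    proof (rule expect_mono)
      fix \<eta> assume e: "\<eta> \<subseteq> E ?S"
      have "\<not> reach n r \<eta>" if st: "\<eta> \<inter> ?st = {}"
      proof
        assume "reach n r \<eta>"
        then obtain y where y: "n \<le> d r y" "conn \<eta> r y" by (auto simp: reach_def)
        have "y = r" using y(2)
        proof (induction rule: conn_induct)
          case (step y z)
          hence "{r, z} \<in> \<eta> \<inter> ?st" using e by auto
          thus ?case using st by blast
        qed simp
        thus False using y n d_self[OF rV] by simp
      qed
      thus "of_bool (\<eta> \<inter> ?st = {}) \<le> (1 - of_bool (reach n r \<eta>) :: real)" by auto
    qed (use finE wt_pos[OF b] in auto)
    also have "\<dots> = 1 - theta n r \<beta>" unfolding theta_def expect_diff using P_const[OF S b] by simp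
    finally show ?thesis by simp
  qed
  obtain r t where r: "r \<in> R" "t \<in> shifts" "x = r + t" using R(3)[OF x] by auto
  thus ?thesis using *[OF r(1)] theta_shift[OF r(2), of r] R by auto
qed

text \<open>The factor 2 counts the two endpoints of an edge; the other factor comes from
  \<open>sum_distance_le\<close>.\<close>

abbreviation "osss_const \<equiv> 2 * real (3 * M + 4)"

text \<open>OSSS is applied to the exploration of the clusters of the sphere of radius \<open>k\<close> around \<open>x\<close>,
  and averaged over \<open>k\<close>.\<close>

lemma sum_cov_ge:
  assumes x: "x \<in> V" and b: "0 < \<beta>" and n: "1 \<le> n"
  defines "S \<equiv> vol n x" and "f \<equiv> \<lambda>\<eta>. of_bool (reach n x \<eta>) :: real"
  shows "real n * (theta n x \<beta> * (1 - theta n x \<beta>)) \<le> osss_const * (\<Sum>j<n. Theta j \<beta>) *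
    (\<Sum>e\<in>E S. cov (E S) (wt True S \<beta>) f (\<lambda>\<eta>. of_bool (e \<in> \<eta>)))"
proof -
  have S: "finvol S" unfolding S_def by (rule finvol_vol[OF x])
  have SE: "E S \<subseteq> E V" using S EJ_mono by blast
  interpret w: fkg_weight "E S" "wt True S \<beta>" by (rule fkg_wt[OF S b])
  \<comment> \<open>By \<open>reach_local\<close> the event is decided by the edges inside this
    ball, so only those are explored.\<close>
  define U where "U = bal x (n + M)"
  have U: "finvol U" "U \<subseteq> S" unfolding U_def S_def vol_def using finvol_bal[OF x] bal_mono by auto
  \<comment> \<open>Seeds are taken in a shell of width M instead of a sphere: an edge has length at
    most M and cannot jump over the shell.\<close>
  define K where "K k = {s \<in> V. k \<le> d x s \<and> d x s \<le> k + M}" for k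
  define T where "T = {y \<in> V. n \<le> d x y}"
  let ?G = "\<lambda>j. Theta j \<beta>"
  let ?c = "\<lambda>e. w.edge_cov f e"
  have fi: "increasing_on (E S) f" unfolding f_def by (rule increasing_reach)
  have cov0: "0 \<le> ?c e" for e by (rule w.edge_cov_nonneg[OF fi])
  have covff: "cov (E S) (wt True S \<beta>) f f = theta n x \<beta> * (1 - theta n x \<beta>)"
  proof -
    have "(\<lambda>\<eta>. f \<eta> * f \<eta>) = f" by (auto simp: f_def)
    thus ?thesis unfolding cov_def theta_def S_def[symmetric] f_def[symmetric] by (simp add: algebra_simps)
  qed
  \<comment> \<open>A vertex y joined to the shell of radius k is joined to distance at least |k - d
    x y| - M from itself. The distance is truncated at (n - M) div 2 so that the corresponding
    volume around y stays inside S.\<close>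
  have vertex: "P True S \<beta> (\<lambda>\<omega>. of_bool (\<exists>s\<in>K k. conn \<omega> s y))
      \<le> ?G (min ((k - d x y) + (d x y - k) - M) ((n - M) div 2))" if y: "y \<in> U" and k: "k \<le> n" for y k
  proof -
    have yV: "y \<in> V" using y U by auto
    let ?r = "(k - d x y) + (d x y - k) - M"
    let ?j = "min ?r ((n - M) div 2)"
    have "P True S \<beta> (\<lambda>\<omega>. of_bool (\<exists>s\<in>K k. conn \<omega> s y)) \<le> P True S \<beta> (\<lambda>\<omega>. of_bool (reach ?r y \<omega>))"
    proof (rule expect_mono)
      fix \<omega>
      have "reach ?r y \<omega>" if "s \<in> K k" "conn \<omega> s y" for s
      proof -
        have s: "s \<in> V" "k \<le> d x s" "d x s \<le> k + M" using that by (auto simp: K_def)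
        have "d x s \<le> d x y + d y s" "d x y \<le> d x s + d y s"
          using d_tri[OF x yV s(1)] d_tri[OF x s(1) yV] d_sym[OF yV s(1)] by auto
        hence "?r \<le> d y s" using s by linarith
        thus ?thesis using s(1) conn_sym[OF that(2)] unfolding reach_def by blast
      qed
      thus "of_bool (\<exists>s\<in>K k. conn \<omega> s y) \<le> (of_bool (reach ?r y \<omega>) :: real)" by auto
    qed (use w.fin w.pos in auto)
    also have "\<dots> \<le> theta ?j y \<beta>"
    proof (cases "?j = 0")
      case True
      hence "theta ?j y \<beta> = 1" using theta_0[OF yV b] by simp
      moreover have "P True S \<beta> (\<lambda>\<omega>. of_bool (reach ?r y \<omega>)) \<le> P True S \<beta> (\<lambda>_. 1)"
        by (rule expect_mono) (use w.fin w.pos in auto)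
      ultimately show ?thesis using P_const[OF S b] by simp
    next
      case False
      hence "M \<le> n" by linarith
      moreover have "2 * ?j \<le> n - M" by linarith
      ultimately have "vol ?j y \<subseteq> S" unfolding vol_def S_def
        by (intro bal_subset[OF x y[unfolded U_def]]) linarith
      thus ?thesis by (intro reach_le_theta[OF S b yV]) auto
    qed
    also have "\<dots> \<le> ?G ?j" by (rule theta_le_Theta[OF yV b])
    finally show ?thesis .
  qed
  have tree: "theta n x \<beta> * (1 - theta n x \<beta>) \<le> (\<Sum>e\<in>E S. P True S \<beta>
      (\<lambda>\<omega>. of_bool (e \<in> E U \<and> (\<exists>z\<in>e. \<exists>s\<in>K k. conn \<omega> s z))) * ?c e)" if k: "k \<in> {1..n}" for k
  proof -
    interpret se: seed_exploration "E U" "K k" T x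
    proof
      show "finite (E U)" using U finite_EJ by metis
      fix \<eta> y assume e: "\<eta> \<subseteq> E U" "y \<in> T" "conn \<eta> x y"
      have "\<eta> \<subseteq> E V" using e U EJ_mono by blast
      then obtain v where "v \<in> V" "k \<le> d x v" "d x v \<le> k + M" "conn (\<eta> \<inter> E (bal x (k + M))) x v"
        using conn_exit_ball[OF x, of \<eta> y k] e k by (auto simp: T_def)
      moreover have "conn (\<eta> \<inter> E (bal x (k + M))) x v \<Longrightarrow> conn \<eta> x v" by (rule conn_mono[rotated]) auto
      ultimately show "\<exists>s\<in>K k. conn \<eta> x s" by (auto simp: K_def)
    qed
    have "cov (E S) (wt True S \<beta>) f f \<le> (\<Sum>e\<in>E S. P True S \<beta> (\<lambda>\<omega>. of_bool (e \<in> tree_queries se.seed_tree \<omega>)) * ?c e)"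
    proof (rule w.OSSS[OF fi se.valid_seed_tree])
      show "E U \<subseteq> E S" using U EJ_mono by blast
      fix \<omega> assume "\<omega> \<subseteq> E S"
      hence "\<omega> \<subseteq> E V" using SE by auto
      hence "reach n x (\<omega> \<inter> E U) \<longleftrightarrow> reach n x \<omega>" by (intro reach_local[OF x]) (auto simp: U_def)
      moreover have "(\<exists>y\<in>T. conn (\<omega> \<inter> E U) x y) \<longleftrightarrow> reach n x (\<omega> \<inter> E U)" by (auto simp: reach_def T_def)
      ultimately show "tree_value se.seed_tree \<omega> = f \<omega>" unfolding se.value_seed_tree f_def by simp
    qed
    also have "\<dots> \<le> (\<Sum>e\<in>E S. P True S \<beta>
      (\<lambda>\<omega>. of_bool (e \<in> E U \<and> (\<exists>z\<in>e. \<exists>s\<in>K k. conn \<omega> s z))) * ?c e)"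
      using cov0 w.fin w.pos se.queries_seed_tree
      by (intro sum_mono mult_right_mono expect_mono) auto
    finally show ?thesis unfolding covff .
  qed
  have edge: "(\<Sum>k\<in>{1..n}. P True S \<beta> (\<lambda>\<omega>. of_bool (e \<in> E U \<and> (\<exists>z\<in>e. \<exists>s\<in>K k. conn \<omega> s z))))
      \<le> osss_const * (\<Sum>j<n. ?G j)" for e
  proof (cases "e \<in> E U")
    case False
    moreover have "P True S \<beta> (\<lambda>_. 0) = 0" using P_const[OF S b] .
    ultimately show ?thesis using Theta_nonneg[OF b] by (simp add: sum_nonneg)
  next
    case True
    then obtain y z where e: "e = {y, z}" "y \<in> U" "z \<in> U" using U by (auto elim: E_cases)
    have G: "antimono ?G" "\<And>j. 0 \<le> ?G j" using Theta_antimono[OF b] Theta_nonneg[OF b] by (auto intro: antimonoI)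
    have "(\<Sum>k\<in>{1..n}. P True S \<beta> (\<lambda>\<omega>. of_bool (e \<in> E U \<and> (\<exists>z\<in>e. \<exists>s\<in>K k. conn \<omega> s z))))
      \<le> (\<Sum>k\<in>{1..n}. P True S \<beta> (\<lambda>\<omega>. of_bool (\<exists>s\<in>K k. conn \<omega> s y)) + P True S \<beta> (\<lambda>\<omega>. of_bool (\<exists>s\<in>K k. conn \<omega> s z)))"
      unfolding expect_add[symmetric]
      by (intro sum_mono expect_mono) (use w.fin w.pos e in auto)
    also have "\<dots> \<le> (\<Sum>k\<in>{1..n}. ?G (min ((k - d x y) + (d x y - k) - M) ((n - M) div 2))
        + ?G (min ((k - d x z) + (d x z - k) - M) ((n - M) div 2)))"
      using e vertex by (intro sum_mono add_mono) auto
    also have "\<dots> \<le> osss_const * (\<Sum>j<n. ?G j)"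
      using sum_distance_le[OF G n, of "d x y" M] sum_distance_le[OF G n, of "d x z" M]
      by (simp add: sum.distrib algebra_simps)
    finally show ?thesis .
  qed
  have "real n * (theta n x \<beta> * (1 - theta n x \<beta>)) = (\<Sum>k\<in>{1..n}. theta n x \<beta> * (1 - theta n x \<beta>))" by simp
  also have "\<dots> \<le> (\<Sum>k\<in>{1..n}. \<Sum>e\<in>E S. P True S \<beta>
      (\<lambda>\<omega>. of_bool (e \<in> E U \<and> (\<exists>z\<in>e. \<exists>s\<in>K k. conn \<omega> s z))) * ?c e)"
    by (rule sum_mono) (rule tree)
  also have "\<dots> = (\<Sum>e\<in>E S. (\<Sum>k\<in>{1..n}. P True S \<beta>
      (\<lambda>\<omega>. of_bool (e \<in> E U \<and> (\<exists>z\<in>e. \<exists>s\<in>K k. conn \<omega> s z)))) * ?c e)"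
    by (subst sum.swap) (simp only: sum_distrib_right)
  also have "\<dots> \<le> (\<Sum>e\<in>E S. osss_const * (\<Sum>j<n. ?G j) * ?c e)"
    by (intro sum_mono mult_right_mono edge cov0)
  also have "\<dots> = osss_const * (\<Sum>j<n. ?G j) * (\<Sum>e\<in>E S. ?c e)"
    by (simp only: sum_distrib_left)
  finally show ?thesis .
qed

text \<open>\<open>edge_rate_ge\<close> turns the sum of covariances into at most \<beta> times the
  derivative, and finite energy bounds 1 - theta below by exp (- \<beta> Jtot). The estimate
  \<open>sum_cov_ge\<close> has the same sum of \<open>Theta j\<close> for every centre, so it can
  be added up over the representatives.\<close>

theorem Theta_deriv:
  assumes b: "0 < \<beta>" and n: "1 \<le> n"
  shows "\<exists>D. (Theta n has_real_derivative D) (at \<beta>) \<and>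
    real n * exp (- \<beta> * Jtot) * Theta n \<beta> \<le> \<beta> * osss_const * (\<Sum>j<n. Theta j \<beta>) * D"
proof -
  let ?G = "\<Sum>j<n. Theta j \<beta>"
  define D where "D x = (\<Sum>e\<in>E (vol n x). edge_rate \<beta> e * cov (E (vol n x)) (wt True (vol n x) \<beta>)
    (\<lambda>\<eta>. of_bool (reach n x \<eta>)) (\<lambda>\<eta>. of_bool (e \<in> \<eta>)))" for x
  have G0: "0 \<le> osss_const * ?G" using Theta_nonneg[OF b] by (intro mult_nonneg_nonneg sum_nonneg) auto
  have deriv: "(theta n x has_real_derivative D x) (at \<beta>)" if "x \<in> V" for x
    unfolding theta_def[abs_def] D_def by (rule P_deriv[OF finvol_vol[OF that] b])
  have ineq: "real n * exp (- \<beta> * Jtot) * theta n x \<beta> \<le> \<beta> * osss_const * ?G * D x" if x: "x \<in> V" for x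
  proof -
    let ?S = "vol n x"
    have S: "finvol ?S" by (rule finvol_vol[OF x])
    interpret w: fkg_weight "E ?S" "wt True ?S \<beta>" by (rule fkg_wt[OF S b])
    let ?c = "\<lambda>e. w.edge_cov (\<lambda>\<eta>. of_bool (reach n x \<eta>)) e"
    have "(\<Sum>e\<in>E ?S. ?c e) = \<beta> * (\<Sum>e\<in>E ?S. 1 / \<beta> * ?c e)" using b by (simp add: sum_distrib_left)
    also have "\<dots> \<le> \<beta> * D x" unfolding D_def
      using b edge_rate_ge[OF b] w.edge_cov_nonneg[OF increasing_reach]
      by (intro mult_left_mono sum_mono mult_right_mono) auto
    finally have c: "(\<Sum>e\<in>E ?S. ?c e) \<le> \<beta> * D x" .
    have "exp (- \<beta> * Jtot) * theta n x \<beta> \<le> (1 - theta n x \<beta>) * theta n x \<beta>"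
      using theta_le_energy[OF x b n] theta_bounds[OF x b] by (intro mult_right_mono) auto
    hence "real n * (exp (- \<beta> * Jtot) * theta n x \<beta>) \<le> real n * (theta n x \<beta> * (1 - theta n x \<beta>))"
      by (intro mult_left_mono) (auto simp: mult.commute)
    also have "\<dots> \<le> osss_const * ?G * (\<Sum>e\<in>E ?S. ?c e)" by (rule sum_cov_ge[OF x b n])
    also have "\<dots> \<le> osss_const * ?G * (\<beta> * D x)" using c G0 by (rule mult_left_mono)
    finally show ?thesis by (simp add: mult_ac)
  qed
  have "(Theta n has_real_derivative (\<Sum>r\<in>R. D r)) (at \<beta>)"
    unfolding Theta_def[abs_def] using R deriv by (intro DERIV_sum) auto
  moreover have "real n * exp (- \<beta> * Jtot) * Theta n \<beta> \<le> \<beta> * osss_const * ?G * (\<Sum>r\<in>R. D r)"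
  proof -
    have "real n * exp (- \<beta> * Jtot) * Theta n \<beta> = (\<Sum>r\<in>R. real n * exp (- \<beta> * Jtot) * theta n r \<beta>)"
      unfolding Theta_def by (rule sum_distrib_left)
    also have "\<dots> \<le> (\<Sum>r\<in>R. \<beta> * osss_const * ?G * D r)"
      by (intro sum_mono ineq) (use R(2) in blast)
    also have "\<dots> = \<beta> * osss_const * ?G * (\<Sum>r\<in>R. D r)" by (rule sum_distrib_left[symmetric])
    finally show ?thesis .
  qed
  ultimately show ?thesis by (intro exI[of _ "\<Sum>r\<in>R. D r"] conjI)
qed

end

section \<open>Analysis of the differential inequality\<close>

text \<open>A Gronwall argument: g x exp (- k x) is nondecreasing.\<close>

lemma exp_growth:
  fixes g :: "real \<Rightarrow> real"
  assumes "u \<le> v" and der: "\<And>x. u \<le> x \<Longrightarrow> x \<le> v \<Longrightarrow> (g has_real_derivative g' x) (at x) \<and> k * g x \<le> g' x"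
  shows "g u \<le> g v * exp (- k * (v - u))"
proof -
  have "g u * exp (- k * u) \<le> g v * exp (- k * v)"
  proof (rule DERIV_nonneg_imp_nondecreasing[OF assms(1)])
    fix x assume x: "u \<le> x" "x \<le> v"
    have "((\<lambda>x. g x * exp (- k * x)) has_real_derivative (g' x - k * g x) * exp (- k * x)) (at x)"
      using der[OF x] by (auto intro!: derivative_eq_intros simp: algebra_simps)
    moreover have "0 \<le> (g' x - k * g x) * exp (- k * x)" using der[OF x] by simp
    ultimately show "\<exists>y. ((\<lambda>x. g x * exp (- k * x)) has_real_derivative y) (at x) \<and> 0 \<le> y" by blast
  qed
  hence "g u * exp (- k * u) * exp (k * u) \<le> g v * exp (- k * v) * exp (k * u)" by (rule mult_right_mono) simp
  thus ?thesis by (simp add: mult.assoc mult_exp_exp algebra_simps)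
qed

lemma summable_exp_sqrt:
  assumes "0 < k"
  shows "summable (\<lambda>n. exp (- k * sqrt (real n)))"
proof (rule summable_comparison_test_ev)
  have "eventually (\<lambda>n. exp (- k * sqrt (real n)) \<le> 1 / real n ^ 2) sequentially"
    using assms by real_asymp
  thus "eventually (\<lambda>n. norm (exp (- k * sqrt (real n))) \<le> 1 / real n ^ 2) sequentially" by simp
  show "summable (\<lambda>n. 1 / real n ^ 2)"
    using inverse_power_summable[of 2, where 'a = real] by (simp add: inverse_eq_divide power_one_over)
qed

lemma harm_le_ln: "1 \<le> n \<Longrightarrow> harm n \<le> ln (real n) + 1"
proof (induction n rule: dec_induct)
  case (step n)
  have "ln (1 + - (1 / real (Suc n))) \<le> - (1 / real (Suc n))"
    using step by (intro ln_add_one_self_le_self2) (simp add: field_simps)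
  moreover have "1 + - (1 / real (Suc n)) = real n / real (Suc n)" by (simp add: field_simps)
  moreover have "ln (real n / real (Suc n)) = ln (real n) - ln (real (Suc n))"
    by (rule ln_divide_pos) (use step in auto)
  ultimately show ?case using step.IH by (simp add: harm_Suc inverse_eq_divide)
qed (simp add: harm_def)

text \<open>Let S n be the sum of f j over j < n, at an intermediate parameter s. If S n is
  eventually at most sqrt n, the inequality gives f n' \<ge> c sqrt n f n and hence stretched
  exponential decay at s' < s; then S n is bounded at s', and the inequality used once more gives
  exponential decay at b. Otherwise S n exceeds sqrt n for arbitrarily large n, and a logarithmic
  average of the f i is forced at a to be of order ln n along these n, which is incompatible with f
  n a becoming small.\<close>

theorem sharpness_dichotomy:
  fixes f :: "nat \<Rightarrow> real \<Rightarrow> real" and a b c K :: real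
  assumes ab: "0 < b" "b < a" and c: "0 < c"
    and f0: "\<And>n x. 0 < x \<Longrightarrow> 0 \<le> f n x" and fK: "\<And>n x. 0 < x \<Longrightarrow> f n x \<le> K" and f1: "\<And>x. 0 < x \<Longrightarrow> 1 \<le> f 0 x"
    and anti: "\<And>m n x. 0 < x \<Longrightarrow> m \<le> n \<Longrightarrow> f n x \<le> f m x"
    and mono: "\<And>n x y. 0 < x \<Longrightarrow> x \<le> y \<Longrightarrow> f n x \<le> f n y"
    and deriv: "\<And>n x. 1 \<le> n \<Longrightarrow> b \<le> x \<Longrightarrow> x \<le> a \<Longrightarrow>
      \<exists>D. (f n has_real_derivative D) (at x) \<and> c * real n * f n x \<le> (\<Sum>j<n. f j x) * D"
  shows "(\<exists>k>0. \<forall>n. f n b \<le> K * exp (- k * real n)) \<or> (\<exists>\<epsilon>>0. \<forall>n. \<epsilon> \<le> f n a)"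
proof -
  define S where "S n x = (\<Sum>j<n. f j x)" for n x
  define s where "s = (a + b) / 2"
  define s' where "s' = (b + s) / 2"
  have s: "b < s'" "s' < s" "s < a" "0 < s" "0 < s'" unfolding s_def s'_def using ab by (simp_all add: field_simps add_pos_pos)
  obtain D where D: "\<And>n x. 1 \<le> n \<Longrightarrow> b \<le> x \<Longrightarrow> x \<le> a \<Longrightarrow>
      (f n has_real_derivative D n x) (at x) \<and> c * real n * f n x \<le> S n x * D n x"
    using deriv unfolding S_def by metis
  have S1: "1 \<le> S n x" if "1 \<le> n" "0 < x" for n x
    unfolding S_def using member_le_sum[of 0 "{..<n}" "\<lambda>j. f j x"] f0 f1[of x] that by fastforce
  have Smono: "S n x \<le> S n y" if "0 < x" "x \<le> y" for n x y
    unfolding S_def using mono that by (intro sum_mono) auto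
  have D0: "0 \<le> D n x" if "1 \<le> n" "b \<le> x" "x \<le> a" for n x
  proof -
    have "0 \<le> S n x * D n x" using D[OF that] c f0[of x n] ab that
      by (smt (verit) mult_nonneg_nonneg of_nat_0_le_iff)
    thus ?thesis using S1[of n x] that ab by (simp add: zero_le_mult_iff)
  qed
  have Dge: "c * real n / B * f n x \<le> D n x" if "1 \<le> n" "b \<le> x" "x \<le> a" "S n x \<le> B" for n x B
  proof -
    have B: "0 < B" using S1[of n x] that ab by linarith
    have "c * real n * f n x \<le> S n x * D n x" using D that by blast
    also have "\<dots> \<le> B * D n x" using D0 that by (intro mult_right_mono) auto
    finally show ?thesis using B by (simp add: pos_divide_le_eq mult.commute)
  qed
  have K0: "0 \<le> K" using f0[of b 0] fK[of b 0] ab by linarith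
  have decay: "f n u \<le> K * exp (- (c * real n / B * (v - u)))"
    if "1 \<le> n" "b \<le> u" "u \<le> v" "v \<le> a" "S n v \<le> B" for n u v B
  proof -
    have "f n u \<le> f n v * exp (- (c * real n / B) * (v - u))"
    proof (rule exp_growth[OF that(3)])
      fix x assume x: "u \<le> x" "x \<le> v"
      have "S n x \<le> B" using Smono[of x v n] x that ab by linarith
      thus "(f n has_real_derivative D n x) (at x) \<and> c * real n / B * f n x \<le> D n x"
        using D[of n x] Dge[of n x B] x that by simp
    qed
    also have "\<dots> \<le> K * exp (- (c * real n / B) * (v - u))"
      using fK[of v n] that ab by (intro mult_right_mono) auto
    finally show ?thesis by simp
  qed
  show ?thesis
  proof (cases "\<exists>N. \<forall>n\<ge>N. S n s \<le> sqrt (real n)")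
    case True
    then obtain N where N: "\<And>n. n \<ge> N \<Longrightarrow> S n s \<le> sqrt (real n)" by auto
    \<comment> \<open>With S n at most sqrt n the rate c n / S n is at least c sqrt n.\<close>
    have stretch: "f n s' \<le> K * exp (- (c * (s - s')) * sqrt (real n))" if "n \<ge> Suc N" for n
    proof -
      have "f n s' \<le> K * exp (- (c * real n / sqrt (real n) * (s - s')))"
        using that s ab N[of n] by (intro decay) auto
      moreover have "c * real n / sqrt (real n) * (s - s') = c * (s - s') * (real n / sqrt (real n))" by simp
      moreover have "real n / sqrt (real n) = sqrt (real n)" by (rule real_div_sqrt) simp
      ultimately show ?thesis by simp
    qed
    have "summable (\<lambda>n. f n s')"
    proof (rule summable_comparison_test_ev)
      show "eventually (\<lambda>n. norm (f n s') \<le> K * exp (- (c * (s - s')) * sqrt (real n))) sequentially"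
        using stretch f0[of s'] s by (auto simp: eventually_sequentially intro!: exI[of _ "Suc N"])
      show "summable (\<lambda>n. K * exp (- (c * (s - s')) * sqrt (real n)))"
        using c s by (intro summable_mult summable_exp_sqrt) auto
    qed
    hence B: "S n s' \<le> suminf (\<lambda>n. f n s')" for n
      unfolding S_def using f0[of s'] s by (intro sum_le_suminf) auto
    let ?B = "suminf (\<lambda>n. f n s')"
    have B1: "0 < ?B" using B[of 1] S1[of 1 s'] s by simp
    have "f n b \<le> K * exp (- (c / ?B * (s' - b)) * real n)" for n
    proof (cases "n = 0")
      case False
      have "f n b \<le> K * exp (- (c * real n / ?B * (s' - b)))"
        using False s B by (intro decay) auto
      thus ?thesis by (simp add: mult_ac)
    qed (use fK[of b 0] ab in simp)
    moreover have "0 < c / ?B * (s' - b)" using c B1 s by simp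
    ultimately show ?thesis by blast
  next
    case False
    hence inf: "\<exists>n\<ge>N. sqrt (real n) < S n s" for N by (meson not_le)
    \<comment> \<open>The weights 1 / i match the factor n in the inequality: the derivative of f i
      / i is at least c f i / S i, whose sum is comparable to ln (S n).\<close>
    define T where "T n x = (\<Sum>i=1..n. f i x / real i)" for n x
    have Tlow: "(a - s) * (c * (ln (S n s) - ln K)) \<le> T n a" if n: "1 \<le> n" for n
    proof -
      have K1: "1 \<le> K" using f1[of b] fK[of b 0] ab by linarith
      have "\<exists>z>s. z < a \<and> T n a - T n s = (a - s) * (\<Sum>i=1..n. D i z / real i)"
      proof (rule MVT2[OF s(3)])
        fix x assume x: "s \<le> x" "x \<le> a"
        show "(T n has_real_derivative (\<Sum>i=1..n. D i x / real i)) (at x)"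
          unfolding T_def[abs_def] using D x s by (intro DERIV_sum DERIV_cdivide) auto
      qed
      then obtain z where z: "s < z" "z < a" "T n a - T n s = (a - s) * (\<Sum>i=1..n. D i z / real i)" by blast
      have z0: "0 < z" using z s by linarith
      \<comment> \<open>Telescoping, with S (i + 1) = S i + f i and ln (1 + x) \<le> x.\<close>
      have "c * (ln (S (Suc m) z) - ln (S 1 z)) \<le> (\<Sum>i=1..m. D i z / real i)" for m
      proof (induction m)
        case (Suc m)
        let ?i = "Suc m"
        have Sp: "1 \<le> S ?i z" "1 \<le> S (Suc ?i) z" using S1 z0 by auto
        have "S (Suc ?i) z / S ?i z = 1 + f ?i z / S ?i z" using Sp by (simp add: S_def field_simps)
        hence "ln (S (Suc ?i) z) - ln (S ?i z) = ln (1 + f ?i z / S ?i z)"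
          using Sp ln_divide_pos[of "S (Suc ?i) z" "S ?i z"] by simp
        also have "\<dots> \<le> f ?i z / S ?i z" using f0[OF z0] Sp by (intro ln_add_one_self_le_self) simp
        finally have "c * (ln (S (Suc ?i) z) - ln (S ?i z)) \<le> c * (f ?i z / S ?i z)"
          using c by (intro mult_left_mono) auto
        also have "\<dots> \<le> D ?i z / real ?i"
          using D[of ?i z] z s Sp by (simp add: field_simps)
        finally show ?case using Suc.IH by (simp add: algebra_simps)
      qed (simp add: S_def)
      moreover have "c * (ln (S n s) - ln K) \<le> c * (ln (S (Suc n) z) - ln (S 1 z))"
      proof (intro mult_left_mono diff_mono)
        have "S n s \<le> S n z" using Smono s z by simp
        also have "\<dots> \<le> S (Suc n) z" using f0[OF z0] by (simp add: S_def)
        finally show "ln (S n s) \<le> ln (S (Suc n) z)" using S1[OF n s(4)] by simp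
        show "ln (S 1 z) \<le> ln K" using fK[OF z0, of 0] f1[OF z0] K1 by (simp add: S_def)
      qed (use c in simp)
      ultimately have "c * (ln (S n s) - ln K) \<le> (\<Sum>i=1..n. D i z / real i)" by (meson order_trans)
      hence "(a - s) * (c * (ln (S n s) - ln K)) \<le> T n a - T n s"
        unfolding z(3) using s by (intro mult_left_mono) auto
      moreover have "0 \<le> T n s" unfolding T_def using f0[OF s(4)] by (intro sum_nonneg) auto
      ultimately show ?thesis by linarith
    qed
    show ?thesis
    proof (rule ccontr)
      assume no: "\<not> ?thesis"
      \<comment> \<open>Along the chosen n the lower bound for T n a grows like (a - s) c / 2 times
        ln n, that is, 2 \<epsilon> ln n. If some f N a is below \<epsilon>, the upper bound grows
        only like \<epsilon> ln n.\<close>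
      define \<epsilon> where "\<epsilon> = (a - s) * c / 4"
      have e: "0 < \<epsilon>" using c s by (simp add: \<epsilon>_def)
      obtain N where N: "f N a < \<epsilon>" using no e by (meson not_le)
      have Tup: "T n a \<le> K * real N + \<epsilon> * (ln (real n) + 1)" if "1 \<le> n" for n
      proof -
        have "T n a \<le> (\<Sum>i=1..n. (if i \<le> N then K else 0) + \<epsilon> * (1 / real i))"
          unfolding T_def
        proof (rule sum_mono)
          fix i assume i: "i \<in> {1..n}"
          show "f i a / real i \<le> (if i \<le> N then K else 0) + \<epsilon> * (1 / real i)"
          proof (cases "i \<le> N")
            case True
            have "f i a / real i \<le> f i a" using f0[of a i] i ab by (simp add: divide_le_eq mult_le_cancel_left1)
            also have "\<dots> \<le> K" using fK ab by simp
            also have "\<dots> \<le> K + \<epsilon> * (1 / real i)" using e by simp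
            finally show ?thesis using True by simp
          next
            case False
            hence "f i a \<le> \<epsilon>" using anti[of a N i] N ab by simp
            hence "f i a / real i \<le> \<epsilon> / real i" by (intro divide_right_mono) auto
            thus ?thesis using False by simp
          qed
        qed
        also have "\<dots> = (\<Sum>i\<in>{1..n} \<inter> {..N}. K) + \<epsilon> * harm n"
        proof -
          have "(\<Sum>i\<in>{1..n} \<inter> {..N}. K) = (\<Sum>i=1..n. if i \<le> N then K else 0)"
            by (subst sum.inter_restrict) (auto intro!: sum.cong)
          thus ?thesis by (simp add: sum.distrib sum_distrib_left harm_def inverse_eq_divide)
        qed
        also have "\<dots> \<le> K * real N + \<epsilon> * (ln (real n) + 1)"
        proof (intro add_mono mult_left_mono)
          have "card ({1..n} \<inter> {..N}) \<le> N" using card_mono[of "{1..N}" "{1..n} \<inter> {..N}"] by auto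
          thus "(\<Sum>i\<in>{1..n} \<inter> {..N}. K) \<le> K * real N" using K0 by (simp add: mult.commute mult_left_mono)
          show "harm n \<le> ln (real n) + 1" using harm_le_ln[OF that] .
        qed (use e in simp)
        finally show ?thesis .
      qed
      have "filterlim (\<lambda>n. \<epsilon> * ln (real n)) at_top sequentially" using e by real_asymp
      hence "eventually (\<lambda>n. K * real N + \<epsilon> + 4 * \<epsilon> * ln K < \<epsilon> * ln (real n)) sequentially"
        by (simp add: filterlim_at_top_dense)
      then obtain N' where N': "\<And>n. n \<ge> N' \<Longrightarrow> K * real N + \<epsilon> + 4 * \<epsilon> * ln K < \<epsilon> * ln (real n)"
        by (auto simp: eventually_sequentially)
      obtain n where n: "n \<ge> max 1 N'" "sqrt (real n) < S n s" using inf by blast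
      have n1: "1 \<le> n" using n by simp
      have "ln (sqrt (real n)) \<le> ln (S n s)" using n n1 by (intro ln_mono) auto
      hence "ln (real n) / 2 \<le> ln (S n s)" using n1 by (simp add: ln_sqrt)
      hence "4 * \<epsilon> * (ln (real n) / 2 - ln K) \<le> 4 * \<epsilon> * (ln (S n s) - ln K)"
        using e by (intro mult_left_mono) auto
      also have "\<dots> = (a - s) * (c * (ln (S n s) - ln K))" by (simp add: \<epsilon>_def)
      also have "\<dots> \<le> K * real N + \<epsilon> * (ln (real n) + 1)" using Tlow[OF n1] Tup[OF n1] by linarith
      finally show False using N'[of n] n by (simp add: algebra_simps)
    qed
  qed
qed

section \<open>Infinite-volume measures\<close>

lemma tendsto_monotone_volumes:
  fixes F :: "'v set \<Rightarrow> real"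
  assumes S0: "finite S0" "S0 \<subseteq> V"
    and mono: "\<And>S S'. S0 \<subseteq> S \<Longrightarrow> S \<subseteq> S' \<Longrightarrow> finite S' \<Longrightarrow> S' \<subseteq> V \<Longrightarrow> F S \<le> F S'"
    and bound: "\<And>S. finite S \<Longrightarrow> S0 \<subseteq> S \<Longrightarrow> S \<subseteq> V \<Longrightarrow> F S \<le> C"
  shows "\<exists>l. (F \<longlongrightarrow> l) (finite_subsets_at_top V)"
proof -
  define \<S> where "\<S> = {S. finite S \<and> S0 \<subseteq> S \<and> S \<subseteq> V}"
  have ne: "F ` \<S> \<noteq> {}" using S0 by (auto simp: \<S>_def)
  have bdd: "bdd_above (F ` \<S>)" using bound by (auto simp: \<S>_def intro!: bdd_aboveI[of _ C])
  have "(F \<longlongrightarrow> Sup (F ` \<S>)) (finite_subsets_at_top V)"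
  proof (rule order_tendstoI)
    fix a assume "a < Sup (F ` \<S>)"
    then obtain S where S: "S \<in> \<S>" "a < F S" using less_cSup_iff[OF ne bdd] by auto
    show "eventually (\<lambda>S. a < F S) (finite_subsets_at_top V)"
      unfolding eventually_finite_subsets_at_top
    proof (intro exI[of _ S] conjI allI impI)
      fix S' assume "finite S' \<and> S \<subseteq> S' \<and> S' \<subseteq> V"
      hence "F S \<le> F S'" using S by (intro mono) (auto simp: \<S>_def)
      thus "a < F S'" using S by simp
    qed (use S in \<open>auto simp: \<S>_def\<close>)
  next
    fix a assume a: "Sup (F ` \<S>) < a"
    show "eventually (\<lambda>S. F S < a) (finite_subsets_at_top V)"
      unfolding eventually_finite_subsets_at_top
    proof (intro exI[of _ S0] conjI allI impI)
      fix S assume "finite S \<and> S0 \<subseteq> S \<and> S \<subseteq> V"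
      hence "F S \<le> Sup (F ` \<S>)" using bdd by (intro cSup_upper) (auto simp: \<S>_def)
      thus "F S < a" using a by simp
    qed (use S0 in auto)
  qed
  thus ?thesis by blast
qed

text \<open>Limits are taken along the directed family of all finite volumes; this specialises them
  to any exhausting sequence, with the same value for all sequences.\<close>

lemma exhausting_filterlim:
  assumes "exhausting V S"
  shows "filterlim S (finite_subsets_at_top V) sequentially"
  unfolding filterlim_def le_filter_def eventually_filtermap eventually_finite_subsets_at_top
proof (intro allI impI, elim exE conjE)
  fix P X assume X: "finite X" "X \<subseteq> V" and P: "\<forall>Y. finite Y \<and> X \<subseteq> Y \<and> Y \<subseteq> V \<longrightarrow> P Y"
  have S: "\<And>n. finite (S n)" "incseq S" "(\<Union>n. S n) = V" using assms by (auto simp: exhausting_def)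
  have "\<exists>N. \<forall>n\<ge>N. X \<subseteq> S n" using X
  proof (induction X rule: finite_induct)
    case (insert x X)
    then obtain N where N: "\<And>n. n \<ge> N \<Longrightarrow> X \<subseteq> S n" by auto
    obtain m where m: "x \<in> S m" using insert S by blast
    have "insert x X \<subseteq> S n" if "n \<ge> max N m" for n
      using N[of n] m incseqD[OF S(2), of m n] that by auto
    thus ?case by blast
  qed auto
  then obtain N where N: "\<And>n. n \<ge> N \<Longrightarrow> X \<subseteq> S n" by auto
  have "P (S n)" if "n \<ge> N" for n using P N[OF that] S by blast
  thus "eventually (\<lambda>n. P (S n)) sequentially" unfolding eventually_sequentially by blast
qed

definition local_on :: "'v set \<Rightarrow> ('v set set \<Rightarrow> 'c) \<Rightarrow> bool" where
  "local_on V f \<longleftrightarrow> (\<exists>A. finite A \<and> A \<subseteq> pairs_on V \<and> (\<forall>\<eta>. f \<eta> = f (\<eta> \<inter> A)))"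

lemma local_onI: "finite A \<Longrightarrow> A \<subseteq> pairs_on V \<Longrightarrow> (\<And>\<eta>. f \<eta> = f (\<eta> \<inter> A)) \<Longrightarrow> local_on V f"
  unfolding local_on_def by blast

lemma local_on_Int: "finite A \<Longrightarrow> A \<subseteq> pairs_on V \<Longrightarrow> local_on V (\<lambda>\<eta>. f (\<eta> \<inter> A))"
  by (rule local_onI[of A]) auto

lemma local_on_const [simp]: "local_on V (\<lambda>_. c)"
  by (rule local_onI[of "{}"]) auto

lemma local_on_binop:
  assumes "local_on V f" "local_on V g"
  shows "local_on V (\<lambda>\<eta>. h (f \<eta>) (g \<eta>))"
proof -
  obtain A B where A: "finite A" "A \<subseteq> pairs_on V" "\<And>\<eta>. f \<eta> = f (\<eta> \<inter> A)"
    and B: "finite B" "B \<subseteq> pairs_on V" "\<And>\<eta>. g \<eta> = g (\<eta> \<inter> B)"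
    using assms unfolding local_on_def by blast
  have "f \<eta> = f (\<eta> \<inter> (A \<union> B))" "g \<eta> = g (\<eta> \<inter> (A \<union> B))" for \<eta>
  proof -
    have "\<eta> \<inter> (A \<union> B) \<inter> A = \<eta> \<inter> A" "\<eta> \<inter> (A \<union> B) \<inter> B = \<eta> \<inter> B" by auto
    thus "f \<eta> = f (\<eta> \<inter> (A \<union> B))" "g \<eta> = g (\<eta> \<inter> (A \<union> B))" using A(3) B(3) by metis+
  qed
  thus ?thesis using A B by (intro local_onI[of "A \<union> B"]) auto
qed

lemma local_on_edge: "e \<in> pairs_on V \<Longrightarrow> local_on V (\<lambda>\<eta>. of_bool (e \<in> \<eta>))"
  by (rule local_onI[of "{e}"]) auto

lemma local_on_bounded:
  fixes f :: "'v set set \<Rightarrow> real"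
  assumes "local_on V f"
  shows "\<exists>B\<ge>0. \<forall>\<eta>. \<bar>f \<eta>\<bar> \<le> B"
proof -
  obtain A where A: "finite A" "\<And>\<eta>. f \<eta> = f (\<eta> \<inter> A)" using assms unfolding local_on_def by blast
  have "\<bar>f \<eta>\<bar> \<le> (\<Sum>\<zeta>\<in>Pow A. \<bar>f \<zeta>\<bar>)" for \<eta>
    using member_le_sum[of "\<eta> \<inter> A" "Pow A" "\<lambda>\<zeta>. \<bar>f \<zeta>\<bar>"] A by auto
  moreover have "0 \<le> (\<Sum>\<zeta>\<in>Pow A. \<bar>f \<zeta>\<bar>)" by (rule sum_nonneg) simp
  ultimately show ?thesis by blast
qed

text \<open>Adding a large multiple of the number of open edges makes a local function increasing.\<close>

lemma local_on_increasing_diff: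
  fixes f :: "'v set set \<Rightarrow> real"
  assumes "local_on V f"
  shows "\<exists>g h. local_on V g \<and> local_on V h \<and> mono g \<and> mono h \<and> (\<forall>\<eta>. f \<eta> = g \<eta> - h \<eta>)"
proof -
  obtain A where A: "finite A" "A \<subseteq> pairs_on V" "\<And>\<eta>. f \<eta> = f (\<eta> \<inter> A)"
    using assms unfolding local_on_def by blast
  obtain B where B: "0 \<le> B" "\<And>\<eta>. \<bar>f \<eta>\<bar> \<le> B" using local_on_bounded[OF assms] by blast
  define h where "h \<eta> = 2 * B * real (card (\<eta> \<inter> A))" for \<eta>
  have h: "local_on V h" unfolding h_def using A by (intro local_onI[of A]) auto
  have mh: "mono h"
    unfolding h_def using A B by (intro monoI mult_left_mono) (auto intro!: card_mono)
  have "mono (\<lambda>\<eta>. f \<eta> + h \<eta>)"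
  proof (rule monoI)
    fix \<eta> \<eta>' :: "'v set set" assume e: "\<eta> \<subseteq> \<eta>'"
    show "f \<eta> + h \<eta> \<le> f \<eta>' + h \<eta>'"
    proof (cases "\<eta> \<inter> A = \<eta>' \<inter> A")
      case True
      thus ?thesis using A(3)[of \<eta>] A(3)[of \<eta>'] by (simp add: h_def)
    next
      case False
      hence "card (\<eta> \<inter> A) < card (\<eta>' \<inter> A)" using e A(1) by (intro psubset_card_mono) auto
      hence "real (card (\<eta> \<inter> A)) + 1 \<le> real (card (\<eta>' \<inter> A))" by simp
      hence "2 * B * (real (card (\<eta> \<inter> A)) + 1) \<le> h \<eta>'" unfolding h_def using B(1) by (intro mult_left_mono) auto
      hence "h \<eta> + 2 * B \<le> h \<eta>'" by (simp add: h_def algebra_simps)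
      thus ?thesis using B(2)[of \<eta>] B(2)[of \<eta>'] by linarith
    qed
  qed
  thus ?thesis using h mh local_on_binop[OF assms h, of "(+)"]
    by (intro exI[of _ "\<lambda>\<eta>. f \<eta> + h \<eta>"] exI[of _ h]) auto
qed

lemma local_on_volume:
  assumes "finite A" "A \<subseteq> pairs_on V"
  shows "\<exists>S. finite S \<and> S \<subseteq> V \<and> A \<subseteq> pairs_on S"
proof (intro exI[of _ "\<Union>A"] conjI)
  show "finite (\<Union>A)" using assms by (auto simp: pairs_on_def)
  show "\<Union>A \<subseteq> V" using assms by (auto simp: pairs_on_def)
  show "A \<subseteq> pairs_on (\<Union>A)"
  proof
    fix e assume e: "e \<in> A"
    then obtain x y where "e = {x, y}" "x \<noteq> y" using assms by (auto simp: pairs_on_def)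
    moreover have "e \<subseteq> \<Union>A" using e by auto
    ultimately show "e \<in> pairs_on (\<Union>A)" by (auto simp: pairs_on_def)
  qed
qed

section \<open>Expectations of local functions in infinite volume\<close>

context fk_model
begin

text \<open>Convergence is guaranteed for local functions by \<open>ivE_tendsto\<close>. Working
  with this functional allows the comparisons to be made before any infinite-volume measure
  exists.\<close>

definition ivE :: "bool \<Rightarrow> real \<Rightarrow> ('v set set \<Rightarrow> real) \<Rightarrow> real" where
  "ivE b \<beta> f = Lim (finite_subsets_at_top V) (\<lambda>S. P b S \<beta> f)"

lemma P_le_bound:
  assumes "finvol S" "0 < \<beta>" "\<And>\<eta>. \<bar>f \<eta>\<bar> \<le> B"
  shows "\<bar>P b S \<beta> f\<bar> \<le> B"
proof -
  have fin: "finite (E S)" using assms finite_EJ by blast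
  have f: "- B \<le> f \<eta>" "f \<eta> \<le> B" for \<eta> using assms(3)[of \<eta>] by linarith+
  show ?thesis using expect_bounds[OF fin wt_pos[OF assms(2), of S b], of "- B" f B] f by (auto simp: abs_le_iff)
qed

lemma P_mono_fun: "finvol S \<Longrightarrow> 0 < \<beta> \<Longrightarrow> (\<And>\<eta>. \<eta> \<subseteq> E S \<Longrightarrow> f \<eta> \<le> g \<eta>) \<Longrightarrow> P b S \<beta> f \<le> P b S \<beta> g"
  by (rule expect_mono) (use finite_EJ wt_pos in auto)

lemma P_free_increasing:
  assumes "finvol S" "finvol S'" "S \<subseteq> S'" "0 < \<beta>" "mono f"
  shows "P False S \<beta> f \<le> P False S' \<beta> f"
proof -
  have "P False S \<beta> f \<le> P False S' \<beta> (\<lambda>\<eta>. f (\<eta> \<inter> E S))"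
    by (rule P_free_mono_volume[OF assms(1-4)]) (use assms(5) in \<open>auto intro!: mono_onI dest: monoD\<close>)
  also have "\<dots> \<le> P False S' \<beta> f"
    by (rule P_mono_fun[OF assms(2,4)]) (auto intro!: monoD[OF assms(5)])
  finally show ?thesis .
qed

lemma P_wired_decreasing:
  assumes "finvol S" "finvol S'" "S \<subseteq> S'" "0 < \<beta>" "mono f" "A \<subseteq> pairs_on S" "\<And>\<eta>. f \<eta> = f (\<eta> \<inter> A)"
  shows "P True S' \<beta> f \<le> P True S \<beta> f"
proof -
  have "P True S' \<beta> f = P True S' \<beta> (\<lambda>\<eta>. f (\<eta> \<inter> E S))"
  proof (rule expect_cong)
    fix \<eta> assume "\<eta> \<subseteq> E S'"
    hence "\<eta> \<inter> E S \<inter> A = \<eta> \<inter> A" using assms(6) by (auto simp: EJ_def)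
    thus "f \<eta> = f (\<eta> \<inter> E S)" using assms(7)[of \<eta>] assms(7)[of "\<eta> \<inter> E S"] by simp
  qed
  also have "\<dots> \<le> P True S \<beta> f"
    by (rule P_wired_mono_volume[OF assms(1-4)]) (use assms(5) in \<open>auto intro!: mono_onI dest: monoD\<close>)
  finally show ?thesis .
qed

text \<open>For increasing local functions the free expectations increase and the wired ones
  decrease once the volume contains the relevant pairs. Every local function is a difference of two
  increasing ones.\<close>

lemma ivE_tendsto:
  assumes f: "local_on V f" and b: "0 < \<beta>"
  shows "((\<lambda>S. P b S \<beta> f) \<longlongrightarrow> ivE b \<beta> f) (finite_subsets_at_top V)"
proof -
  have inc: "\<exists>l. ((\<lambda>S. P b S \<beta> g) \<longlongrightarrow> l) (finite_subsets_at_top V)" if g: "local_on V g" "mono g" for g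
  proof -
    obtain A where A: "finite A" "A \<subseteq> pairs_on V" "\<And>\<eta>. g \<eta> = g (\<eta> \<inter> A)"
      using g(1) unfolding local_on_def by blast
    obtain B where B: "\<And>\<eta>. \<bar>g \<eta>\<bar> \<le> B" using local_on_bounded[OF g(1)] by blast
    obtain S0 where S0: "finite S0" "S0 \<subseteq> V" "A \<subseteq> pairs_on S0" using local_on_volume[OF A(1,2)] by blast
    have bd: "\<bar>P b S \<beta> g\<bar> \<le> B" if "finite S" "S \<subseteq> V" for S by (rule P_le_bound) (use b B that in auto)
    show ?thesis
    proof (cases b)
      case True
      have "\<exists>l. ((\<lambda>S. - P b S \<beta> g) \<longlongrightarrow> l) (finite_subsets_at_top V)"
      proof (rule tendsto_monotone_volumes[OF S0(1,2), of _ B])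
        fix S S' assume S: "S0 \<subseteq> S" "S \<subseteq> S'" "finite S'" "S' \<subseteq> V"
        have "A \<subseteq> pairs_on S" using S0 S pairs_on_mono by blast
        hence "P True S' \<beta> g \<le> P True S \<beta> g"
          by (intro P_wired_decreasing[OF _ _ S(2) b g(2) _ A(3)]) (use S finite_subset in auto)
        thus "- P b S \<beta> g \<le> - P b S' \<beta> g" using True by simp
      qed (use bd in \<open>auto simp: abs_le_iff\<close>)
      then obtain l where "((\<lambda>S. - P b S \<beta> g) \<longlongrightarrow> l) (finite_subsets_at_top V)" by blast
      from tendsto_minus[OF this] show ?thesis by auto
    next
      case False
      show ?thesis
      proof (rule tendsto_monotone_volumes[OF S0(1,2), of _ B])
        fix S S' assume S: "S0 \<subseteq> S" "S \<subseteq> S'" "finite S'" "S' \<subseteq> V"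
        have "P False S \<beta> g \<le> P False S' \<beta> g"
          by (intro P_free_increasing[OF _ _ S(2) b g(2)]) (use S finite_subset in auto)
        thus "P b S \<beta> g \<le> P b S' \<beta> g" using False by simp
      qed (use bd in \<open>auto simp: abs_le_iff\<close>)
    qed
  qed
  obtain g h where gh: "local_on V g" "local_on V h" "mono g" "mono h" "\<And>\<eta>. f \<eta> = g \<eta> - h \<eta>"
    using local_on_increasing_diff[OF f] by blast
  obtain l m where lm: "((\<lambda>S. P b S \<beta> g) \<longlongrightarrow> l) (finite_subsets_at_top V)"
    "((\<lambda>S. P b S \<beta> h) \<longlongrightarrow> m) (finite_subsets_at_top V)" using inc[OF gh(1,3)] inc[OF gh(2,4)] by (elim exE)
  have "f = (\<lambda>\<eta>. g \<eta> - h \<eta>)" using gh(5) by auto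
  hence lim: "((\<lambda>S. P b S \<beta> f) \<longlongrightarrow> l - m) (finite_subsets_at_top V)"
    using tendsto_diff[OF lm] by (simp add: expect_diff)
  show ?thesis unfolding ivE_def using lim tendsto_Lim[OF finite_subsets_at_top_neq_bot lim] by simp
qed

lemma ivE_unique:
  assumes "local_on V f" "0 < \<beta>" "((\<lambda>S. P b S \<beta> f) \<longlongrightarrow> l) (finite_subsets_at_top V)"
  shows "ivE b \<beta> f = l"
  using tendsto_unique[OF finite_subsets_at_top_neq_bot ivE_tendsto[OF assms(1,2)] assms(3)] .

lemma eventually_finvol: "eventually (\<lambda>S. finvol S) (finite_subsets_at_top V)"
  by (rule eventually_finite_subsets_at_top_weakI) auto

lemma eventually_finvol_superset:
  "finvol S0 \<Longrightarrow> eventually (\<lambda>S. finvol S \<and> S0 \<subseteq> S) (finite_subsets_at_top V)"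
  unfolding eventually_finite_subsets_at_top by (intro exI[of _ S0]) auto

lemma ivE_diff: "local_on V f \<Longrightarrow> local_on V g \<Longrightarrow> 0 < \<beta> \<Longrightarrow> ivE b \<beta> (\<lambda>\<eta>. f \<eta> - g \<eta>) = ivE b \<beta> f - ivE b \<beta> g"
  unfolding ivE_def[of _ _ "\<lambda>\<eta>. f \<eta> - g \<eta>"] expect_diff
  by (intro tendsto_Lim tendsto_diff ivE_tendsto) auto

lemma ivE_cmult: "local_on V f \<Longrightarrow> 0 < \<beta> \<Longrightarrow> ivE b \<beta> (\<lambda>\<eta>. c * f \<eta>) = c * ivE b \<beta> f"
  unfolding ivE_def[of _ _ "\<lambda>\<eta>. c * f \<eta>"] expect_cmult
  by (intro tendsto_Lim tendsto_mult_left ivE_tendsto) auto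

lemma ivE_sum:
  "(\<And>i. i \<in> I \<Longrightarrow> local_on V (f i)) \<Longrightarrow> 0 < \<beta> \<Longrightarrow> ivE b \<beta> (\<lambda>\<eta>. \<Sum>i\<in>I. f i \<eta>) = (\<Sum>i\<in>I. ivE b \<beta> (f i))"
  unfolding ivE_def[of _ _ "\<lambda>\<eta>. \<Sum>i\<in>I. f i \<eta>"] expect_sum
  by (intro tendsto_Lim tendsto_sum ivE_tendsto) auto

lemma ivE_const: "0 < \<beta> \<Longrightarrow> ivE b \<beta> (\<lambda>_. c) = c"
  by (rule ivE_unique) (auto intro!: tendsto_eventually eventually_mono[OF eventually_finvol] P_const)

lemma ivE_mono:
  assumes "local_on V f" "local_on V g" "0 < \<beta>" "\<And>\<eta>. \<eta> \<subseteq> E V \<Longrightarrow> f \<eta> \<le> g \<eta>"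
  shows "ivE b \<beta> f \<le> ivE b \<beta> g"
proof (rule tendsto_le[OF finite_subsets_at_top_neq_bot ivE_tendsto[OF assms(2,3)] ivE_tendsto[OF assms(1,3)]])
  have "P b S \<beta> f \<le> P b S \<beta> g" if "finvol S" for S
    using that EJ_mono[of S V J] by (intro P_mono_fun assms) auto
  thus "eventually (\<lambda>S. P b S \<beta> f \<le> P b S \<beta> g) (finite_subsets_at_top V)"
    using eventually_mono[OF eventually_finvol] by auto
qed

lemma ivE_nonneg: "local_on V f \<Longrightarrow> 0 < \<beta> \<Longrightarrow> (\<And>\<eta>. 0 \<le> f \<eta>) \<Longrightarrow> 0 \<le> ivE b \<beta> f"
  using ivE_mono[of "\<lambda>_. 0" f \<beta> b] by (simp add: ivE_const)

lemma ivE_le_param: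
  assumes f: "local_on V f" "mono f" and "0 < \<beta>" "\<beta> \<le> \<beta>'" "b \<le> b'"
  shows "ivE b \<beta> f \<le> ivE b' \<beta>' f"
proof -
  have b': "0 < \<beta>'" using assms by linarith
  show ?thesis
  proof (rule tendsto_le[OF finite_subsets_at_top_neq_bot ivE_tendsto[OF f(1) b'] ivE_tendsto[OF f(1) assms(3)]])
    have "P b S \<beta> f \<le> P b' S \<beta>' f" if "finvol S" for S
      by (intro P_mono that assms) (use f(2) in \<open>auto intro!: mono_onI dest: monoD\<close>)
    thus "eventually (\<lambda>S. P b S \<beta> f \<le> P b' S \<beta>' f) (finite_subsets_at_top V)"
      using eventually_mono[OF eventually_finvol] by auto
  qed
qed

lemma P_free_le_ivE:
  assumes S: "finvol S" and b: "0 < \<beta>" and f: "local_on V f" "mono f"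
  shows "P False S \<beta> f \<le> ivE False \<beta> f"
proof (rule tendsto_lowerbound[OF ivE_tendsto[OF f(1) b] _ finite_subsets_at_top_neq_bot])
  show "eventually (\<lambda>S'. P False S \<beta> f \<le> P False S' \<beta> f) (finite_subsets_at_top V)"
    by (rule eventually_mono[OF eventually_finvol_superset[OF S]]) (use S b f P_free_increasing in blast)
qed

lemma ivE_le_P_wired:
  assumes S: "finvol S" and b: "0 < \<beta>" and f: "local_on V f" "mono f"
    and A: "A \<subseteq> pairs_on S" "\<And>\<eta>. f \<eta> = f (\<eta> \<inter> A)"
  shows "ivE True \<beta> f \<le> P True S \<beta> f"
proof (rule tendsto_upperbound[OF ivE_tendsto[OF f(1) b] _ finite_subsets_at_top_neq_bot])
  show "eventually (\<lambda>S'. P True S' \<beta> f \<le> P True S \<beta> f) (finite_subsets_at_top V)"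
    by (rule eventually_mono[OF eventually_finvol_superset[OF S]])
      (use P_wired_decreasing[OF S _ _ b f(2) A] in blast)
qed

section \<open>Construction of the infinite-volume measures from their marginals\<close>

definition marginal :: "bool \<Rightarrow> real \<Rightarrow> 'v set set \<Rightarrow> 'v set set \<Rightarrow> real" where
  "marginal b \<beta> A \<zeta> = (if \<zeta> \<subseteq> A then ivE b \<beta> (\<lambda>\<eta>. of_bool (\<eta> \<inter> A = \<zeta>)) else 0)"

lemma local_on_cylinder: "finite A \<Longrightarrow> A \<subseteq> pairs_on V \<Longrightarrow> local_on V (\<lambda>\<eta>. of_bool (\<eta> \<inter> A = \<zeta>))"
  by (rule local_on_Int)

lemma ivE_marginal:
  assumes A: "finite A" "A \<subseteq> pairs_on V" and b: "0 < \<beta>"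
  shows "ivE b \<beta> (\<lambda>\<eta>. g (\<eta> \<inter> A)) = (\<Sum>\<zeta>\<in>Pow A. marginal b \<beta> A \<zeta> * g \<zeta>)"
proof -
  have "g (\<eta> \<inter> A) = (\<Sum>\<zeta>\<in>Pow A. g \<zeta> * of_bool (\<eta> \<inter> A = \<zeta>))" for \<eta>
    using A by (subst sum.mono_neutral_right[of "Pow A" "{\<eta> \<inter> A}"]) auto
  hence "ivE b \<beta> (\<lambda>\<eta>. g (\<eta> \<inter> A)) = ivE b \<beta> (\<lambda>\<eta>. \<Sum>\<zeta>\<in>Pow A. g \<zeta> * of_bool (\<eta> \<inter> A = \<zeta>))" by simp
  also have "\<dots> = (\<Sum>\<zeta>\<in>Pow A. ivE b \<beta> (\<lambda>\<eta>. g \<zeta> * of_bool (\<eta> \<inter> A = \<zeta>)))"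
    by (rule ivE_sum[OF _ b]) (rule local_onI[OF A], simp)
  also have "\<dots> = (\<Sum>\<zeta>\<in>Pow A. marginal b \<beta> A \<zeta> * g \<zeta>)"
    using ivE_cmult[OF local_on_cylinder[OF A] b] by (intro sum.cong) (auto simp: marginal_def)
  finally show ?thesis .
qed

definition marginal_pmf :: "bool \<Rightarrow> real \<Rightarrow> 'v set set \<Rightarrow> 'v set set pmf" where
  "marginal_pmf b \<beta> A = embed_pmf (marginal b \<beta> A)"

text \<open>The value 0 off \<open>Pow A\<close> makes \<open>marginal\<close> a density on the
  whole type; the mass on \<open>Pow A\<close> is 1 because the cylinders partition all
  configurations.\<close>

lemma pmf_marginal:
  assumes A: "finite A" "A \<subseteq> pairs_on V" and b: "0 < \<beta>"
  shows "pmf (marginal_pmf b \<beta> A) \<zeta> = marginal b \<beta> A \<zeta>"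
  unfolding marginal_pmf_def
proof (rule pmf_embed_pmf)
  show nn: "0 \<le> marginal b \<beta> A \<zeta>" for \<zeta>
    unfolding marginal_def using ivE_nonneg[OF local_on_cylinder[OF A] b] by auto
  have "(\<integral>\<^sup>+\<zeta>. ennreal (marginal b \<beta> A \<zeta>) \<partial>count_space UNIV) = (\<Sum>\<zeta>\<in>Pow A. ennreal (marginal b \<beta> A \<zeta>))"
    by (rule nn_integral_count_space') (use A in \<open>auto simp: marginal_def\<close>)
  also have "\<dots> = ennreal (\<Sum>\<zeta>\<in>Pow A. marginal b \<beta> A \<zeta>)" by (rule sum_ennreal) (rule nn)
  also have "(\<Sum>\<zeta>\<in>Pow A. marginal b \<beta> A \<zeta>) = 1"
    using ivE_marginal[OF A b, of b "\<lambda>_. 1"] ivE_const[OF b] by simp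
  finally show "(\<integral>\<^sup>+\<zeta>. ennreal (marginal b \<beta> A \<zeta>) \<partial>count_space UNIV) = 1" by simp
qed

lemma set_marginal_pmf:
  "finite A \<Longrightarrow> A \<subseteq> pairs_on V \<Longrightarrow> 0 < \<beta> \<Longrightarrow> set_pmf (marginal_pmf b \<beta> A) \<subseteq> Pow A"
  by (auto simp: set_pmf_iff pmf_marginal marginal_def split: if_splits)

lemma expectation_marginal:
  assumes A: "finite A" "A \<subseteq> pairs_on V" and b: "0 < \<beta>"
  shows "measure_pmf.expectation (marginal_pmf b \<beta> A) g = ivE b \<beta> (\<lambda>\<eta>. g (\<eta> \<inter> A))"
  unfolding ivE_marginal[OF A b]
  using A set_marginal_pmf[OF A b] by (subst integral_measure_pmf[of "Pow A"]) (auto simp: pmf_marginal[OF A b])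

text \<open>The consistency condition of Kolmogorov's theorem; it holds because all marginals come
  from the single functional \<open>ivE\<close>.\<close>

lemma map_marginal_pmf:
  assumes H: "finite H" "H \<subseteq> pairs_on V" and J: "A \<subseteq> H" and b: "0 < \<beta>"
  shows "map_pmf (\<lambda>\<zeta>. \<zeta> \<inter> A) (marginal_pmf b \<beta> H) = marginal_pmf b \<beta> A"
proof (rule pmf_eqI)
  fix \<zeta>
  have A: "finite A" "A \<subseteq> pairs_on V" using H J finite_subset by auto
  have "pmf (map_pmf (\<lambda>\<zeta>. \<zeta> \<inter> A) (marginal_pmf b \<beta> H)) \<zeta>
      = measure_pmf.expectation (marginal_pmf b \<beta> H) (\<lambda>\<zeta>'. of_bool (\<zeta>' \<inter> A = \<zeta>))"
  proof -
    have "indicator ((\<lambda>\<zeta>. \<zeta> \<inter> A) -` {\<zeta>}) = (\<lambda>\<zeta>'. of_bool (\<zeta>' \<inter> A = \<zeta>) :: real)"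
      by (auto simp: indicator_def fun_eq_iff)
    moreover have "measure_pmf.prob p X = measure_pmf.expectation p (indicator X)" for p and X :: "'v set set set"
      by simp
    ultimately show ?thesis unfolding pmf_map by metis
  qed
  also have "\<dots> = ivE b \<beta> (\<lambda>\<eta>. of_bool (\<eta> \<inter> H \<inter> A = \<zeta>))" by (rule expectation_marginal[OF H b])
  also have "\<dots> = ivE b \<beta> (\<lambda>\<eta>. of_bool (\<eta> \<inter> A = \<zeta>))" using J by (simp add: Int_assoc Int_absorb1)
  also have "\<dots> = marginal b \<beta> A \<zeta>"
  proof (cases "\<zeta> \<subseteq> A")
    case False
    hence "(\<lambda>\<eta>. of_bool (\<eta> \<inter> A = \<zeta>)) = (\<lambda>_. 0 :: real)" by auto
    thus ?thesis using False ivE_const[OF b, of b 0] by (simp add: marginal_def)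
  qed (simp add: marginal_def)
  finally show "pmf (map_pmf (\<lambda>\<zeta>. \<zeta> \<inter> A) (marginal_pmf b \<beta> H)) \<zeta> = pmf (marginal_pmf b \<beta> A) \<zeta>"
    using pmf_marginal[OF A b] by simp
qed

definition opens :: "'v config \<Rightarrow> 'v set set" where
  "opens \<omega> = {e \<in> pairs_on V. \<omega> e}"

definition real_config :: "'v set set \<Rightarrow> 'v set set \<Rightarrow> 'v set \<Rightarrow> real" where
  "real_config A \<zeta> = (\<lambda>e\<in>A. of_bool (e \<in> \<zeta>))"

text \<open>The Kolmogorov extension theorem is available for real-valued processes, so the
  configurations are first built with values 0 and 1.\<close>

lemma exists_infinite_volume:
  assumes b: "0 < \<beta>"
  shows "\<exists>\<mu>. prob_space \<mu> \<and> sets \<mu> = sets (config_algebra V) \<and>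
    (\<forall>A \<zeta>. finite A \<and> A \<subseteq> pairs_on V \<and> \<zeta> \<subseteq> A \<longrightarrow>
      measure \<mu> {\<omega> \<in> space \<mu>. opens \<omega> \<inter> A = \<zeta>} = marginal b \<beta> A \<zeta>)"
proof -
  let ?I = "pairs_on V"
  let ?B = "\<lambda>A. \<Pi>\<^sub>M e\<in>A. (borel :: real measure)"
  define Pf where "Pf A = distr (measure_pmf (marginal_pmf b \<beta> A)) (?B A) (real_config A)" for A
  have rc: "real_config A \<zeta> \<in> space (?B A)" for A \<zeta>
    by (auto simp: real_config_def space_PiM)
  interpret polish_projective ?I Pf
  proof (intro polish_projective.intro projective_family.intro)
    fix A H :: "'v set set" assume H: "A \<subseteq> H" "finite H" "H \<subseteq> ?I"
    have "distr (Pf H) (?B A) (\<lambda>f. restrict f A)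
        = distr (measure_pmf (marginal_pmf b \<beta> H)) (?B A) ((\<lambda>f. restrict f A) \<circ> real_config H)"
      unfolding Pf_def
      by (rule distr_distr) (use H rc in \<open>auto intro!: measurable_restrict_subset\<close>)
    also have "(\<lambda>f. restrict f A) \<circ> real_config H = real_config A \<circ> (\<lambda>\<zeta>. \<zeta> \<inter> A)"
      using H by (auto simp: real_config_def fun_eq_iff restrict_def)
    also have "distr (measure_pmf (marginal_pmf b \<beta> H)) (?B A) (real_config A \<circ> (\<lambda>\<zeta>. \<zeta> \<inter> A))
        = distr (distr (measure_pmf (marginal_pmf b \<beta> H)) (count_space UNIV) (\<lambda>\<zeta>. \<zeta> \<inter> A)) (?B A) (real_config A)"
      by (rule distr_distr[symmetric]) (use rc in auto)
    also have "\<dots> = Pf A"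
      unfolding Pf_def map_marginal_pmf[OF H(2,3,1) b, symmetric] map_pmf_rep_eq ..
    finally show "Pf A = distr (Pf H) (?B A) (\<lambda>f. restrict f A)" ..
  next
    fix A :: "'v set set" assume "finite A" "A \<subseteq> ?I"
    show "prob_space (Pf A)" unfolding Pf_def
      by (rule measure_pmf.prob_space_distr) (use rc in auto)
  qed
  \<comment> \<open>Reads the Boolean configuration back from the real-valued one: the value 1 means
    open, every other value closed.\<close>
  define T where "T = (\<lambda>x :: 'v set \<Rightarrow> real. \<lambda>e\<in>?I. x e = 1)"
  have T: "T \<in> measurable lim (config_algebra V)"
    unfolding T_def config_algebra_def
  proof (rule measurable_restrict)
    fix e assume e: "e \<in> ?I"
    have [measurable]: "(\<lambda>x. x e) \<in> borel_measurable (?B ?I)" using e by (rule measurable_component_singleton)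
    have "(\<lambda>x. x e = 1) \<in> measurable (?B ?I) (count_space UNIV)" by measurable
    thus "(\<lambda>x. x e = 1) \<in> measurable lim (count_space UNIV)" unfolding measurable_cong_sets[OF sets_lim refl] .
  qed
  define \<mu> where "\<mu> = distr lim (config_algebra V) T"
  have "measure \<mu> {\<omega> \<in> space \<mu>. opens \<omega> \<inter> A = \<zeta>} = marginal b \<beta> A \<zeta>"
    if A: "finite A" "A \<subseteq> ?I" and z: "\<zeta> \<subseteq> A" for A \<zeta>
  proof -
    let ?X = "{x \<in> space (?B A). \<forall>e\<in>A. x e = 1 \<longleftrightarrow> e \<in> \<zeta>}"
    have X: "?X \<in> sets (?B A)" using A(1)
    proof -
      have [measurable]: "(\<lambda>x. x e) \<in> borel_measurable (?B A)" if "e \<in> A" for e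
        using that by (rule measurable_component_singleton)
      show ?thesis using A(1) by measurable
    qed
    have meas: "{\<omega> \<in> space (config_algebra V). opens \<omega> \<inter> A = \<zeta>} \<in> sets (config_algebra V)"
    proof -
      have eq: "{\<omega> \<in> space (config_algebra V). opens \<omega> \<inter> A = \<zeta>}
          = {\<omega> \<in> space (config_algebra V). \<forall>e\<in>A. \<omega> e = (e \<in> \<zeta>)}"
        using A z by (auto simp: opens_def)
      have [measurable]: "(\<lambda>\<omega>. \<omega> e) \<in> measurable (config_algebra V) (count_space UNIV)" if "e \<in> A" for e
        unfolding config_algebra_def using that A by (intro measurable_component_singleton) auto
      show ?thesis unfolding eq using A(1) by measurable
    qed
    have "measure \<mu> {\<omega> \<in> space \<mu>. opens \<omega> \<inter> A = \<zeta>}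
        = measure lim (T -` {\<omega> \<in> space (config_algebra V). opens \<omega> \<inter> A = \<zeta>} \<inter> space lim)"
      unfolding \<mu>_def using measure_distr[OF T meas] by simp
    also have "T -` {\<omega> \<in> space (config_algebra V). opens \<omega> \<inter> A = \<zeta>} \<inter> space lim = emb ?I A ?X"
    proof -
      have "opens (T x) \<inter> A = \<zeta> \<longleftrightarrow> (\<forall>e\<in>A. x e = 1 \<longleftrightarrow> e \<in> \<zeta>)" for x
        using A z by (auto simp: opens_def T_def subset_iff)
      thus ?thesis using measurable_space[OF T]
        by (auto simp: prod_emb_def space_PiM)
    qed
    also have "measure lim (emb ?I A ?X) = measure (Pf A) ?X" by (rule measure_lim_emb[OF A(2,1) X])
    also have "\<dots> = measure (measure_pmf (marginal_pmf b \<beta> A)) (real_config A -` ?X)"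
      unfolding Pf_def using X rc by (subst measure_distr) auto
    also have "\<dots> = measure (measure_pmf (marginal_pmf b \<beta> A)) {\<zeta>}"
    proof (rule measure_pmf.finite_measure_eq_AE)
      have "\<zeta>' \<in> real_config A -` ?X \<longleftrightarrow> \<zeta>' \<in> {\<zeta>}" if "\<zeta>' \<in> set_pmf (marginal_pmf b \<beta> A)" for \<zeta>'
      proof -
        have "\<zeta>' \<subseteq> A" using that set_marginal_pmf[OF A b, of b] by auto
        thus ?thesis using z rc by (auto simp: real_config_def)
      qed
      thus "AE \<zeta>' in measure_pmf (marginal_pmf b \<beta> A). \<zeta>' \<in> real_config A -` ?X \<longleftrightarrow> \<zeta>' \<in> {\<zeta>}"
        by (auto simp: AE_measure_pmf_iff)
    qed auto
    also have "\<dots> = marginal b \<beta> A \<zeta>" by (simp add: measure_pmf_single pmf_marginal[OF A b])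
    finally show ?thesis .
  qed
  moreover have "prob_space \<mu>" unfolding \<mu>_def by (rule P.prob_space_distr[OF T])
  moreover have "sets \<mu> = sets (config_algebra V)" by (simp add: \<mu>_def)
  ultimately show ?thesis by blast
qed

section \<open>Identification with the weak limits\<close>

abbreviation "cluster_count b \<equiv> (if b then wired_count V J else free_count)"
abbreviation "fk_inf b \<beta> \<equiv> infinite_volume V (fk_finite (cluster_count b) J \<beta> q)"

definition cfg :: "'v set set \<Rightarrow> 'v config" where
  "cfg \<eta> = (\<lambda>e\<in>pairs_on V. e \<in> \<eta>)"

text \<open>A configuration that opens a pair with vanishing coupling contains the factor exp 0 - 1
  = 0. This is what permits leaving such pairs out.\<close>

lemma fk_weight_wt:
  assumes S: "finvol S"
  shows "fk_weight (cluster_count b) J \<beta> q S \<omega> =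
    (if {e \<in> pairs_on S. \<omega> e} \<subseteq> E S then wt b S \<beta> {e \<in> pairs_on S. \<omega> e} else 0)"
proof -
  let ?\<eta> = "{e \<in> pairs_on S. \<omega> e}" and ?y = "\<lambda>e. exp (\<beta> * coupling J e) - 1"
  have fin: "finite (pairs_on S)" using S finite_pairs_on by blast
  have k: "cluster_count b S \<omega> = card (comps S (?\<eta> \<union> bd b S))"
    using S by (simp add: wired_count_comps free_count_comps bc_edges_def)
  have prod: "(\<Prod>e\<in>pairs_on S. ?y e ^ of_bool (\<omega> e)) = prod ?y ?\<eta>"
    using fin by (intro prod.mono_neutral_cong_right) auto
  show ?thesis
  proof (cases "?\<eta> \<subseteq> E S")
    case True
    thus ?thesis unfolding fk_weight_def k prod by (simp add: fkw_def)
  next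
    case False
    then obtain e where e: "e \<in> ?\<eta>" "e \<notin> E S" by auto
    have "0 \<le> coupling J e"
    proof -
      obtain x y where "e = {x, y}" "x \<in> S" "y \<in> S" using e by (auto simp: pairs_on_def)
      moreover have "x \<in> V" "y \<in> V" using calculation S by blast+
      ultimately show ?thesis using coupling_eq[of x y] J_nonneg[of x y] by simp
    qed
    hence "?y e = 0" using e by (auto simp: EJ_def)
    hence "prod ?y ?\<eta> = 0" using fin e(1) by (intro prod_zero) auto
    thus ?thesis using False unfolding fk_weight_def prod by simp
  qed
qed

lemma sum_configs:
  assumes S: "finvol S"
  shows "(\<Sum>\<omega>\<in>configs S. fk_weight (cluster_count b) J \<beta> q S \<omega> * h {e \<in> pairs_on S. \<omega> e})
    = (\<Sum>\<eta>\<in>Pow (E S). wt b S \<beta> \<eta> * h \<eta>)"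
proof -
  have fin: "finite (pairs_on S)" using S finite_pairs_on by blast
  have "(\<Sum>\<omega>\<in>configs S. fk_weight (cluster_count b) J \<beta> q S \<omega> * h {e \<in> pairs_on S. \<omega> e})
     = (\<Sum>\<eta>\<in>Pow (pairs_on S). (if \<eta> \<subseteq> E S then wt b S \<beta> \<eta> else 0) * h \<eta>)"
    unfolding fk_weight_wt[OF S]
    by (rule sum.reindex_bij_witness[of _ "\<lambda>\<eta>. \<lambda>e\<in>pairs_on S. e \<in> \<eta>" "\<lambda>\<omega>. {e \<in> pairs_on S. \<omega> e}"])
      (auto simp: configs_def PiE_def extensional_def fun_eq_iff restrict_def)
  also have "\<dots> = (\<Sum>\<eta>\<in>Pow (E S). wt b S \<beta> \<eta> * h \<eta>)"
    using fin EJ_pairs[of J S] by (intro sum.mono_neutral_cong_right) auto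
  finally show ?thesis .
qed

lemma fk_finite_integral:
  assumes S: "finvol S" and b: "0 < \<beta>"
  shows "(\<integral>\<omega>. f (extend_config V S \<omega>) \<partial>(fk_finite (cluster_count b) J \<beta> q S)) = P b S \<beta> (\<lambda>\<eta>. f (cfg \<eta>))"
proof -
  have fin: "finite (configs S)" unfolding configs_def using S finite_pairs_on by (intro finite_PiE) auto
  have ext: "extend_config V S \<omega> = cfg {e \<in> pairs_on S. \<omega> e}" for \<omega>
    by (auto simp: extend_config_def cfg_def fun_eq_iff restrict_def)
  have part: "fk_partition (cluster_count b) J \<beta> q S = (\<Sum>\<eta>\<in>Pow (E S). wt b S \<beta> \<eta>)"
    unfolding fk_partition_def using sum_configs[OF S, of b \<beta> "\<lambda>_. 1"] by simp
  have Z: "0 < (\<Sum>\<eta>\<in>Pow (E S). wt b S \<beta> \<eta>)" by (rule sum_Pow_pos) (use S finite_EJ wt_pos[OF b] in auto)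
  have nn: "0 \<le> fk_weight (cluster_count b) J \<beta> q S \<omega>" for \<omega>
    unfolding fk_weight_wt[OF S] using wt_pos[OF b, of S b] by (auto simp: less_imp_le)
  have "(\<integral>\<omega>. f (extend_config V S \<omega>) \<partial>(fk_finite (cluster_count b) J \<beta> q S))
      = (\<Sum>\<omega>\<in>configs S. fk_weight (cluster_count b) J \<beta> q S \<omega> / fk_partition (cluster_count b) J \<beta> q S * f (extend_config V S \<omega>))"
    unfolding fk_finite_def using fin nn Z part by (subst lebesgue_integral_point_measure_finite) auto
  also have "\<dots> = (\<Sum>\<omega>\<in>configs S. fk_weight (cluster_count b) J \<beta> q S \<omega> * f (cfg {e \<in> pairs_on S. \<omega> e})) / (\<Sum>\<eta>\<in>Pow (E S). wt b S \<beta> \<eta>)"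
    by (simp add: part ext sum_divide_distrib)
  also have "\<dots> = P b S \<beta> (\<lambda>\<eta>. f (cfg \<eta>))"
    using sum_configs[OF S, of b \<beta> "\<lambda>\<eta>. f (cfg \<eta>)"] by (simp add: expect_def)
  finally show ?thesis .
qed

lemma topspace_config: "topspace (config_topology V) = configs V"
  by (simp add: config_topology_def configs_def)

lemma cfg_configs: "cfg \<eta> \<in> configs V"
  by (auto simp: cfg_def configs_def)

lemma cfg_opens: "\<omega> \<in> configs V \<Longrightarrow> cfg (opens \<omega>) = \<omega>"
  by (auto simp: cfg_def opens_def configs_def PiE_def extensional_def fun_eq_iff restrict_def)

text \<open>Every point has a basic open box on which f varies by less than \<epsilon>. By
  compactness finitely many boxes suffice, and A collects the finitely many coordinates they
  restrict: two configurations agreeing on A lie in a common box.\<close>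

lemma continuous_almost_local:
  assumes f: "continuous_map (config_topology V) euclideanreal f" and e: "0 < \<epsilon>"
  shows "\<exists>A. finite A \<and> A \<subseteq> pairs_on V \<and>
    (\<forall>\<omega>\<in>configs V. \<forall>\<omega>'\<in>configs V. (\<forall>e\<in>A. \<omega> e = \<omega>' e) \<longrightarrow> \<bar>f \<omega> - f \<omega>'\<bar> < \<epsilon>)"
proof -
  let ?I = "pairs_on V" and ?X = "config_topology V"
  define ok where "ok U \<longleftrightarrow> finite {e \<in> ?I. U e \<noteq> UNIV} \<and>
    (\<forall>\<omega>\<in>Pi\<^sub>E ?I U. \<forall>\<omega>'\<in>Pi\<^sub>E ?I U. \<bar>f \<omega> - f \<omega>'\<bar> < \<epsilon>)" for U :: "'v set \<Rightarrow> bool set"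
  have comp: "compact_space ?X"
    unfolding config_topology_def compact_space_product_topology by (auto simp: compact_space_discrete_topology)
  have open_ok: "openin ?X (Pi\<^sub>E ?I U)" if "ok U" for U
  proof -
    have "finite {e \<in> ?I. U e \<noteq> topspace (discrete_topology UNIV)}" using that by (simp add: ok_def)
    thus ?thesis unfolding config_topology_def by (intro openin_PiE_gen[THEN iffD2] disjI2 conjI) auto
  qed
  have cover: "\<exists>U. ok U \<and> \<omega> \<in> Pi\<^sub>E ?I U" if w: "\<omega> \<in> configs V" for \<omega>
  proof -
    let ?B = "{x. \<bar>x - f \<omega>\<bar> < \<epsilon> / 2}"
    have "open ?B" by (intro open_Collect_less continuous_intros)
    define W where "W = {\<omega>' \<in> topspace ?X. f \<omega>' \<in> ?B}"
    have "openin ?X W" unfolding W_def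
      by (rule openin_continuous_map_preimage[OF f]) (use \<open>open ?B\<close> in simp)
    hence "\<forall>x\<in>W. \<exists>U. finite {e \<in> ?I. U e \<noteq> UNIV} \<and> x \<in> Pi\<^sub>E ?I U \<and> Pi\<^sub>E ?I U \<subseteq> W"
      unfolding config_topology_def openin_product_topology_alt topspace_discrete_topology by meson
    moreover have "\<omega> \<in> W" using w e by (simp add: topspace_config W_def)
    ultimately obtain U where U: "finite {e \<in> ?I. U e \<noteq> UNIV}" "\<omega> \<in> Pi\<^sub>E ?I U"
      "Pi\<^sub>E ?I U \<subseteq> W"
      by meson
    have "\<bar>f \<omega>1 - f \<omega>2\<bar> < \<epsilon>" if "\<omega>1 \<in> Pi\<^sub>E ?I U" "\<omega>2 \<in> Pi\<^sub>E ?I U" for \<omega>1 \<omega>2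
    proof -
      have "\<bar>f \<omega>1 - f \<omega>\<bar> < \<epsilon> / 2" "\<bar>f \<omega>2 - f \<omega>\<bar> < \<epsilon> / 2" using U(3) that by (auto simp: W_def)
      thus ?thesis by linarith
    qed
    thus ?thesis using U by (auto simp: ok_def)
  qed
  have "topspace ?X \<subseteq> \<Union>(Pi\<^sub>E ?I ` Collect ok)" using cover by (auto simp: topspace_config)
  then obtain \<F> where F: "finite \<F>" "\<F> \<subseteq> Pi\<^sub>E ?I ` Collect ok" "topspace ?X \<subseteq> \<Union>\<F>"
    using comp open_ok unfolding compact_space_alt by (metis (mono_tags, lifting) imageE mem_Collect_eq)
  then obtain \<U> where U: "finite \<U>" "\<U> \<subseteq> Collect ok" "\<F> = Pi\<^sub>E ?I ` \<U>"
    using finite_subset_image[OF F(1,2)] by blast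
  define A where "A = (\<Union>U\<in>\<U>. {e \<in> ?I. U e \<noteq> UNIV})"
  show ?thesis
  proof (intro exI[of _ A] conjI ballI impI)
    show "finite A" "A \<subseteq> ?I" using U by (auto simp: A_def ok_def)
    fix \<omega> \<omega>' assume w: "\<omega> \<in> configs V" "\<omega>' \<in> configs V" "\<forall>e\<in>A. \<omega> e = \<omega>' e"
    obtain W where W: "W \<in> \<U>" "\<omega> \<in> Pi\<^sub>E ?I W" using F(3) w(1) U(3) by (auto simp: topspace_config)
    have "\<omega>' \<in> Pi\<^sub>E ?I W"
    proof (rule PiE_I)
      fix e assume e: "e \<in> ?I"
      show "\<omega>' e \<in> W e"
      proof (cases "W e = UNIV")
        case False
        hence "e \<in> A" using e W by (auto simp: A_def)
        thus ?thesis using w(3) PiE_mem[OF W(2) e] by simp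
      qed simp
    qed (use w in \<open>auto simp: configs_def PiE_def extensional_def\<close>)
    thus "\<bar>f \<omega> - f \<omega>'\<bar> < \<epsilon>" using W U(2) by (auto simp: ok_def)
  qed
qed

lemma local_on_continuous:
  fixes f :: "'v set set \<Rightarrow> real"
  assumes "local_on V f"
  shows "continuous_map (config_topology V) euclideanreal (\<lambda>\<omega>. f (opens \<omega>))"
proof -
  obtain A where A: "finite A" "A \<subseteq> pairs_on V" "\<And>\<eta>. f \<eta> = f (\<eta> \<inter> A)"
    using assms unfolding local_on_def by blast
  have ind: "(\<Prod>e\<in>A. of_bool (\<omega> e = (e \<in> \<zeta>))) = (of_bool (opens \<omega> \<inter> A = \<zeta>) :: real)" if "\<zeta> \<subseteq> A" for \<zeta> \<omega>
  proof -
    have "opens \<omega> \<inter> A = \<zeta> \<longleftrightarrow> (\<forall>e\<in>A. \<omega> e = (e \<in> \<zeta>))" using A that by (auto simp: opens_def)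
    moreover have "(\<Prod>e\<in>B. of_bool (\<omega> e = (e \<in> \<zeta>))) = (of_bool (\<forall>e\<in>B. \<omega> e = (e \<in> \<zeta>)) :: real)" if "finite B" for B
      using that by (induction rule: finite_induct) auto
    ultimately show ?thesis using A(1) by simp
  qed
  have "f (opens \<omega>) = (\<Sum>\<zeta>\<in>Pow A. f \<zeta> * (\<Prod>e\<in>A. of_bool (\<omega> e = (e \<in> \<zeta>))))" for \<omega>
  proof -
    have "(\<Sum>\<zeta>\<in>Pow A. f \<zeta> * (\<Prod>e\<in>A. of_bool (\<omega> e = (e \<in> \<zeta>)))) = (\<Sum>\<zeta>\<in>Pow A. f \<zeta> * of_bool (opens \<omega> \<inter> A = \<zeta>))"
      by (intro sum.cong refl) (simp add: ind)
    also have "\<dots> = f (opens \<omega> \<inter> A)"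
      using A(1) by (subst sum.mono_neutral_right[of "Pow A" "{opens \<omega> \<inter> A}"]) auto
    finally show ?thesis using A(3)[of "opens \<omega>"] by simp
  qed
  moreover have "continuous_map (config_topology V) euclideanreal
      (\<lambda>\<omega>. \<Sum>\<zeta>\<in>Pow A. f \<zeta> * (\<Prod>e\<in>A. of_bool (\<omega> e = (e \<in> \<zeta>))))"
  proof (intro continuous_map_sum continuous_map_real_mult continuous_map_prod)
    fix e \<zeta> assume "e \<in> A"
    hence "continuous_map (config_topology V) (discrete_topology UNIV) (\<lambda>\<omega>. \<omega> e)"
      unfolding config_topology_def using A(2) by (intro continuous_map_product_projection) auto
    from continuous_map_compose[OF this, of euclideanreal "\<lambda>x. of_bool (x = (e \<in> \<zeta>))"]
    show "continuous_map (config_topology V) euclideanreal (\<lambda>\<omega>. of_bool (\<omega> e = (e \<in> \<zeta>)))"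
      by (simp add: o_def)
  qed (use A in auto)
  ultimately show ?thesis by simp
qed

lemma measurable_coordinate:
  "sets \<mu> = sets (config_algebra V) \<Longrightarrow> e \<in> pairs_on V \<Longrightarrow> (\<lambda>\<omega>. \<omega> e) \<in> measurable \<mu> (count_space UNIV)"
  unfolding config_algebra_def by (subst measurable_cong_sets[of _ _ _ "count_space UNIV"]) auto

lemma space_config: "sets \<mu> = sets (config_algebra V) \<Longrightarrow> space \<mu> = configs V"
  using sets_eq_imp_space_eq[of \<mu> "config_algebra V"] by (simp add: config_algebra_def configs_def space_PiM)

lemma cylinder_sets:
  assumes \<mu>: "sets \<mu> = sets (config_algebra V)" and A: "finite A" "A \<subseteq> pairs_on V"
  shows "{\<omega> \<in> space \<mu>. opens \<omega> \<inter> A = \<zeta>} \<in> sets \<mu>"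
proof (cases "\<zeta> \<subseteq> A")
  case True
  have eq: "{\<omega> \<in> space \<mu>. opens \<omega> \<inter> A = \<zeta>} = {\<omega> \<in> space \<mu>. \<forall>e\<in>A. \<omega> e = (e \<in> \<zeta>)}"
    using A True by (auto simp: opens_def)
  have [measurable]: "(\<lambda>\<omega>. \<omega> e) \<in> measurable \<mu> (count_space UNIV)" if "e \<in> A" for e
    using that A by (intro measurable_coordinate[OF \<mu>]) auto
  show ?thesis unfolding eq using A(1) by measurable
next
  case False
  hence eq: "{\<omega> \<in> space \<mu>. opens \<omega> \<inter> A = \<zeta>} = {}" by auto
  show ?thesis unfolding eq by simp
qed

lemma local_on_measurable:
  fixes f :: "'v set set \<Rightarrow> 'c::topological_space"
  assumes \<mu>: "sets \<mu> = sets (config_algebra V)" and f: "local_on V f"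
  shows "(\<lambda>\<omega>. f (opens \<omega>)) \<in> measurable \<mu> (count_space UNIV)"
proof (rule measurableI)
  fix X :: "'c set"
  obtain A where A: "finite A" "A \<subseteq> pairs_on V" "\<And>\<eta>. f \<eta> = f (\<eta> \<inter> A)"
    using f unfolding local_on_def by blast
  have "(\<lambda>\<omega>. f (opens \<omega>)) -` X \<inter> space \<mu> = (\<Union>\<zeta>\<in>{\<zeta> \<in> Pow A. f \<zeta> \<in> X}. {\<omega> \<in> space \<mu>. opens \<omega> \<inter> A = \<zeta>})"
    using A(3) by auto
  also have "\<dots> \<in> sets \<mu>"
    using A cylinder_sets[OF \<mu> A(1,2)] by (intro sets.finite_UN) auto
  finally show "(\<lambda>\<omega>. f (opens \<omega>)) -` X \<inter> space \<mu> \<in> sets \<mu>" .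
qed auto

lemma local_on_borel:
  fixes f :: "'v set set \<Rightarrow> real"
  assumes \<mu>: "sets \<mu> = sets (config_algebra V)" and f: "local_on V f"
  shows "(\<lambda>\<omega>. f (opens \<omega>)) \<in> borel_measurable \<mu>"
  using measurable_compose[OF local_on_measurable[OF \<mu> f], of "\<lambda>x. x" borel] by simp

lemma local_on_integrable:
  fixes f :: "'v set set \<Rightarrow> real"
  assumes \<mu>: "prob_space \<mu>" "sets \<mu> = sets (config_algebra V)" and f: "local_on V f"
  shows "integrable \<mu> (\<lambda>\<omega>. f (opens \<omega>))"
proof -
  interpret prob_space \<mu> by (rule \<mu>(1))
  obtain B where "\<And>\<eta>. \<bar>f \<eta>\<bar> \<le> B" using local_on_bounded[OF f] by blast
  thus ?thesis by (intro integrable_const_bound[of _ B] local_on_borel[OF \<mu>(2) f]) auto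
qed

lemma integral_marginals:
  assumes \<mu>: "prob_space \<mu>" "sets \<mu> = sets (config_algebra V)" and b: "0 < \<beta>"
    and m: "\<And>A \<zeta>. finite A \<Longrightarrow> A \<subseteq> pairs_on V \<Longrightarrow> \<zeta> \<subseteq> A \<Longrightarrow>
      measure \<mu> {\<omega> \<in> space \<mu>. opens \<omega> \<inter> A = \<zeta>} = marginal b \<beta> A \<zeta>"
    and f: "local_on V f"
  shows "(\<integral>\<omega>. f (opens \<omega>) \<partial>\<mu>) = ivE b \<beta> f"
proof -
  interpret prob_space \<mu> by (rule \<mu>(1))
  obtain A where A: "finite A" "A \<subseteq> pairs_on V" "\<And>\<eta>. f \<eta> = f (\<eta> \<inter> A)"
    using f unfolding local_on_def by blast
  let ?C = "\<lambda>\<zeta>. {\<omega> \<in> space \<mu>. opens \<omega> \<inter> A = \<zeta>}"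
  have "(\<integral>\<omega>. f (opens \<omega>) \<partial>\<mu>) = (\<integral>\<omega>. (\<Sum>\<zeta>\<in>Pow A. f \<zeta> * indicator (?C \<zeta>) \<omega>) \<partial>\<mu>)"
  proof (rule Bochner_Integration.integral_cong[OF refl])
    fix \<omega> assume w: "\<omega> \<in> space \<mu>"
    have "(\<Sum>\<zeta>\<in>Pow A. f \<zeta> * indicator (?C \<zeta>) \<omega>) = f (opens \<omega> \<inter> A)"
      using A(1) w by (subst sum.mono_neutral_right[of "Pow A" "{opens \<omega> \<inter> A}"]) (auto simp: indicator_def)
    thus "f (opens \<omega>) = (\<Sum>\<zeta>\<in>Pow A. f \<zeta> * indicator (?C \<zeta>) \<omega>)" using A(3)[of "opens \<omega>"] by simp
  qed
  also have "\<dots> = (\<Sum>\<zeta>\<in>Pow A. f \<zeta> * measure \<mu> (?C \<zeta>))"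
  proof (subst Bochner_Integration.integral_sum)
    fix \<zeta>
    show "integrable \<mu> (\<lambda>\<omega>. f \<zeta> * indicator (?C \<zeta>) \<omega>)"
      using cylinder_sets[OF \<mu>(2) A(1,2)]
      by (intro integrable_mult_right integrable_real_indicator) (auto simp: emeasure_eq_measure)
  next
    have I: "(\<integral>\<omega>. f \<zeta> * indicator (?C \<zeta>) \<omega> \<partial>\<mu>) = f \<zeta> * measure \<mu> (?C \<zeta>)" for \<zeta>
      using sets.Int_space_eq2[OF cylinder_sets[OF \<mu>(2) A(1,2), of \<zeta>]] by simp
    show "(\<Sum>\<zeta>\<in>Pow A. \<integral>\<omega>. f \<zeta> * indicator (?C \<zeta>) \<omega> \<partial>\<mu>) = (\<Sum>\<zeta>\<in>Pow A. f \<zeta> * measure \<mu> (?C \<zeta>))"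
      by (rule sum.cong[OF refl]) (rule I)
  qed
  also have "\<dots> = (\<Sum>\<zeta>\<in>Pow A. marginal b \<beta> A \<zeta> * f \<zeta>)"
    using m[OF A(1,2)] by (intro sum.cong) (auto simp: mult.commute)
  also have "\<dots> = ivE b \<beta> (\<lambda>\<eta>. f (\<eta> \<inter> A))" by (rule ivE_marginal[OF A(1,2) b, symmetric])
  also have "(\<lambda>\<eta>. f (\<eta> \<inter> A)) = f" using A(3) by auto
  finally show ?thesis .
qed

text \<open>Local functions converge by \<open>ivE_tendsto\<close>. A continuous function is
  uniformly close to a local one, and a three-part estimate transfers the convergence.\<close>

lemma weak_limit_integral:
  assumes \<mu>: "prob_space \<mu>" "sets \<mu> = sets (config_algebra V)" and b: "0 < \<beta>"
    and int: "\<And>f. local_on V f \<Longrightarrow> (\<integral>\<omega>. f (opens \<omega>) \<partial>\<mu>) = ivE b \<beta> f"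
    and S: "exhausting V S"
  shows "weak_limit V S (\<lambda>n. fk_finite (cluster_count b) J \<beta> q (S n)) \<mu>"
  unfolding weak_limit_def
proof (intro allI impI, elim conjE)
  fix f assume f: "continuous_map (config_topology V) euclideanreal f" "bounded (f ` configs V)"
  interpret prob_space \<mu> by (rule \<mu>(1))
  have fS: "finvol (S n)" for n using S by (auto simp: exhausting_def)
  have sp: "space \<mu> = configs V" by (rule space_config[OF \<mu>(2)])
  have app: "\<exists>A. finite A \<and> A \<subseteq> pairs_on V \<and> (\<forall>\<eta>. \<bar>f (cfg \<eta>) - f (cfg (\<eta> \<inter> A))\<bar> < \<epsilon>)" if "0 < \<epsilon>" for \<epsilon>
  proof -
    obtain A where A: "finite A" "A \<subseteq> pairs_on V"
      "\<forall>\<omega>\<in>configs V. \<forall>\<omega>'\<in>configs V. (\<forall>e\<in>A. \<omega> e = \<omega>' e) \<longrightarrow> \<bar>f \<omega> - f \<omega>'\<bar> < \<epsilon>"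
      using continuous_almost_local[OF f(1) \<open>0 < \<epsilon>\<close>] by blast
    have "\<bar>f (cfg \<eta>) - f (cfg (\<eta> \<inter> A))\<bar> < \<epsilon>" for \<eta>
      using A(2) by (intro A(3)[rule_format] cfg_configs) (auto simp: cfg_def)
    thus ?thesis using A by blast
  qed
  define Ak where "Ak k = (SOME A. finite A \<and> A \<subseteq> pairs_on V \<and> (\<forall>\<eta>. \<bar>f (cfg \<eta>) - f (cfg (\<eta> \<inter> A))\<bar> < 1 / real (Suc k)))" for k
  have Ak: "finite (Ak k)" "Ak k \<subseteq> pairs_on V" "\<And>\<eta>. \<bar>f (cfg \<eta>) - f (cfg (\<eta> \<inter> Ak k))\<bar> < 1 / real (Suc k)" for k
    using someI_ex[OF app[of "1 / real (Suc k)"]] unfolding Ak_def by auto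
  have loc: "local_on V (\<lambda>\<eta>. f (cfg (\<eta> \<inter> Ak k)))" for k by (rule local_on_Int[OF Ak(1,2)])
  \<comment> \<open>Continuity refers to the product topology, measurability to the product algebra;
    f is measurable as the pointwise limit of its local approximations.\<close>
  have fmeas: "f \<in> borel_measurable \<mu>"
  proof (rule borel_measurable_LIMSEQ_real)
    show "(\<lambda>\<omega>. f (cfg (opens \<omega> \<inter> Ak k))) \<in> borel_measurable \<mu>" for k
      by (rule local_on_borel[OF \<mu>(2) loc])
    fix \<omega> assume "\<omega> \<in> space \<mu>"
    hence w: "cfg (opens \<omega>) = \<omega>" using sp cfg_opens by simp
    have "(\<lambda>k. f (cfg (opens \<omega> \<inter> Ak k)) - f \<omega>) \<longlonglongrightarrow> 0"
    proof (rule Lim_null_comparison)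
      show "eventually (\<lambda>k. norm (f (cfg (opens \<omega> \<inter> Ak k)) - f \<omega>) \<le> 1 / real (Suc k)) sequentially"
        using Ak(3)[of "opens \<omega>"] w by (intro always_eventually allI) (simp add: abs_minus_commute less_imp_le)
      show "(\<lambda>k. 1 / real (Suc k)) \<longlonglongrightarrow> 0" by (rule LIMSEQ_Suc[OF lim_1_over_n])
    qed
    thus "(\<lambda>k. f (cfg (opens \<omega> \<inter> Ak k))) \<longlonglongrightarrow> f \<omega>" by (simp add: LIM_zero_iff)
  qed
  obtain B where B: "\<And>\<omega>. \<omega> \<in> configs V \<Longrightarrow> \<bar>f \<omega>\<bar> \<le> B" using f(2) by (auto simp: bounded_iff)
  have fint: "integrable \<mu> f"
    using B sp by (intro integrable_const_bound[of _ B] fmeas) auto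
  have "(\<lambda>n. P b (S n) \<beta> (\<lambda>\<eta>. f (cfg \<eta>))) \<longlonglongrightarrow> (\<integral>\<omega>. f \<omega> \<partial>\<mu>)"
  proof (rule LIMSEQ_I)
    fix r :: real assume r: "0 < r"
    then obtain k where k: "1 / real (Suc k) < r / 3" using reals_Archimedean[of "r / 3"] by (auto simp: inverse_eq_divide)
    let ?g = "\<lambda>\<eta>. f (cfg (\<eta> \<inter> Ak k))"
    have lim: "(\<lambda>n. P b (S n) \<beta> ?g) \<longlonglongrightarrow> ivE b \<beta> ?g"
      using filterlim_compose[OF ivE_tendsto[OF loc b] exhausting_filterlim[OF S]] .
    have "0 < r / 3" using r by simp
    from LIMSEQ_D[OF lim this] obtain N where N: "\<And>n. n \<ge> N \<Longrightarrow> norm (P b (S n) \<beta> ?g - ivE b \<beta> ?g) < r / 3"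
      by blast
    have 1: "\<bar>P b (S n) \<beta> (\<lambda>\<eta>. f (cfg \<eta>)) - P b (S n) \<beta> ?g\<bar> \<le> r / 3" for n
      unfolding expect_diff[symmetric]
      by (rule P_le_bound[OF fS b]) (use Ak(3) k in \<open>meson less_imp_le less_trans\<close>)
    have 2: "\<bar>(\<integral>\<omega>. f \<omega> \<partial>\<mu>) - ivE b \<beta> ?g\<bar> \<le> r / 3"
    proof -
      have "(\<integral>\<omega>. f \<omega> \<partial>\<mu>) - ivE b \<beta> ?g = (\<integral>\<omega>. f \<omega> - ?g (opens \<omega>) \<partial>\<mu>)"
        using fint local_on_integrable[OF \<mu> loc] int[OF loc] by simp
      also have "\<bar>\<dots>\<bar> \<le> (\<integral>\<omega>. \<bar>f \<omega> - ?g (opens \<omega>)\<bar> \<partial>\<mu>)" by (rule integral_abs_bound)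
      also have "\<dots> \<le> (\<integral>\<omega>. r / 3 \<partial>\<mu>)"
      proof (rule integral_mono)
        show "integrable \<mu> (\<lambda>\<omega>. \<bar>f \<omega> - ?g (opens \<omega>)\<bar>)"
          using fint local_on_integrable[OF \<mu> loc] by (intro integrable_abs Bochner_Integration.integrable_diff)
        fix \<omega> assume "\<omega> \<in> space \<mu>"
        hence "cfg (opens \<omega>) = \<omega>" using sp cfg_opens by simp
        thus "\<bar>f \<omega> - ?g (opens \<omega>)\<bar> \<le> r / 3" using Ak(3)[of "opens \<omega>" k] k by simp
      qed simp
      finally show ?thesis by (simp add: prob_space)
    qed
    show "\<exists>no. \<forall>n\<ge>no. norm (P b (S n) \<beta> (\<lambda>\<eta>. f (cfg \<eta>)) - (\<integral>\<omega>. f \<omega> \<partial>\<mu>)) < r"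
    proof (intro exI[of _ N] allI impI)
      fix n assume "n \<ge> N"
      from N[OF this] 1[of n] 2 show "norm (P b (S n) \<beta> (\<lambda>\<eta>. f (cfg \<eta>)) - (\<integral>\<omega>. f \<omega> \<partial>\<mu>)) < r"
        unfolding real_norm_def by linarith
    qed
  qed
  thus "(\<lambda>n. \<integral>\<omega>. f (extend_config V (S n) \<omega>) \<partial>fk_finite (cluster_count b) J \<beta> q (S n)) \<longlonglongrightarrow> (\<integral>\<omega>. f \<omega> \<partial>\<mu>)"
    using fk_finite_integral[OF fS b] by simp
qed

lemma exists_exhausting: "countable V \<Longrightarrow> \<exists>S. exhausting V S"
proof (cases "V = {}")
  case True
  thus ?thesis by (intro exI[of _ "\<lambda>_. {}"]) (auto simp: exhausting_def incseq_def)
next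
  case False
  assume c: "countable V"
  have "exhausting V (\<lambda>n. from_nat_into V ` {..n})"
    unfolding exhausting_def incseq_def
  proof (intro conjI allI impI equalityI subsetI)
    fix x assume "x \<in> V"
    then obtain n where "from_nat_into V n = x" using from_nat_into_surj[OF c] by blast
    thus "x \<in> (\<Union>n. from_nat_into V ` {..n})" by blast
  next
    fix x assume "x \<in> (\<Union>n. from_nat_into V ` {..n})"
    thus "x \<in> V" using from_nat_into[OF False] by auto
  qed auto
  thus ?thesis by blast
qed

text \<open>Indicators of finite-dimensional cylinders are local, hence continuous for the product
  of discrete topologies, so weak limits determine all cylinder probabilities.\<close>

lemma weak_limit_unique:
  assumes \<mu>: "prob_space \<mu>" "sets \<mu> = sets (config_algebra V)" and \<nu>: "prob_space \<nu>" "sets \<nu> = sets (config_algebra V)"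
    and wl: "weak_limit V S \<phi> \<mu>" "weak_limit V S \<phi> \<nu>"
  shows "\<mu> = \<nu>"
proof (rule measure_eqI_PiM_infinite)
  let ?M = "\<lambda>e::'v set. count_space (UNIV :: bool set)"
  show "sets \<mu> = sets (\<Pi>\<^sub>M e\<in>pairs_on V. ?M e)" "sets \<nu> = sets (\<Pi>\<^sub>M e\<in>pairs_on V. ?M e)"
    using \<mu> \<nu> by (simp_all add: config_algebra_def)
  interpret M: prob_space \<mu> by (rule \<mu>(1))
  interpret N: prob_space \<nu> by (rule \<nu>(1))
  show "finite_measure \<mu>" by unfold_locales
  fix X :: "'v set \<Rightarrow> bool set" and A assume A: "finite A" "A \<subseteq> pairs_on V"
  let ?U = "prod_emb (pairs_on V) ?M A (Pi\<^sub>E A X)"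
  define f where "f \<eta> = (of_bool (\<forall>e\<in>A. (e \<in> \<eta>) \<in> X e) :: real)" for \<eta>
  have loc: "local_on V f" by (rule local_onI[OF A]) (auto simp: f_def)
  have ind: "f (opens \<omega>) = indicator ?U \<omega>" if "\<omega> \<in> configs V" for \<omega>
  proof -
    have "\<omega> \<in> ?U \<longleftrightarrow> (\<forall>e\<in>A. \<omega> e \<in> X e)"
      using that A by (auto simp: prod_emb_def configs_def space_PiM PiE_def extensional_def restrict_def Pi_def)
    moreover have "(e \<in> opens \<omega>) = \<omega> e" if "e \<in> A" for e using that A by (auto simp: opens_def)
    ultimately show ?thesis by (auto simp: f_def indicator_def)
  qed
  have U: "?U \<in> sets (config_algebra V)"
    unfolding config_algebra_def using A by (intro sets_PiM_I) auto
  have bnd: "bounded ((\<lambda>\<omega>. f (opens \<omega>)) ` configs V)"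
    by (rule boundedI[of _ 1]) (auto simp: f_def)
  have "(\<integral>\<omega>. f (opens \<omega>) \<partial>\<mu>) = (\<integral>\<omega>. f (opens \<omega>) \<partial>\<nu>)"
  proof (rule LIMSEQ_unique)
    show "(\<lambda>n. \<integral>\<omega>. f (opens (extend_config V (S n) \<omega>)) \<partial>\<phi> n) \<longlonglongrightarrow> (\<integral>\<omega>. f (opens \<omega>) \<partial>\<mu>)"
      using wl(1) local_on_continuous[OF loc] bnd unfolding weak_limit_def by blast
    show "(\<lambda>n. \<integral>\<omega>. f (opens (extend_config V (S n) \<omega>)) \<partial>\<phi> n) \<longlonglongrightarrow> (\<integral>\<omega>. f (opens \<omega>) \<partial>\<nu>)"
      using wl(2) local_on_continuous[OF loc] bnd unfolding weak_limit_def by blast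
  qed
  moreover have "(\<integral>\<omega>. f (opens \<omega>) \<partial>\<mu>) = measure \<mu> ?U"
  proof -
    have "(\<integral>\<omega>. f (opens \<omega>) \<partial>\<mu>) = (\<integral>\<omega>. indicator ?U \<omega> \<partial>\<mu>)"
      by (rule Bochner_Integration.integral_cong) (auto simp: space_config[OF \<mu>(2)] ind)
    thus ?thesis using U \<mu> sets.sets_into_space[of ?U \<mu>] by (simp add: Int_absorb2)
  qed
  moreover have "(\<integral>\<omega>. f (opens \<omega>) \<partial>\<nu>) = measure \<nu> ?U"
  proof -
    have "(\<integral>\<omega>. f (opens \<omega>) \<partial>\<nu>) = (\<integral>\<omega>. indicator ?U \<omega> \<partial>\<nu>)"
      by (rule Bochner_Integration.integral_cong) (auto simp: space_config[OF \<nu>(2)] ind)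
    thus ?thesis using U \<nu> sets.sets_into_space[of ?U \<nu>] by (simp add: Int_absorb2)
  qed
  ultimately show "emeasure \<mu> ?U = emeasure \<nu> ?U"
    by (simp add: M.emeasure_eq_measure N.emeasure_eq_measure)
qed

text \<open>Resolves the definite description in \<open>infinite_volume\<close>. Countability
  provides an exhausting sequence, along which weak limits are unique; from here on the measure is
  accessed through \<open>ivE\<close>.\<close>

theorem infinite_volume_characterization:
  assumes b: "0 < \<beta>" and V: "countable V"
  shows "prob_space (fk_inf b \<beta>)" "sets (fk_inf b \<beta>) = sets (config_algebra V)"
    "\<And>f. local_on V f \<Longrightarrow> (\<integral>\<omega>. f (opens \<omega>) \<partial>(fk_inf b \<beta>)) = ivE b \<beta> f"
proof -
  obtain \<mu> where \<mu>: "prob_space \<mu>" "sets \<mu> = sets (config_algebra V)"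
    and m: "\<forall>A \<zeta>. finite A \<and> A \<subseteq> pairs_on V \<and> \<zeta> \<subseteq> A \<longrightarrow>
      measure \<mu> {\<omega> \<in> space \<mu>. opens \<omega> \<inter> A = \<zeta>} = marginal b \<beta> A \<zeta>"
    using exists_infinite_volume[OF b, of b] by (elim exE conjE)
  have int: "(\<integral>\<omega>. f (opens \<omega>) \<partial>\<mu>) = ivE b \<beta> f" if "local_on V f" for f
    by (rule integral_marginals[OF \<mu> b _ that]) (use m in simp)
  have wl: "\<forall>S. exhausting V S \<longrightarrow> weak_limit V S (\<lambda>n. fk_finite (cluster_count b) J \<beta> q (S n)) \<mu>"
    using weak_limit_integral[OF \<mu> b int] by blast
  obtain S where S: "exhausting V S" using exists_exhausting[OF V] by blast
  have "fk_inf b \<beta> = \<mu>" unfolding infinite_volume_def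
  proof (rule the_equality)
    show "prob_space \<mu> \<and> sets \<mu> = sets (config_algebra V) \<and>
      (\<forall>S. exhausting V S \<longrightarrow> weak_limit V S (\<lambda>n. fk_finite (cluster_count b) J \<beta> q (S n)) \<mu>)"
      using \<mu> wl by blast
    fix \<nu> assume "prob_space \<nu> \<and> sets \<nu> = sets (config_algebra V) \<and>
      (\<forall>S. exhausting V S \<longrightarrow> weak_limit V S (\<lambda>n. fk_finite (cluster_count b) J \<beta> q (S n)) \<nu>)"
    thus "\<nu> = \<mu>" using weak_limit_unique[OF _ _ \<mu>] wl S by blast
  qed
  thus "prob_space (fk_inf b \<beta>)" "sets (fk_inf b \<beta>) = sets (config_algebra V)"
    "\<And>f. local_on V f \<Longrightarrow> (\<integral>\<omega>. f (opens \<omega>) \<partial>(fk_inf b \<beta>)) = ivE b \<beta> f"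
    using \<mu> int by auto
qed

end

section \<open>Infinite clusters\<close>

text \<open>The path is cut after its last edge in F; the remaining piece starts in S.\<close>

lemma conn_remove_finite:
  assumes "conn \<eta> v y" "\<And>a b. {a, b} \<in> F \<Longrightarrow> a \<in> S \<and> b \<in> S"
  shows "conn (\<eta> - F) v y \<or> (\<exists>s\<in>S. conn (\<eta> - F) s y)"
  using assms(1)
proof (induction rule: conn_induct)
  case (step y z)
  show ?case
  proof (cases "{y, z} \<in> F")
    case True
    hence "z \<in> S" using assms(2) by blast
    thus ?thesis using conn_refl[of "\<eta> - F" z] by blast
  next
    case False
    hence "conn (\<eta> - F) y z" using step(2) by (intro conn_edge) simp
    thus ?thesis using step(3) conn_trans[of "\<eta> - F" _ y z] by blast
  qed
qed simp

context fk_lattice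
begin

lemma E_V: "finvol S \<Longrightarrow> E S \<subseteq> E V"
  by (rule EJ_mono) simp

definition near_edges :: "nat \<Rightarrow> 'v \<Rightarrow> 'v set set" where
  "near_edges n x = E (bal x (n + M))"

lemma near_edges: "x \<in> V \<Longrightarrow> finite (near_edges n x)" "x \<in> V \<Longrightarrow> near_edges n x \<subseteq> E V"
  "x \<in> V \<Longrightarrow> near_edges n x \<subseteq> pairs_on V"
proof -
  show 1: "x \<in> V \<Longrightarrow> near_edges n x \<subseteq> E V" unfolding near_edges_def by (rule E_V[OF finvol_bal])
  show "x \<in> V \<Longrightarrow> finite (near_edges n x)" unfolding near_edges_def using finvol_bal finite_EJ by blast
  show "x \<in> V \<Longrightarrow> near_edges n x \<subseteq> pairs_on V" using 1 EJ_pairs by blast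
qed

lemma reach_near: "x \<in> V \<Longrightarrow> \<eta> \<subseteq> E V \<Longrightarrow> reach n x (\<eta> \<inter> near_edges n x) \<longleftrightarrow> reach n x \<eta>"
  unfolding near_edges_def by (rule reach_local) auto

text \<open>The intersection makes this a local function on all configurations; on those contained
  in \<open>E V\<close> it is the indicator of \<open>reach\<close>.\<close>

definition reach_ind :: "nat \<Rightarrow> 'v \<Rightarrow> 'v set set \<Rightarrow> real" where
  "reach_ind n x \<eta> = of_bool (reach n x (\<eta> \<inter> near_edges n x))"

lemma local_on_reach_ind: "x \<in> V \<Longrightarrow> local_on V (reach_ind n x)"
  by (rule local_onI[OF near_edges(1,3)[of x n]]) (auto simp: reach_ind_def)

lemma mono_reach_ind: "mono (reach_ind n x)"
proof (rule monoI)
  fix \<eta> \<eta>' :: "'v set set" assume "\<eta> \<subseteq> \<eta>'"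
  hence "\<eta> \<inter> near_edges n x \<subseteq> \<eta>' \<inter> near_edges n x" by auto
  from reach_mono[OF this, of n x] show "reach_ind n x \<eta> \<le> reach_ind n x \<eta>'" unfolding reach_ind_def by simp
qed

lemma near_edges_vol: "near_edges n x \<subseteq> E (vol n x)"
  unfolding near_edges_def vol_def by (rule EJ_mono[OF bal_mono]) simp

lemma P_reach_ind:
  assumes "x \<in> V" "finvol S"
  shows "P b S \<beta> (reach_ind n x) = P b S \<beta> (\<lambda>\<eta>. of_bool (reach n x \<eta>))"
proof (rule expect_cong)
  fix \<eta> assume "\<eta> \<subseteq> E S"
  hence "\<eta> \<subseteq> E V" using E_V[OF assms(2)] by auto
  thus "reach_ind n x \<eta> = of_bool (reach n x \<eta>)" unfolding reach_ind_def using reach_near[OF assms(1)] by simp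
qed

lemma ivE_reach_le_theta:
  assumes "x \<in> V" "0 < \<beta>"
  shows "ivE True \<beta> (reach_ind n x) \<le> theta n x \<beta>"
proof -
  have "ivE True \<beta> (reach_ind n x) \<le> P True (vol n x) \<beta> (reach_ind n x)"
  proof (rule ivE_le_P_wired[OF finvol_vol[OF assms(1)] assms(2) local_on_reach_ind[OF assms(1)] mono_reach_ind])
    show "near_edges n x \<subseteq> pairs_on (vol n x)" using near_edges_vol EJ_pairs by blast
  qed (simp add: reach_ind_def)
  thus ?thesis unfolding theta_def P_reach_ind[OF assms(1) finvol_vol[OF assms(1)]] .
qed

text \<open>Given a volume S, choose m so large that \<open>vol m x\<close> contains it. The event
  at distance m implies the one at distance n, and shrinking the volume from \<open>vol m x\<close>
  to S raises the wired probability.\<close>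

lemma theta_lower_imp_ivE:
  assumes x: "x \<in> V" and b: "0 < \<beta>" and t: "\<And>m. \<epsilon> \<le> theta m x \<beta>"
  shows "\<epsilon> \<le> ivE True \<beta> (reach_ind n x)"
proof (rule tendsto_lowerbound[OF ivE_tendsto[OF local_on_reach_ind[OF x] b] _ finite_subsets_at_top_neq_bot])
  have "\<epsilon> \<le> P True S \<beta> (reach_ind n x)" if S: "finvol S" "vol n x \<subseteq> S" for S
  proof -
    obtain m where m: "n \<le> m" "S \<subseteq> vol m x"
    proof -
      \<comment> \<open>The sum of all distances serves as a crude bound for their maximum.\<close>
      define m where "m = n + (\<Sum>y\<in>S. d x y)"
      have "d x y \<le> m" if "y \<in> S" for y
        using member_le_sum[of y S "d x"] that S by (simp add: m_def)
      hence "S \<subseteq> vol m x" using S by (force simp: vol_def bal_def)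
      thus ?thesis using that[of m] by (simp add: m_def)
    qed
    have "\<epsilon> \<le> theta m x \<beta>" by (rule t)
    also have "\<dots> \<le> P True (vol m x) \<beta> (reach_ind n x)"
      unfolding theta_def P_reach_ind[OF x finvol_vol[OF x]]
      by (rule P_mono_fun[OF finvol_vol[OF x] b]) (auto dest: reach_antimono[OF m(1)])
    also have "\<dots> \<le> P True S \<beta> (reach_ind n x)"
    proof (rule P_wired_decreasing[OF S(1) finvol_vol[OF x] m(2) b mono_reach_ind])
      show "near_edges n x \<subseteq> pairs_on S" using near_edges_vol EJ_pairs pairs_on_mono[OF S(2)] by blast
    qed (simp add: reach_ind_def)
    finally show ?thesis .
  qed
  thus "eventually (\<lambda>S. \<epsilon> \<le> P True S \<beta> (reach_ind n x)) (finite_subsets_at_top V)"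
    by (intro eventually_mono[OF eventually_finvol_superset[OF finvol_vol[OF x]]]) blast
qed

lemma bounded_iff_finite:
  assumes "v \<in> V" "\<eta> \<subseteq> E V"
  shows "(\<exists>n. \<not> reach n v \<eta>) \<longleftrightarrow> finite {y. conn \<eta> v y}"
proof
  assume "\<exists>n. \<not> reach n v \<eta>"
  then obtain n where n: "\<not> reach n v \<eta>" by blast
  have "{y. conn \<eta> v y} \<subseteq> bal v n"
  proof
    fix y assume y: "y \<in> {y. conn \<eta> v y}"
    have "\<eta> \<subseteq> pairs_on V" using assms(2) EJ_pairs by blast
    hence "y \<in> V" using conn_in[of \<eta> v y V] y assms(1) by simp
    moreover have "\<not> n \<le> d v y" using n y calculation unfolding reach_def by blast
    ultimately show "y \<in> bal v n" by (simp add: bal_def)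
  qed
  thus "finite {y. conn \<eta> v y}" using finvol_bal[OF assms(1)] finite_subset by blast
next
  assume fin: "finite {y. conn \<eta> v y}"
  have "\<not> reach (Suc (\<Sum>y\<in>{y. conn \<eta> v y}. d v y)) v \<eta>"
  proof
    assume "reach (Suc (\<Sum>y\<in>{y. conn \<eta> v y}. d v y)) v \<eta>"
    then obtain y where y: "Suc (\<Sum>y\<in>{y. conn \<eta> v y}. d v y) \<le> d v y" "conn \<eta> v y" by (auto simp: reach_def)
    thus False using member_le_sum[of y "{y. conn \<eta> v y}" "d v"] fin by simp
  qed
  thus "\<exists>n. \<not> reach n v \<eta>" by blast
qed

text \<open>Absence of infinite clusters is insensitive to the edges in S: each cluster is covered
  by finitely many clusters of the configuration without them.\<close>

lemma all_bounded_remove_iff: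
  assumes S: "finvol S" and "\<eta> \<subseteq> E V"
  shows "(\<forall>v\<in>V. \<exists>n. \<not> reach n v (\<eta> - E S)) \<longleftrightarrow> (\<forall>v\<in>V. \<exists>n. \<not> reach n v \<eta>)"
proof -
  have sub: "\<eta> - E S \<subseteq> E V" using assms by auto
  have "finite {y. conn \<eta> v y}" if fin: "\<And>v. v \<in> V \<Longrightarrow> finite {y. conn (\<eta> - E S) v y}" and v: "v \<in> V" for v
  proof (rule finite_subset)
    show "{y. conn \<eta> v y} \<subseteq> {y. conn (\<eta> - E S) v y} \<union> (\<Union>s\<in>S. {y. conn (\<eta> - E S) s y})"
    proof
      fix y assume "y \<in> {y. conn \<eta> v y}"
      hence "conn \<eta> v y" by simp
      hence "conn (\<eta> - E S) v y \<or> (\<exists>s\<in>S. conn (\<eta> - E S) s y)"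
        by (rule conn_remove_finite) (use S in \<open>simp add: E_iff\<close>)
      thus "y \<in> {y. conn (\<eta> - E S) v y} \<union> (\<Union>s\<in>S. {y. conn (\<eta> - E S) s y})" by blast
    qed
    show "finite ({y. conn (\<eta> - E S) v y} \<union> (\<Union>s\<in>S. {y. conn (\<eta> - E S) s y}))"
      using fin v S by auto
  qed
  moreover have "\<not> reach n v (\<eta> - E S)" if "\<not> reach n v \<eta>" for n v
    using that reach_mono[of "\<eta> - E S" \<eta> n v] by auto
  ultimately show ?thesis using bounded_iff_finite[OF _ sub] bounded_iff_finite[OF _ assms(2)] by metis
qed

text \<open>An increasing event of a finite volume \<open>S\<close> retains at least its free probability in \<open>S\<close>
  conditionally on whatever happens off \<open>S\<close>.\<close>

lemma ivE_free_condition: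
  assumes S: "finvol S" and b: "0 < \<beta>" and f: "mono f" "A \<subseteq> E S" "\<And>\<eta>. f \<eta> = f (\<eta> \<inter> A)"
    and g: "local_on V g" "\<And>\<eta>. 0 \<le> g \<eta>"
  shows "P False S \<beta> f * ivE False \<beta> (\<lambda>\<eta>. g (\<eta> - E S)) \<le> ivE False \<beta> (\<lambda>\<eta>. f \<eta> * g (\<eta> - E S))"
proof -
  obtain B where B: "finite B" "B \<subseteq> pairs_on V" "\<And>\<eta>. g \<eta> = g (\<eta> \<inter> B)" using g(1) unfolding local_on_def by blast
  have finA: "finite A" "A \<subseteq> pairs_on V"
    using f(2) finite_EJ[of S J] E_V[OF S] EJ_pairs[of J V] S by (auto intro: finite_subset)
  have lf: "local_on V f"
  proof (rule local_onI[OF finA])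
    show "f \<eta> = f (\<eta> \<inter> A)" for \<eta> by (rule f(3))
  qed
  have lg: "local_on V (\<lambda>\<eta>. g (\<eta> - E S))"
  proof (rule local_onI[OF B(1,2)])
    fix \<eta>
    have "(\<eta> \<inter> B - E S) \<inter> B = (\<eta> - E S) \<inter> B" by auto
    thus "g (\<eta> - E S) = g (\<eta> \<inter> B - E S)" using B(3) by metis
  qed
  have lfg: "local_on V (\<lambda>\<eta>. f \<eta> * g (\<eta> - E S))" by (rule local_on_binop[OF lf lg])
  have "P False S \<beta> f * P False S' \<beta> (\<lambda>\<eta>. g (\<eta> - E S)) \<le> P False S' \<beta> (\<lambda>\<eta>. f \<eta> * g (\<eta> - E S))"
    if S': "finvol S'" "S \<subseteq> S'" for S'
  proof -
    have "f (\<eta> \<inter> E S) = f \<eta>" for \<eta>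
    proof -
      have "\<eta> \<inter> E S \<inter> A = \<eta> \<inter> A" using f(2) by auto
      thus ?thesis using f(3)[of "\<eta> \<inter> E S"] f(3)[of \<eta>] by simp
    qed
    moreover have "increasing_on (E S) f" using f(1) by (auto intro!: mono_onI dest: monoD)
    ultimately show ?thesis using P_free_volume[OF S S' b, of f g] g(2) by simp
  qed
  hence ev: "eventually (\<lambda>S'. P False S \<beta> f * P False S' \<beta> (\<lambda>\<eta>. g (\<eta> - E S))
      \<le> P False S' \<beta> (\<lambda>\<eta>. f \<eta> * g (\<eta> - E S))) (finite_subsets_at_top V)"
    by (intro eventually_mono[OF eventually_finvol_superset[OF S]]) blast
  show ?thesis
    by (rule tendsto_le[OF finite_subsets_at_top_neq_bot ivE_tendsto[OF lfg b]
      tendsto_mult_left[OF ivE_tendsto[OF lg b]] ev])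
qed

lemma measure_local:
  assumes b: "0 < \<beta>" and V: "countable V" and Q: "local_on V (\<lambda>\<eta>. of_bool (Q \<eta>) :: real)"
  shows "{\<omega> \<in> space (fk_inf w \<beta>). Q (opens \<omega>)} \<in> sets (fk_inf w \<beta>)"
    "measure (fk_inf w \<beta>) {\<omega> \<in> space (fk_inf w \<beta>). Q (opens \<omega>)} = ivE w \<beta> (\<lambda>\<eta>. of_bool (Q \<eta>))"
proof -
  let ?\<mu> = "fk_inf w \<beta>"
  note \<mu> = infinite_volume_characterization[OF b V, where b = w]
  have "(\<lambda>\<omega>. of_bool (Q (opens \<omega>)) :: real) \<in> borel_measurable ?\<mu>" by (rule local_on_borel[OF \<mu>(2) Q])
  hence "(\<lambda>\<omega>. of_bool (Q (opens \<omega>)) :: real) -` {1} \<inter> space ?\<mu> \<in> sets ?\<mu>"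
    by (rule measurable_sets) simp
  moreover have eq: "(\<lambda>\<omega>. of_bool (Q (opens \<omega>)) :: real) -` {1} \<inter> space ?\<mu> = {\<omega> \<in> space ?\<mu>. Q (opens \<omega>)}"
    by (auto simp: of_bool_def split: if_splits)
  ultimately show s: "{\<omega> \<in> space ?\<mu>. Q (opens \<omega>)} \<in> sets ?\<mu>" by simp
  have "ivE w \<beta> (\<lambda>\<eta>. of_bool (Q \<eta>)) = (\<integral>\<omega>. of_bool (Q (opens \<omega>)) \<partial>?\<mu>)" by (rule \<mu>(3)[OF Q, symmetric])
  also have "\<dots> = (\<integral>\<omega>. indicator {\<omega> \<in> space ?\<mu>. Q (opens \<omega>)} \<omega> \<partial>?\<mu>)"
    by (rule Bochner_Integration.integral_cong) (auto simp: indicator_def)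
  also have "\<dots> = measure ?\<mu> {\<omega> \<in> space ?\<mu>. Q (opens \<omega>)}"
    using sets.Int_space_eq2[OF s] by simp
  finally show "measure ?\<mu> {\<omega> \<in> space ?\<mu>. Q (opens \<omega>)} = ivE w \<beta> (\<lambda>\<eta>. of_bool (Q \<eta>))" ..
qed

text \<open>D is the absence of infinite clusters. Being a tail event, it can be written with
  countably many local events that look only at edges off S. Each of these satisfies the bound by
  \<open>ivE_free_condition\<close>, which then passes to the limit.\<close>

lemma free_condition_tail:
  assumes b: "0 < \<beta>" and V: "countable V" and x: "x \<in> V" and S: "finvol S" "bal x (n + M) \<subseteq> S"
  defines "\<mu> \<equiv> fk_inf False \<beta>"
  defines "D \<equiv> {\<omega> \<in> space \<mu>. \<forall>v\<in>V. \<exists>n. \<not> reach n v (opens \<omega> \<inter> E V)}"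
    and "A \<equiv> {\<omega> \<in> space \<mu>. reach n x (opens \<omega> \<inter> E V)}"
  shows "D \<in> sets \<mu>" "A \<in> sets \<mu>" "P False S \<beta> (reach_ind n x) * measure \<mu> D \<le> measure \<mu> (A \<inter> D)"
proof -
  interpret prob_space \<mu> unfolding \<mu>_def by (rule infinite_volume_characterization(1)[OF b V])
  note ml = measure_local[OF b V, where w = False, folded \<mu>_def]
  have nA: "near_edges n x \<subseteq> E S" unfolding near_edges_def by (rule EJ_mono[OF S(2)])
  \<comment> \<open>No vertex within distance k of x is connected to distance m from itself, a
    condition on finitely many edges.\<close>
  define Q where "Q k m \<eta> \<longleftrightarrow> (\<forall>v\<in>bal x k. \<not> reach m v (\<eta> \<inter> near_edges m v))" for k m \<eta>
  have finV: "finite (bal x k)" "bal x k \<subseteq> V" for k using finvol_bal[OF x] by auto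
  have Aeq: "A = {\<omega> \<in> space \<mu>. reach n x (opens \<omega> \<inter> near_edges n x)}"
  proof -
    have "reach n x (opens \<omega> \<inter> E V) \<longleftrightarrow> reach n x (opens \<omega> \<inter> near_edges n x)" for \<omega>
    proof -
      have "opens \<omega> \<inter> E V \<inter> near_edges n x = opens \<omega> \<inter> near_edges n x" using near_edges(2)[OF x] by auto
      thus ?thesis using reach_near[OF x, of "opens \<omega> \<inter> E V" n] by simp
    qed
    thus ?thesis unfolding A_def by simp
  qed
  have lQ: "local_on V (\<lambda>\<eta>. of_bool (Q k m \<eta>) :: real)" for k m
  proof (rule local_onI[of "\<Union>v\<in>bal x k. near_edges m v"])
    show "finite (\<Union>v\<in>bal x k. near_edges m v)" "(\<Union>v\<in>bal x k. near_edges m v) \<subseteq> pairs_on V"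
      using near_edges finV[of k] by blast+
    fix \<eta>
    have "\<eta> \<inter> (\<Union>v\<in>bal x k. near_edges m v) \<inter> near_edges m v = \<eta> \<inter> near_edges m v" if "v \<in> bal x k" for v
      using that by auto
    thus "of_bool (Q k m \<eta>) = (of_bool (Q k m (\<eta> \<inter> (\<Union>v\<in>bal x k. near_edges m v))) :: real)"
      by (simp add: Q_def)
  qed
  have lQS: "local_on V (\<lambda>\<eta>. of_bool (Q k m (\<eta> - E S)) :: real)" for k m
  proof -
    obtain B where B: "finite B" "B \<subseteq> pairs_on V" "\<And>\<eta>. (of_bool (Q k m \<eta>) :: real) = of_bool (Q k m (\<eta> \<inter> B))"
      using lQ[of k m] unfolding local_on_def by blast
    show ?thesis
    proof (rule local_onI[OF B(1,2)])
      fix \<eta>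
      have "(\<eta> \<inter> B - E S) \<inter> B = (\<eta> - E S) \<inter> B" by auto
      thus "of_bool (Q k m (\<eta> - E S)) = (of_bool (Q k m (\<eta> \<inter> B - E S)) :: real)" using B(3) by metis
    qed
  qed
  let ?G = "\<lambda>k m. {\<omega> \<in> space \<mu>. Q k m (opens \<omega> - E S)}"
  have G: "?G k m \<in> sets \<mu>" for k m by (rule ml(1)[OF lQS])
  have lA: "local_on V (\<lambda>\<eta>. of_bool (reach n x (\<eta> \<inter> near_edges n x)) :: real)"
    using local_on_reach_ind[OF x, of n] by (simp add: reach_ind_def[abs_def])
  show Am: "A \<in> sets \<mu>" unfolding Aeq by (rule ml(1)[OF lA])
  have Q_reach: "Q k m (opens \<omega> - E S) \<longleftrightarrow> (\<forall>v\<in>bal x k. \<not> reach m v (opens \<omega> \<inter> E V - E S))" for k m \<omega>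
  proof -
    have "reach m v ((opens \<omega> - E S) \<inter> near_edges m v) \<longleftrightarrow> reach m v (opens \<omega> \<inter> E V - E S)" if "v \<in> bal x k" for v
    proof -
      have v: "v \<in> V" using that finV by blast
      have "(opens \<omega> - E S) \<inter> near_edges m v = (opens \<omega> \<inter> E V - E S) \<inter> near_edges m v"
        using near_edges(2)[OF v, of m] by auto
      thus ?thesis using reach_near[OF v, of "opens \<omega> \<inter> E V - E S" m] by auto
    qed
    thus ?thesis by (simp add: Q_def)
  qed
  \<comment> \<open>By \<open>all_bounded_remove_iff\<close> the event can be read off the
    configuration with the edges of S removed. One m works for all vertices of a finite ball, so the
    union over m stands inside the intersection over k.\<close>
  have D_eq: "D = (\<Inter>k. \<Union>m. ?G k m)"
  proof (intro equalityI subsetI)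
    fix \<omega> assume w: "\<omega> \<in> D"
    let ?\<eta> = "opens \<omega> \<inter> E V - E S"
    have all: "\<forall>v\<in>V. \<exists>m. \<not> reach m v ?\<eta>"
      using w all_bounded_remove_iff[OF S(1), of "opens \<omega> \<inter> E V"] by (simp add: D_def)
    have "\<exists>m. \<forall>v\<in>bal x k. \<not> reach m v ?\<eta>" for k
    proof -
      obtain h where h: "\<And>v. v \<in> V \<Longrightarrow> \<not> reach (h v) v ?\<eta>" using all by metis
      have "\<not> reach (\<Sum>v\<in>bal x k. h v) v ?\<eta>" if v: "v \<in> bal x k" for v
        using reach_antimono[OF member_le_sum[OF v, of h]] h[of v] v finV[of k] by auto
      thus ?thesis by blast
    qed
    thus "\<omega> \<in> (\<Inter>k. \<Union>m. ?G k m)" using w by (auto simp: Q_reach D_def)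
  next
    fix \<omega> assume w: "\<omega> \<in> (\<Inter>k. \<Union>m. ?G k m)"
    let ?\<eta> = "opens \<omega> \<inter> E V - E S"
    have "\<exists>m. \<not> reach m v ?\<eta>" if v: "v \<in> V" for v
    proof -
      have "v \<in> bal x (d x v)" using v by (simp add: bal_def)
      moreover obtain m where "\<omega> \<in> ?G (d x v) m" using w by blast
      ultimately show ?thesis using Q_reach by blast
    qed
    hence "\<forall>v\<in>V. \<exists>m. \<not> reach m v (opens \<omega> \<inter> E V)"
      using all_bounded_remove_iff[OF S(1), of "opens \<omega> \<inter> E V"] by simp
    thus "\<omega> \<in> D" using w by (auto simp: D_def)
  qed
  show Dm: "D \<in> sets \<mu>" unfolding D_eq using G by auto
  have inc: "incseq (?G k)" for k
  proof (rule incseq_SucI, rule subsetI)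
    fix m \<omega> assume "\<omega> \<in> ?G k m"
    thus "\<omega> \<in> ?G k (Suc m)" unfolding mem_Collect_eq Q_reach
      using reach_antimono[of m "Suc m"] by auto
  qed
  have dec: "decseq (\<lambda>k. \<Union>m. ?G k m)"
  proof (rule decseq_SucI, rule subsetI)
    fix k \<omega> assume "\<omega> \<in> (\<Union>m. ?G (Suc k) m)"
    thus "\<omega> \<in> (\<Union>m. ?G k m)" unfolding Q_def using bal_mono[of k "Suc k" x] by auto
  qed
  let ?p = "P False S \<beta> (reach_ind n x)"
  have 1: "?p * measure \<mu> (?G k m) \<le> measure \<mu> (A \<inter> ?G k m)" for k m
  proof -
    have "?p * ivE False \<beta> (\<lambda>\<eta>. of_bool (Q k m (\<eta> - E S)))
        \<le> ivE False \<beta> (\<lambda>\<eta>. reach_ind n x \<eta> * of_bool (Q k m (\<eta> - E S)))"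
      by (rule ivE_free_condition[OF S(1) b mono_reach_ind nA _ lQ]) (auto simp: reach_ind_def)
    moreover have "(\<lambda>\<eta>. reach_ind n x \<eta> * of_bool (Q k m (\<eta> - E S)))
        = (\<lambda>\<eta>. of_bool (reach n x (\<eta> \<inter> near_edges n x) \<and> Q k m (\<eta> - E S)))"
      by (auto simp: reach_ind_def)
    moreover have lAQ: "local_on V (\<lambda>\<eta>. of_bool (reach n x (\<eta> \<inter> near_edges n x) \<and> Q k m (\<eta> - E S)) :: real)"
      using local_on_binop[OF lA lQS[of k m], of times] by (simp add: of_bool_conj)
    moreover have "A \<inter> ?G k m = {\<omega> \<in> space \<mu>. reach n x (opens \<omega> \<inter> near_edges n x) \<and> Q k m (opens \<omega> - E S)}"
      unfolding Aeq by auto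
    ultimately show ?thesis using ml(2)[OF lQS, of k m] ml(2)[OF lAQ] by simp
  qed
  have 2: "?p * measure \<mu> (\<Union>m. ?G k m) \<le> measure \<mu> (A \<inter> (\<Union>m. ?G k m))" for k
  proof (rule LIMSEQ_le)
    show "(\<lambda>m. ?p * measure \<mu> (?G k m)) \<longlonglongrightarrow> ?p * measure \<mu> (\<Union>m. ?G k m)"
      by (intro tendsto_mult_left finite_Lim_measure_incseq inc) (use G in auto)
    have "incseq (\<lambda>m. A \<inter> ?G k m)" using inc[of k] unfolding incseq_def by blast
    hence "(\<lambda>m. measure \<mu> (A \<inter> ?G k m)) \<longlonglongrightarrow> measure \<mu> (\<Union>m. A \<inter> ?G k m)"
      by (intro finite_Lim_measure_incseq) (use G Am in auto)
    moreover have "(\<Union>m. A \<inter> ?G k m) = A \<inter> (\<Union>m. ?G k m)" by auto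
    ultimately show "(\<lambda>m. measure \<mu> (A \<inter> ?G k m)) \<longlonglongrightarrow> measure \<mu> (A \<inter> (\<Union>m. ?G k m))" by simp
  qed (use 1 in auto)
  show "?p * measure \<mu> D \<le> measure \<mu> (A \<inter> D)"
  proof (rule LIMSEQ_le)
    show "(\<lambda>k. ?p * measure \<mu> (\<Union>m. ?G k m)) \<longlonglongrightarrow> ?p * measure \<mu> D"
      unfolding D_eq by (intro tendsto_mult_left finite_Lim_measure_decseq dec) (use G in auto)
    have "decseq (\<lambda>k. A \<inter> (\<Union>m. ?G k m))" using dec unfolding decseq_def by blast
    hence "(\<lambda>k. measure \<mu> (A \<inter> (\<Union>m. ?G k m))) \<longlonglongrightarrow> measure \<mu> (\<Inter>k. A \<inter> (\<Union>m. ?G k m))"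
      by (intro finite_Lim_measure_decseq) (use G Am in auto)
    moreover have "(\<Inter>k. A \<inter> (\<Union>m. ?G k m)) = A \<inter> D" unfolding D_eq by auto
    ultimately show "(\<lambda>k. measure \<mu> (A \<inter> (\<Union>m. ?G k m))) \<longlonglongrightarrow> measure \<mu> (A \<inter> D)" by simp
  qed (use 2 in auto)
qed

text \<open>On D the cluster of x is finite, so the events \<open>A n \<inter> D\<close> decrease to
  the empty set. Conditioning on the tail event D keeps the probability of \<open>A n\<close> at
  least \<epsilon>, hence \<epsilon> times the measure of D is at most 0.\<close>

theorem AE_infinite_cluster:
  assumes b: "0 < \<beta>" and V: "countable V" and x: "x \<in> V" and e: "0 < \<epsilon>"
    and reach: "\<And>n. \<epsilon> \<le> ivE False \<beta> (reach_ind n x)"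
  shows "AE \<omega> in fk_inf False \<beta>. \<exists>C\<in>clusters V \<omega>. infinite C"
proof -
  define \<mu> where "\<mu> = fk_inf False \<beta>"
  interpret prob_space \<mu> unfolding \<mu>_def by (rule infinite_volume_characterization(1)[OF b V])
  define D where "D = {\<omega> \<in> space \<mu>. \<forall>v\<in>V. \<exists>n. \<not> reach n v (opens \<omega> \<inter> E V)}"
  define A where "A n = {\<omega> \<in> space \<mu>. reach n x (opens \<omega> \<inter> E V)}" for n
  note tail = free_condition_tail[OF b V x, folded \<mu>_def, folded D_def A_def]
  have Dm: "D \<in> sets \<mu>" by (rule tail(1)[OF finvol_bal[OF x] order.refl])
  have Am: "A n \<in> sets \<mu>" for n by (rule tail(2)[OF finvol_bal[OF x] order.refl])
  have "\<epsilon> * measure \<mu> D \<le> measure \<mu> (A n \<inter> D)" for n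
  proof -
    have "ivE False \<beta> (reach_ind n x) * measure \<mu> D \<le> measure \<mu> (A n \<inter> D)"
    proof (rule tendsto_upperbound[OF tendsto_mult_right[OF ivE_tendsto[OF local_on_reach_ind[OF x] b]]
          _ finite_subsets_at_top_neq_bot])
      show "eventually (\<lambda>S. P False S \<beta> (reach_ind n x) * measure \<mu> D \<le> measure \<mu> (A n \<inter> D)) (finite_subsets_at_top V)"
        by (rule eventually_mono[OF eventually_finvol_superset[OF finvol_bal[OF x, of "n + M"]]]) (use tail(3) in blast)
    qed
    moreover have "\<epsilon> * measure \<mu> D \<le> ivE False \<beta> (reach_ind n x) * measure \<mu> D"
      by (rule mult_right_mono[OF reach]) simp
    ultimately show ?thesis by linarith
  qed
  moreover have "(\<lambda>n. measure \<mu> (A n \<inter> D)) \<longlonglongrightarrow> measure \<mu> (\<Inter>n. A n \<inter> D)"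
  proof (rule finite_Lim_measure_decseq)
    show "decseq (\<lambda>n. A n \<inter> D)"
      by (rule decseq_SucI) (auto simp: A_def intro: reach_antimono[OF le_SucI[OF order.refl]])
  qed (use Am Dm in auto)
  moreover have "(\<Inter>n. A n \<inter> D) = {}" using x by (auto simp: A_def D_def)
  ultimately have "\<epsilon> * measure \<mu> D \<le> 0"
    using LIMSEQ_le_const[of "\<lambda>n. measure \<mu> (A n \<inter> D)" 0 "\<epsilon> * measure \<mu> D"] by auto
  hence "measure \<mu> D = 0" using e measure_nonneg[of \<mu> D] by (simp add: mult_le_0_iff)
  hence null: "emeasure \<mu> D = 0" by (simp add: emeasure_eq_measure)
  have "\<exists>C\<in>clusters V \<omega>. infinite C" if w: "\<omega> \<in> space \<mu>" "\<omega> \<notin> D" for \<omega>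
  proof -
    obtain v where v: "v \<in> V" "\<And>n. reach n v (opens \<omega> \<inter> E V)" using w by (auto simp: D_def)
    have "infinite {y. conn (opens \<omega> \<inter> E V) v y}"
      using bounded_iff_finite[OF v(1), of "opens \<omega> \<inter> E V"] v(2) by auto
    moreover have "{y. conn (opens \<omega> \<inter> E V) v y} \<subseteq> {y. conn (opens \<omega>) v y}"
      using conn_mono[of "opens \<omega> \<inter> E V" "opens \<omega>"] by auto
    ultimately have "infinite {y. conn (opens \<omega>) v y}" using finite_subset by blast
    moreover have "{y. conn (opens \<omega>) v y} \<in> clusters V \<omega>"
      unfolding clusters_comps comps_def opens_def using v(1) by blast
    ultimately show ?thesis by blast
  qed
  hence "{\<omega> \<in> space \<mu>. \<not> (\<exists>C\<in>clusters V \<omega>. infinite C)} \<subseteq> D" by blast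
  thus ?thesis unfolding \<mu>_def[symmetric] using null Dm by (rule AE_I)
qed

text \<open>Almost surely no pair with vanishing coupling is open, so that the path may be assumed to use
  edges of \<open>E V\<close> only.\<close>

lemma measure_connected_le_theta:
  assumes b: "0 < \<beta>" and V: "countable V" and x: "x \<in> V" and y: "y \<in> V"
  shows "measure (fk_inf True \<beta>) {\<omega> \<in> space (fk_inf True \<beta>). open_connected V \<omega> x y} \<le> theta (d x y) x \<beta>"
proof -
  define \<mu> where "\<mu> = fk_inf True \<beta>"
  interpret prob_space \<mu> unfolding \<mu>_def by (rule infinite_volume_characterization(1)[OF b V])
  let ?n = "d x y"
  let ?A = "{\<omega> \<in> space \<mu>. reach ?n x (opens \<omega> \<inter> near_edges ?n x)}"
  let ?N = "\<lambda>e. {\<omega> \<in> space \<mu>. e \<in> opens \<omega>}"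
  let ?N' = "\<Union>e\<in>pairs_on V - E V. ?N e"
  have lA: "local_on V (\<lambda>\<eta>. of_bool (reach ?n x (\<eta> \<inter> near_edges ?n x)) :: real)"
    using local_on_reach_ind[OF x, of ?n] by (simp add: reach_ind_def[abs_def])
  have Am: "?A \<in> sets \<mu>" unfolding \<mu>_def by (rule measure_local(1)[OF b V lA])
  have "measure \<mu> ?A = ivE True \<beta> (reach_ind ?n x)"
    unfolding \<mu>_def measure_local(2)[OF b V lA] by (simp add: reach_ind_def[abs_def])
  hence A: "measure \<mu> ?A \<le> theta ?n x \<beta>" using ivE_reach_le_theta[OF x b] by simp
  have N: "?N e \<in> null_sets \<mu>" if e: "e \<in> pairs_on V - E V" for e
  proof -
    have le: "local_on V (\<lambda>\<eta>. of_bool (e \<in> \<eta>) :: real)" using e by (intro local_on_edge) simp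
    have "ivE True \<beta> (\<lambda>\<eta>. of_bool (e \<in> \<eta>)) \<le> ivE True \<beta> (\<lambda>_. 0)"
      by (rule ivE_mono[OF le local_on_const b]) (use e in auto)
    hence "measure \<mu> (?N e) \<le> 0" unfolding \<mu>_def measure_local(2)[OF b V le] by (simp add: ivE_const[OF b])
    hence "measure \<mu> (?N e) = 0" using measure_nonneg[of \<mu> "?N e"] by linarith
    moreover have "?N e \<in> sets \<mu>" unfolding \<mu>_def by (rule measure_local(1)[OF b V le])
    ultimately show ?thesis by (simp add: null_sets_def emeasure_eq_measure)
  qed
  have "countable (pairs_on V)"
  proof (rule countable_subset)
    show "pairs_on V \<subseteq> (\<lambda>(x, y). {x, y}) ` (V \<times> V)" by (auto simp: pairs_on_def)
  qed (use V in auto)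
  hence N': "?N' \<in> null_sets \<mu>" using N by (intro null_sets_UN') auto
  have sub: "{\<omega> \<in> space \<mu>. open_connected V \<omega> x y} \<subseteq> ?A \<union> ?N'"
  proof
    fix \<omega> assume w: "\<omega> \<in> {\<omega> \<in> space \<mu>. open_connected V \<omega> x y}"
    show "\<omega> \<in> ?A \<union> ?N'"
    proof (cases "opens \<omega> \<subseteq> E V")
      case True
      have "conn (opens \<omega>) x y" using w by (simp add: open_connected_conn opens_def)
      hence "reach ?n x (opens \<omega>)" using y by (auto simp: reach_def)
      thus ?thesis using reach_near[OF x True] w by simp
    next
      case False
      then obtain e where "e \<in> opens \<omega>" "e \<notin> E V" by blast
      moreover have "e \<in> pairs_on V" using calculation by (simp add: opens_def)
      ultimately show ?thesis using w by blast
    qed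
  qed
  have "measure \<mu> {\<omega> \<in> space \<mu>. open_connected V \<omega> x y} \<le> measure \<mu> (?A \<union> ?N')"
    by (rule finite_measure_mono[OF sub]) (use Am N' in auto)
  also have "\<dots> = measure \<mu> ?A" using Am N' by (rule measure_Un_null_set)
  finally show ?thesis using A unfolding \<mu>_def by linarith
qed

end

section \<open>Comparison of the free and wired measures\<close>

context fk_lattice
begin

abbreviation edge_open :: "'v set \<Rightarrow> 'v set set \<Rightarrow> real" where
  "edge_open e \<equiv> (\<lambda>\<eta>. of_bool (e \<in> \<eta>))"

lemma mono_edge_open: "mono (edge_open e)"
  by (auto intro!: monoI)

lemma shift_pairs:
  assumes "t \<in> shifts" "e \<in> pairs_on V"
  shows "shift t ` e \<in> pairs_on V"
proof -
  have "shift t ` e \<in> pairs_on (shift t ` V)" unfolding pairs_on_shift using assms by blast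
  moreover have "shift t ` V \<subseteq> V" using V_shift[OF assms(1)] by blast
  ultimately show ?thesis using pairs_on_mono by blast
qed

text \<open>Translation maps the directed family of finite volumes onto itself, so the limit may be
  computed along translated volumes.\<close>

lemma ivE_shift_edge:
  assumes t: "t \<in> shifts" and e: "e \<in> pairs_on V" and b: "0 < \<beta>"
  shows "ivE w \<beta> (edge_open (shift t ` e)) = ivE w \<beta> (edge_open e)"
proof -
  have "filterlim (\<lambda>S. shift t ` S) (finite_subsets_at_top V) (finite_subsets_at_top V)"
    unfolding filterlim_def le_filter_def eventually_filtermap eventually_finite_subsets_at_top
  proof (intro allI impI, elim exE conjE)
    fix Q X assume X: "finite X" "X \<subseteq> V" and Q: "\<forall>Y. finite Y \<and> X \<subseteq> Y \<and> Y \<subseteq> V \<longrightarrow> Q Y"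
    show "\<exists>X. finite X \<and> X \<subseteq> V \<and> (\<forall>Y. finite Y \<and> X \<subseteq> Y \<and> Y \<subseteq> V \<longrightarrow> Q (shift t ` Y))"
    proof (intro exI[of _ "shift (- t) ` X"] conjI allI impI)
      show "shift (- t) ` X \<subseteq> V" by (rule V_shift_image[OF shifts_neg[OF t] X(2)])
      fix Y assume Y: "finite Y \<and> shift (- t) ` X \<subseteq> Y \<and> Y \<subseteq> V"
      have "shift t ` (shift (- t) ` X) \<subseteq> shift t ` Y" using Y by (intro image_mono) blast
      moreover have "shift t ` (shift (- t) ` X) = X" by (simp add: image_image)
      ultimately show "Q (shift t ` Y)" using Q Y V_shift_image[OF t, of Y] by simp
    qed (use X in simp)
  qed
  from filterlim_compose[OF ivE_tendsto[OF local_on_edge[OF shift_pairs[OF t e]] b, of w] this]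
  have "((\<lambda>S. P w (shift t ` S) \<beta> (edge_open (shift t ` e))) \<longlongrightarrow> ivE w \<beta> (edge_open (shift t ` e)))
      (finite_subsets_at_top V)" .
  moreover have "P w (shift t ` S) \<beta> (edge_open (shift t ` e)) = P w S \<beta> (edge_open e)" if "finvol S" for S
  proof -
    have "shift t ` e \<in> shift_edges t \<eta> \<longleftrightarrow> e \<in> \<eta>" for \<eta>
    proof
      assume "shift t ` e \<in> shift_edges t \<eta>"
      hence "shift (- t) ` (shift t ` e) \<in> shift_edges (- t) (shift_edges t \<eta>)" by (rule imageI)
      moreover have "shift (- t) ` (shift t ` e) = e" by (simp add: image_image)
      ultimately show "e \<in> \<eta>" unfolding shift_shift_edges by simp
    qed (rule imageI)
    thus ?thesis using P_shift[OF t, of S] that by simp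
  qed
  hence "eventually (\<lambda>S. P w (shift t ` S) \<beta> (edge_open (shift t ` e)) = P w S \<beta> (edge_open e)) (finite_subsets_at_top V)"
    by (rule eventually_mono[OF eventually_finvol])
  ultimately have "((\<lambda>S. P w S \<beta> (edge_open e)) \<longlongrightarrow> ivE w \<beta> (edge_open (shift t ` e))) (finite_subsets_at_top V)"
    by (rule Lim_transform_eventually)
  thus ?thesis by (rule ivE_unique[OF local_on_edge[OF e] b, symmetric])
qed

definition gap :: "real \<Rightarrow> 'v set \<Rightarrow> real" where
  "gap \<beta> e = ivE True \<beta> (edge_open e) - ivE False \<beta> (edge_open e)"

lemma gap_nonneg: "0 < \<beta> \<Longrightarrow> e \<in> pairs_on V \<Longrightarrow> 0 \<le> gap \<beta> e"
  unfolding gap_def using ivE_le_param[OF local_on_edge mono_edge_open, of e \<beta> \<beta> False True] by simp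

lemma gap_outside:
  assumes "0 < \<beta>" "e \<in> pairs_on V" "e \<notin> E V"
  shows "gap \<beta> e = 0"
proof -
  have "ivE w \<beta> (edge_open e) \<le> 0" for w
  proof -
    have "ivE w \<beta> (edge_open e) \<le> ivE w \<beta> (\<lambda>_. 0)"
      by (rule ivE_mono[OF local_on_edge[OF assms(2)] local_on_const assms(1)]) (use assms(3) in auto)
    thus ?thesis by (simp add: ivE_const[OF assms(1)])
  qed
  moreover have "0 \<le> ivE w \<beta> (edge_open e)" for w
    using ivE_nonneg[OF local_on_edge[OF assms(2)] assms(1)] by simp
  ultimately have "ivE w \<beta> (edge_open e) = 0" for w by (rule order_antisym)
  thus ?thesis by (simp add: gap_def)
qed

text \<open>The two free energies differ by a boundary term; the mean value theorem yields a parameter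
  at which their derivatives, hence the edge densities, are close.\<close>

lemma exists_small_gap:
  assumes a: "0 < a" "a < b" and S: "finvol S"
  shows "\<exists>\<beta>>a. \<beta> < b \<and> (\<Sum>e\<in>E S. gap \<beta> e) \<le> b / (b - a) * (real (card (boundary V J S)) * ln q)"
proof -
  let ?h = "\<lambda>\<beta>. logZ True S \<beta> - logZ False S \<beta>"
  let ?h' = "\<lambda>\<beta>. (\<Sum>e\<in>E S. edge_rate \<beta> e * P True S \<beta> (edge_open e)) - (\<Sum>e\<in>E S. edge_rate \<beta> e * P False S \<beta> (edge_open e))"
  let ?c = "real (card (boundary V J S)) * ln q"
  have "\<exists>\<beta>>a. \<beta> < b \<and> ?h b - ?h a = (b - a) * ?h' \<beta>"
    by (rule MVT2[OF a(2)]) (use a in \<open>auto intro!: DERIV_diff logZ_deriv[OF S]\<close>)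
  then obtain \<beta> where \<beta>: "a < \<beta>" "\<beta> < b" "?h b - ?h a = (b - a) * ?h' \<beta>" by blast
  have b0: "0 < \<beta>" "0 < b" using \<beta> a by auto
  have "(\<Sum>e\<in>E S. gap \<beta> e) / b \<le> ?h' \<beta>"
    unfolding sum_divide_distrib sum_subtractf[symmetric]
  proof (rule sum_mono)
    fix e assume e: "e \<in> E S"
    hence eS: "e \<in> pairs_on S" using EJ_pairs by blast
    hence eV: "e \<in> pairs_on V" using S pairs_on_mono by blast
    \<comment> \<open>The finite-volume densities enclose the infinite-volume ones, so
      \<open>gap\<close> is at most their difference in S.\<close>
    have "ivE True \<beta> (edge_open e) \<le> P True S \<beta> (edge_open e)"
      by (rule ivE_le_P_wired[OF S b0(1) local_on_edge[OF eV] mono_edge_open, of "{e}"]) (use eS in auto)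
    moreover have "P False S \<beta> (edge_open e) \<le> ivE False \<beta> (edge_open e)"
      by (rule P_free_le_ivE[OF S b0(1) local_on_edge[OF eV] mono_edge_open])
    ultimately have g: "gap \<beta> e \<le> P True S \<beta> (edge_open e) - P False S \<beta> (edge_open e)" by (simp add: gap_def)
    have "gap \<beta> e / b = 1 / b * gap \<beta> e" by simp
    also have "\<dots> \<le> edge_rate \<beta> e * (P True S \<beta> (edge_open e) - P False S \<beta> (edge_open e))"
    proof (rule mult_mono[OF _ g])
      have "1 / b \<le> 1 / \<beta>" using b0 \<beta> by (simp add: frac_le)
      thus "1 / b \<le> edge_rate \<beta> e" using edge_rate_ge[OF b0(1) e] by linarith
      hence "0 \<le> 1 / b" using b0 by simp
      thus "0 \<le> edge_rate \<beta> e" using \<open>1 / b \<le> edge_rate \<beta> e\<close> by linarith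
    qed (rule gap_nonneg[OF b0(1) eV])
    finally show "gap \<beta> e / b \<le> edge_rate \<beta> e * P True S \<beta> (edge_open e) - edge_rate \<beta> e * P False S \<beta> (edge_open e)"
      by (simp add: right_diff_distrib)
  qed
  moreover have "(b - a) * ?h' \<beta> \<le> ?c"
    using logZ_wired_free[OF S b0(2)] logZ_wired_free[OF S a(1)] \<beta>(3) by linarith
  hence "?h' \<beta> \<le> ?c / (b - a)" using a by (simp add: pos_le_divide_eq mult.commute)
  ultimately have "(\<Sum>e\<in>E S. gap \<beta> e) / b \<le> ?c / (b - a)" by linarith
  hence "(\<Sum>e\<in>E S. gap \<beta> e) \<le> b / (b - a) * ?c" using b0 by (simp add: pos_divide_le_eq mult.commute)
  thus ?thesis using \<beta> by blast
qed

text \<open>Adding edges one by one turns small gaps into closeness of all local functions: with h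
  counting open edges in A, the function C h - f is increasing for large C, so its free mean is at
  most its wired mean, and the wired-free difference of f is at most C times the sum of the gaps.
  Since \<beta> lies between a and b, monotonicity in the parameter leads from a to \<beta> for the
  wired and from \<beta> to b for the free mean.\<close>

lemma ivE_wired_le_free:
  assumes f: "local_on V f" "mono f" and a: "0 < a" "a < b"
    and small: "\<And>A \<epsilon>. finite A \<Longrightarrow> A \<subseteq> E V \<Longrightarrow> 0 < \<epsilon> \<Longrightarrow> \<exists>\<beta>>a. \<beta> < b \<and> (\<forall>e\<in>A. gap \<beta> e \<le> \<epsilon>)"
  shows "ivE True a f \<le> ivE False b f"
proof (rule field_le_epsilon)
  fix \<epsilon> :: real assume e: "0 < \<epsilon>"
  obtain A where A: "finite A" "A \<subseteq> pairs_on V" "\<And>\<eta>. f \<eta> = f (\<eta> \<inter> A)"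
    using f(1) unfolding local_on_def by blast
  obtain B where B: "0 \<le> B" "\<And>\<eta>. \<bar>f \<eta>\<bar> \<le> B" using local_on_bounded[OF f(1)] by blast
  \<comment> \<open>2 B bounds the variation of f, so one additional open edge in A compensates any
    increase of f.\<close>
  define C where "C = 2 * B"
  have C: "0 \<le> C" using B by (simp add: C_def)
  \<comment> \<open>The summand 1 keeps the denominator positive when A is empty or C = 0.\<close>
  define \<delta> where "\<delta> = \<epsilon> / (C * real (card A) + 1)"
  have d: "0 < \<delta>" using e C by (simp add: \<delta>_def add_nonneg_pos)
  obtain \<beta> where \<beta>: "a < \<beta>" "\<beta> < b" "\<forall>e\<in>A \<inter> E V. gap \<beta> e \<le> \<delta>"
    using small[of "A \<inter> E V" \<delta>] A d by auto
  have b0: "0 < \<beta>" using \<beta> a by simp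
  define h where "h \<eta> = (\<Sum>e\<in>A. edge_open e \<eta>)" for \<eta>
  have hc: "h \<eta> = real (card (\<eta> \<inter> A))" for \<eta>
    unfolding h_def using A(1) by (simp add: Int_commute)
  have lh: "local_on V h" unfolding hc[abs_def] by (rule local_onI[OF A(1,2)]) simp
  have lCh: "local_on V (\<lambda>\<eta>. C * h \<eta>)" using local_on_binop[OF local_on_const lh, of times C] by simp
  have lg: "local_on V (\<lambda>\<eta>. C * h \<eta> - f \<eta>)" by (rule local_on_binop[OF lCh f(1)])
  have mg: "mono (\<lambda>\<eta>. C * h \<eta> - f \<eta>)"
  proof (rule monoI)
    fix \<eta> \<eta>' :: "'v set set" assume s: "\<eta> \<subseteq> \<eta>'"
    show "C * h \<eta> - f \<eta> \<le> C * h \<eta>' - f \<eta>'"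
    proof (cases "\<eta> \<inter> A = \<eta>' \<inter> A")
      case True
      thus ?thesis using A(3)[of \<eta>] A(3)[of \<eta>'] by (simp add: hc)
    next
      case False
      hence "card (\<eta> \<inter> A) < card (\<eta>' \<inter> A)" using s A(1) by (intro psubset_card_mono) auto
      hence "h \<eta> + 1 \<le> h \<eta>'" by (simp add: hc)
      hence "C * (h \<eta> + 1) \<le> C * h \<eta>'" using C by (rule mult_left_mono)
      thus ?thesis using B(2)[of \<eta>] B(2)[of \<eta>'] by (simp add: C_def algebra_simps)
    qed
  qed
  have "ivE False \<beta> (\<lambda>\<eta>. C * h \<eta> - f \<eta>) \<le> ivE True \<beta> (\<lambda>\<eta>. C * h \<eta> - f \<eta>)"
    by (rule ivE_le_param[OF lg mg b0]) auto
  hence "ivE True \<beta> f - ivE False \<beta> f \<le> C * (ivE True \<beta> h - ivE False \<beta> h)"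
    unfolding ivE_diff[OF lCh f(1) b0] ivE_cmult[OF lh b0] by (simp add: algebra_simps)
  also have "ivE True \<beta> h - ivE False \<beta> h = (\<Sum>e\<in>A. gap \<beta> e)"
  proof -
    have "ivE w \<beta> h = (\<Sum>e\<in>A. ivE w \<beta> (edge_open e))" for w
      unfolding h_def[abs_def] by (rule ivE_sum[OF _ b0]) (use A local_on_edge in blast)
    thus ?thesis by (simp add: gap_def sum_subtractf)
  qed
  also have "(\<Sum>e\<in>A. gap \<beta> e) \<le> (\<Sum>e\<in>A. \<delta>)"
  proof (rule sum_mono)
    fix e assume eA: "e \<in> A"
    show "gap \<beta> e \<le> \<delta>"
    proof (cases "e \<in> E V")
      case False
      hence "gap \<beta> e = 0" using gap_outside[OF b0] eA A by blast
      thus ?thesis using d by simp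
    qed (use \<beta> eA in blast)
  qed
  hence "C * (\<Sum>e\<in>A. gap \<beta> e) \<le> C * (\<Sum>e\<in>A. \<delta>)" using C by (rule mult_left_mono)
  also have "\<dots> = C * real (card A) * \<delta>" by simp
  also have "\<dots> \<le> (C * real (card A) + 1) * \<delta>" using d by (intro mult_right_mono) auto
  also have "\<dots> = \<epsilon>"
  proof -
    have "0 < C * real (card A) + 1" using C by (simp add: add_nonneg_pos)
    thus ?thesis by (simp add: \<delta>_def)
  qed
  finally have "ivE True \<beta> f \<le> ivE False \<beta> f + \<epsilon>" by simp
  moreover have "ivE True a f \<le> ivE True \<beta> f" by (rule ivE_le_param[OF f a(1)]) (use \<beta> in auto)
  moreover have "ivE False \<beta> f \<le> ivE False b f" by (rule ivE_le_param[OF f b0]) (use \<beta> in auto)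
  ultimately show "ivE True a f \<le> ivE False b f + \<epsilon>" by linarith
qed

end

section \<open>Integer translations of the plane and boxes\<close>

definition lattice_point :: "int \<Rightarrow> int \<Rightarrow> point" where
  "lattice_point i j = (of_int i, of_int j)"

definition lattice_points :: "point set" where
  "lattice_points = {lattice_point i j | i j. True}"

lemma lattice_point_add: "lattice_point i j + lattice_point k l = lattice_point (i + k) (j + l)"
  by (simp add: lattice_point_def)

lemma lattice_point_minus: "- lattice_point i j = lattice_point (- i) (- j)"
  by (simp add: lattice_point_def)

lemma lattice_point_eq_iff: "lattice_point i j = lattice_point k l \<longleftrightarrow> i = k \<and> j = l"
  by (simp add: lattice_point_def)

lemma lattice_point_in: "lattice_point i j \<in> lattice_points"
  by (auto simp: lattice_points_def)

locale fk_Z2 = fk_lattice V J q lattice_points d M R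
  for V :: "point set" and J :: "point \<Rightarrow> point \<Rightarrow> real" and q :: real
    and d :: "point \<Rightarrow> point \<Rightarrow> nat" and M :: nat and R :: "point set"
begin

lemma uniform_shift:
  assumes "finite W" "W \<subseteq> V"
  shows "\<exists>K\<ge>0. \<forall>x\<in>W. \<exists>r\<in>R. \<exists>k l. \<bar>k\<bar> \<le> K \<and> \<bar>l\<bar> \<le> K \<and> x = r + lattice_point k l"
proof -
  have "\<forall>x\<in>W. \<exists>p. \<exists>r\<in>R. x = r + lattice_point (fst p) (snd p)"
  proof
    fix x assume "x \<in> W"
    then obtain r t where r: "r \<in> R" "t \<in> lattice_points" "x = r + t" using R(3) assms(2) by blast
    then obtain i j where "t = lattice_point i j" by (auto simp: lattice_points_def)
    hence "x = r + lattice_point (fst (i, j)) (snd (i, j))" using r by simp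
    thus "\<exists>p. \<exists>r\<in>R. x = r + lattice_point (fst p) (snd p)" using r(1) by blast
  qed
  then obtain p where p: "\<And>x. x \<in> W \<Longrightarrow> \<exists>r\<in>R. x = r + lattice_point (fst (p x)) (snd (p x))" by metis
  let ?K = "\<Sum>x\<in>W. \<bar>fst (p x)\<bar> + \<bar>snd (p x)\<bar>"
  have bound: "\<bar>fst (p x)\<bar> \<le> ?K" "\<bar>snd (p x)\<bar> \<le> ?K" if "x \<in> W" for x
    using member_le_sum[of x W "\<lambda>x. \<bar>fst (p x)\<bar> + \<bar>snd (p x)\<bar>"] assms(1) that by auto
  show ?thesis
  proof (intro exI[of _ ?K] conjI ballI)
    show "0 \<le> ?K" by (rule sum_nonneg) auto
    fix x assume x: "x \<in> W"
    from p[OF x] obtain r where r: "r \<in> R" "x = r + lattice_point (fst (p x)) (snd (p x))" by blast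
    show "\<exists>r\<in>R. \<exists>k l. \<bar>k\<bar> \<le> ?K \<and> \<bar>l\<bar> \<le> ?K \<and> x = r + lattice_point k l"
      by (rule bexI[OF _ r(1)], rule exI[of _ "fst (p x)"], rule exI[of _ "snd (p x)"], intro conjI bound[OF x] r(2))
  qed
qed

definition box :: "int \<Rightarrow> point set" where
  "box N = (\<lambda>(r, i, j). r + lattice_point i j) ` (R \<times> {0..<N} \<times> {0..<N})"

lemma box_I: "r \<in> R \<Longrightarrow> 0 \<le> i \<Longrightarrow> i < N \<Longrightarrow> 0 \<le> j \<Longrightarrow> j < N \<Longrightarrow> r + lattice_point i j \<in> box N"
  unfolding box_def by (intro image_eqI[of _ _ "(r, i, j)"]) auto

lemma finvol_box: "finvol (box N)"
proof
  show "finite (box N)" unfolding box_def using R(1) by (intro finite_imageI finite_cartesian_product) auto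
  show "box N \<subseteq> V" unfolding box_def using R(2) V_shift[OF lattice_point_in] by fastforce
qed

text \<open>K bounds the lattice displacements occurring in the balls of radius M around the
  representatives. A vertex whose cell is at least K cells away from the sides has all its
  neighbours in the box, so the boundary lies in a frame of N^2 - (N - 2 K)^2 \<le> 4 K N
  cells.\<close>

lemma card_boundary_box: "\<exists>K\<ge>0. \<forall>N\<ge>2 * K. real (card (boundary V J (box N))) \<le> real (card R) * (4 * of_int K * of_int N)"
proof -
  have "finite (\<Union>r\<in>R. bal r M)"
    using R(1) by (rule finite_UN_I) (use R(2) finvol_bal in blast)
  moreover have "(\<Union>r\<in>R. bal r M) \<subseteq> V" by (auto simp: bal_def)
  ultimately obtain K where K: "0 \<le> K" "\<forall>x\<in>\<Union>r\<in>R. bal r M. \<exists>r\<in>R. \<exists>k l. \<bar>k\<bar> \<le> K \<and> \<bar>l\<bar> \<le> K \<and> x = r + lattice_point k l"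
    by (rule uniform_shift[THEN exE]) (elim conjE)
  have "real (card (boundary V J (box N))) \<le> real (card R) * (4 * of_int K * of_int N)" if N: "2 * K \<le> N" for N
  proof -
    let ?I = "{0..<N} \<times> {0..<N}" and ?I' = "{K..<N - K} \<times> {K..<N - K}"
    have "boundary V J (box N) \<subseteq> (\<lambda>(r, i, j). r + lattice_point i j) ` (R \<times> (?I - ?I'))"
    proof
      fix x assume x: "x \<in> boundary V J (box N)"
      then obtain r i j where r: "r \<in> R" "(i, j) \<in> ?I" "x = r + lattice_point i j"
        by (auto simp: boundary_def box_def)
      obtain y where y: "y \<in> V" "y \<notin> box N" "0 < J x y" using x by (auto simp: boundary_def)
      have "(i, j) \<notin> ?I'"
      proof
        assume ij: "(i, j) \<in> ?I'"
        let ?t = "lattice_point i j"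
        have rV: "r \<in> V" using r R by auto
        have "- ?t \<in> lattice_points" by (simp add: lattice_point_minus lattice_point_in)
        hence yV: "y - ?t \<in> V" using V_shift[of "- ?t" y] y by simp
        have "0 < J r (y - ?t)" using J_shift[OF lattice_point_in rV yV, of i j] y r by simp
        hence "y - ?t \<in> bal r M" using J_range[OF rV yV] yV by (simp add: bal_def)
        hence "y - ?t \<in> (\<Union>r\<in>R. bal r M)" using r(1) by blast
        then obtain r' k l where k: "r' \<in> R" "\<bar>k\<bar> \<le> K" "\<bar>l\<bar> \<le> K" "y - ?t = r' + lattice_point k l"
          using K(2)[rule_format] by blast
        have "y = r' + (lattice_point k l + ?t)" using k(4) by (metis add.assoc diff_add_cancel)
        hence "y = r' + lattice_point (k + i) (l + j)" by (simp add: lattice_point_add)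
        moreover have "0 \<le> k + i" "k + i < N" "0 \<le> l + j" "l + j < N" using k ij by auto
        ultimately show False using box_I[OF k(1)] y(2) by blast
      qed
      thus "x \<in> (\<lambda>(r, i, j). r + lattice_point i j) ` (R \<times> (?I - ?I'))"
        using r by (intro image_eqI[of _ _ "(r, i, j)"]) auto
    qed
    moreover have fin: "finite (R \<times> (?I - ?I'))" using R(1) by auto
    ultimately have "card (boundary V J (box N)) \<le> card (R \<times> (?I - ?I'))"
      by (meson card_image_le card_mono finite_imageI le_trans)
    also have "\<dots> = card R * (card ?I - card ?I')"
      using K(1) by (subst card_cartesian_product, subst card_Diff_subset) auto
    finally have "real (card (boundary V J (box N))) \<le> real (card R * (card ?I - card ?I'))" by (rule of_nat_mono)
    also have "real (card R * (card ?I - card ?I')) = real (card R) * (real (card ?I) - real (card ?I'))"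
    proof -
      have "card ?I' \<le> card ?I" using K(1) by (intro card_mono) auto
      thus ?thesis by (simp add: of_nat_diff)
    qed
    also have "\<dots> = real (card R) * (of_int N * of_int N - of_int (N - 2 * K) * of_int (N - 2 * K))"
      using N K(1) by (simp add: card_cartesian_product)
    also have "\<dots> \<le> real (card R) * (4 * of_int K * of_int N)"
      by (intro mult_left_mono) (auto simp: algebra_simps)
    finally show ?thesis .
  qed
  thus ?thesis using K(1) by blast
qed

text \<open>The translates of e by vectors at least L away from the sides of the box remain inside
  it, are pairwise distinct and all have the same gap; there are (N - 2 L)^2 of them.\<close>

lemma sum_gap_box:
  assumes b: "0 < \<beta>" and e: "e \<in> E V"
    and L: "\<And>x. x \<in> e \<Longrightarrow> \<exists>r\<in>R. \<exists>k l. \<bar>k\<bar> \<le> L \<and> \<bar>l\<bar> \<le> L \<and> x = r + lattice_point k l" and N: "2 * L \<le> N"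
  shows "(of_int N - 2 * of_int L)\<^sup>2 * gap \<beta> e \<le> (\<Sum>e\<in>E (box N). gap \<beta> e)"
proof -
  let ?I = "{L..<N - L} \<times> {L..<N - L}" and ?s = "\<lambda>(i, j). shift (lattice_point i j) ` e"
  have eV: "e \<in> pairs_on V" using e EJ_pairs by blast
  obtain u v where uv: "e = {u, v}" "u \<in> V" "v \<in> V" "u \<noteq> v" "0 < J u v"
    by (rule E_cases[OF e order.refl])
  have inj: "inj_on ?s ?I"
  proof (rule inj_onI, clarify)
    fix i j i' j' assume "shift (lattice_point i j) ` e = shift (lattice_point i' j') ` e"
    hence "{u + lattice_point i j, v + lattice_point i j} = {u + lattice_point i' j', v + lattice_point i' j'}"
      using uv by simp
    hence "lattice_point i j = lattice_point i' j' \<or>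
      (u + lattice_point i j = v + lattice_point i' j' \<and> v + lattice_point i j = u + lattice_point i' j')"
      by (auto simp: doubleton_eq_iff)
    thus "i = i' \<and> j = j'"
    proof
      assume "lattice_point i j = lattice_point i' j'"
      thus ?thesis by (simp add: lattice_point_eq_iff)
    next
      \<comment> \<open>If the endpoints were swapped, the two translations t, t' would satisfy t -
        t' = t' - t, hence t = t'.\<close>
      assume "u + lattice_point i j = v + lattice_point i' j' \<and> v + lattice_point i j = u + lattice_point i' j'"
      thus ?thesis by (cases u, cases v) (auto simp: lattice_point_def)
    qed
  qed
  have sub: "?s ` ?I \<subseteq> E (box N)"
  proof
    fix e' assume "e' \<in> ?s ` ?I"
    then obtain i j where ij: "(i, j) \<in> ?I" "e' = {u + lattice_point i j, v + lattice_point i j}"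
      using uv(1) by auto
    have "x + lattice_point i j \<in> box N" if x: "x \<in> e" for x
    proof -
      obtain r k l where k: "r \<in> R" "\<bar>k\<bar> \<le> L" "\<bar>l\<bar> \<le> L" "x = r + lattice_point k l" using L[OF x] by blast
      have "x + lattice_point i j = r + lattice_point (k + i) (l + j)"
        using k(4) by (simp add: add.assoc lattice_point_add)
      moreover have "0 \<le> k + i" "k + i < N" "0 \<le> l + j" "l + j < N" using k ij by auto
      ultimately show ?thesis using box_I[OF k(1)] by simp
    qed
    moreover have "0 < J (u + lattice_point i j) (v + lattice_point i j)"
      using J_shift[OF lattice_point_in uv(2,3)] uv(5) by simp
    ultimately show "e' \<in> E (box N)" using E_iff[of "box N"] finvol_box uv ij(2) by simp
  qed
  have "(of_int N - 2 * of_int L)\<^sup>2 * gap \<beta> e = (\<Sum>p\<in>?I. gap \<beta> e)"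
    using N by (simp add: card_cartesian_product power2_eq_square)
  also have "\<dots> = (\<Sum>p\<in>?I. gap \<beta> (?s p))"
    unfolding gap_def using ivE_shift_edge[OF lattice_point_in eV b] by (intro sum.cong) auto
  also have "\<dots> = sum (gap \<beta>) (?s ` ?I)" by (subst sum.reindex[OF inj]) simp
  also have "\<dots> \<le> sum (gap \<beta>) (E (box N))"
  proof (rule sum_mono2[OF _ sub])
    show "finite (E (box N))" using finvol_box finite_EJ by blast
    fix e assume "e \<in> E (box N) - ?s ` ?I"
    hence "e \<in> pairs_on V" using E_V[OF finvol_box] EJ_pairs by blast
    thus "0 \<le> gap \<beta> e" by (rule gap_nonneg[OF b])
  qed
  finally show ?thesis .
qed

text \<open>Surface against volume: in a box of side N the gaps sum to O(N) at a suitable parameter,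
  while each e in A contributes of order N^2 equal terms. The parameter depends on N, hence on A and
  \<epsilon>.\<close>

lemma gap_vanishes:
  assumes a: "0 < a" "a < b" and A: "finite A" "A \<subseteq> E V" and e: "0 < \<epsilon>"
  shows "\<exists>\<beta>>a. \<beta> < b \<and> (\<forall>e\<in>A. gap \<beta> e \<le> \<epsilon>)"
proof -
  have W: "finite (\<Union>A)" "\<Union>A \<subseteq> V"
    using A by (auto simp: EJ_def pairs_on_def)
  obtain L where L: "0 \<le> L" "\<And>x. x \<in> \<Union>A \<Longrightarrow> \<exists>r\<in>R. \<exists>k l. \<bar>k\<bar> \<le> L \<and> \<bar>l\<bar> \<le> L \<and> x = r + lattice_point k l"
    using uniform_shift[OF W] by blast
  obtain K where K: "0 \<le> K" "\<And>N. 2 * K \<le> N \<Longrightarrow> real (card (boundary V J (box N))) \<le> real (card R) * (4 * of_int K * of_int N)"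
    using card_boundary_box by blast
  define c where "c = b / (b - a) * (real (card R) * (4 * of_int K) * ln q)"
  define L' :: real where "L' = of_int L"
  have "(\<lambda>n. c * real n / (real n - 2 * L')\<^sup>2) \<longlonglongrightarrow> 0" by real_asymp
  hence "eventually (\<lambda>n. c * real n / (real n - 2 * L')\<^sup>2 < \<epsilon>) sequentially"
    using e by (auto dest: order_tendstoD)
  moreover have "eventually (\<lambda>n. n \<ge> nat (2 * L + 2 * K + 1)) sequentially" by (rule eventually_ge_at_top)
  ultimately obtain n where n: "c * real n / (real n - 2 * L')\<^sup>2 < \<epsilon>" "n \<ge> nat (2 * L + 2 * K + 1)"
    using eventually_happens'[OF sequentially_bot eventually_conj] by blast
  define N where "N = int n"
  have N: "2 * L < N" "2 * K \<le> N" using n(2) L(1) K(1) unfolding N_def by linarith+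
  obtain \<beta> where \<beta>: "a < \<beta>" "\<beta> < b" "(\<Sum>e\<in>E (box N). gap \<beta> e) \<le> b / (b - a) * (real (card (boundary V J (box N))) * ln q)"
    using exists_small_gap[OF a finvol_box] by blast
  have b0: "0 < \<beta>" using \<beta> a by simp
  have "gap \<beta> e \<le> \<epsilon>" if eA: "e \<in> A" for e
  proof -
    let ?D = "(of_int N - 2 * of_int L :: real)\<^sup>2"
    have D: "0 < ?D" using N(1) by (simp add: of_int_less_iff[symmetric, where 'a = real] del: of_int_less_iff)
    have "?D * gap \<beta> e \<le> (\<Sum>e\<in>E (box N). gap \<beta> e)"
    proof (rule sum_gap_box[OF b0])
      show "e \<in> E V" using A eA by blast
      show "2 * L \<le> N" using N by simp
      show "\<exists>r\<in>R. \<exists>k l. \<bar>k\<bar> \<le> L \<and> \<bar>l\<bar> \<le> L \<and> x = r + lattice_point k l" if "x \<in> e" for x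
        by (rule L(2)[OF UnionI[OF eA that]])
    qed
    also have "\<dots> \<le> b / (b - a) * (real (card (boundary V J (box N))) * ln q)" by (rule \<beta>(3))
    also have "\<dots> \<le> b / (b - a) * (real (card R) * (4 * of_int K * of_int N) * ln q)"
      using K(2)[OF N(2)] a q1 by (intro mult_left_mono mult_right_mono) auto
    also have "\<dots> = c * of_int N" by (simp add: c_def)
    finally have "gap \<beta> e \<le> c * of_int N / ?D" using D by (simp add: pos_le_divide_eq mult.commute)
    also have "\<dots> < \<epsilon>" using n(1) by (simp add: N_def L'_def)
    finally show ?thesis by simp
  qed
  thus ?thesis using \<beta> by blast
qed

theorem wired_le_free:
  assumes "local_on V f" "mono f" "0 < a" "a < b"
  shows "ivE True a f \<le> ivE False b f"
  using ivE_wired_le_free[OF assms] gap_vanishes[OF assms(3,4)] by blast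

section \<open>The phase transition\<close>

text \<open>The critical parameter will be the supremum of this set. The prefactor
  \<open>card R\<close> is the bound of \<open>Theta\<close> that \<open>sharpness_dichotomy\<close>
  returns.\<close>

definition good :: "real set" where
  "good = {b. 0 < b \<and> (\<exists>k>0. \<forall>n. Theta n b \<le> real (card R) * exp (- k * real n))}"

lemma good_or_percolates:
  assumes "V \<noteq> {}" and ab: "0 < b" "b < a" and "b \<notin> good"
  shows "\<exists>\<epsilon>>0. \<forall>n. \<epsilon> \<le> Theta n a"
proof -
  \<comment> \<open>The factor exp (- x Jtot) / (x \<open>osss_const\<close>) supplied by
    \<open>Theta_deriv\<close> decreases in x, so its value at a serves the whole interval.\<close>
  let ?c = "exp (- a * Jtot) / (a * osss_const)"
  have a0: "0 < a" using ab by simp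
  have Rne: "R \<noteq> {}" using assms(1) R(3) by blast
  have R1: "1 \<le> Theta 0 x" if "0 < x" for x
  proof -
    have "Theta 0 x = real (card R)" 
    proof -
      have "Theta 0 x = (\<Sum>r\<in>R. 1)" unfolding Theta_def
        by (rule sum.cong[OF refl], rule theta_0[OF _ that]) (use R(2) in blast)
      thus ?thesis by simp
    qed
    moreover have "0 < card R" using Rne R(1) by (simp add: card_gt_0_iff)
    ultimately show ?thesis by simp
  qed
  have "(\<exists>k>0. \<forall>n. Theta n b \<le> real (card R) * exp (- k * real n)) \<or> (\<exists>\<epsilon>>0. \<forall>n. \<epsilon> \<le> Theta n a)"
  proof (rule sharpness_dichotomy[OF ab, of ?c Theta "real (card R)"])
    show "0 < ?c" using a0 by (intro divide_pos_pos mult_pos_pos) auto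
    fix n :: nat and x :: real assume n: "1 \<le> n" and x: "b \<le> x" "x \<le> a"
    have x0: "0 < x" using x ab by simp
    obtain D where D: "(Theta n has_real_derivative D) (at x)"
      "real n * exp (- x * Jtot) * Theta n x \<le> x * osss_const * (\<Sum>j<n. Theta j x) * D"
      using Theta_deriv[OF x0 n] by blast
    let ?G = "(\<Sum>j<n. Theta j x) * D"
    have T0: "0 \<le> Theta n x" by (rule Theta_nonneg[OF x0])
    have le: "real n * exp (- x * Jtot) * Theta n x \<le> x * osss_const * ?G" using D(2) by (simp add: mult.assoc)
    moreover have "0 \<le> real n * exp (- x * Jtot) * Theta n x" using T0 by simp
    ultimately have "0 \<le> (x * osss_const) * ?G" by linarith
    moreover have "0 < x * osss_const" using x0 by (intro mult_pos_pos) auto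
    moreover have "0 \<le> g" if "0 \<le> p * g" "0 < p" for p g :: real using that by (simp add: zero_le_mult_iff)
    ultimately have G: "0 \<le> ?G" by blast
    have "real n * exp (- a * Jtot) * Theta n x \<le> real n * exp (- x * Jtot) * Theta n x"
      using x Jtot_nonneg T0 by (intro mult_right_mono mult_left_mono) (auto intro: mult_right_mono)
    also have "\<dots> \<le> x * osss_const * ?G" by (rule le)
    also have "\<dots> \<le> a * osss_const * ?G" using x G by (intro mult_right_mono) auto
    finally have "real n * exp (- a * Jtot) * Theta n x / (a * osss_const) \<le> ?G"
      using a0 by (simp add: pos_divide_le_eq mult.commute)
    hence "?c * real n * Theta n x \<le> ?G" by (simp add: mult_ac)
    thus "\<exists>D. (Theta n has_real_derivative D) (at x) \<and> ?c * real n * Theta n x \<le> (\<Sum>j<n. Theta j x) * D"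
      using D(1) by blast
  qed (use Theta_nonneg Theta_le R1 Theta_antimono Theta_mono in auto)
  thus ?thesis using assms(4) ab(1) unfolding good_def by blast
qed

text \<open>The interval is divided at its midpoint a'. From b to a' the dichotomy yields wired
  connections to all distances, and from a' to a the wired measure is replaced by the free
  one.\<close>

lemma percolation_free:
  assumes V: "V \<noteq> {}" "countable V" and ab: "0 < b" "b < a" and "b \<notin> good"
  shows "AE \<omega> in fk_inf False a. \<exists>C\<in>clusters V \<omega>. infinite C"
proof -
  define a' where "a' = (a + b) / 2"
  have a': "b < a'" "a' < a" "0 < a'" using ab by (auto simp: a'_def)
  obtain \<epsilon> where e: "0 < \<epsilon>" "\<And>n. \<epsilon> \<le> Theta n a'" using good_or_percolates[OF V(1) ab(1) a'(1) assms(5)] by blast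
  have Rne: "R \<noteq> {}" using V(1) R(3) by blast
  have card: "0 < card R" using Rne R(1) by (simp add: card_gt_0_iff)
  define \<delta> where "\<delta> = \<epsilon> / real (card R)"
  have d: "0 < \<delta>" using e card by (simp add: \<delta>_def)
  \<comment> \<open>One representative must serve all n: otherwise each fails at some distance, and
    since \<open>theta\<close> is antitone in n all of them fail at the sum of these distances,
    contradicting the bound on \<open>Theta\<close>.\<close>
  have "\<exists>r\<in>R. \<forall>n. \<delta> \<le> theta n r a'"
  proof (rule ccontr)
    assume "\<not> ?thesis"
    hence "\<forall>r\<in>R. \<exists>n. theta n r a' < \<delta>" by (meson not_le)
    then obtain h where h: "\<And>r. r \<in> R \<Longrightarrow> theta (h r) r a' < \<delta>" by metis
    let ?n = "\<Sum>r\<in>R. h r"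
    have "theta ?n r a' < \<delta>" if r: "r \<in> R" for r
    proof -
      have "h r \<le> ?n" using member_le_sum[OF r, of h] R(1) by auto
      hence "theta ?n r a' \<le> theta (h r) r a'" using R(2) r a' by (intro theta_antimono) auto
      thus ?thesis using h[OF r] by simp
    qed
    hence "Theta ?n a' < (\<Sum>r\<in>R. \<delta>)" unfolding Theta_def using R(1) Rne by (intro sum_strict_mono) auto
    also have "\<dots> = \<epsilon>" using card by (simp add: \<delta>_def)
    finally show False using e(2)[of ?n] by simp
  qed
  then obtain r where r: "r \<in> R" "\<And>n. \<delta> \<le> theta n r a'" by blast
  have rV: "r \<in> V" using r R(2) by auto
  have "\<delta> \<le> ivE False a (reach_ind n r)" for n
    using theta_lower_imp_ivE[OF rV a'(3) r(2)] wired_le_free[OF local_on_reach_ind[OF rV] mono_reach_ind a'(3,2)]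
    by (rule order_trans)
  moreover have a0: "0 < a" using ab by simp
  ultimately show ?thesis using AE_infinite_cluster[OF a0 V(2) rV d] by blast
qed

text \<open>The prefactor \<open>card R\<close> has to disappear. Beyond m0 it is absorbed by half
  of the rate k. For 1 \<le> n \<le> m0 finite energy gives theta \<le> 1 - \<delta> \<le> exp (-
  \<delta>), and c n \<le> \<delta> by the choice of c. For n = 0 the bound is 1.\<close>

lemma decay_wired:
  assumes V: "V \<noteq> {}" "countable V" and b: "0 < \<beta>" "\<beta> \<le> b" "b \<in> good"
  shows "\<exists>c>0. \<forall>x\<in>V. \<forall>y\<in>V. measure (fk_inf True \<beta>) {\<omega> \<in> space (fk_inf True \<beta>). open_connected V \<omega> x y}
    \<le> exp (- c * real (d x y))"
proof -
  obtain k where k: "0 < k" "\<And>n. Theta n b \<le> real (card R) * exp (- k * real n)" using b(3) by (auto simp: good_def)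
  have Rne: "R \<noteq> {}" using V(1) R(3) by blast
  have card: "1 \<le> real (card R)" using Rne R(1) by (simp add: card_gt_0_iff Suc_leI)
  define \<delta> where "\<delta> = exp (- \<beta> * Jtot)"
  have d: "0 < \<delta>" by (simp add: \<delta>_def)
  obtain m0 :: nat where m0: "2 * ln (real (card R)) / k \<le> real m0" using real_arch_simple by blast
  define c where "c = min (k / 2) (\<delta> / (real m0 + 1))"
  have c: "0 < c" "c \<le> k / 2" "c \<le> \<delta> / (real m0 + 1)"
    unfolding c_def using k(1) d by (simp_all only: min.cobounded1 min.cobounded2) simp
  have th: "theta n x \<beta> \<le> exp (- c * real n)" if x: "x \<in> V" for x n
  proof (cases "n = 0")
    case True
    thus ?thesis using theta_bounds(2)[OF x b(1)] by simp
  next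
    case n: False
    show ?thesis
    proof (cases "n \<le> m0")
      case True
      have "theta n x \<beta> \<le> 1 - \<delta>" unfolding \<delta>_def using n by (intro theta_le_energy[OF x b(1)]) simp
      also have "\<dots> \<le> exp (- \<delta>)" using exp_ge_add_one_self[of "- \<delta>"] by simp
      also have "\<dots> \<le> exp (- c * real n)"
      proof -
        have "c * real n \<le> \<delta> / (real m0 + 1) * (real m0 + 1)" using c True d by (intro mult_mono) auto
        thus ?thesis by simp
      qed
      finally show ?thesis .
    next
      case False
      have "theta n x \<beta> \<le> Theta n \<beta>" by (rule theta_le_Theta[OF x b(1)])
      also have "\<dots> \<le> Theta n b" by (rule Theta_mono[OF b(1,2)])
      also have "\<dots> \<le> real (card R) * exp (- k * real n)" by (rule k(2))
      also have "\<dots> = exp (ln (real (card R)) - k * real n)" using card by (simp add: exp_diff exp_minus field_simps)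
      also have "\<dots> \<le> exp (- c * real n)"
      proof -
        have "2 * ln (real (card R)) / k \<le> real n" using m0 False by simp
        hence "ln (real (card R)) \<le> k / 2 * real n" using k(1) by (simp add: field_simps)
        moreover have "c * real n \<le> k / 2 * real n" using c by (intro mult_right_mono) auto
        ultimately show ?thesis by simp
      qed
      finally show ?thesis .
    qed
  qed
  show ?thesis
  proof (intro exI[of _ c] conjI ballI)
    fix x y assume x: "x \<in> V" "y \<in> V"
    show "measure (fk_inf True \<beta>) {\<omega> \<in> space (fk_inf True \<beta>). open_connected V \<omega> x y} \<le> exp (- c * real (d x y))"
      using measure_connected_le_theta[OF b(1) V(2) x] th[OF x(1)] by (rule order_trans)
  qed (rule c(1))
qed

end

section \<open>Graph distance and the translations of the planar graph\<close>

lemma relpowp_sym: "symp r \<Longrightarrow> (r ^^ n) x y \<Longrightarrow> (r ^^ n) y x"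
proof (induction n arbitrary: x y)
  case (Suc n)
  then obtain z where "(r ^^ n) x z" "r z y" by auto
  hence "r y z" "(r ^^ n) z x" using Suc by (auto dest: sympD)
  thus ?case by (rule relpowp_Suc_I2)
qed simp

lemma graph_dist_le: "((\<lambda>u v. {u, v} \<in> E) ^^ n) x y \<Longrightarrow> graph_dist E x y \<le> n"
  unfolding graph_dist_def by (rule Least_le)

lemma graph_dist_attained:
  assumes "graph_connected V E" "x \<in> V" "y \<in> V"
  shows "((\<lambda>u v. {u, v} \<in> E) ^^ graph_dist E x y) x y"
proof -
  have "(\<lambda>u v. {u, v} \<in> E)\<^sup>*\<^sup>* x y" using assms by (simp add: graph_connected_def)
  then obtain n where "((\<lambda>u v. {u, v} \<in> E) ^^ n) x y" by (auto dest: rtranclp_imp_relpowp)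
  thus ?thesis unfolding graph_dist_def by (rule LeastI)
qed

lemma graph_dist_self: "graph_dist E x x = 0"
  using graph_dist_le[of 0 E x x] by simp

lemma graph_dist_sym:
  assumes "graph_connected V E" "x \<in> V" "y \<in> V"
  shows "graph_dist E x y = graph_dist E y x"
proof -
  have sy: "symp (\<lambda>u v. {u, v} \<in> E)" by (rule sympI) (simp add: insert_commute)
  have "graph_dist E x y \<le> graph_dist E y x" if "x \<in> V" "y \<in> V" for x y
    by (rule graph_dist_le[OF relpowp_sym[OF sy graph_dist_attained[OF assms(1) that(2,1)]]])
  thus ?thesis using assms by (intro order_antisym) auto
qed

lemma graph_dist_tri:
  assumes "graph_connected V E" "x \<in> V" "y \<in> V" "z \<in> V"
  shows "graph_dist E x z \<le> graph_dist E x y + graph_dist E y z"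
proof (rule graph_dist_le)
  show "((\<lambda>u v. {u, v} \<in> E) ^^ (graph_dist E x y + graph_dist E y z)) x z"
    unfolding relpowp_add
    using graph_dist_attained[OF assms(1-3)] graph_dist_attained[OF assms(1,3,4)] by blast
qed

lemma finite_graph_ball:
  assumes "graph_connected V E" "locally_finite V E" "E \<subseteq> pairs_on V" "x \<in> V"
  shows "finite {y \<in> V. graph_dist E x y \<le> n}"
proof -
  let ?r = "\<lambda>u v. {u, v} \<in> E"
  have step: "finite {y. (?r ^^ k) x y} \<and> {y. (?r ^^ k) x y} \<subseteq> V" for k
  proof (induction k)
    case (Suc k)
    have nb: "finite {z. {y, z} \<in> E}" if "y \<in> V" for y
    proof (rule finite_subset)
      show "{z. {y, z} \<in> E} \<subseteq> \<Union>{e \<in> E. y \<in> e}" by auto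
      have "finite {e \<in> E. y \<in> e}" using assms(2) that by (simp add: locally_finite_def)
      moreover have "finite e" if "e \<in> E" for e using assms(3) that by (auto simp: pairs_on_def)
      ultimately show "finite (\<Union>{e \<in> E. y \<in> e})" by auto
    qed
    have eq: "{y. (?r ^^ Suc k) x y} = (\<Union>y\<in>{y. (?r ^^ k) x y}. {z. {y, z} \<in> E})" by auto
    have "{z. {y, z} \<in> E} \<subseteq> V" for y using assms(3) by (auto simp: pairs_on_def doubleton_eq_iff)
    thus ?case unfolding eq using Suc nb by blast
  qed (use assms(4) in simp)
  have "{y \<in> V. graph_dist E x y \<le> n} \<subseteq> (\<Union>k\<in>{..n}. {y. (?r ^^ k) x y})"
    using graph_dist_attained[OF assms(1,4)] by auto
  thus ?thesis using step finite_subset by blast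
qed

text \<open>Bundled so that closure under sums and negatives carries invariance from the two unit
  translations to all integer ones.\<close>

definition shift_invariant :: "point set \<Rightarrow> point set set \<Rightarrow> (point \<Rightarrow> point \<Rightarrow> real) \<Rightarrow> point \<Rightarrow> bool" where
  "shift_invariant V E J t \<longleftrightarrow> shift t ` V = V \<and> shift_edges t E = E \<and>
     (\<forall>x\<in>V. \<forall>y\<in>V. J (x + t) (y + t) = J x y)"

lemma shift_invariant_add:
  assumes "shift_invariant V E J s" "shift_invariant V E J t"
  shows "shift_invariant V E J (s + t)"
  unfolding shift_invariant_def
proof (intro conjI ballI)
  have "shift (s + t) ` A = shift t ` shift s ` A" for A by (simp add: image_image add.assoc)
  thus "shift (s + t) ` V = V" "shift_edges (s + t) E = E"
    using assms by (simp_all add: shift_invariant_def image_image[symmetric, of "(`) (shift t)" "(`) (shift s)"])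
  fix x y assume xy: "x \<in> V" "y \<in> V"
  have "shift s ` V = V" using assms(1) by (simp add: shift_invariant_def)
  hence "x + s \<in> V" "y + s \<in> V" using xy by blast+
  hence "J ((x + s) + t) ((y + s) + t) = J (x + s) (y + s)" using assms(2) by (simp add: shift_invariant_def)
  also have "\<dots> = J x y" using assms(1) xy by (simp add: shift_invariant_def)
  finally show "J (x + (s + t)) (y + (s + t)) = J x y" by (simp only: add.assoc)
qed

lemma shift_invariant_minus:
  assumes "shift_invariant V E J t"
  shows "shift_invariant V E J (- t)"
  unfolding shift_invariant_def
proof (intro conjI ballI)
  have V: "shift t ` V = V" and E: "shift_edges t E = E" and J: "\<forall>x\<in>V. \<forall>y\<in>V. J (x + t) (y + t) = J x y"
    using assms by (auto simp: shift_invariant_def)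
  have "shift (- t) ` (shift t ` V) = V" by (simp add: image_image)
  thus V': "shift (- t) ` V = V" unfolding V .
  have "shift_edges (- t) (shift_edges t E) = E" by (rule shift_shift_edges)
  thus "shift_edges (- t) E = E" unfolding E .
  fix x y assume "x \<in> V" "y \<in> V"
  hence "x + - t \<in> V" "y + - t \<in> V" using V' by blast+
  thus "J (x + - t) (y + - t) = J x y" using J[rule_format, of "x + - t" "y + - t"] by simp
qed

lemma shift_invariant_lattice:
  assumes "shift_invariant V E J (1, 0)" "shift_invariant V E J (0, 1)" "t \<in> lattice_points"
  shows "shift_invariant V E J t"
proof -
  have 0: "shift_invariant V E J 0" by (simp add: shift_invariant_def)
  have x: "shift_invariant V E J (real n, 0)" for n
  proof (induction n)
    case (Suc n)
    have "(real (Suc n), 0) = (real n, 0 :: real) + (1, 0)" by simp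
    thus ?case using shift_invariant_add[OF Suc assms(1)] by (simp add: add.commute)
  qed (use 0 in \<open>simp add: zero_prod_def\<close>)
  have y: "shift_invariant V E J (0, real n)" for n
  proof (induction n)
    case (Suc n)
    have "(0, real (Suc n)) = (0 :: real, real n) + (0, 1)" by simp
    thus ?case using shift_invariant_add[OF Suc assms(2)] by (simp add: add.commute)
  qed (use 0 in \<open>simp add: zero_prod_def\<close>)
  have x': "shift_invariant V E J (of_int i, 0)" for i
    by (cases i rule: int_cases2) (use x shift_invariant_minus[OF x] in auto)
  have y': "shift_invariant V E J (0, of_int i)" for i
    by (cases i rule: int_cases2) (use y shift_invariant_minus[OF y] in auto)
  obtain i j where "t = (of_int i, 0) + (0, of_int j)"
    using assms(3) by (auto simp: lattice_points_def lattice_point_def)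
  thus ?thesis using shift_invariant_add[OF x' y'] by simp
qed

lemma graph_dist_shift:
  assumes "shift_edges t E = E"
  shows "graph_dist E (x + t) (y + t) = graph_dist E x y"
proof -
  have edge: "{u + t, v + t} \<in> E" if "{u, v} \<in> E" "shift_edges t E = E" for u v t
    using imageI[OF that(1), of "(`) (shift t)"] that(2) by simp
  have pow: "((\<lambda>u v. {u, v} \<in> E) ^^ n) (x + t) (y + t)"
    if "((\<lambda>u v. {u, v} \<in> E) ^^ n) x y" "shift_edges t E = E" for n x y t
    using that(1)
  proof (induction n arbitrary: y)
    case (Suc n)
    then obtain z where "((\<lambda>u v. {u, v} \<in> E) ^^ n) x z" "{z, y} \<in> E" by auto
    thus ?case using Suc.IH edge[OF _ that(2)] by auto
  qed simp
  have "shift_edges (- t) (shift_edges t E) = E" by (rule shift_shift_edges)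
  hence neg: "shift_edges (- t) E = E" unfolding assms .
  have "((\<lambda>u v. {u, v} \<in> E) ^^ n) (x + t) (y + t) \<longleftrightarrow> ((\<lambda>u v. {u, v} \<in> E) ^^ n) x y" for n
    using pow[OF _ assms, of n x y] pow[OF _ neg, of n "x + t" "y + t"] by auto
  thus ?thesis unfolding graph_dist_def by simp
qed

lemma properly_embedded_locally_finite:
  "properly_embedded V E drawing \<Longrightarrow> compact K \<Longrightarrow> finite (V \<inter> K)"
  by (simp add: properly_embedded_def)

text \<open>Properness of the embedding leaves finitely many vertices in each compact set. This
  makes the set of representatives finite, and V countable as a union over discs of growing
  radius.\<close>

lemma fk_Z2_symmetric_planar_graph:
  assumes G: "symmetric_planar_graph V E drawing" and J: "finite_range_interaction V E J" and q: "1 \<le> q"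
  shows "\<exists>M R. fk_Z2 V J q (graph_dist E) M R" "countable V" "V \<noteq> {}"
proof -
  have con: "graph_connected V E" and lf: "locally_finite V E" and sub: "E \<subseteq> pairs_on V"
    and emb: "properly_embedded V E drawing"
    and sym: "\<And>T. T \<in> plane_symmetries \<Longrightarrow> embedding_invariant T V E drawing"
    using G by (auto simp: symmetric_planar_graph_def)
  have fin: "finite (V \<inter> K)" if "compact K" for K
    by (rule properly_embedded_locally_finite[OF emb that])
  have J0: "\<And>x y. x \<in> V \<Longrightarrow> y \<in> V \<Longrightarrow> 0 \<le> J x y" and Js: "\<And>x y. x \<in> V \<Longrightarrow> y \<in> V \<Longrightarrow> J x y = J y x"
    and Jt: "\<And>T x y. T \<in> plane_symmetries \<Longrightarrow> x \<in> V \<Longrightarrow> y \<in> V \<Longrightarrow> J (T x) (T y) = J x y"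
    using J by (auto simp: finite_range_interaction_def)
  obtain M :: real where M: "1 \<le> M" "\<And>x y. x \<in> V \<Longrightarrow> y \<in> V \<Longrightarrow> M < real (graph_dist E x y) \<Longrightarrow> J x y = 0"
    using J by (auto simp: finite_range_interaction_def)
  have inv: "shift_invariant V E J t" if "shift t \<in> plane_symmetries" for t
    using sym[OF that] Jt[OF that] by (auto simp: shift_invariant_def embedding_invariant_def)
  have s1: "shift (1, 0) = (\<lambda>(a, b). (a + 1, b :: real))" and s2: "shift (0, 1) = (\<lambda>(a :: real, b). (a, b + 1))"
    by (auto simp: fun_eq_iff)
  have "shift (1, 0) \<in> plane_symmetries" "shift (0, 1) \<in> plane_symmetries"
    unfolding s1 s2 plane_symmetries_def by simp_all
  note inv' = shift_invariant_lattice[OF inv[OF this(1)] inv[OF this(2)]]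
  \<comment> \<open>Subtracting the integer parts of its coordinates moves every vertex into the
    unit square, which is taken closed so that it is compact.\<close>
  define R where "R = V \<inter> cbox (0, 0) (1, 1)"
  have "fk_Z2 V J q (graph_dist E) (nat \<lfloor>M\<rfloor>) R"
    unfolding fk_Z2_def
  proof unfold_locales
    fix x y assume xy: "x \<in> V" "y \<in> V"
    show "0 \<le> J x y" by (rule J0[OF xy])
    show "J x y = J y x" by (rule Js[OF xy])
    show "graph_dist E x y = graph_dist E y x" by (rule graph_dist_sym[OF con xy])
    show "graph_dist E x y \<le> nat \<lfloor>M\<rfloor>" if "0 < J x y"
    proof -
      have "real (graph_dist E x y) \<le> M" by (rule ccontr) (use M(2)[OF xy] that in simp)
      thus ?thesis using M(1) by (simp add: le_nat_floor)
    qed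
    show "graph_dist E x z \<le> graph_dist E x y + graph_dist E y z" if "z \<in> V" for z
      by (rule graph_dist_tri[OF con xy that])
  next
    fix x assume x: "x \<in> V"
    show "finite {y \<in> V. graph_dist E x y \<le> n}" for n by (rule finite_graph_ball[OF con lf sub x])
    show "\<exists>r\<in>R. \<exists>t\<in>lattice_points. x = r + t"
    proof -
      obtain a b where ab: "x = (a, b)" by (cases x)
      let ?t = "lattice_point \<lfloor>a\<rfloor> \<lfloor>b\<rfloor>"
      have "shift_invariant V E J (- ?t)" by (rule inv') (simp add: lattice_point_minus lattice_point_in)
      hence "x + - ?t \<in> V" using x by (auto simp: shift_invariant_def)
      moreover have "x + - ?t \<in> cbox (0, 0) (1, 1)"
      proof -
        have "0 \<le> a - of_int \<lfloor>a\<rfloor>" "a - of_int \<lfloor>a\<rfloor> \<le> 1" "0 \<le> b - of_int \<lfloor>b\<rfloor>" "b - of_int \<lfloor>b\<rfloor> \<le> 1"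
          by linarith+
        thus ?thesis by (simp add: ab lattice_point_def cbox_Pair_eq)
      qed
      ultimately show ?thesis
        by (intro bexI[of _ "x + - ?t"] bexI[of _ ?t]) (auto simp: R_def lattice_point_in)
    qed
  next
    fix t assume t: "t \<in> lattice_points"
    note it = inv'[OF t]
    obtain i j where "t = lattice_point i j" using t by (auto simp: lattice_points_def)
    thus "- t \<in> lattice_points" by (simp add: lattice_point_minus lattice_point_in)
    fix x assume x: "x \<in> V"
    show "x + t \<in> V" using it x by (auto simp: shift_invariant_def)
    fix y assume y: "y \<in> V"
    show "graph_dist E (x + t) (y + t) = graph_dist E x y"
      using it by (intro graph_dist_shift) (simp add: shift_invariant_def)
    show "J (x + t) (y + t) = J x y" using it x y by (simp add: shift_invariant_def)
  next
    show "finite R" unfolding R_def by (rule fin) simp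
  qed (use q graph_dist_self in \<open>auto simp: R_def\<close>)
  thus "\<exists>M R. fk_Z2 V J q (graph_dist E) M R" by blast
  have "V = (\<Union>n. V \<inter> cball 0 (real n))"
  proof -
    have "\<exists>n. x \<in> cball 0 (real n)" for x :: point
      using real_arch_simple[of "norm x"] by simp
    thus ?thesis by blast
  qed
  moreover have "countable (\<Union>n. V \<inter> cball 0 (real n))"
    using fin by (intro countable_UN) (auto intro: countable_finite)
  ultimately show "countable V" by simp
  show "V \<noteq> {}" using con by (simp add: graph_connected_def)
qed

theorem theorem1p2:
  fixes V :: "point set" and E :: "point set set" and drawing :: "point set \<Rightarrow> point set"
    and J :: "point \<Rightarrow> point \<Rightarrow> real" and q :: real
  assumes "symmetric_planar_graph V E drawing"
    and "finite_range_interaction V E J"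
    and "1 \<le> q"
  shows "\<exists>\<beta>\<^sub>c::ereal. 0 \<le> \<beta>\<^sub>c \<and>
    (\<forall>\<beta>::real. 0 < \<beta> \<and> ereal \<beta> < \<beta>\<^sub>c \<longrightarrow>
       (\<exists>c::real. 0 < c \<and> (\<forall>x\<in>V. \<forall>y\<in>V.
          measure (fk_wired V J \<beta> q) {\<omega> \<in> space (fk_wired V J \<beta> q). open_connected V \<omega> x y}
            \<le> exp (- c * real (graph_dist E x y))))) \<and>
    (\<forall>\<beta>::real. 0 < \<beta> \<and> \<beta>\<^sub>c < ereal \<beta> \<longrightarrow>
       (AE \<omega> in fk_free V J \<beta> q. \<exists>C\<in>clusters V \<omega>. infinite C))"
proof -
  note V = fk_Z2_symmetric_planar_graph(2,3)[OF assms]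
  obtain M R where "fk_Z2 V J q (graph_dist E) M R"
    using fk_Z2_symmetric_planar_graph(1)[OF assms] by blast
  then interpret fk_Z2 V J q "graph_dist E" M R .
  have fk: "fk_inf True \<beta> = fk_wired V J \<beta> q" "fk_inf False \<beta> = fk_free V J \<beta> q" for \<beta>
    by (simp_all add: fk_wired_def fk_free_def)
  \<comment> \<open>Inserting 0 gives the value 0 instead of minus infinity when no parameter is
    good.\<close>
  define \<beta>\<^sub>c where "\<beta>\<^sub>c = Sup (insert 0 (ereal ` good))"
  show ?thesis
  proof (intro exI[of _ \<beta>\<^sub>c] conjI allI impI; (elim conjE)?)
    show "0 \<le> \<beta>\<^sub>c" unfolding \<beta>\<^sub>c_def by (rule Sup_upper) simp
  next
    fix \<beta> :: real assume b: "0 < \<beta>" "ereal \<beta> < \<beta>\<^sub>c"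
    then obtain b where "b \<in> good" "\<beta> < b"
      unfolding \<beta>\<^sub>c_def less_Sup_iff by auto
    thus "\<exists>c::real. 0 < c \<and> (\<forall>x\<in>V. \<forall>y\<in>V.
        measure (fk_wired V J \<beta> q) {\<omega> \<in> space (fk_wired V J \<beta> q). open_connected V \<omega> x y}
          \<le> exp (- c * real (graph_dist E x y)))"
      using decay_wired[OF V(2,1) b(1), of b] unfolding fk by simp
  next
    fix \<beta> :: real assume b: "0 < \<beta>" "\<beta>\<^sub>c < ereal \<beta>"
    \<comment> \<open>Percolation at \<beta> is derived from failure of decay at a strictly smaller
      parameter, so one is chosen between the critical value and \<beta>.\<close>
    obtain b where b': "\<beta>\<^sub>c < ereal b" "b < \<beta>"
      using ereal_dense2[OF b(2)] by auto
    have "0 \<le> \<beta>\<^sub>c" unfolding \<beta>\<^sub>c_def by (rule Sup_upper) simp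
    hence b0: "0 < b" using b'(1) by (metis ereal_less(2) order_le_less_trans)
    have "b \<notin> good"
    proof
      assume "b \<in> good"
      hence "ereal b \<le> \<beta>\<^sub>c" unfolding \<beta>\<^sub>c_def by (intro Sup_upper) simp
      thus False using b'(1) by simp
    qed
    thus "AE \<omega> in fk_free V J \<beta> q. \<exists>C\<in>clusters V \<omega>. infinite C"
      using percolation_free[OF V(2,1) b0 b'(2)] unfolding fk by simp
  qed
qed

end
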